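(* Let $Q\to X$ be a continuous principal $G$-bundle over a compact metric space $X$ and let $\phi$ be a continuous automorphism of $Q$. Suppose that the flow on the base space $X$ has a unique invariant probability measure $\nu$, with $\mathrm{supp}\,\nu=X$. Let $H_{\mathrm{Ly}}=H_{\mathrm{Ly}}(\nu)$ be its polar exponent. Then $\Lambda_{\mathrm{Mo}}$ is the polyhedron whose vertices are $wH_{\mathrm{Ly}}$, $w\in\mathcal{W}_{\Theta_{\mathrm{Mo}}}$.
   Context: Lie notation. $G$ is a noncompact semi-simple Lie group, or more generally a reductive Lie group with noncompact semi-simple component, with Lie algebra $\mathfrak{g}$. Fix a Cartan decomposition $\mathfrak{g}=\mathfrak{k}\oplus\mathfrak{s}$, a maximal abelian $\mathfrak{a}\subset\mathfrak{s}$, the set $\Pi$ of roots of $(\mathfrak{g},\mathfrak{a})$ with root spaces $\mathfrak{g}_\alpha$, positive roots $\Pi^+$ and simple roots $\Sigma$. Put $\mathfrak{n}=\sum_{\alpha\in\Pi^+}\mathfrak{g}_\alpha$, $\mathfrak{a}^+=\{H\in\mathfrak{a}:\alpha(H)>0,\ \alpha\in\Sigma\}$ with closure $\mathrm{cl}\,\mathfrak{a}^+$, $K=\exp\mathfrak{k}$ (maximal compact), $A=\exp\mathfrak{a}$, $N=\exp\mathfrak{n}$, $S=\exp\mathfrak{s}$; $G=KAN=KS=K(\mathrm{cl}\exp\mathfrak{a}^+)K$. $\mathcal{W}$ is the Weyl group (normalizer modulo centralizer of $\mathfrak{a}$ in $K$). For $\Theta\subset\Sigma$: $\mathcal{W}_\Theta\subset\mathcal{W}$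 is the subgroup generated by the reflections with respect to the roots in $\Theta$; $\langle\Theta\rangle$ is the set of roots spanned over $\mathbb{Z}$ by $\Theta$; $\mathfrak{p}_\Theta=\mathfrak{m}\oplus\mathfrak{a}\oplus\sum_{\alpha\in\Pi^+}\mathfrak{g}_\alpha\oplus\sum_{\alpha\in\langle\Theta\rangle\cap\Pi^+}\mathfrak{g}_{-\alpha}$ ($\mathfrak{m}$ the centralizer of $\mathfrak{a}$ in $\mathfrak{k}$); $P_\Theta$ is the normalizer of $\mathfrak{p}_\Theta$ in $G$; $\mathbb{F}_\Theta=G/P_\Theta$ is the flag manifold with origin $b_\Theta$; $\mathbb{F}=\mathbb{F}_\emptyset$ with origin $b_0$. For $H\in\mathrm{cl}\,\mathfrak{a}^+$, $Z_H=\{g\in G:\mathrm{Ad}(g)H=H\}$; for $D=\mathrm{Ad}(g)H$, $w\in\mathcal{W}$, $\mathrm{fix}_\Theta(D,w)=gZ_H\cdot wb_\Theta$. Bundles and flow. $\phi$ generates a discrete-time flow $\phi_n$ on $Q$; the induced flows on $X$ and on associated bundles are also denoted $\phi$. $\mathbb{E}_\Theta=Q\times_G\mathbb{F}_\Theta$, $\mathbb{E}=Q\times_G\mathbb{F}$. Fix a continuous $K$-subbundle $R\subset Q$. For $r\in R$ write $\phi_n(r)=r'\cdot hn'$ with $r'\in R$, $h\in A$, $n'\in N$, and put $\mathsf{a}(n,r)=\log h$; this factors through $R\to\mathbb{E}$, $r\mapsto r\cdot b_0$, to an additive cocycle $\mathsf{a}(n,\xi)$ over the flow on $\mathbb{E}$.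 Also write $\phi_n(r)=r''\cdot s$, $r''\in R$, $s\in S$, $s=k\exp(\mathsf{a}^+(n,r))k^{-1}$, $k\in K$, $\mathsf{a}^+(n,r)\in\mathrm{cl}\,\mathfrak{a}^+$. By the Multiplicative Ergodic Theorem, $\lim_{k\to+\infty}\frac1k\mathsf{a}^+(k,r)$ exists and is equal to a constant $H_{\mathrm{Ly}}(\nu)\in\mathrm{cl}\,\mathfrak{a}^+$, the polar exponent, for $r\in R$ above a set of full $\nu$-measure. Morse data (known). The flow on $X$ is chain transitive, and each $\mathbb{E}_\Theta$ has a finest Morse decomposition (components = chain recurrent components). The components are $\mathcal{M}_\Theta(w)=\bigcup_{x\in X}\mathrm{fix}_\Theta(\chi_{\mathrm{Mo}}(x),w)$, $w\in\mathcal{W}$, for a continuous $\phi$-invariant section $\chi_{\mathrm{Mo}}$ of $Q\times_G\mathrm{Ad}(G)H_{\mathrm{Mo}}$ with $H_{\mathrm{Mo}}\in\mathrm{cl}\,\mathfrak{a}^+$ (where $\mathrm{fix}_\Theta(\chi(x),w)=p\cdot\mathrm{fix}_\Theta(D,w)$ if $\chi(x)=p\cdot D$, $p\in Q$); $\Theta_{\mathrm{Mo}}=\{\alpha\in\Sigma:\alpha(H_{\mathrm{Mo}})=0\}$. On $\mathbb{E}$ the unique attractor component is $\mathcal{M}^+=\mathcal{M}_\emptyset(1)$. $\Lambda_{\mathrm{Mo}}\subset\mathfrak{a}$ denotes the Morse spectrum of $\mathcal{M}^+$ for the cocycle $\mathsf{a}(n,\xi)$: the set of limits $\lim_j \big(\sum_i\mathsf{a}(n_i,\xi_i)\big)/\big(\sum_i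 n_i\big)$ over sequences of $(\varepsilon_j,T_j)$-chains in $\mathcal{M}^+$ with $\varepsilon_j\to0$, $T_j\to\infty$, where an $(\varepsilon,T)$-chain consists of points $\xi_0,\dots,\xi_m$ and times $n_0,\dots,n_{m-1}\ge T$ with $d(\phi_{n_i}\xi_i,\xi_{i+1})<\varepsilon$. *)

theory Defs
  imports "HOL-Probability.Probability" "HOL-Algebra.Coset" "HOL-Algebra.Generated_Groups"
begin

section \<open>Lie groups\<close>

text \<open>
  A Lie group is a group in the sense of HOL-Algebra together with a topology on its carrier and
  an atlas with values in \<open>'l\<close>; a chart is a pair \<open>(U, \<kappa>)\<close> of an open set and a map. The chosen
  chart \<open>chart1\<close> around the identity identifies the tangent space at the identity, that is the
  Lie algebra, with the whole type \<open>'l\<close>. The inner product and norm of \<open>'l\<close> as a Euclidean space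
  carry no meaning for the Lie structure; only its vector space structure and topology are used.

  The remaining fields hold the data fixed once and for all: an invariant bilinear form, the
  Cartan decomposition, the maximal abelian subspace and the simple roots. A root is a function on
  \<open>'l\<close> that is linear on the maximal abelian subspace and, to make it a unique representative of
  its functional, zero elsewhere.
\<close>

record ('g, 'l) lie_data = "'g monoid" +
  gtop :: "'g topology"
  charts :: "('g set \<times> ('g \<Rightarrow> 'l)) set"
  chart1 :: "'g set \<times> ('g \<Rightarrow> 'l)"
  form :: "'l \<Rightarrow> 'l \<Rightarrow> real"
  kk :: "'l set"
  ss :: "'l set"
  aa :: "'l set"
  simple :: "('l \<Rightarrow> real) set"

primrec Ck_on :: "nat \<Rightarrow> 'a::euclidean_space set \<Rightarrow> ('a \<Rightarrow> 'b::euclidean_space) \<Rightarrow> bool" where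
  "Ck_on 0 S f \<longleftrightarrow> continuous_on S f"
| "Ck_on (Suc k) S f \<longleftrightarrow>
     f differentiable_on S \<and> (\<forall>v. Ck_on k S (\<lambda>x. frechet_derivative f (at x) v))"

text \<open>Used for open \<open>S\<close> only.\<close>

definition smooth_on :: "'a::euclidean_space set \<Rightarrow> ('a \<Rightarrow> 'b::euclidean_space) \<Rightarrow> bool" where
  "smooth_on S f \<longleftrightarrow> (\<forall>k. Ck_on k S f)"

definition lie_group :: "('g, 'l::euclidean_space) lie_data \<Rightarrow> bool" where
  "lie_group L \<longleftrightarrow>
     group L \<and> topspace (gtop L) = carrier L \<and>
     Hausdorff_space (gtop L) \<and> second_countable (gtop L) \<and>
     continuous_map (prod_topology (gtop L) (gtop L)) (gtop L) (\<lambda>(g, h). g \<otimes>\<^bsub>L\<^esub> h) \<and>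
     continuous_map (gtop L) (gtop L) (\<lambda>g. inv\<^bsub>L\<^esub> g) \<and>
     (\<forall>(U, \<kappa>) \<in> charts L. openin (gtop L) U \<and> open (\<kappa> ` U) \<and>
        homeomorphic_map (subtopology (gtop L) U) (top_of_set (\<kappa> ` U)) \<kappa>) \<and>
     carrier L = (\<Union>(U, \<kappa>) \<in> charts L. U) \<and>
     (\<forall>(U, \<kappa>) \<in> charts L. \<forall>(V, \<mu>) \<in> charts L.
        smooth_on (\<kappa> ` (U \<inter> V)) (\<lambda>x. \<mu> (inv_into U \<kappa> x))) \<and>
     (\<forall>(U, \<kappa>) \<in> charts L. \<forall>(V, \<mu>) \<in> charts L. \<forall>(W, \<rho>) \<in> charts L.
        smooth_on {(x, y). x \<in> \<kappa> ` U \<and> y \<in> \<mu> ` V \<and> inv_into U \<kappa> x \<otimes>\<^bsub>L\<^esub> inv_into V \<mu> y \<in> W}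
          (\<lambda>(x, y). \<rho> (inv_into U \<kappa> x \<otimes>\<^bsub>L\<^esub> inv_into V \<mu> y))) \<and>
     (\<forall>(U, \<kappa>) \<in> charts L. \<forall>(V, \<mu>) \<in> charts L.
        smooth_on {x \<in> \<kappa> ` U. inv\<^bsub>L\<^esub> (inv_into U \<kappa> x) \<in> V} (\<lambda>x. \<mu> (inv\<^bsub>L\<^esub> (inv_into U \<kappa> x)))) \<and>
     chart1 L \<in> charts L \<and> \<one>\<^bsub>L\<^esub> \<in> fst (chart1 L)"

definition loc :: "('g, 'l::euclidean_space) lie_data \<Rightarrow> 'g \<Rightarrow> 'l" where
  "loc L = snd (chart1 L)"

definition unloc :: "('g, 'l::euclidean_space) lie_data \<Rightarrow> 'l \<Rightarrow> 'g" where
  "unloc L = inv_into (fst (chart1 L)) (loc L)"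

definition Ad :: "('g, 'l::euclidean_space) lie_data \<Rightarrow> 'g \<Rightarrow> 'l \<Rightarrow> 'l" where
  "Ad L g = frechet_derivative (\<lambda>x. loc L (g \<otimes>\<^bsub>L\<^esub> unloc L x \<otimes>\<^bsub>L\<^esub> inv\<^bsub>L\<^esub> g)) (at (loc L \<one>\<^bsub>L\<^esub>))"

text \<open>The bracket is the differential at the identity of the adjoint representation.\<close>

definition bracket :: "('g, 'l::euclidean_space) lie_data \<Rightarrow> 'l \<Rightarrow> 'l \<Rightarrow> 'l" where
  "bracket L X Y = frechet_derivative (\<lambda>x. Ad L (unloc L x) Y) (at (loc L \<one>\<^bsub>L\<^esub>)) X"

definition one_parameter_subgroup ::
  "('g, 'l::euclidean_space) lie_data \<Rightarrow> 'l \<Rightarrow> (real \<Rightarrow> 'g) \<Rightarrow> bool" where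
  "one_parameter_subgroup L X \<gamma> \<longleftrightarrow>
     continuous_map euclideanreal (gtop L) \<gamma> \<and> (\<forall>s t. \<gamma> (s + t) = \<gamma> s \<otimes>\<^bsub>L\<^esub> \<gamma> t) \<and>
     ((\<lambda>t. loc L (\<gamma> t)) has_vector_derivative X) (at 0)"

definition lie_exp :: "('g, 'l::euclidean_space) lie_data \<Rightarrow> 'l \<Rightarrow> 'g" where
  "lie_exp L X = (THE \<gamma>. one_parameter_subgroup L X \<gamma>) 1"


section \<open>Reductive groups, roots and the Weyl group\<close>

definition lie_ideal :: "('g, 'l::euclidean_space) lie_data \<Rightarrow> 'l set \<Rightarrow> bool" where
  "lie_ideal L I \<longleftrightarrow> subspace I \<and> (\<forall>X. \<forall>Y\<in>I. bracket L X Y \<in> I)"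

definition derived_algebra :: "('g, 'l::euclidean_space) lie_data \<Rightarrow> 'l set" where
  "derived_algebra L = span {bracket L X Y | X Y. True}"

definition KK :: "('g, 'l::euclidean_space) lie_data \<Rightarrow> 'g set" where
  "KK L = lie_exp L ` kk L"

text \<open>
  A reductive Lie group in the sense of Knapp, with \<open>K = exp \<kk>\<close> (so that \<open>G\<close> is connected and
  Knapp's condition that \<open>Ad G\<close> consists of inner automorphisms is automatic). For semisimple
  groups the Killing form is a possible choice of the form, and compactness of \<open>K\<close> says that the
  centre is finite. Maximality of \<open>K\<close> among compact subgroups follows from the polar decomposition.
  The last condition says that the semisimple component is not compact.
\<close>

definition reductive_lie_group :: "('g, 'l::euclidean_space) lie_data \<Rightarrow> bool" where
  "reductive_lie_group L \<longleftrightarrow>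
     lie_group L \<and>
     (\<forall>I. lie_ideal L I \<longrightarrow> (\<exists>J. lie_ideal L J \<and> I \<inter> J = {0} \<and> {X + Y | X Y. X \<in> I \<and> Y \<in> J} = UNIV)) \<and>
     subspace (kk L) \<and> subspace (ss L) \<and> kk L \<inter> ss L = {0} \<and>
     {X + Y | X Y. X \<in> kk L \<and> Y \<in> ss L} = UNIV \<and>
     (\<forall>X\<in>kk L. \<forall>Y\<in>kk L. bracket L X Y \<in> kk L) \<and>
     (\<forall>X\<in>kk L. \<forall>Y\<in>ss L. bracket L X Y \<in> ss L) \<and>
     (\<forall>X\<in>ss L. \<forall>Y\<in>ss L. bracket L X Y \<in> kk L) \<and>
     bilinear (form L) \<and> (\<forall>X Y. form L X Y = form L Y X) \<and>
     (\<forall>g\<in>carrier L. \<forall>X Y. form L (Ad L g X) (Ad L g Y) = form L X Y) \<and>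
     (\<forall>X\<in>kk L. \<forall>Y\<in>ss L. form L X Y = 0) \<and>
     (\<forall>X\<in>kk L. X \<noteq> 0 \<longrightarrow> form L X X < 0) \<and>
     (\<forall>X\<in>ss L. X \<noteq> 0 \<longrightarrow> form L X X > 0) \<and>
     subgroup (KK L) L \<and> compactin (gtop L) (KK L) \<and>
     homeomorphic_map (prod_topology (subtopology (gtop L) (KK L)) (top_of_set (ss L))) (gtop L)
       (\<lambda>(k, X). k \<otimes>\<^bsub>L\<^esub> lie_exp L X) \<and>
     derived_algebra L \<inter> ss L \<noteq> {0}"

definition abelian_in :: "('g, 'l::euclidean_space) lie_data \<Rightarrow> 'l set \<Rightarrow> 'l set \<Rightarrow> bool" where
  "abelian_in L V S \<longleftrightarrow> subspace V \<and> V \<subseteq> S \<and> (\<forall>X\<in>V. \<forall>Y\<in>V. bracket L X Y = 0)"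

definition root_space :: "('g, 'l::euclidean_space) lie_data \<Rightarrow> ('l \<Rightarrow> real) \<Rightarrow> 'l set" where
  "root_space L \<alpha> = {X. \<forall>H\<in>aa L. bracket L H X = \<alpha> H *\<^sub>R X}"

definition dual_aa :: "('g, 'l::euclidean_space) lie_data \<Rightarrow> ('l \<Rightarrow> real) set" where
  "dual_aa L = {\<alpha>. (\<forall>H\<in>aa L. \<forall>H'\<in>aa L. \<alpha> (H + H') = \<alpha> H + \<alpha> H') \<and>
     (\<forall>c. \<forall>H\<in>aa L. \<alpha> (c *\<^sub>R H) = c * \<alpha> H) \<and> (\<forall>H. H \<notin> aa L \<longrightarrow> \<alpha> H = 0)}"

definition roots :: "('g, 'l::euclidean_space) lie_data \<Rightarrow> ('l \<Rightarrow> real) set" where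
  "roots L = {\<alpha> \<in> dual_aa L. \<alpha> \<noteq> (\<lambda>_. 0) \<and> root_space L \<alpha> \<noteq> {0}}"

definition simple_system :: "('g, 'l::euclidean_space) lie_data \<Rightarrow> ('l \<Rightarrow> real) set \<Rightarrow> bool" where
  "simple_system L S \<longleftrightarrow> finite S \<and> S \<subseteq> roots L \<and>
     (\<forall>c. (\<forall>H. (\<Sum>\<sigma>\<in>S. c \<sigma> * \<sigma> H) = 0) \<longrightarrow> (\<forall>\<sigma>\<in>S. c \<sigma> = 0)) \<and>
     (\<forall>\<beta>\<in>roots L. \<exists>c::('l \<Rightarrow> real) \<Rightarrow> int. \<beta> = (\<lambda>H. \<Sum>\<sigma>\<in>S. of_int (c \<sigma>) * \<sigma> H) \<and>
        ((\<forall>\<sigma>\<in>S. c \<sigma> \<ge> 0) \<or> (\<forall>\<sigma>\<in>S. c \<sigma> \<le> 0)))"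

text \<open>The standing data: group, Cartan decomposition, maximal abelian subspace, simple roots.\<close>

definition flag_data :: "('g, 'l::euclidean_space) lie_data \<Rightarrow> bool" where
  "flag_data L \<longleftrightarrow> reductive_lie_group L \<and>
     abelian_in L (aa L) (ss L) \<and> (\<forall>V. abelian_in L V (ss L) \<and> aa L \<subseteq> V \<longrightarrow> V = aa L) \<and>
     simple_system L (simple L)"

definition pos_roots :: "('g, 'l::euclidean_space) lie_data \<Rightarrow> ('l \<Rightarrow> real) set" where
  "pos_roots L = {\<beta> \<in> roots L. \<exists>c::('l \<Rightarrow> real) \<Rightarrow> nat.
     \<beta> = (\<lambda>H. \<Sum>\<sigma>\<in>simple L. of_nat (c \<sigma>) * \<sigma> H)}"

definition span_roots ::
  "('g, 'l::euclidean_space) lie_data \<Rightarrow> ('l \<Rightarrow> real) set \<Rightarrow> ('l \<Rightarrow> real) set" where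
  "span_roots L \<Theta> = {\<beta> \<in> roots L. \<exists>c::('l \<Rightarrow> real) \<Rightarrow> int.
     \<beta> = (\<lambda>H. \<Sum>\<sigma>\<in>\<Theta>. of_int (c \<sigma>) * \<sigma> H)}"

definition AA :: "('g, 'l::euclidean_space) lie_data \<Rightarrow> 'g set" where
  "AA L = lie_exp L ` aa L"

definition nn :: "('g, 'l::euclidean_space) lie_data \<Rightarrow> 'l set" where
  "nn L = span (\<Union>\<alpha>\<in>pos_roots L. root_space L \<alpha>)"

definition NN :: "('g, 'l::euclidean_space) lie_data \<Rightarrow> 'g set" where
  "NN L = lie_exp L ` nn L"

definition SS :: "('g, 'l::euclidean_space) lie_data \<Rightarrow> 'g set" where
  "SS L = lie_exp L ` ss L"

definition chamber :: "('g, 'l::euclidean_space) lie_data \<Rightarrow> 'l set" where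
  "chamber L = {H \<in> aa L. \<forall>\<alpha>\<in>simple L. \<alpha> H > 0}"

definition normalizer_aa :: "('g, 'l::euclidean_space) lie_data \<Rightarrow> 'g set" where
  "normalizer_aa L = {k \<in> KK L. Ad L k ` aa L = aa L}"

definition centralizer_aa :: "('g, 'l::euclidean_space) lie_data \<Rightarrow> 'g set" where
  "centralizer_aa L = {k \<in> KK L. \<forall>H\<in>aa L. Ad L k H = H}"

text \<open>The elements of the Weyl group are cosets, that is subsets of \<open>K\<close>.\<close>

definition weyl_group :: "('g, 'l::euclidean_space) lie_data \<Rightarrow> 'g set monoid" where
  "weyl_group L = (L\<lparr>carrier := normalizer_aa L\<rparr>) Mod centralizer_aa L"

definition weyl_act :: "('g, 'l::euclidean_space) lie_data \<Rightarrow> 'g set \<Rightarrow> 'l \<Rightarrow> 'l" where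
  "weyl_act L w H = (THE H'. \<exists>k\<in>w. H' = Ad L k H)"

definition root_vector :: "('g, 'l::euclidean_space) lie_data \<Rightarrow> ('l \<Rightarrow> real) \<Rightarrow> 'l" where
  "root_vector L \<alpha> = (THE H. H \<in> aa L \<and> (\<forall>H'\<in>aa L. form L H H' = \<alpha> H'))"

definition root_reflection :: "('g, 'l::euclidean_space) lie_data \<Rightarrow> ('l \<Rightarrow> real) \<Rightarrow> 'l \<Rightarrow> 'l" where
  "root_reflection L \<alpha> H = H - (2 * \<alpha> H / \<alpha> (root_vector L \<alpha>)) *\<^sub>R root_vector L \<alpha>"

definition weyl_subgroup ::
  "('g, 'l::euclidean_space) lie_data \<Rightarrow> ('l \<Rightarrow> real) set \<Rightarrow> 'g set set" where
  "weyl_subgroup L \<Theta> = generate (weyl_group L)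
     {w \<in> carrier (weyl_group L). \<exists>\<alpha>\<in>\<Theta>. \<forall>H\<in>aa L. weyl_act L w H = root_reflection L \<alpha> H}"


section \<open>Flag manifolds\<close>

definition quotient_topology :: "'a topology \<Rightarrow> ('a \<Rightarrow> 'b) \<Rightarrow> 'b topology" where
  "quotient_topology T f =
     topology (\<lambda>V. V \<subseteq> f ` topspace T \<and> openin T {x \<in> topspace T. f x \<in> V})"

lemma openin_quotient_topology:
  "openin (quotient_topology T f) V \<longleftrightarrow>
     V \<subseteq> f ` topspace T \<and> openin T {x \<in> topspace T. f x \<in> V}"
proof -
  have inter: "{x \<in> topspace T. f x \<in> A \<inter> B} =
      {x \<in> topspace T. f x \<in> A} \<inter> {x \<in> topspace T. f x \<in> B}" for A B
    by blast
  have union: "{x \<in> topspace T. f x \<in> \<Union>K} = (\<Union>A\<in>K. {x \<in> topspace T. f x \<in> A})" for K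
    by blast
  have "istopology (\<lambda>V. V \<subseteq> f ` topspace T \<and> openin T {x \<in> topspace T. f x \<in> V})"
    unfolding istopology_def inter union by (blast intro: openin_Int openin_Union)
  then show ?thesis
    by (simp add: quotient_topology_def topology_inverse')
qed

lemma quotient_map_quotient_topology: "quotient_map T (quotient_topology T f) f"
proof -
  have "openin (quotient_topology T f) (f ` topspace T)"
    unfolding openin_quotient_topology by (auto intro: back_subst[of "openin T", OF openin_topspace])
  then have "topspace (quotient_topology T f) = f ` topspace T"
    by (meson openin_quotient_topology openin_subset openin_topspace subset_antisym)
  then show ?thesis
    by (auto simp: quotient_map_def openin_quotient_topology)
qed

text \<open>Here \<open>\<mm>\<close> is the centralizer of \<open>\<aa>\<close> in \<open>\<kk>\<close>.\<close>

definition parabolic_algebra ::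
  "('g, 'l::euclidean_space) lie_data \<Rightarrow> ('l \<Rightarrow> real) set \<Rightarrow> 'l set" where
  "parabolic_algebra L \<Theta> = span ({X \<in> kk L. \<forall>H\<in>aa L. bracket L H X = 0} \<union> aa L \<union>
     (\<Union>\<alpha>\<in>pos_roots L. root_space L \<alpha>) \<union>
     (\<Union>\<alpha>\<in>span_roots L \<Theta> \<inter> pos_roots L. root_space L (\<lambda>H. - \<alpha> H)))"

definition parabolic :: "('g, 'l::euclidean_space) lie_data \<Rightarrow> ('l \<Rightarrow> real) set \<Rightarrow> 'g set" where
  "parabolic L \<Theta> = {g \<in> carrier L. Ad L g ` parabolic_algebra L \<Theta> = parabolic_algebra L \<Theta>}"

text \<open>Points of the flag manifold are left cosets of \<open>parabolic L \<Theta>\<close>; its origin is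
  \<open>parabolic L \<Theta>\<close> itself, and the group acts by \<open>l_coset\<close>.\<close>

definition flag_topology ::
  "('g, 'l::euclidean_space) lie_data \<Rightarrow> ('l \<Rightarrow> real) set \<Rightarrow> 'g set topology" where
  "flag_topology L \<Theta> = quotient_topology (gtop L) (\<lambda>g. g <#\<^bsub>L\<^esub> parabolic L \<Theta>)"

definition stabilizer :: "('g, 'l::euclidean_space) lie_data \<Rightarrow> 'l \<Rightarrow> 'g set" where
  "stabilizer L H = {g \<in> carrier L. Ad L g H = H}"

definition adjoint_orbit :: "('g, 'l::euclidean_space) lie_data \<Rightarrow> 'l \<Rightarrow> 'l set" where
  "adjoint_orbit L H = {Ad L g H | g. g \<in> carrier L}"

text \<open>
  For \<open>D = Ad g H\<close> this is the subset \<open>g Z\<^sub>H \<cdot> w b\<^sub>\<Theta>\<close> of the flag manifold, which is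
  independent of \<open>g\<close>. If \<open>w\<close> is the class of \<open>k\<close>, then the setwise product of \<open>w\<close> with the
  parabolic subgroup is the coset of \<open>k\<close>, that is \<open>w b\<^sub>\<Theta>\<close>.
\<close>

definition fix_flag ::
  "('g, 'l::euclidean_space) lie_data \<Rightarrow> ('l \<Rightarrow> real) set \<Rightarrow> 'l \<Rightarrow> 'l \<Rightarrow> 'g set \<Rightarrow> 'g set set" where
  "fix_flag L \<Theta> H D w =
     {(g \<otimes>\<^bsub>L\<^esub> z) <#\<^bsub>L\<^esub> (w <#>\<^bsub>L\<^esub> parabolic L \<Theta>) | g z.
        g \<in> carrier L \<and> Ad L g H = D \<and> z \<in> stabilizer L H}"


section \<open>Principal bundles and associated bundles\<close>

text \<open>
  Local triviality, over the base type \<open>'x\<close>, of a part \<open>P\<close> of the total space on which the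
  subgroup \<open>H\<close> acts on the right.
\<close>

definition locally_trivial ::
  "('g, 'l) lie_data \<Rightarrow> ('q::topological_space \<Rightarrow> 'g \<Rightarrow> 'q) \<Rightarrow> ('q \<Rightarrow> 'x::topological_space) \<Rightarrow>
     'q set \<Rightarrow> 'g set \<Rightarrow> bool" where
  "locally_trivial L act proj P H \<longleftrightarrow> (\<forall>x. \<exists>U \<psi>. open U \<and> x \<in> U \<and>
     homeomorphic_map (prod_topology (top_of_set U) (subtopology (gtop L) H))
       (top_of_set (P \<inter> proj -` U)) \<psi> \<and>
     (\<forall>y\<in>U. \<forall>h\<in>H. proj (\<psi> (y, h)) = y \<and> (\<forall>g\<in>H. \<psi> (y, h \<otimes>\<^bsub>L\<^esub> g) = act (\<psi> (y, h)) g)))"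

definition principal_bundle ::
  "('g, 'l) lie_data \<Rightarrow> ('q::topological_space \<Rightarrow> 'g \<Rightarrow> 'q) \<Rightarrow> ('q \<Rightarrow> 'x::topological_space) \<Rightarrow>
     bool" where
  "principal_bundle L act proj \<longleftrightarrow>
     continuous_map (prod_topology euclidean (gtop L)) euclidean (\<lambda>(q, g). act q g) \<and>
     (\<forall>q. act q \<one>\<^bsub>L\<^esub> = q) \<and>
     (\<forall>q. \<forall>g\<in>carrier L. \<forall>h\<in>carrier L. act (act q g) h = act q (g \<otimes>\<^bsub>L\<^esub> h)) \<and>
     continuous_on UNIV proj \<and> locally_trivial L act proj UNIV (carrier L)"

definition K_subbundle ::
  "('g, 'l::euclidean_space) lie_data \<Rightarrow> ('q::topological_space \<Rightarrow> 'g \<Rightarrow> 'q) \<Rightarrow>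
     ('q \<Rightarrow> 'x::topological_space) \<Rightarrow> 'q set \<Rightarrow> bool" where
  "K_subbundle L act proj R \<longleftrightarrow>
     (\<forall>r\<in>R. \<forall>k\<in>KK L. act r k \<in> R) \<and> locally_trivial L act proj R (KK L)"

definition bundle_automorphism ::
  "('g, 'l) lie_data \<Rightarrow> ('q::topological_space \<Rightarrow> 'g \<Rightarrow> 'q) \<Rightarrow> ('q \<Rightarrow> 'q) \<Rightarrow> bool" where
  "bundle_automorphism L act \<phi> \<longleftrightarrow> homeomorphic_map euclidean euclidean \<phi> \<and>
     (\<forall>q. \<forall>g\<in>carrier L. \<phi> (act q g) = act (\<phi> q) g)"

definition base_map :: "('q \<Rightarrow> 'x) \<Rightarrow> ('q \<Rightarrow> 'q) \<Rightarrow> 'x \<Rightarrow> 'x" where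
  "base_map proj \<phi> x = (THE y. \<forall>q. proj q = x \<longrightarrow> proj (\<phi> q) = y)"

text \<open>
  \<open>assoc_point L act \<rho> q f\<close> is the point \<open>q \<cdot> f\<close> of the bundle associated to the left action \<open>\<rho>\<close>:
  the class of \<open>(q, f)\<close> under \<open>(q, f) \<sim> (q g, g\<^sup>-\<^sup>1 f)\<close>.
\<close>

definition assoc_point ::
  "('g, 'l) lie_data \<Rightarrow> ('q \<Rightarrow> 'g \<Rightarrow> 'q) \<Rightarrow> ('g \<Rightarrow> 'f \<Rightarrow> 'f) \<Rightarrow> 'q \<Rightarrow> 'f \<Rightarrow> ('q \<times> 'f) set" where
  "assoc_point L act \<rho> q f = {(act q g, \<rho> (inv\<^bsub>L\<^esub> g) f) | g. g \<in> carrier L}"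

definition assoc_topology ::
  "('g, 'l) lie_data \<Rightarrow> ('q::topological_space \<Rightarrow> 'g \<Rightarrow> 'q) \<Rightarrow> ('g \<Rightarrow> 'f \<Rightarrow> 'f) \<Rightarrow>
     'f topology \<Rightarrow> ('q \<times> 'f) set topology" where
  "assoc_topology L act \<rho> F =
     quotient_topology (prod_topology euclidean F) (\<lambda>(q, f). assoc_point L act \<rho> q f)"

text \<open>The induced map sends the class of \<open>(q, f)\<close> to the class of \<open>(\<phi> q, f)\<close>.\<close>

definition assoc_map :: "('q \<Rightarrow> 'q) \<Rightarrow> ('q \<times> 'f) set \<Rightarrow> ('q \<times> 'f) set" where
  "assoc_map \<phi> \<xi> = (\<lambda>(q, f). (\<phi> q, f)) ` \<xi>"

abbreviation flag_point ::
  "('g, 'l) lie_data \<Rightarrow> ('q \<Rightarrow> 'g \<Rightarrow> 'q) \<Rightarrow> 'q \<Rightarrow> 'g set \<Rightarrow> ('q \<times> 'g set) set" where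
  "flag_point L act \<equiv> assoc_point L act (l_coset L)"

definition flag_bundle_topology ::
  "('g, 'l::euclidean_space) lie_data \<Rightarrow> ('q::topological_space \<Rightarrow> 'g \<Rightarrow> 'q) \<Rightarrow>
     ('l \<Rightarrow> real) set \<Rightarrow> ('q \<times> 'g set) set topology" where
  "flag_bundle_topology L act \<Theta> = assoc_topology L act (l_coset L) (flag_topology L \<Theta>)"

definition flag_bundle ::
  "('g, 'l::euclidean_space) lie_data \<Rightarrow> ('q::topological_space \<Rightarrow> 'g \<Rightarrow> 'q) \<Rightarrow>
     ('l \<Rightarrow> real) set \<Rightarrow> ('q \<times> 'g set) set set" where
  "flag_bundle L act \<Theta> = topspace (flag_bundle_topology L act \<Theta>)"

text \<open>A choice of compatible metrics on all flag bundles.\<close>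

definition flag_bundle_metrics ::
  "('g, 'l::euclidean_space) lie_data \<Rightarrow> ('q::topological_space \<Rightarrow> 'g \<Rightarrow> 'q) \<Rightarrow>
     (('l \<Rightarrow> real) set \<Rightarrow> ('q \<times> 'g set) set \<Rightarrow> ('q \<times> 'g set) set \<Rightarrow> real) \<Rightarrow> bool" where
  "flag_bundle_metrics L act d \<longleftrightarrow> (\<forall>\<Theta>. \<Theta> \<subseteq> simple L \<longrightarrow>
     Metric_space (flag_bundle L act \<Theta>) (d \<Theta>) \<and>
     Metric_space.mtopology (flag_bundle L act \<Theta>) (d \<Theta>) = flag_bundle_topology L act \<Theta>)"


section \<open>Cocycles and the polar exponent\<close>

definition a_cocycle_R ::
  "('g, 'l::euclidean_space) lie_data \<Rightarrow> ('q \<Rightarrow> 'g \<Rightarrow> 'q) \<Rightarrow> 'q set \<Rightarrow> ('q \<Rightarrow> 'q) \<Rightarrow>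
     nat \<Rightarrow> 'q \<Rightarrow> 'l" where
  "a_cocycle_R L act R \<phi> n r = (THE H. H \<in> aa L \<and>
     (\<exists>r'\<in>R. \<exists>n'\<in>NN L. (\<phi> ^^ n) r = act r' (lie_exp L H \<otimes>\<^bsub>L\<^esub> n')))"

definition a_cocycle ::
  "('g, 'l::euclidean_space) lie_data \<Rightarrow> ('q \<Rightarrow> 'g \<Rightarrow> 'q) \<Rightarrow> 'q set \<Rightarrow> ('q \<Rightarrow> 'q) \<Rightarrow>
     nat \<Rightarrow> ('q \<times> 'g set) set \<Rightarrow> 'l" where
  "a_cocycle L act R \<phi> n \<xi> = (THE H. \<exists>r\<in>R.
     \<xi> = flag_point L act r (parabolic L {}) \<and> H = a_cocycle_R L act R \<phi> n r)"

definition a_plus ::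
  "('g, 'l::euclidean_space) lie_data \<Rightarrow> ('q \<Rightarrow> 'g \<Rightarrow> 'q) \<Rightarrow> 'q set \<Rightarrow> ('q \<Rightarrow> 'q) \<Rightarrow>
     nat \<Rightarrow> 'q \<Rightarrow> 'l" where
  "a_plus L act R \<phi> n r = (THE H. H \<in> closure (chamber L) \<and>
     (\<exists>r'\<in>R. \<exists>s\<in>SS L. \<exists>k\<in>KK L. (\<phi> ^^ n) r = act r' s \<and>
        s = k \<otimes>\<^bsub>L\<^esub> lie_exp L H \<otimes>\<^bsub>L\<^esub> inv\<^bsub>L\<^esub> k))"

definition is_polar_exponent ::
  "('g, 'l::euclidean_space) lie_data \<Rightarrow> ('q \<Rightarrow> 'g \<Rightarrow> 'q) \<Rightarrow> ('q \<Rightarrow> 'x) \<Rightarrow> 'q set \<Rightarrow> ('q \<Rightarrow> 'q) \<Rightarrow>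
     'x measure \<Rightarrow> 'l \<Rightarrow> bool" where
  "is_polar_exponent L act proj R \<phi> \<nu> H \<longleftrightarrow> H \<in> closure (chamber L) \<and>
     (AE x in \<nu>. \<forall>r\<in>R. proj r = x \<longrightarrow>
        (\<lambda>k. (1 / real k) *\<^sub>R a_plus L act R \<phi> k r) \<longlonglongrightarrow> H)"

definition invariant_prob :: "('x::topological_space \<Rightarrow> 'x) \<Rightarrow> 'x measure \<Rightarrow> bool" where
  "invariant_prob f \<mu> \<longleftrightarrow> prob_space \<mu> \<and> sets \<mu> = sets borel \<and> distr \<mu> borel f = \<mu>"


section \<open>Chains, Morse components and the Morse spectrum\<close>

text \<open>
  An \<open>(\<epsilon>, T)\<close>-chain of the flow generated by \<open>F\<close>, inside \<open>M\<close>, with points \<open>\<xi> 0, \<dots>, \<xi> m\<close> and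
  times \<open>n 0, \<dots>, n (m - 1)\<close>; values of \<open>\<xi>\<close> and \<open>n\<close> beyond these are irrelevant.
\<close>

definition is_chain ::
  "('e \<Rightarrow> 'e) \<Rightarrow> ('e \<Rightarrow> 'e \<Rightarrow> real) \<Rightarrow> 'e set \<Rightarrow> real \<Rightarrow> real \<Rightarrow> nat \<Rightarrow> (nat \<Rightarrow> 'e) \<Rightarrow> (nat \<Rightarrow> nat) \<Rightarrow> bool"
  where
  "is_chain F d M \<epsilon> T m \<xi> n \<longleftrightarrow> m > 0 \<and> (\<forall>i\<le>m. \<xi> i \<in> M) \<and>
     (\<forall>i<m. real (n i) \<ge> T \<and> d ((F ^^ n i) (\<xi> i)) (\<xi> (Suc i)) < \<epsilon>)"

definition chain_reach ::
  "('e \<Rightarrow> 'e) \<Rightarrow> ('e \<Rightarrow> 'e \<Rightarrow> real) \<Rightarrow> 'e set \<Rightarrow> 'e \<Rightarrow> 'e \<Rightarrow> bool" where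
  "chain_reach F d M \<eta> \<zeta> \<longleftrightarrow>
     (\<forall>\<epsilon>>0. \<forall>T>0. \<exists>m \<xi> n. is_chain F d M \<epsilon> T m \<xi> n \<and> \<xi> 0 = \<eta> \<and> \<xi> m = \<zeta>)"

definition chain_components ::
  "('e \<Rightarrow> 'e) \<Rightarrow> ('e \<Rightarrow> 'e \<Rightarrow> real) \<Rightarrow> 'e set \<Rightarrow> 'e set set" where
  "chain_components F d M =
     {{\<zeta> \<in> M. chain_reach F d M \<eta> \<zeta> \<and> chain_reach F d M \<zeta> \<eta>} | \<eta>. \<eta> \<in> M \<and> chain_reach F d M \<eta> \<eta>}"

definition omega_limit :: "'e topology \<Rightarrow> ('e \<Rightarrow> 'e) \<Rightarrow> 'e set \<Rightarrow> 'e set" where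
  "omega_limit E F V = (\<Inter>n. E closure_of (\<Union>k\<in>{n..}. (F ^^ k) ` V))"

definition attractor :: "'e topology \<Rightarrow> ('e \<Rightarrow> 'e) \<Rightarrow> 'e set \<Rightarrow> bool" where
  "attractor E F C \<longleftrightarrow> (\<exists>V. openin E V \<and> C \<subseteq> V \<and> omega_limit E F V = C)"

definition morse_component ::
  "('g, 'l::euclidean_space) lie_data \<Rightarrow> ('q \<Rightarrow> 'g \<Rightarrow> 'q) \<Rightarrow> ('x \<Rightarrow> ('q \<times> 'l) set) \<Rightarrow> 'l \<Rightarrow>
     ('l \<Rightarrow> real) set \<Rightarrow> 'g set \<Rightarrow> ('q \<times> 'g set) set set" where
  "morse_component L act \<tau> H \<Theta> w =
     (\<Union>x. {flag_point L act p f | p D f. D \<in> adjoint_orbit L H \<and>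
        \<tau> x = assoc_point L act (Ad L) p D \<and> f \<in> fix_flag L \<Theta> H D w})"

text \<open>
  \<open>\<tau>\<close> is a continuous invariant section of \<open>Q \<times>\<^sub>G Ad(G)H\<close> that describes the finest Morse
  decomposition of every flag bundle, that is, the chain recurrent components. The condition on
  attractors is needed to single out \<open>H\<close>: the other conditions do not distinguish the attractor
  from the repeller.
\<close>

definition is_morse_data ::
  "('g, 'l::euclidean_space) lie_data \<Rightarrow> ('q::topological_space \<Rightarrow> 'g \<Rightarrow> 'q) \<Rightarrow>
     ('q \<Rightarrow> 'x::topological_space) \<Rightarrow> ('q \<Rightarrow> 'q) \<Rightarrow>
     (('l \<Rightarrow> real) set \<Rightarrow> ('q \<times> 'g set) set \<Rightarrow> ('q \<times> 'g set) set \<Rightarrow> real) \<Rightarrow>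
     ('x \<Rightarrow> ('q \<times> 'l) set) \<Rightarrow> 'l \<Rightarrow> bool" where
  "is_morse_data L act proj \<phi> d \<tau> H \<longleftrightarrow>
     H \<in> closure (chamber L) \<and>
     continuous_map euclidean (assoc_topology L act (Ad L) (top_of_set (adjoint_orbit L H))) \<tau> \<and>
     (\<forall>x. \<forall>(p, D)\<in>\<tau> x. proj p = x) \<and>
     (\<forall>x. assoc_map \<phi> (\<tau> x) = \<tau> (base_map proj \<phi> x)) \<and>
     (\<forall>\<Theta>. \<Theta> \<subseteq> simple L \<longrightarrow>
        chain_components (assoc_map \<phi>) (d \<Theta>) (flag_bundle L act \<Theta>) =
        morse_component L act \<tau> H \<Theta> ` carrier (weyl_group L)) \<and>
     {C \<in> chain_components (assoc_map \<phi>) (d {}) (flag_bundle L act {}).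
        attractor (flag_bundle_topology L act {}) (assoc_map \<phi>) C} =
     {morse_component L act \<tau> H {} \<one>\<^bsub>weyl_group L\<^esub>}"

definition morse_spectrum ::
  "('e \<Rightarrow> 'e) \<Rightarrow> ('e \<Rightarrow> 'e \<Rightarrow> real) \<Rightarrow> 'e set \<Rightarrow> (nat \<Rightarrow> 'e \<Rightarrow> 'l::euclidean_space) \<Rightarrow> 'l set" where
  "morse_spectrum F d M a = {l. \<exists>\<epsilon> T m \<xi> n.
     (\<forall>j. \<epsilon> j > 0 \<and> T j > 0 \<and> is_chain F d M (\<epsilon> j) (T j) (m j) (\<xi> j) (n j)) \<and>
     \<epsilon> \<longlonglongrightarrow> 0 \<and> filterlim T at_top sequentially \<and>
     (\<lambda>j. (1 / real (\<Sum>i<m j. n j i)) *\<^sub>R (\<Sum>i<m j. a (n j i) (\<xi> j i))) \<longlonglongrightarrow> l}"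

end

(*
  The cocycle is compared with the polar part of the flow. A reduction of the Morse section to the
  stabilizer Z_H of H = H_Mo writes phi^n, up to bounded factors, as k exp(b) k' with k, k' in the
  maximal compact subgroup of Z_H, where b is close to a^+(n,r); that M^+ attracts makes b dominant
  up to a constant. Moving the base point by the Weyl elements in Z_H gives orbits in M^+ with
  exponents w H_Ly, and chains following several such orbits in turn realize their convex
  combinations. Conversely, Kostant's inequality bounds H0(a(n,xi)) on M^+ by H0'(a^+(n,r)) up to a
  constant, H0' being the dominant element of the orbit of H0 under the Weyl group of Theta_Mo; by
  unique ergodicity the averages of the latter converge uniformly to H0'(H_Ly), so no point of the
  spectrum is separated from the orbit of H_Ly.
*)
theory Submission
 imports Defs "HOL-Complex_Analysis.Complex_Analysis" "Jordan_Normal_Form.Determinant" "HOL-Real_Asymp.Real_Asymp"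
begin
no_notation matrix_matrix_mult (infixl "**" 70)
notation mult (infixl "**\<index>" 70)
notation has_derivative (infix "hasD" 50)
notation has_vector_derivative (infix "hasV" 50)
notation LIMSEQ (infix "---->" 60)
notation scaleR (infixr "*R" 75)
abbreviation "cmap == continuous_map"

section \<open>Smooth maps and the group law in a chart\<close>

text \<open>The structure theory that the overview uses freely is derived here from the charts: the
  exponential map is a limit of dyadic powers, and the bracket comes from differentiating the group
  law. Kostant's inequality rests on one fact: for dominant \<open>b\<close> and \<open>H0\<close>,
  the pairing \<open>form H0 (Ad k b)\<close> over \<open>k\<close> in \<open>K\<close> is largest
  at the identity. Its delicate point is that an element of \<open>K\<close> preserving the minimal
  parabolic subalgebra fixes \<aa>. Such an element need not be joined to the identity inside the
  stabilizer of that subalgebra, so an identity valid near the start of a one-parameter group is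
  carried to its end by analytic continuation.

  Why an attractor makes \<open>b\<close> almost dominant: if \<open>ro H\<close> is nonzero and
  \<open>ro b\<close> is very negative, the flow expands the direction of the root space of
  \<open>-ro\<close> by the factor \<open>exp (- ro b)\<close> and drives points near the attractor
  away from it. Roots vanishing at \<open>H\<close> are made nonnegative on \<open>b\<close> by
  conjugation inside the stabilizer, which is why only their Weyl group appears. Bounded errors are
  measured by the \<open>K\<close>-biinvariant length \<open>nX\<close>, for which the polar part is
  Lipschitz.\<close>

lemma smooth_hasD:
 assumes "smooth_on S f" "open S" "x:S"
 shows "(f hasD frechet_derivative f (at x)) (at x)"
proof -
 have "Ck_on (Suc 0) S f" using assms(1) by (simp only: smooth_on_def)
 thus ?thesis using assms(2,3) by (auto simp: differentiable_on_eq_differentiable_at frechet_derivative_works)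
qed

lemma smooth_on_derivative_has_derivative:
 assumes "smooth_on S f" "open S" "x:S"
 shows "EX G. ((%z. frechet_derivative f (at z) v) hasD G) (at x)"
proof -
 have "Ck_on (Suc (Suc 0)) S f" using assms(1) by (simp only: smooth_on_def)
 thus ?thesis using assms(2,3) by (auto simp: differentiable_on_eq_differentiable_at differentiable_def)
qed

text \<open>\<open>Ck_on\<close> controls the derivative one direction at a time. The bounds on the
  compact ball in the basis directions add up to a bound \<open>C\<close> on the operator norm, to
  which the mean value inequality on the convex ball applies.\<close>

lemma Ck_on_1_lipschitz_on_cball:
 assumes g: "Ck_on (Suc 0) S g" and S: "open S" "cball z r <= S"
 shows "EX C>=0. ALL x:cball z r. ALL y:cball z r. norm (g x-g y) <= C * norm (x-y)"
proof -
 let ?G = "%x. frechet_derivative g (at x)"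
 have der: "(g hasD ?G x) (at x)" if "x:S" for x using g that S(1) by (auto simp: differentiable_on_eq_differentiable_at frechet_derivative_works)
 have "EX K>=0. ALL x:cball z r. norm (?G x w) <= K" for w
 proof -
  have "continuous_on (cball z r) (%x. ?G x w)" using g S(2) by (auto intro: continuous_on_subset)
  hence "bounded ((%x. ?G x w) ` cball z r)" by (intro compact_imp_bounded compact_continuous_image) auto
  then obtain K where "ALL x:cball z r. norm (?G x w) <= K" by (auto simp: bounded_iff)
  thus ?thesis by (intro exI[of _ "max K 0"]) force
 qed
 then obtain K where K: "!!w. K w >= 0" "!!w x. x:cball z r ==> norm (?G x w) <= K w" by metis
 define C where "C = (\<Sum>b\<in>Basis. K b)"
 have "onorm (?G x) <= C" if x: "x:cball z r" for x
 proof (rule onorm_le)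
  fix w
  interpret bounded_linear "?G x" using der x S(2) by blast
  have "?G x w = ?G x (\<Sum>b\<in>Basis. (w \<bullet> b) *R b)" by (simp add: euclidean_representation)
  also have "... = (\<Sum>b\<in>Basis. (w \<bullet> b) *R ?G x b)" by (simp add: sum scaleR)
  also have "norm ... <= (\<Sum>b\<in>Basis. norm w * K b)"
  proof (rule sum_norm_le)
   fix b :: 'a assume "b:Basis"
   thus "norm ((w \<bullet> b) *R ?G x b) <= norm w * K b" using K(2)[OF x, of b] by (auto intro!: mult_mono Basis_le_norm)
  qed
  finally show "norm (?G x w) <= C * norm w" by (simp add: C_def sum_distrib_left mult.commute)
 qed
 hence "norm (g x-g y) <= C * norm (x-y)" if "x:cball z r" "y:cball z r" for x y
  using that has_derivative_at_withinI[OF der, OF subsetD[OF S(2)]] by (intro differentiable_bound[OF convex_cball, where f = g and f' = ?G]) blast+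
 moreover have "C >= 0" using K(1) by (auto simp: C_def sum_nonneg)
 ultimately show ?thesis by auto
qed

text \<open>For a fixed direction the estimate is the previous lemma applied to the directional
  derivative; summing over the basis directions makes the constant uniform in
  \<open>v\<close>.\<close>

lemma smooth_on_derivative_lipschitz:
 fixes f :: "'a::euclidean_space => 'b::euclidean_space"
 assumes f: "smooth_on S f" and S: "open S" "cball z r <= S"
 shows "EX C>=0. ALL x:cball z r. ALL y:cball z r. ALL v.
  norm (frechet_derivative f (at x) v-frechet_derivative f (at y) v) <= C * norm (x-y) * norm v"
proof -
 have "Ck_on (Suc (Suc 0)) S f" using f by (simp only: smooth_on_def)
 hence "Ck_on (Suc 0) S (%x. frechet_derivative f (at x) v)" for v by simp
 from Ck_on_1_lipschitz_on_cball[OF this S] obtain K where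
  K: "!!v. K v >= 0" "!!v x y. x:cball z r ==> y:cball z r ==>
   norm (frechet_derivative f (at x) v-frechet_derivative f (at y) v) <= K v * norm (x-y)" by metis
 define C where "C = (\<Sum>b\<in>Basis. K b)"
 have "norm (frechet_derivative f (at x) v-frechet_derivative f (at y) v) <= C * norm (x-y) * norm v"
  if x: "x:cball z r" and y: "y:cball z r" for x y v
 proof -
  have lin: "bounded_linear (frechet_derivative f (at w))" if "w:cball z r" for w using that smooth_hasD[OF f S(1), of w] S(2) by blast
  define F where "F w = frechet_derivative f (at x) w-frechet_derivative f (at y) w" for w
  interpret F: bounded_linear F unfolding F_def using lin x y by (intro bounded_linear_sub)
  have "F v = F (\<Sum>b\<in>Basis. (v \<bullet> b) *R b)" by (simp add: euclidean_representation)
  also have "... = (\<Sum>b\<in>Basis. (v \<bullet> b) *R F b)" by (simp add: F.sum F.scaleR)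
  also have "norm ... <= (\<Sum>b\<in>Basis. norm v * (K b * norm (x-y)))"
  proof (rule sum_norm_le)
   fix b :: 'a assume "b:Basis"
   thus "norm ((v \<bullet> b) *R F b) <= norm v * (K b * norm (x-y))"
    using K(2)[OF x y, of b] by (auto intro!: mult_mono simp: Basis_le_norm F_def)
  qed
  finally show ?thesis by (simp add: C_def F_def sum_distrib_left sum_distrib_right mult_ac)
 qed
 moreover have "C >= 0" using K(1) by (auto simp: C_def sum_nonneg)
 ultimately show ?thesis by auto
qed

lemma hasD_slice_l:
 assumes "(f hasD D) (at (a,b))"
 shows "((%x. f (x,b)) hasD (%v. D (v,0))) (at a)"
proof -
 have "((%x. (x,b)) hasD (%v. (v,0))) (at a)" by (auto intro!: derivative_eq_intros)
 thus ?thesis using has_derivative_compose[of "%x. (x,b)" "%v. (v,0)" a UNIV f D] assms by simp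
qed

lemma hasD_slice_r:
 assumes "(f hasD D) (at (a,b))"
 shows "((%x. f (a,x)) hasD (%v. D (0,v))) (at b)"
proof -
 have "((%x. (a,x)) hasD (%v. (0,v))) (at b)" by (auto intro!: derivative_eq_intros)
 thus ?thesis using has_derivative_compose[of "%x. (a,x)" "%v. (0,v)" b UNIV f D] assms by simp
qed

text \<open>The unit laws make the partial derivative in the first variable the identity on the
  slice \<open>(a, e)\<close>, and symmetrically for the second. Since the derivative is Lipschitz,
  the map \<open>a \<mapsto> f (a, b) - a\<close> has derivative of order
  \<open>norm (b - e)\<close>, and the mean value inequality turns this into the estimate.\<close>

lemma smooth_unital_product_estimate:
 fixes f :: "'a::euclidean_space \<times> 'a => 'a"
 assumes f: "smooth_on S f" and S: "open S" "(e,e):S" and unit: "!!a. (a,e):S ==> f (a,e) = a" "!!b. (e,b):S ==> f (e,b) = b"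
 obtains r C where "r > 0" "C > 0" "cball e r \<times> cball e r <= S"
  "!!a a' b. a:cball e r ==> a':cball e r ==> b:cball e r ==>
   norm (f (a,b)-f (a',b)-(a-a')) <= C * norm (b-e) * norm (a-a')"
  "!!a b b'. a:cball e r ==> b:cball e r ==> b':cball e r ==>
   norm (f (a,b)-f (a,b')-(b-b')) <= C * norm (a-e) * norm (b-b')"
proof -
 obtain R where R: "R > 0" "cball (e,e) R <= S" using S open_contains_cball by blast
 obtain C where C: "C >= 0" "!!x y v. x:cball (e,e) R ==> y:cball (e,e) R ==>
   norm (frechet_derivative f (at x) v-frechet_derivative f (at y) v) <= C * norm (x-y) * norm v"
  using smooth_on_derivative_lipschitz[OF f S(1) R(2)] by blast
 define r where "r = R/2"
 have r: "r > 0" using R by (simp add: r_def)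
 have cb: "(a,b):cball (e,e) R" if "a:cball e r" "b:cball e r" for a b
 proof -
  have "dist (e,e) (a,b) <= dist e a+dist e b" unfolding dist_Pair_Pair by (rule sqrt_sum_squares_le_sum) auto
  thus ?thesis using that by (simp add: r_def)
 qed
 have sub: "cball e r \<times> cball e r <= S" using cb R(2) by auto
 let ?D = "%x. frechet_derivative f (at x)"
 have der: "(f hasD ?D x) (at x)" if "x:S" for x using smooth_hasD[OF f S(1) that] .
 have slice: "e:cball e r" using r by simp
 have D1: "?D (a,e) (v,0) = v" if a: "a:cball e r" for a v
 proof -
  have ain: "(a,e):S" using a sub slice by auto
  have "\<forall>\<^sub>F x in at a. f (x,e) = x"
  proof -
   have "open ((%x. (x,e)) -` S)" by (intro S(1) continuous_intros)
   hence "\<forall>\<^sub>F x in at a. x:(%x. (x,e)) -` S" using ain by (intro eventually_at_in_open') auto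
   thus ?thesis by eventually_elim (auto simp: unit)
  qed
  hence "((%x. x) hasD (%v. ?D (a,e) (v,0))) (at a)" using has_derivative_transform_eventually ain unit(1) hasD_slice_l[OF der[OF ain]] by fastforce
  moreover have "((%x. x) hasD (%v. v)) (at a)" by simp
  ultimately show ?thesis using has_derivative_unique by metis
 qed
 have D2: "?D (e,b) (0,v) = v" if b: "b:cball e r" for b v
 proof -
  have bin: "(e,b):S" using b sub slice by auto
  have "\<forall>\<^sub>F x in at b. f (e,x) = x"
  proof -
   have "open ((%x. (e,x)) -` S)" by (intro S(1) continuous_intros)
   hence "\<forall>\<^sub>F x in at b. x:(%x. (e,x)) -` S" using bin by (intro eventually_at_in_open') auto
   thus ?thesis by eventually_elim (auto simp: unit)
  qed
  hence "((%x. x) hasD (%v. ?D (e,b) (0,v))) (at b)" using has_derivative_transform_eventually bin unit(2) hasD_slice_r[OF der[OF bin]] by fastforce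
  moreover have "((%x. x) hasD (%v. v)) (at b)" by simp
  ultimately show ?thesis using has_derivative_unique by metis
 qed
 \<comment> \<open>\<open>C + 1\<close> instead of \<open>C\<close> because the constant handed out
   has to be positive, whereas a Lipschitz constant may be zero.\<close>
 have e1: "norm (f (a,b)-f (a',b)-(a-a')) <= (C+1) * norm (b-e) * norm (a-a')"
  if a: "a:cball e r" "a':cball e r" and b: "b:cball e r" for a a' b
 proof -
  define g where "g x = f (x,b)-x" for x
  have dg: "(g hasD (%v. ?D (x,b) (v,0)-v)) (at x)" if "x:cball e r" for x
  proof -
   have xin: "(x,b):S" using that b sub by auto
   show ?thesis unfolding g_def using hasD_slice_l[OF der[OF xin]] by simp
  qed
  have "onorm (%v. ?D (x,b) (v,0)-v) <= (C+1) * norm (b-e)" if x: "x:cball e r" for x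
  proof (rule onorm_le)
   fix v
   have "norm (?D (x,b) (v,0)-?D (x,e) (v,0)) <= C * norm ((x,b)-(x,e)) * norm (v,0::'a)" using C(2) cb x b slice by blast
   also have "... = C * norm (b-e) * norm v" by simp
   also have "... <= (C+1) * norm (b-e) * norm v" by (intro mult_right_mono) auto
   finally show "norm (?D (x,b) (v,0)-v) <= (C+1) * norm (b-e) * norm v" by (simp add: D1[OF x])
  qed
  hence "norm (g a-g a') <= (C+1) * norm (b-e) * norm (a-a')" using a has_derivative_at_withinI[OF dg]
   by (intro differentiable_bound[OF convex_cball, where f = g and f' = "%x v. ?D (x,b) (v,0)-v"]) blast+
  thus ?thesis by (simp add: g_def algebra_simps)
 qed
 have e2: "norm (f (a,b)-f (a,b')-(b-b')) <= (C+1) * norm (a-e) * norm (b-b')"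
  if a: "a:cball e r" and b: "b:cball e r" "b':cball e r" for a b b'
 proof -
  define g where "g x = f (a,x)-x" for x
  have dg: "(g hasD (%v. ?D (a,x) (0,v)-v)) (at x)" if "x:cball e r" for x
  proof -
   have xin: "(a,x):S" using that a sub by auto
   show ?thesis unfolding g_def using hasD_slice_r[OF der[OF xin]] by simp
  qed
  have "onorm (%v. ?D (a,x) (0,v)-v) <= (C+1) * norm (a-e)" if x: "x:cball e r" for x
  proof (rule onorm_le)
   fix v
   have "norm (?D (a,x) (0,v)-?D (e,x) (0,v)) <= C * norm ((a,x)-(e,x)) * norm (0::'a,v)" using C(2) cb x a slice by blast
   also have "... = C * norm (a-e) * norm v" by simp
   also have "... <= (C+1) * norm (a-e) * norm v" by (intro mult_right_mono) auto
   finally show "norm (?D (a,x) (0,v)-v) <= (C+1) * norm (a-e) * norm v" by (simp add: D2[OF x])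
  qed
  hence "norm (g b-g b') <= (C+1) * norm (a-e) * norm (b-b')" using b has_derivative_at_withinI[OF dg]
   by (intro differentiable_bound[OF convex_cball, where f = g and f' = "%x v. ?D (a,x) (0,v)-v"]) blast+
  thus ?thesis by (simp add: g_def algebra_simps)
 qed
 show thesis by (rule that[of r "C+1"]) (use r C(1) sub e1 e2 in auto)
qed

lemma homeomorphic_map_inv_into:
 assumes "homeomorphic_map (subtopology T U) (top_of_set (f ` U)) f" "U <= topspace T"
 shows "cmap (top_of_set (f ` U)) T (inv_into U f)" "inj_on f U"
  "cmap (subtopology T U) euclidean f"
proof -
 have top: "topspace (subtopology T U) = U" using assms(2) by auto
 obtain g where g: "homeomorphic_maps (subtopology T U) (top_of_set (f ` U)) f g" using assms(1) homeomorphic_map_maps by blast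
 show inj: "inj_on f U" using assms(1) homeomorphic_imp_injective_map top by force
 have "cmap (top_of_set (f ` U)) T g" using g continuous_map_in_subtopology by (auto simp: homeomorphic_maps_def)
 moreover have "g y = inv_into U f y" if "y:f ` U" for y using g that inj top by (auto simp: homeomorphic_maps_def)
 ultimately show "cmap (top_of_set (f ` U)) T (inv_into U f)" by (auto intro: continuous_map_eq)
 show "cmap (subtopology T U) euclidean f" using homeomorphic_imp_continuous_map[OF assms(1)] continuous_map_in_subtopology by auto
qed

section \<open>The group law in the chart at the identity\<close>

locale lie_grp =
 fixes L :: "('g,'l::euclidean_space) lie_data" (structure)
 assumes lie: "lie_group L"
begin

abbreviation "G == gtop L"
abbreviation "bk == bracket L"
abbreviation "CL == carrier L"
abbreviation "AD == Ad L"
abbreviation "fo == form L"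
abbreviation "KL == KK L"
abbreviation "aL == aa L"
abbreviation "sL == simple L"
abbreviation "rL == roots L"
abbreviation "rfl == root_reflection L"
abbreviation "rsp == root_space L"
abbreviation "rvec == root_vector L"
abbreviation "cch == closure (chamber L)"

lemma group_L: "group L" using lie by (simp add: lie_group_def)

sublocale group L by (rule group_L)

lemma topspace_G [simp]: "topspace G = CL" using lie by (simp add: lie_group_def)

lemma Hausdorff_G: "Hausdorff_space G" using lie by (simp add: lie_group_def)

lemma cmap_mult:
 assumes "cmap T G f" "cmap T G g"
 shows "cmap T G (%x. f x**g x)"
proof -
 have "cmap (prod_topology G G) G (%(g,h). g**h)" using lie by (simp add: lie_group_def)
 from continuous_map_compose[OF _ this, of T "%x. (f x,g x)"] assms show ?thesis by (simp add: continuous_map_pairedI o_def)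
qed

lemma continuous_map_inv:
 assumes "cmap T G f"
 shows "cmap T G (%x. inv (f x))"
proof -
 have "cmap G G (%g. inv g)" using lie by (simp add: lie_group_def)
 from continuous_map_compose[OF assms this] show ?thesis by (simp add: o_def)
qed

lemma continuous_map_carrier:
 "cmap T G f ==> x:topspace T ==> f x:CL" using continuous_map_image_subset_topspace by force

lemma continuous_map_pow:
 assumes "cmap T G f"
 shows "cmap T G (%x. f x [^] (n::nat))"
proof (induction n)
 case 0
 thus ?case by simp
next
 case (Suc n)
 thus ?case using assms by (simp add: cmap_mult)
qed

lemma chart:
 assumes "(U,kp):charts L"
 shows "openin G U" "U <= CL" "open (kp ` U)" "inj_on kp U"
  "cmap (top_of_set (kp ` U)) G (inv_into U kp)"
  "cmap (subtopology G U) euclidean kp"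
proof -
 show o: "openin G U" "open (kp ` U)" using lie assms by (auto simp: lie_group_def)
 show "U <= CL" using openin_subset[OF o(1)] by simp
 moreover have "homeomorphic_map (subtopology G U) (top_of_set (kp ` U)) kp" using lie assms by (auto simp: lie_group_def)
 ultimately show "inj_on kp U" "cmap (top_of_set (kp ` U)) G (inv_into U kp)"
  "cmap (subtopology G U) euclidean kp" using homeomorphic_map_inv_into[of G U kp] by auto
qed

lemma chart_mult:
 assumes U: "(U,kp):charts L" and V: "(V,mea):charts L" and W: "(W,rh):charts L"
 defines "S == {(x,y). x:kp ` U&y:mea ` V&inv_into U kp x**inv_into V mea y:W}"
 shows "open S" "smooth_on S (%(x,y). rh (inv_into U kp x**inv_into V mea y))"
proof -
 let ?T = "top_of_set (kp ` U \<times> mea ` V)"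
 have "cmap ?T (top_of_set (kp ` U)) fst" "cmap ?T (top_of_set (mea ` V)) snd" by (auto simp: continuous_on_fst continuous_on_snd)
 from continuous_map_compose[OF this(1) chart(5)[OF U]] continuous_map_compose[OF this(2) chart(5)[OF V]]
 have "cmap ?T G (%z. inv_into U kp (fst z)**inv_into V mea (snd z))" by (simp add: cmap_mult o_def)
 from openin_continuous_map_preimage[OF this chart(1)[OF W]]
 have "openin ?T {z:kp ` U \<times> mea ` V. inv_into U kp (fst z)**inv_into V mea (snd z):W}" by simp
 moreover have "{z:kp ` U \<times> mea ` V. inv_into U kp (fst z)**inv_into V mea (snd z):W} = S" by (auto simp: S_def)
 ultimately show "open S" by (metis openin_open_trans open_Times chart(3)[OF U] chart(3)[OF V])
 show "smooth_on S (%(x,y). rh (inv_into U kp x**inv_into V mea y))" using lie U V W unfolding S_def lie_group_def by blast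
qed

definition U1 :: "'g set" where "U1 = fst (chart1 L)"

definition e1 :: 'l where "e1 = loc L \<one>"

text \<open>The chart at the identity, moved so that the identity has coordinate \<open>0\<close>.\<close>

definition u :: "'l => 'g" where "u x = unloc L (e1+x)"

definition l :: "'g => 'l" where "l g = loc L g-e1"

definition mu :: "'l => 'l => 'l" where "mu a b = l (u a**u b)"

definition V1 :: "'l set" where "V1 = l ` U1"

lemma chart1: "(U1,loc L):charts L" "\<one>:U1" using lie by (auto simp: lie_group_def U1_def loc_def)

lemma unloc_eq: "unloc L = inv_into U1 (loc L)" by (simp add: unloc_def U1_def)

lemma V1_eq: "x:V1 \<longleftrightarrow> e1+x:loc L ` U1" by (force simp: V1_def l_def algebra_simps)

lemma U1: "openin G U1" "U1 <= CL" using chart[OF chart1(1)] by auto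

lemma U1_carrier: "g:U1 ==> g:CL" using U1 by auto

lemma open_V1: "open V1"
proof -
 have "V1 = (%x. e1+x) -` loc L ` U1" by (auto simp: V1_eq)
 thus ?thesis using chart(3)[OF chart1(1)] by (auto intro!: continuous_intros)
qed

lemma l_one [simp]: "l \<one> = 0" by (simp add: l_def e1_def)

lemma zero_V1: "0:V1" using chart1(2) by (force simp: V1_def)

lemma u_l [simp]: "g:U1 ==> u (l g) = g" using chart(4)[OF chart1(1)] by (simp add: u_def l_def unloc_eq)

lemma u_in_U1: "x:V1 ==> u x:U1" by (auto simp: V1_def)

lemma l_u [simp]: "x:V1 ==> l (u x) = x" by (auto simp: V1_def)

lemma u_zero [simp]: "u 0 = \<one>" using u_l[OF chart1(2)] by simp

lemma l_inj: "g:U1 ==> h:U1 ==> l g = l h ==> g = h" by (metis u_l)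

lemma continuous_map_u: "cmap (top_of_set V1) G u"
proof -
 have "cmap (top_of_set V1) (top_of_set (loc L ` U1)) (%x. e1+x)" using V1_eq by (auto simp: continuous_intros)
 from continuous_map_compose[OF this chart(5)[OF chart1(1)]] show ?thesis by (simp add: o_def u_def[abs_def] unloc_eq)
qed

lemma continuous_map_l: "cmap (subtopology G U1) euclidean l" unfolding l_def using chart(6)[OF chart1(1)] by (intro continuous_map_diff) auto

lemma mult_chart_smooth:
 "EX S. open S&(e1,e1):S&smooth_on S (%(x,y). loc L (unloc L x**unloc L y)) &
  (ALL (x,y):S. x-e1:V1&y-e1:V1&unloc L x**unloc L y:U1)"
proof (intro exI[of _ "{(x,y). x:loc L ` U1&y:loc L ` U1&unloc L x**unloc L y:U1}"] conjI)
 show "(e1,e1) : {(x,y). x:loc L ` U1&y:loc L ` U1&unloc L x**unloc L y:U1}" using chart1(2) u_zero by (auto simp: e1_def u_def)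
qed (use chart_mult[OF chart1(1) chart1(1) chart1(1)] in "auto simp: unloc_eq V1_eq")

text \<open>Taking the radius at most \<open>1 / C\<close> gives \<open>C * r <= 1\<close>. With it,
  changing the right factor of a product changes the coordinate of the product at most twice as
  much, the bound behind all estimates of powers.\<close>

lemma mu_estimate_ex:
 "EX r C. r > 0&C > 0&C * r <= 1&cball 0 r <= V1 &
  (ALL a:cball 0 r. ALL b:cball 0 r. u a**u b:U1) &
  (ALL a:cball 0 r. ALL a':cball 0 r. ALL b:cball 0 r.
    norm (mu a b-mu a' b-(a-a')) <= C * norm b * norm (a-a')) &
  (ALL a:cball 0 r. ALL b:cball 0 r. ALL b':cball 0 r.
    norm (mu a b-mu a b'-(b-b')) <= C * norm a * norm (b-b'))"
proof -
 let ?f = "%(x,y). loc L (unloc L x**unloc L y)"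
 obtain S where S: "open S" "(e1,e1):S" "smooth_on S ?f"
  "!!x y. (x,y):S ==> x-e1:V1&y-e1:V1&unloc L x**unloc L y:U1" using mult_chart_smooth by auto
 have un: "unloc L e1 = \<one>" "!!x. x-e1:V1 ==> unloc L x:CL&loc L (unloc L x) = x"
  using u_zero u_in_U1 U1_carrier l_u by (force simp: u_def l_def)+
 obtain r C where r: "r > 0" "C > 0" and sub: "cball e1 r \<times> cball e1 r <= S" and
  E1: "!!a a' b. a:cball e1 r ==> a':cball e1 r ==> b:cball e1 r ==>
   norm (?f (a,b)-?f (a',b)-(a-a')) <= C * norm (b-e1) * norm (a-a')" and
  E2: "!!a b b'. a:cball e1 r ==> b:cball e1 r ==> b':cball e1 r ==>
   norm (?f (a,b)-?f (a,b')-(b-b')) <= C * norm (a-e1) * norm (b-b')"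
  by (rule smooth_unital_product_estimate[OF S(3,1,2)]) (use S(4) un in auto)
 define r' where "r' = min r (1/C)"
 have r': "r' > 0" "r' <= r" "C * r' <= 1" using r by (auto simp: r'_def min_def field_simps)
 have sh: "e1+a:cball e1 r" if "a:cball 0 r'" for a using that r' by (simp add: dist_norm)
 have mu: "mu a b = ?f (e1+a,e1+b)-e1" for a b by (simp add: mu_def l_def u_def)
 have inS: "(e1+a,e1+b):S" if "a:cball 0 r'" "b:cball 0 r'" for a b using sub sh that by auto
 show ?thesis
 proof (rule exI[of _ r'], rule exI[of _ C], intro conjI)
  show "cball 0 r' <= V1" using S(4)[OF inS[of _ 0]] r' by auto
  show "ALL a:cball 0 r'. ALL b:cball 0 r'. u a**u b:U1" using S(4)[OF inS] by (simp add: u_def)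
  show "ALL a:cball 0 r'. ALL a':cball 0 r'. ALL b:cball 0 r'.
    norm (mu a b-mu a' b-(a-a')) <= C * norm b * norm (a-a')"
  proof (intro ballI)
   fix a a' b :: 'l assume "a:cball 0 r'" "a':cball 0 r'" "b:cball 0 r'"
   thus "norm (mu a b-mu a' b-(a-a')) <= C * norm b * norm (a-a')" using E1[OF sh sh sh, of a a' b] by (simp add: mu)
  qed
  show "ALL a:cball 0 r'. ALL b:cball 0 r'. ALL b':cball 0 r'.
    norm (mu a b-mu a b'-(b-b')) <= C * norm a * norm (b-b')"
  proof (intro ballI)
   fix a b b' :: 'l assume "a:cball 0 r'" "b:cball 0 r'" "b':cball 0 r'"
   thus "norm (mu a b-mu a b'-(b-b')) <= C * norm a * norm (b-b')" using E2[OF sh sh sh, of a b b'] by (simp add: mu)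
  qed
 qed (use r r' in auto)
qed

text \<open>A single choice fixes the radius and the constant together, so that \<open>rr\<close>
  and \<open>CC\<close> are constants of the group that every later estimate can share.\<close>

definition rC :: "real \<times> real" where
 "rC = (SOME (r,C). r > 0&C > 0&C * r <= 1&cball 0 r <= V1 &
  (ALL a:cball 0 r. ALL b:cball 0 r. u a**u b:U1) &
  (ALL a:cball 0 r. ALL a':cball 0 r. ALL b:cball 0 r.
    norm (mu a b-mu a' b-(a-a')) <= C * norm b * norm (a-a')) &
  (ALL a:cball 0 r. ALL b:cball 0 r. ALL b':cball 0 r.
    norm (mu a b-mu a b'-(b-b')) <= C * norm a * norm (b-b')))"

definition rr :: real where "rr = fst rC"
definition CC :: real where "CC = snd rC"

lemma rC: "rr > 0" "CC > 0" "CC * rr <= 1" "cball 0 rr <= V1"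
  "norm a <= rr ==> norm b <= rr ==> u a**u b:U1"
  "norm a <= rr ==> norm a' <= rr ==> norm b <= rr ==>
    norm (mu a b-mu a' b-(a-a')) <= CC * norm b * norm (a-a')"
  "norm a <= rr ==> norm b <= rr ==> norm b' <= rr ==>
    norm (mu a b-mu a b'-(b-b')) <= CC * norm a * norm (b-b')"
proof -
 have "EX p. case p of (r,C) => r > 0&C > 0&C * r <= 1&cball 0 r <= V1 &
  (ALL a:cball 0 r. ALL b:cball 0 r. u a**u b:U1) &
  (ALL a:cball 0 r. ALL a':cball 0 r. ALL b:cball 0 r.
    norm (mu a b-mu a' b-(a-a')) <= C * norm b * norm (a-a')) &
  (ALL a:cball 0 r. ALL b:cball 0 r. ALL b':cball 0 r.
    norm (mu a b-mu a b'-(b-b')) <= C * norm a * norm (b-b'))" using mu_estimate_ex by auto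
 note * = someI_ex[OF this, folded rC_def]
 obtain r C where eq: "rC = (r,C)" by force
 hence "rr = r" "CC = C" by (auto simp: rr_def CC_def)
 with * eq show "rr > 0" "CC > 0" "CC * rr <= 1" "cball 0 rr <= V1"
  "norm a <= rr ==> norm b <= rr ==> u a**u b:U1"
  "norm a <= rr ==> norm a' <= rr ==> norm b <= rr ==>
    norm (mu a b-mu a' b-(a-a')) <= CC * norm b * norm (a-a')"
  "norm a <= rr ==> norm b <= rr ==> norm b' <= rr ==>
    norm (mu a b-mu a b'-(b-b')) <= CC * norm a * norm (b-b')" by auto
qed

lemma small_V1: "norm a <= rr ==> a:V1" using rC(4) by auto

lemma small_U1: "norm a <= rr ==> u a:U1" using small_V1 u_in_U1 by simp

lemma small_carrier [simp]: "norm a <= rr ==> u a:CL" using small_U1 U1_carrier by simp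

lemma small_l_u [simp]: "norm a <= rr ==> l (u a) = a" using small_V1 by simp

lemma u_mu: "norm a <= rr ==> norm b <= rr ==> u (mu a b) = u a**u b" using rC(5) by (simp add: mu_def)

lemma mu_zero: "norm a <= rr ==> mu a 0 = a" "norm a <= rr ==> mu 0 a = a" by (simp_all add: mu_def)

section \<open>The exponential map\<close>

definition pw :: "'l => nat => 'l" where "pw x k = l (u x [^] k)"

lemma CC_mult_le: "norm a <= rr ==> CC * norm a <= 1" using rC(2,3) mult_left_mono[of "norm a" rr CC] by linarith

lemma mu_diff_left:
 assumes "norm a <= rr" "norm a' <= rr" "norm b <= rr"
 shows "norm (mu a b-mu a' b) <= (1+CC * norm b) * norm (a-a')"
proof -
 show ?thesis using norm_triangle_ineq[of "mu a b-mu a' b-(a-a')" "a-a'"] rC(6)[OF assms] by (simp add: algebra_simps)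
qed

lemma mu_diff_right:
 assumes "norm a <= rr" "norm b <= rr" "norm b' <= rr"
 shows "norm (mu a b-mu a b') <= 2 * norm (b-b')"
proof -
 have "CC * norm a * norm (b-b') <= 1 * norm (b-b')" by (intro mult_right_mono CC_mult_le assms) auto
 thus ?thesis using norm_triangle_ineq[of "mu a b-mu a b'-(b-b')" "b-b'"] rC(7)[OF assms] by simp
qed

lemma mu_norm_le: "norm a <= rr ==> norm b <= rr ==> norm (mu a b) <= norm a+2 * norm b"
 using mu_diff_right[of a b 0] rC(1) mu_zero(1) norm_triangle_ineq[of "mu a b-a" a] by simp

lemma pw_0 [simp]: "pw x 0 = 0" by (simp add: pw_def)

lemma pw_bound:
 "real k * norm x <= rr/2 ==> u (pw x k) = u x [^] k&norm (pw x k) <= 2 * real k * norm x"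
proof (induction k)
 case 0
 thus ?case by simp
next
 case (Suc k)
 have k: "real k * norm x <= rr/2" and x: "norm x <= rr" using Suc.prems mult_nonneg_nonneg[of "real k" "norm x"] norm_ge_zero[of x]
  unfolding of_nat_Suc ring_distribs by linarith+
 have IH: "u (pw x k) = u x [^] k" "norm (pw x k) <= 2 * real k * norm x" using Suc.IH[OF k] by auto
 hence p: "norm (pw x k) <= rr" using k by simp
 have eq: "pw x (Suc k) = mu (pw x k) x" by (simp add: pw_def[of x "Suc k"] mu_def IH)
 show ?case unfolding eq using u_mu[OF p x] mu_norm_le[OF p x] IH by (simp add: algebra_simps)
qed

lemma pw_small: "real k * norm x <= rr/2 ==> norm (pw x k) <= rr" using pw_bound[of k x] by simp

lemma pw_Suc:
 assumes "real (Suc k) * norm x <= rr/2"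
 shows "pw x (Suc k) = mu (pw x k) x" "real k * norm x <= rr/2" "norm x <= rr/2"
proof -
 have "real k * norm x >= 0" by simp
 thus *: "real k * norm x <= rr/2" "norm x <= rr/2" using assms norm_ge_zero[of x] unfolding of_nat_Suc ring_distribs by linarith+
 show "pw x (Suc k) = mu (pw x k) x" using pw_bound[OF *(1)] by (simp add: pw_def mu_def)
qed

text \<open>Each further factor multiplies the difference by at most \<open>1 + CC * norm x\<close>
  and adds \<open>2 * norm (x - y)\<close>. As \<open>k * norm x\<close> is at most
  \<open>rr/2\<close> and \<open>CC * rr <= 1\<close>, these factors multiply to at most
  \<open>exp 1 <= 3\<close>. Hence the constant 6, and growth that is only linear in
  \<open>k\<close>.\<close>

lemma pw_diff:
 assumes "real k * norm x <= rr/2" "real k * norm y <= rr/2"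
 shows "norm (pw x k-pw y k) <= 6 * real k * norm (x-y)"
proof -
 have *: "norm (pw x k-pw y k) <= 2 * real k * (1+CC * norm x) ^ k * norm (x-y)" using assms
 proof (induction k)
  case 0
  thus ?case by simp
 next
  case (Suc k)
  note x = pw_Suc[OF Suc.prems(1)] and y = pw_Suc[OF Suc.prems(2)]
  let ?q = "1+CC * norm x" and ?d = "norm (x-y)"
  have q: "?q >= 1" using rC(2) by simp
  have "norm (mu (pw x k) x-mu (pw y k) y) <=
    norm (mu (pw x k) x-mu (pw y k) x)+norm (mu (pw y k) x-mu (pw y k) y)"
   using norm_triangle_ineq[of "mu (pw x k) x-mu (pw y k) x" "mu (pw y k) x-mu (pw y k) y"] by simp
  also have "... <= ?q * norm (pw x k-pw y k)+2 * ?d" by (intro add_mono mu_diff_left mu_diff_right) (use pw_small x(2,3) y(2,3) rC(1) in auto)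
  also have "... <= ?q * (2 * real k * ?q ^ k * ?d)+2 * (?q ^ Suc k * ?d)"
  proof (intro add_mono mult_left_mono)
   show "?d <= ?q ^ Suc k * ?d" using one_le_power[OF q, of "Suc k"] by (simp add: mult_le_cancel_right1)
  qed (use Suc.IH x y q in auto)
  also have "... = 2 * real (Suc k) * ?q ^ Suc k * ?d" by (simp add: algebra_simps)
  finally show ?case using x(1) y(1) by simp
 qed
 have "(1+CC * norm x) ^ k <= exp (CC * norm x) ^ k" using rC(2) by (intro power_mono) auto
 also have "... = exp (CC * (real k * norm x))" by (simp add: exp_of_nat_mult[symmetric])
 also have "... <= exp 1"
 proof -
  have "CC * (real k * norm x) <= CC * (rr/2)" using assms rC(2) by simp
  thus ?thesis using rC(3) by simp
 qed
 also have "... <= 3" by (rule exp_le)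
 finally have "2 * real k * (1+CC * norm x) ^ k * norm (x-y) <= 2 * real k * 3 * norm (x-y)" by (intro mult_right_mono mult_left_mono) auto
 from order_trans[OF * this] show ?thesis by simp
qed

text \<open>Multiplying by one more factor differs from adding \<open>y\<close> by at most
  \<open>CC * norm (pw y k) * norm y\<close>, and \<open>pw y k\<close> is of order
  \<open>k * norm y\<close>. Over \<open>k\<close> steps these second order errors add up
  quadratically in \<open>k\<close>.\<close>

lemma pw_linear:
 assumes "real k * norm y <= rr/2"
 shows "norm (pw y k-real k *R y) <= 2 * CC * (real k)\<^sup>2 * (norm y)\<^sup>2" using assms
proof (induction k)
 case 0
 thus ?case by simp
next
 case (Suc k)
 note y = pw_Suc[OF Suc.prems]
 have p: "norm (pw y k) <= rr" "norm y <= rr" using pw_small y rC(1) by auto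
 have "norm (mu (pw y k) y-pw y k-y) <= CC * norm (pw y k) * norm y" using rC(7)[OF p, of 0] rC(1) p mu_zero by simp
 also have "... <= CC * (2 * real k * norm y) * norm y" using pw_bound[OF y(2)] rC(2) by (intro mult_right_mono) auto
 finally have "norm (pw y (Suc k)-pw y k-y) <= 2 * CC * real k * (norm y)\<^sup>2" using y(1) by (simp add: power2_eq_square)
 moreover have "norm (pw y (Suc k)-real (Suc k) *R y) <=
   norm (pw y (Suc k)-pw y k-y)+norm (pw y k-real k *R y)" using norm_triangle_ineq[of "pw y (Suc k)-pw y k-y" "pw y k-real k *R y"]
  by (simp add: algebra_simps)
 ultimately have "norm (pw y (Suc k)-real (Suc k) *R y) <= 2 * CC * (real k+(real k)\<^sup>2) * (norm y)\<^sup>2" using Suc.IH y by (simp add: algebra_simps)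
 also have "... <= 2 * CC * (real (Suc k))\<^sup>2 * (norm y)\<^sup>2"
  using rC(2) by (intro mult_right_mono) (auto simp: power2_eq_square algebra_simps)
 finally show ?case .
qed

lemma pw_pw:
 assumes "real k * norm x <= rr/2"
 shows "pw (pw x k) m = pw x (k * m)"
proof -
 have "norm x <= rr | k = 0" using assms rC(1) mult_right_mono[of 1 "real k" "norm x"] by auto
 thus ?thesis using pw_bound[OF assms] by (auto simp: pw_def nat_pow_pow)
qed

lemma two_power_mult_square: "2 ^ n * (a/2 ^ n)\<^sup>2 = a\<^sup>2 * (1/2) ^ n" for a :: real by (simp add: power_divide power2_eq_square)

text \<open>The usual product formula for the exponential. Dyadic exponents make two consecutive
  approximations comparable by a single squaring.\<close>

definition En :: "nat => 'l => 'l" where "En n x = pw ((1/2 ^ n) *R x) (2 ^ n)"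

definition EE :: "'l => 'l" where "EE x = lim (%n. En n x)"

text \<open>With \<open>y = x / 2^(n+1)\<close>, both approximations are \<open>2^n\<close>-th
  powers, of the elements with coordinates \<open>pw y 2\<close> and \<open>2 y\<close>. These
  coordinates differ by at most \<open>8 * CC * (norm y)^2\<close>, and taking the power amplifies
  this by \<open>6 * 2^n\<close>; together this is the factor 12 and one remaining
  \<open>1/2^n\<close>.\<close>

lemma En_step:
 assumes x: "norm x <= rr/4"
 shows "norm (En (Suc n) x-En n x) <= 12 * CC * (norm x)\<^sup>2 * (1/2) ^ n"
proof -
 define y where "y = (1/2 ^ Suc n) *R x"
 have y: "norm y = norm x/2 ^ Suc n" by (simp add: y_def)
 have y4: "norm y <= rr/4"
 proof -
  have "norm x/2 ^ Suc n <= norm x/1" by (intro divide_left_mono one_le_power) auto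
  thus ?thesis using x y by simp
 qed
 hence b2: "real 2 * norm y <= rr/2" by simp
 have "En n x = pw (2 *R y) (2 ^ n)" by (simp add: En_def y_def)
 hence "norm (En (Suc n) x-En n x) = norm (pw (pw y 2) (2 ^ n)-pw (2 *R y) (2 ^ n))" unfolding pw_pw[OF b2] by (simp add: En_def y_def)
 moreover have "norm (pw (pw y 2) (2 ^ n)-pw (2 *R y) (2 ^ n)) <= 6 * real (2 ^ n) * norm (pw y 2-2 *R y)"
 proof (rule pw_diff)
  have "real (2 ^ n) * norm (pw y 2) <= real (2 ^ n) * (4 * norm y)" using pw_bound[OF b2] by simp
  thus "real (2 ^ n) * norm (pw y 2) <= rr/2" using x by (simp add: y)
  show "real (2 ^ n) * norm (2 *R y) <= rr/2" using x rC(1) by (simp add: y)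
 qed
 moreover have "6 * real (2 ^ n) * norm (pw y 2-2 *R y) <= 6 * real (2 ^ n) * (2 * CC * 2\<^sup>2 * (norm y)\<^sup>2)"
  using pw_linear[OF b2] by simp
 moreover have "6 * real (2 ^ n) * (2 * CC * 2\<^sup>2 * (norm y)\<^sup>2) = 12 * CC * (norm x)\<^sup>2 * (1/2) ^ n"
  by (simp add: y power_divide power2_eq_square)
 ultimately show ?thesis by linarith
qed

lemma En_0: "norm x <= rr ==> En 0 x = x" by (simp add: En_def pw_def)

lemma En_bounds:
 assumes x: "norm x <= rr/4"
 shows "real (2 ^ n) * norm ((1/2 ^ n) *R x) <= rr/4" "norm (En n x) <= 2 * norm x"
  "u (En n x) = u ((1/2 ^ n) *R x) [^] (2 ^ n :: nat)"
proof -
 show *: "real (2 ^ n) * norm ((1/2 ^ n) *R x) <= rr/4" using x by simp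
 hence "real (2 ^ n) * norm ((1/2 ^ n) *R x) <= rr/2" using rC(1) by simp
 from pw_bound[OF this] show "norm (En n x) <= 2 * norm x"
  "u (En n x) = u ((1/2 ^ n) *R x) [^] (2 ^ n :: nat)" by (auto simp: En_def)
qed

lemma EE_lim:
 assumes x: "norm x <= rr/4"
 shows "(%n. En n x) ----> EE x" "norm (EE x-x) <= 24 * CC * (norm x)\<^sup>2" "norm (EE x) <= 2 * norm x"
proof -
 let ?d = "%n. En (Suc n) x-En n x" and ?c = "12 * CC * (norm x)\<^sup>2"
 have sums: "(%n. ?c * (1/2) ^ n) sums (?c * 2)" using sums_mult[OF geometric_sums[of "1/2::real"], of ?c] by simp
 hence sm: "summable (%n. ?c * (1/2) ^ n)" by simp
 have "summable (%n. norm (?d n))" by (rule summable_comparison_test'[OF sm, of 0]) (use En_step[OF x] in auto)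
 hence sd: "summable ?d" "norm (suminf ?d) <= (\<Sum>n. norm (?d n))" by (auto intro: summable_norm_cancel summable_norm)
 have "(%n. \<Sum>i<n. ?d i) ----> suminf ?d" using summable_LIMSEQ[OF sd(1)] .
 moreover have "(\<Sum>i<n. ?d i) = En n x-En 0 x" for n by (rule sum_lessThan_telescope)
 ultimately have "(%n. En n x-En 0 x) ----> suminf ?d" by simp
 from tendsto_add[OF this tendsto_const[of "En 0 x"]]
 have lim: "(%n. En n x) ----> suminf ?d+En 0 x" by simp
 thus l: "(%n. En n x) ----> EE x" using limI[OF lim] by (simp add: EE_def)
 show "norm (EE x-x) <= 24 * CC * (norm x)\<^sup>2" using suminf_le[OF En_step[OF x] \<open>summable (%n. norm (?d n))\<close> sm] sums_unique[OF sums] LIMSEQ_unique[OF l lim] En_0 x rC(1) sd(2) by simp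
 show "norm (EE x) <= 2 * norm x" using tendsto_norm[OF l] En_bounds(2)[OF x] by (intro LIMSEQ_le_const2) auto
qed

lemma EE_lipschitz:
 assumes x: "norm x <= rr/4" "norm y <= rr/4"
 shows "norm (EE x-EE y) <= 6 * norm (x-y)"
proof -
 have "norm (En n x-En n y) <= 6 * norm (x-y)" for n
 proof -
  have "norm (En n x-En n y) <= 6 * real (2 ^ n) * norm ((1/2 ^ n) *R x-(1/2 ^ n) *R y)"
   unfolding En_def using En_bounds(1)[OF x(1), of n] En_bounds(1)[OF x(2), of n] rC(1) by (intro pw_diff) auto
  also have "... = 6 * norm (x-y)" by (simp add: scaleR_right_diff_distrib[symmetric])
  finally show ?thesis .
 qed
 moreover have "(%n. norm (En n x-En n y)) ----> norm (EE x-EE y)" by (intro tendsto_intros EE_lim x)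
 ultimately show ?thesis using LIMSEQ_le_const2 by blast
qed

lemma continuous_on_EE: "continuous_on (cball 0 (rr/4)) EE" by (rule lipschitz_on_continuous_on[of 6], rule lipschitz_onI)
  (use EE_lipschitz in "auto simp: dist_norm")

lemma pw_limit:
 assumes "xs ----> x" "!!n. real k * norm (xs n) <= rr/2"
 shows "(%n. pw (xs n) k) ----> pw x k"
proof -
 have x: "real k * norm x <= rr/2"
 proof (rule LIMSEQ_le_const2)
  show "(%n. real k * norm (xs n)) ----> real k * norm x" by (intro tendsto_intros assms(1))
 qed (use assms(2) in blast)
 have "(%n. 6 * real k * norm (xs n-x)) ----> 6 * real k * norm (x-x)" by (intro tendsto_intros assms)
 hence "(%n. 6 * real k * norm (xs n-x)) ----> 0" by simp
 with always_eventually[OF allI[OF pw_diff[OF assms(2) x]]]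
 have "(%n. pw (xs n) k-pw x k) ----> 0" by (rule Lim_null_comparison)
 thus ?thesis by (simp add: LIM_zero_iff)
qed

text \<open>Powers of one element commute, so both sides are limits of \<open>2^n\<close>-th powers,
  of the elements with coordinates \<open>k y\<close> and \<open>pw y k\<close> for
  \<open>y = x / 2^n\<close>. The difference is of second order in \<open>y\<close> and survives the
  amplification by \<open>2^n\<close> as a multiple of \<open>1/2^n\<close>.\<close>

lemma EE_nat_mult:
 assumes "real k * norm x <= rr/4"
 shows "EE (real k *R x) = pw (EE x) k"
proof (cases "k = 0")
 case True
 have "norm (EE 0) <= 0" using EE_lim(3)[of 0] rC(1) by simp
 with True show ?thesis by simp
next
 case False
 have x: "norm x <= rr/4"
 proof -
  have "1 * norm x <= real k * norm x" using False by (intro mult_right_mono) auto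
  thus ?thesis using assms by simp
 qed
 have kx: "norm (real k *R x) <= rr/4" using assms by simp
 have kE: "real k * norm (En n x) <= rr/2" for n using mult_left_mono[OF En_bounds(2)[OF x, of n], of "real k"] assms by simp
 have "norm (En n (real k *R x)-pw (En n x) k) <= 12 * CC * (real k)\<^sup>2 * (norm x)\<^sup>2 * (1/2) ^ n" for n
 proof -
  define y where "y = (1/2 ^ n) *R x"
  have y: "norm y = norm x/2 ^ n" by (simp add: y_def)
  have ky: "real k * norm y <= rr/4"
  proof -
   have "norm x/2 ^ n <= norm x/1" by (intro divide_left_mono) auto
   hence "real k * norm y <= real k * norm x" using y by (intro mult_left_mono) auto
   thus ?thesis using assms by simp
  qed
  hence ky2: "real k * norm y <= rr/2" using rC(1) by simp
  have ey: "real (2 ^ n) * norm y <= rr/2" using x rC(1) by (simp add: y)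
  have "norm (En n (real k *R x)-pw (En n x) k) = norm (pw (real k *R y) (2 ^ n)-pw (pw y k) (2 ^ n))" unfolding En_def y_def[symmetric] pw_pw[OF ey] pw_pw[OF ky2] by (simp only: mult.commute) (simp add: En_def y_def)
  moreover have "norm (pw (real k *R y) (2 ^ n)-pw (pw y k) (2 ^ n)) <=
    6 * real (2 ^ n) * norm (real k *R y-pw y k)"
  proof (rule pw_diff)
   show "real (2 ^ n) * norm (real k *R y) <= rr/2" using assms rC(1) by (simp add: y)
   have "real (2 ^ n) * norm (pw y k) <= real (2 ^ n) * (2 * real k * norm y)" using pw_bound[OF ky2] by simp
   also have "... = 2 * (real k * norm x)" by (simp add: y)
   finally show "real (2 ^ n) * norm (pw y k) <= rr/2" using assms by simp
  qed
  moreover have "6 * real (2 ^ n) * norm (real k *R y-pw y k) <=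
    6 * real (2 ^ n) * (2 * CC * (real k)\<^sup>2 * (norm y)\<^sup>2)"
   using pw_linear[OF ky2] by (intro mult_left_mono) (auto simp: norm_minus_commute)
  moreover have "... = 12 * CC * (real k)\<^sup>2 * (2 ^ n * (norm y)\<^sup>2)" by simp
  ultimately show ?thesis unfolding y two_power_mult_square by linarith
 qed
 from Lim_null_comparison[OF always_eventually[OF allI[OF this]]
   tendsto_mult_right_zero[OF LIMSEQ_realpow_zero]]
 have "(%n. En n (real k *R x)-pw (En n x) k) ----> 0" by simp
 moreover have "(%n. En n (real k *R x)-pw (En n x) k) ----> EE (real k *R x)-pw (EE x) k"
  by (rule tendsto_diff[OF EE_lim(1)[OF kx] pw_limit[OF EE_lim(1)[OF x] kE]])
 ultimately show ?thesis using LIMSEQ_unique by force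
qed

lemma mu_limit:
 assumes "xs ----> x" "ys ----> y" "!!n. norm (xs n) <= rr" "!!n. norm (ys n) <= rr"
 shows "(%n. mu (xs n) (ys n)) ----> mu x y"
proof -
 have xy: "norm x <= rr" "norm y <= rr" using LIMSEQ_le_const2[OF tendsto_norm[OF assms(1)]] LIMSEQ_le_const2[OF tendsto_norm[OF assms(2)]]
   assms(3,4) by auto
 have "norm (mu (xs n) (ys n)-mu x y) <= 2 * norm (xs n-x)+2 * norm (ys n-y)" for n
 proof -
  have "norm (mu (xs n) (ys n)-mu x (ys n)) <= (1+CC * norm (ys n)) * norm (xs n-x)" using assms xy by (intro mu_diff_left)
  moreover have "(1+CC * norm (ys n)) * norm (xs n-x) <= 2 * norm (xs n-x)" using CC_mult_le[OF assms(4)[of n]] by (intro mult_right_mono) auto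
  moreover have "norm (mu x (ys n)-mu x y) <= 2 * norm (ys n-y)" using assms xy by (intro mu_diff_right)
  ultimately show ?thesis using norm_triangle_ineq[of "mu (xs n) (ys n)-mu x (ys n)" "mu x (ys n)-mu x y"] by simp
 qed
 note * = Lim_null_comparison[OF always_eventually[OF allI[OF this]]]
 have "(%n. 2 * norm (xs n-x)+2 * norm (ys n-y)) ----> 2 * norm (x-x)+2 * norm (y-y)" by (intro tendsto_intros assms(1,2))
 hence "(%n. mu (xs n) (ys n)-mu x y) ----> 0" by (intro *) simp
 thus ?thesis by (simp add: LIM_zero_iff)
qed

text \<open>Inserting \<open>u y ** u (- y)\<close>, which is \<open>\<one>\<close> up to second order, in the middle of
 \<open>(u y)\<^sup>k ** (u (- y))\<^sup>k\<close> changes the product by a second order term only.\<close>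

lemma EE_minus:
 assumes x: "norm x <= rr/4"
 shows "mu (EE x) (EE (- x)) = 0"
proof -
 have mx: "norm (- x) <= rr/4" using x by simp
 have "norm (mu (En n x) (En n (- x))) <= 8 * CC * (norm x)\<^sup>2 * (1/2) ^ n" for n
 proof -
  define y where "y = (1/2 ^ n) *R x"
  have y: "norm y = norm x/2 ^ n" by (simp add: y_def)
  have my: "(1/2 ^ n) *R (- x) =-y" by (simp add: y_def)
  have y4: "norm y <= rr/4"
  proof -
   have "norm x/2 ^ n <= norm x/1" by (intro divide_left_mono) auto
   thus ?thesis using x y by linarith
  qed
  define w where "w = mu y (- y)"
  have w: "norm w <= CC * (norm y)\<^sup>2" using rC(7)[of y "- y" 0] y4 rC(1) mu_zero(1) by (simp add: w_def power2_eq_square)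
  have uw: "u w = u y**u (- y)" unfolding w_def using y4 rC(1) by (intro u_mu) auto
  have w4: "norm w <= rr/4"
  proof -
   have "CC * (norm y)\<^sup>2 = (CC * norm y) * norm y" by (simp add: power2_eq_square)
   also have "... <= 1 * norm y" using y4 rC(1) by (intro mult_right_mono CC_mult_le) auto
   finally show ?thesis using w y4 by simp
  qed
  have "norm (mu (pw y k) (pw (- y) k)) <= 8 * real k * (CC * (norm y)\<^sup>2)" if "k <= 2 ^ n" for k using that
  proof (induction k)
   case 0
   thus ?case using mu_zero(1) rC(1) by simp
  next
   case (Suc k)
   have kk: "real (Suc k) * norm y <= rr/4"
   proof -
    have "real (Suc k) <= 2 ^ n" using Suc.prems by (metis of_nat_le_iff of_nat_power of_nat_numeral)
    hence "real (Suc k) * norm y <= 2 ^ n * norm y" by (intro mult_right_mono) auto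
    also have "... = norm x" using y by simp
    finally show ?thesis using x by simp
   qed
   hence "real (Suc k) * norm y <= rr/2" "real (Suc k) * norm (- y) <= rr/2" using rC(1) by auto
   note a = pw_Suc[OF this(1)] and b = pw_Suc[OF this(2)]
   have ka: "real k * norm y <= rr/4" using kk norm_ge_zero[of y] unfolding of_nat_Suc ring_distribs by linarith
   have pa: "norm (pw y k) <= rr/2" "norm (pw (- y) k) <= rr/2" using pw_bound[OF a(2)] pw_bound[OF b(2)] ka by auto
   have up: "u (pw y k) = u y [^] k" "u (pw (- y) k) = u (- y) [^] k" using pw_bound[OF a(2)] pw_bound[OF b(2)] by auto
   define b' where "b' = mu w (pw (- y) k)"
   have pr: "norm (pw (- y) k) <= rr" "norm w <= rr" using pa w4 rC(1) by auto
   have b'd: "norm (b'-pw (- y) k) <= 2 * norm w"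
   proof -
    have "norm (b'-pw (- y) k) <= (1+CC * norm (pw (- y) k)) * norm w"
     unfolding b'_def using mu_diff_left[of w 0 "pw (- y) k"] pr rC(1) mu_zero(2) by simp
    also have "... <= 2 * norm w" using CC_mult_le[OF pr(1)] by (intro mult_right_mono) auto
    finally show ?thesis .
   qed
   have car: "u y:CL" "u (- y):CL" using y4 rC(1) by auto
   have eq: "mu (pw y (Suc k)) (pw (- y) (Suc k)) = mu (pw y k) b'"
   proof -
    have "u b' = u w**u (- y) [^] k" unfolding b'_def up(2)[symmetric] using w4 pa rC(1) by (intro u_mu) auto
    moreover have "u (pw y (Suc k)) = u y [^] Suc k" "u (pw (- y) (Suc k)) = u (- y) [^] Suc k" using kk rC(1) pw_bound by auto
    ultimately show ?thesis unfolding uw nat_pow_Suc2[OF car(2)] using car by (simp add: mu_def up m_assoc)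
   qed
   have "norm (mu (pw y k) b') <= 2 * (2 * norm w)+8 * real k * (CC * (norm y)\<^sup>2)" using b'd w4 pa norm_triangle_ineq[of "b'-pw (- y) k" "pw (- y) k"] norm_triangle_ineq[of "mu (pw y k) b'-mu (pw y k) (pw (- y) k)" "mu (pw y k) (pw (- y) k)"] mu_diff_right[of "pw y k" b' "pw (- y) k"] rC(1) Suc by force
   also have "... <= 8 * (CC * (norm y)\<^sup>2)+8 * real k * (CC * (norm y)\<^sup>2)"
    using w rC(2) zero_le_power2[of "norm y"] mult_nonneg_nonneg[of CC "(norm y)\<^sup>2"] by linarith
   finally show ?case by (simp add: eq algebra_simps)
  qed
  hence "norm (mu (En n x) (En n (- x))) <= 8 * real (2 ^ n) * (CC * (norm y)\<^sup>2)" unfolding En_def my y_def by blast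
  also have "... = 8 * CC * (2 ^ n * (norm y)\<^sup>2)" by simp
  finally show ?thesis unfolding y two_power_mult_square by simp
 qed
 from Lim_null_comparison[OF always_eventually[OF allI[OF this]]
   tendsto_mult_right_zero[OF LIMSEQ_realpow_zero]]
 have "(%n. mu (En n x) (En n (- x))) ----> 0" by simp
 moreover have "(%n. mu (En n x) (En n (- x))) ----> mu (EE x) (EE (- x))"
 proof (rule mu_limit[OF EE_lim(1)[OF x] EE_lim(1)[OF mx]])
  show "norm (En n x) <= rr" "norm (En n (- x)) <= rr" for n using En_bounds(2)[OF x, of n] En_bounds(2)[OF mx, of n] x rC(1) by auto
 qed
 ultimately show ?thesis using LIMSEQ_unique by auto
qed

definition ex :: "'l => 'g" where "ex x = u (EE x)"

lemma EE_norm_le: "norm x <= rr/4 ==> norm (EE x) <= rr/2" using EE_lim(3)[of x] by simp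

lemma EE_small: "norm x <= rr/4 ==> norm (EE x) <= rr" using EE_norm_le[of x] rC(1) by simp

lemma ex_carrier: "norm x <= rr/4 ==> ex x:CL" by (simp add: ex_def EE_small)

lemma l_ex: "norm x <= rr/4 ==> l (ex x) = EE x" by (simp add: ex_def EE_small)

lemma EE_0 [simp]: "EE 0 = 0" using EE_lim(3)[of 0] rC(1) by simp

lemma ex_0 [simp]: "ex 0 = \<one>" by (simp add: ex_def)

lemma ex_nat_mult:
 assumes "real k * norm x <= rr/4" "norm x <= rr/4"
 shows "ex (real k *R x) = ex x [^] k"
proof -
 have "real k * norm (EE x) <= real k * (2 * norm x)" using EE_lim(3)[OF assms(2)] by (intro mult_left_mono) auto
 thus ?thesis using assms(1) pw_bound by (simp add: ex_def EE_nat_mult)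
qed

lemma ex_mult_EE: "norm x <= rr/4 ==> norm y <= rr/4 ==> ex x**ex y = u (mu (EE x) (EE y))" by (simp add: ex_def u_mu EE_small)

lemma ex_minus:
 assumes x: "norm x <= rr/4"
 shows "ex (- x) = inv (ex x)"
proof -
 have "ex x**ex (- x) = \<one>" using x by (simp add: ex_mult_EE EE_minus)
 thus ?thesis using ex_carrier x inv_equality inv_comm by (metis norm_minus_cancel)
qed

lemma EE_limit:
 assumes "xs ----> x" "!!n. norm (xs n) <= rr/4"
 shows "(%n. EE (xs n)) ----> EE x"
proof -
 have x: "norm x <= rr/4" using LIMSEQ_le_const2[OF tendsto_norm[OF assms(1)]] assms(2) by blast
 thus ?thesis using assms(2) by (intro continuous_on_tendsto_compose[OF continuous_on_EE assms(1)]) auto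
qed

lemma floor_quotient_limit:
 assumes "s >= 0"
 shows "(%q. real (nat \<lfloor>s * real (Suc q)\<rfloor>)/real (Suc q)) ----> s"
proof (rule real_tendsto_sandwich)
 have f: "real (nat \<lfloor>s * real (Suc q)\<rfloor>) = of_int \<lfloor>s * real (Suc q)\<rfloor>" for q using assms by simp
 show "\<forall>\<^sub>F q in sequentially. s-inverse (real (Suc q)) <= real (nat \<lfloor>s * real (Suc q)\<rfloor>)/real (Suc q)"
 proof (intro always_eventually allI)
  fix q
  have "(s * real (Suc q)-1)/real (Suc q) <= of_int \<lfloor>s * real (Suc q)\<rfloor>/real (Suc q)" by (intro divide_right_mono) auto
  thus "s-inverse (real (Suc q)) <= real (nat \<lfloor>s * real (Suc q)\<rfloor>)/real (Suc q)"
   unfolding f by (simp add: diff_divide_distrib inverse_eq_divide)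
 qed
 show "\<forall>\<^sub>F q in sequentially. real (nat \<lfloor>s * real (Suc q)\<rfloor>)/real (Suc q) <= s"
  unfolding f by (intro always_eventually) (simp add: pos_divide_le_eq)
 show "(%q. s-inverse (real (Suc q))) ----> s" using tendsto_diff[OF tendsto_const LIMSEQ_inverse_real_of_nat, of s] by simp
qed auto

text \<open>Both parameters are approximated by fractions with the common denominator
  \<open>Suc q\<close>, for which the claim is about powers of a single element. Rounding down keeps
  every argument within the ball where \<open>EE\<close> is controlled.\<close>

lemma ex_add_nonneg:
 assumes st: "s >= 0" "t >= 0" and x: "(s+t) * norm x <= rr/4"
 shows "ex (s *R x)**ex (t *R x) = ex ((s+t) *R x)"
proof -
 define i where "i a q = nat \<lfloor>a * real (Suc q)\<rfloor>" for a :: real and q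
 define f where "f a q = real (i a q)/real (Suc q)" for a q
 have f: "f a ----> a" if "a >= 0" for a using floor_quotient_limit[OF that] by (simp add: f_def[abs_def] i_def)
 have f0: "f a q >= 0" "f a q <= a" if "a >= 0" for a q using that by (auto simp: f_def i_def pos_divide_le_eq)
 have sx: "s * norm x <= rr/4" "t * norm x <= rr/4" using st x mult_nonneg_nonneg unfolding ring_distribs using norm_ge_zero by (smt (verit))+
 have b: "norm (c *R x) <= rr/4" if "0 <= c" "c <= d" "d * norm x <= rr/4" for c d using mult_right_mono[OF that(2), of "norm x"] that by simp
 have eq: "mu (EE (f s q *R x)) (EE (f t q *R x)) = EE ((f s q+f t q) *R x)" for q
 proof -
  let ?y = "(1/real (Suc q)) *R x"
  have fy: "f a q *R x = real (i a q) *R ?y" for a by (simp add: f_def)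
  have fsy: "(f s q+f t q) *R x = real (i s q+i t q) *R ?y" by (simp add: f_def add_divide_distrib)
  have b3: "norm (f s q *R x) <= rr/4" "norm (f t q *R x) <= rr/4" "norm ((f s q+f t q) *R x) <= rr/4"
   using f0[OF st(1), of q] f0[OF st(2), of q] b b[of "f s q+f t q" "s+t"] sx x by auto
  show ?thesis
  proof (cases "i s q = 0 | i t q = 0")
   case True
   thus ?thesis using b3 EE_small mu_zero by (auto simp: f_def)
  next
   case False
   have y: "norm ?y <= rr/4"
   proof -
    have "1 * norm ?y <= real (i s q) * norm ?y" using False by (intro mult_right_mono) auto
    thus ?thesis using b3(1) unfolding fy norm_scaleR by linarith
   qed
   have k: "real (i s q) * norm ?y <= rr/4" "real (i t q) * norm ?y <= rr/4"
    "real (i s q+i t q) * norm ?y <= rr/4" using b3 unfolding fy fsy by auto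
   have "l (ex (f s q *R x)**ex (f t q *R x)) = l (ex ((f s q+f t q) *R x))" unfolding fy fsy ex_nat_mult[OF k(1) y] ex_nat_mult[OF k(2) y] ex_nat_mult[OF k(3) y] using ex_carrier[OF y] nat_pow_mult by simp
   thus ?thesis unfolding l_ex[OF b3(3)] by (simp add: ex_def mu_def)
  qed
 qed
 have lim: "(%q. EE (f a q *R x)) ----> EE (a *R x)" if "a >= 0" "a * norm x <= rr/4" for a using f0 b that
  by (intro EE_limit tendsto_scaleR[OF f[OF that(1)] tendsto_const]) blast
 have bnd: "norm (EE (f a q *R x)) <= rr" if "a >= 0" "a * norm x <= rr/4" for a q using f0 b that by (intro EE_small) blast
 have "(%q. mu (EE (f s q *R x)) (EE (f t q *R x))) ----> mu (EE (s *R x)) (EE (t *R x))" using st sx by (intro mu_limit lim bnd)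
 moreover have "(%q. EE ((f s q+f t q) *R x)) ----> EE ((s+t) *R x)"
 proof (rule EE_limit)
  show "(%q. (f s q+f t q) *R x) ----> (s+t) *R x" by (intro tendsto_intros f st)
  show "norm ((f s q+f t q) *R x) <= rr/4" for q using f0[OF st(1), of q] f0[OF st(2), of q] x by (intro b) auto
 qed
 ultimately have "mu (EE (s *R x)) (EE (t *R x)) = EE ((s+t) *R x)" unfolding eq by (rule LIMSEQ_unique)
 moreover have "norm (s *R x) <= rr/4" "norm (t *R x) <= rr/4" using st sx by auto
 ultimately show ?thesis by (simp add: ex_mult_EE) (simp add: ex_def)
qed

lemma ex_add:
 assumes "\<bar>s\<bar> * norm x <= rr/4" "\<bar>t\<bar> * norm x <= rr/4" "\<bar>s+t\<bar> * norm x <= rr/4"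
 shows "ex (s *R x)**ex (t *R x) = ex ((s+t) *R x)"
proof -
 have c: "ex (r *R x):CL" "ex (- r *R x) = inv (ex (r *R x))" if "\<bar>r\<bar> * norm x <= rr/4" for r using that ex_carrier ex_minus by auto
 note cs = c[OF assms(1)] and ct = c[OF assms(2)] and cst = c[OF assms(3)]
 consider "s >= 0" "t >= 0" | "s <= 0" "t <= 0" | "s >= 0" "t <= 0" "s+t >= 0" | "s >= 0" "t <= 0" "s+t <= 0"
  | "s <= 0" "t >= 0" "s+t >= 0" | "s <= 0" "t >= 0" "s+t <= 0" by linarith
 thus ?thesis
 proof cases
  case 1
  thus ?thesis using assms by (intro ex_add_nonneg) auto
 next
  case 2
  moreover from 2 have eq: "- t +-s = \<bar>s+t\<bar>" by simp
  have "(- t +-s) * norm x <= rr/4" unfolding eq by (rule assms(3))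
  ultimately have "ex ((- t) *R x)**ex ((- s) *R x) = ex ((- t +-s) *R x)" by (intro ex_add_nonneg) auto
  moreover have "- t +-s =-(s+t)" by simp
  ultimately have "inv (ex (s *R x)**ex (t *R x)) = inv (ex ((s+t) *R x))" using cs ct cst by (metis inv_mult_group)
  thus ?thesis using cs ct cst by auto
 next
  case 3
  hence "ex ((s+t) *R x)**ex ((- t) *R x) = ex ((s+t +-t) *R x)" using assms by (intro ex_add_nonneg) auto
  thus ?thesis using ct cs cst inv_solve_right by (smt (verit))
 next
  case 4
  hence "ex ((- (s+t)) *R x)**ex (s *R x) = ex ((- (s+t)+s) *R x)" using assms by (intro ex_add_nonneg) auto
  thus ?thesis using ct cst cs inv_solve_right inv_closed inv_solve_left by (smt (verit))
 next
  case 5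
  hence "ex ((- s) *R x)**ex ((s+t) *R x) = ex ((- s+(s+t)) *R x)" using assms by (intro ex_add_nonneg) auto
  thus ?thesis using cs ct cst inv_solve_left by (smt (verit))
 next
  case 6
  hence "ex (t *R x)**ex ((- (s+t)) *R x) = ex ((t +-(s+t)) *R x)" using assms by (intro ex_add_nonneg) auto
  thus ?thesis using cs cst ct inv_solve_left inv_closed inv_solve_right by (smt (verit))
 qed
qed

section \<open>The exponential map on the whole Lie algebra and its one-parameter subgroups\<close>

definition expG :: "'l => 'g" where
 "expG X = (let N = nat \<lceil>4 * norm X/rr\<rceil>+1 in ex ((1/real N) *R X) [^] N)"

lemma ex_refine:
 assumes "N > 0" "M > 0" "norm X/real N <= rr/4"
 shows "ex ((1/real N) *R X) [^] N = ex ((1/real (N * M)) *R X) [^] (N * M)"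
proof -
 let ?y = "(1/real (N * M)) *R X"
 have My: "real M *R ?y = (1/real N) *R X" using assms(1,2) by simp
 have k: "real M * norm ?y <= rr/4" using assms by simp
 have "1 * norm ?y <= real M * norm ?y" using assms(2) by (intro mult_right_mono) auto
 with k have y: "norm ?y <= rr/4" by linarith
 show ?thesis unfolding My[symmetric] ex_nat_mult[OF k y] using ex_carrier[OF y] by (simp add: nat_pow_pow mult.commute)
qed

text \<open>Two denominators are compared through their product, so the one in the definition of
  \<open>expG\<close> can be replaced by any that brings the argument within \<open>rr/4\<close>.
  This freedom is what lets several exponentials be treated at one scale.\<close>

lemma expG_eq:
 assumes "N > 0" "norm X/real N <= rr/4"
 shows "expG X = ex ((1/real N) *R X) [^] N"
proof -
 define M where "M = nat \<lceil>4 * norm X/rr\<rceil>+1"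
 have "4 * norm X/rr <= real M" unfolding M_def by linarith
 moreover have M0: "M > 0" by (simp add: M_def)
 ultimately have M: "M > 0" "norm X/real M <= rr/4" using rC(1) by (auto simp: field_simps)
 show ?thesis using M assms ex_refine mult.commute by (metis expG_def M_def)
qed

lemma scale_ex: "EX N::nat. N > 0&a/real N <= rr/4" if "a >= 0" for a
proof -
 obtain N :: nat where "4 * a/rr < real N" using reals_Archimedean2 by auto
 moreover from this have "N > 0" using rC(1) that by (metis gr0I less_le_not_le of_nat_0 divide_nonneg_nonneg mult_nonneg_nonneg zero_le_numeral)
 ultimately show ?thesis using rC(1) by (intro exI) (auto simp: field_simps)
qed

lemma expG_small: "norm X <= rr/4 ==> expG X = ex X" using expG_eq[of 1 X] ex_carrier by simp

lemma expGc [simp]: "expG X:CL"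
proof -
 obtain N :: nat where N: "N > 0" "norm X/real N <= rr/4" using scale_ex[of "norm X"] by auto
 thus ?thesis unfolding expG_eq[OF N] using ex_carrier by simp
qed

lemma expG_add: "expG (s *R X)**expG (t *R X) = expG ((s+t) *R X)"
proof -
 obtain N :: nat where N: "N > 0" "(\<bar>s\<bar>+\<bar>t\<bar>) * norm X/real N <= rr/4"
  using scale_ex[of "(\<bar>s\<bar>+\<bar>t\<bar>) * norm X"] by auto
 define x where "x = (1/real N) *R X"
 have b: "\<bar>r\<bar> * norm x <= rr/4" "norm (r *R X)/real N <= rr/4" if "\<bar>r\<bar> <= \<bar>s\<bar>+\<bar>t\<bar>" for r
 proof -
  have "\<bar>r\<bar> * norm X/real N <= (\<bar>s\<bar>+\<bar>t\<bar>) * norm X/real N"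
   using that by (intro divide_right_mono mult_right_mono) auto
  hence "\<bar>r\<bar> * norm X/real N <= rr/4" using N(2) by linarith
  thus "\<bar>r\<bar> * norm x <= rr/4" "norm (r *R X)/real N <= rr/4" by (simp_all add: x_def)
 qed
 have e: "expG (r *R X) = ex (r *R x) [^] N" if "\<bar>r\<bar> <= \<bar>s\<bar>+\<bar>t\<bar>" for r
  using expG_eq[OF N(1) b(2)[OF that]] by (simp add: x_def)
 have bs: "\<bar>s\<bar> * norm x <= rr/4" "\<bar>t\<bar> * norm x <= rr/4" "\<bar>s+t\<bar> * norm x <= rr/4" "\<bar>t+s\<bar> * norm x <= rr/4"
  by (intro b(1); linarith)+
 have "ex (s *R x):CL" "ex (t *R x):CL" using bs ex_carrier by auto
 thus ?thesis using ex_add[OF bs(1,2,3)] ex_add[OF bs(2,1,4)] pow_mult_distrib e add.commute by (smt (verit))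
qed

text \<open>On a ball one denominator serves all arguments, so there \<open>expG\<close> is a fixed
  power of a continuous map.\<close>

lemma cmap_expG: "cmap euclidean G expG"
proof -
 have loc: "cmap (top_of_set (ball 0 R)) G expG" for R
 proof (cases "R > 0")
  case False
  hence "ball (0::'l) R = {}" by simp
  thus ?thesis by (simp only:) simp
 next
  case True
  then obtain N :: nat where N: "N > 0" "R/real N <= rr/4" using scale_ex[of R] by auto
  have b: "norm X/real N <= rr/4" if "X:ball 0 R" for X :: 'l
  proof -
   have "norm X/real N <= R/real N" using that by (intro divide_right_mono) auto
   thus ?thesis using N(2) by linarith
  qed
  let ?T = "top_of_set (ball (0::'l) R)"
  have "cmap ?T (top_of_set (cball 0 (rr/4))) (%X. (1/real N) *R X)" using b by (auto simp: continuous_intros)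
  moreover have "cmap (top_of_set (cball 0 (rr/4))) (top_of_set V1) EE" using continuous_on_EE EE_small small_V1 by simp
  ultimately have "cmap ?T (top_of_set V1) (EE \<circ> (%X. (1/real N) *R X))" by (rule continuous_map_compose)
  from continuous_map_compose[OF this continuous_map_u]
  have "cmap ?T G (%X. u (EE ((1/real N) *R X)))" by (simp add: o_def)
  hence "cmap ?T G (%X. ex ((1/real N) *R X) [^] N)" unfolding ex_def by (rule continuous_map_pow)
  thus ?thesis by (rule continuous_map_eq) (use expG_eq[OF N(1)] b in simp)
 qed
 show ?thesis unfolding continuous_map_alt
 proof (intro conjI ballI allI impI)
  fix W assume W: "openin G W"
  have "open (expG -` W \<inter> ball 0 R)" for R
  proof -
   have "openin (top_of_set (ball 0 R)) {X:topspace (top_of_set (ball 0 R)). expG X:W}" using openin_continuous_map_preimage[OF loc W] .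
   moreover have "{X:topspace (top_of_set (ball 0 R)). expG X:W} = expG -` W \<inter> ball 0 R" by auto
   ultimately show ?thesis using openin_open_trans by force
  qed
  hence "open (\<Union>R. expG -` W \<inter> ball 0 R)" by blast
  moreover have "(\<Union>R. expG -` W \<inter> ball 0 R) = expG -` W \<inter> topspace euclidean" using gt_ex by auto
  ultimately show "openin euclidean (expG -` W \<inter> topspace euclidean)" by simp
 qed auto
qed

lemma EE_has_derivative: "(EE hasD (%x. x)) (at 0)"
proof (rule has_derivativeI_sandwich[of "rr/4" _ _ _ _ "%x. 24 * CC * norm x"])
 show "norm (EE y-EE 0-(y-0))/norm (y-0) <= 24 * CC * norm y" if "y:UNIV" "y ~= 0" "dist y 0 < rr/4" for y
  using EE_lim(2)[of y] that by (simp add: pos_divide_le_eq power2_eq_square)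
 have "((%x. 24 * CC * norm x) \<longlongrightarrow> 24 * CC * norm (0::'l)) (at (0::'l))"
  by (intro tendsto_mult tendsto_const tendsto_norm tendsto_ident_at)
 thus "((%x. 24 * CC * norm x) \<longlongrightarrow> 0) (at (0::'l))" by simp
qed (use rC(1) in auto)

lemma loc_eq: "loc L g = e1+l g" by (simp add: l_def)

lemma l_expG_has_derivative: "((%X. l (expG X)) hasD (%X. X)) (at 0)"
proof (rule has_derivative_transform_within_open[OF EE_has_derivative, of "ball 0 (rr/4)"])
 show "EE x = l (expG x)" if "x:ball 0 (rr/4)" for x using that by (simp add: expG_small l_ex)
qed (use rC(1) in auto)

lemma one_parameter_expG: "one_parameter_subgroup L X (%t. expG (t *R X))" unfolding one_parameter_subgroup_def
proof (intro conjI allI)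
 show "cmap euclideanreal G (%t. expG (t *R X))" using continuous_map_compose[OF _ cmap_expG, of euclideanreal "%t. t *R X"]
  by (simp add: o_def continuous_intros)
 show "expG ((s+t) *R X) = expG (s *R X)**expG (t *R X)" for s t by (simp add: expG_add)
 have "((%t. l (expG (t *R X))) hasD (%t. t *R X)) (at 0)"
  using has_derivative_compose[of "%t. t *R X" "%t. t *R X" "0::real" UNIV "%X. l (expG X)" "%X. X"]
   l_expG_has_derivative has_derivative_scaleR_left[OF has_derivative_ident, of X] by simp
 thus "((%t. loc L (expG (t *R X))) hasV X) (at 0)" unfolding has_vector_derivative_def loc_eq by (auto intro!: derivative_eq_intros)
qed

text \<open>By the derivative at \<open>0\<close>, the coordinate of \<open>ga\<close> at
  \<open>s / 2^n\<close> is \<open>(s / 2^n) X\<close> up to an error \<open>o(1/2^n)\<close>.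
  Passing to the \<open>2^n\<close>-th power amplifies the error by \<open>6 * 2^n\<close>, so
  \<open>ga s\<close> is the limit of the approximations \<open>En n\<close> of
  \<open>s X\<close>.\<close>

lemma one_parameter_unique:
 assumes "one_parameter_subgroup L X ga"
 shows "ga t = expG (t *R X)"
proof -
 have cont: "cmap euclideanreal G ga" and add: "!!s t. ga (s+t) = ga s**ga t" and der: "((%t. loc L (ga t)) hasV X) (at 0)"
  using assms by (auto simp: one_parameter_subgroup_def)
 have car: "ga t:CL" for t using continuous_map_carrier[OF cont] by simp
 have ga0: "ga 0 = \<one>" using add car by (metis add.right_neutral l_cancel_one')
 have pow: "ga (real k * s) = ga s [^] k" for k s
 proof (induction k)
  case (Suc k)
  have "real (Suc k) * s = real k * s+s" by (simp add: ring_distribs)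
  thus ?case using Suc by (simp only: add nat_pow_Suc)
 qed (simp add: ga0)
 obtain m :: nat where m: "\<bar>t\<bar> * norm X/2 ^ m < rr/16"
 proof -
  have "(%m. \<bar>t\<bar> * norm X * (1/2) ^ m) ----> 0" by (rule tendsto_mult_right_zero[OF LIMSEQ_realpow_zero]) auto
  hence "\<forall>\<^sub>F m in sequentially. \<bar>t\<bar> * norm X * (1/2) ^ m < rr/16" using rC(1) by (intro order_tendstoD) auto
  thus thesis using that eventually_happens'[OF sequentially_bot] by (auto simp: power_divide)
 qed
 define s where "s = t/2 ^ m"
 have sX: "norm (s *R X) <= rr/16" using m by (simp add: s_def)
 have "ga s = ex (s *R X)"
 proof (cases "s = 0")
  case True
  thus ?thesis by (simp add: ga0)
 next
  case False
  define h where "h n = s/2 ^ n" for n :: nat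
  have h0: "h ----> 0" using tendsto_mult_right_zero[OF LIMSEQ_realpow_zero[of "1/2"], of s] by (simp add: h_def[abs_def] power_divide)
  have hat: "filterlim h (at 0) sequentially" using h0 False by (auto simp: filterlim_at h_def)
  define w where "w n = l (ga (h n))" for n
  have inU: "\<forall>\<^sub>F n in sequentially. ga (h n):U1" using openin_continuous_map_preimage[OF cont U1(1)] topological_tendstoD[OF h0, of "{x. ga x:U1}"] ga0 chart1(2) by auto
  have "((%x. norm (loc L (ga x)-loc L (ga 0)-(x-0) *R X)/norm (x-0)) \<longlongrightarrow> 0) (at 0)"
   using der by (simp add: has_vector_derivative_def has_derivative_iff_norm)
  from filterlim_compose[OF this hat]
  have lim: "(%n. norm (w n-h n *R X)/\<bar>h n\<bar>) ----> 0" by (simp add: ga0 w_def loc_eq)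
  have lim2: "(%n. 6 * (2 ^ n * norm (w n-h n *R X))) ----> 0"
  proof -
   have "6 * (2 ^ n * norm (w n-h n *R X)) = 6 * \<bar>s\<bar> * (norm (w n-h n *R X)/\<bar>h n\<bar>)" for n using False by (simp add: h_def)
   thus ?thesis using tendsto_mult_right_zero[OF lim, of "6 * \<bar>s\<bar>"] by simp
  qed
  have h2: "2 ^ n * norm (h n *R X) = norm (s *R X)" for n by (simp add: h_def)
  have "\<forall>\<^sub>F n in sequentially. 6 * (2 ^ n * norm (w n-h n *R X)) < rr/16" using rC(1) by (intro order_tendstoD(2)[OF lim2]) auto
  with inU have ev: "\<forall>\<^sub>F n in sequentially. norm (l (ga s)-En n (s *R X)) <= 6 * (2 ^ n * norm (w n-h n *R X))&ga s:U1"
  proof eventually_elim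
   case (elim n)
   have "2 ^ n * norm (w n) <= 2 ^ n * (norm (w n-h n *R X)+norm (h n *R X))" using norm_triangle_ineq[of "w n-h n *R X" "h n *R X"] by simp
   moreover have "0 <= 2 ^ n * norm (w n-h n *R X)" by simp
   ultimately have "2 ^ n * norm (w n) <= rr/2" using elim sX h2[of n] unfolding ring_distribs by linarith
   hence a: "real (2 ^ n) * norm (w n) <= rr/2" by simp
   have "2 ^ n * norm (h n *R X) <= rr/2" using sX h2[of n] rC(1) by linarith
   hence b: "real (2 ^ n) * norm (h n *R X) <= rr/2" by simp
   have gs: "ga s = u (pw (w n) (2 ^ n))" using pow[of "2 ^ n" "h n"] pw_bound[OF a] elim by (simp add: w_def h_def)
   show ?case using gs pw_small[OF a] small_U1 pw_diff[OF a b] by (simp add: En_def h_def)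
  qed
  hence "\<forall>\<^sub>F n in sequentially. norm (l (ga s)-En n (s *R X)) <= 6 * (2 ^ n * norm (w n-h n *R X))" by (rule eventually_mono) simp
  from Lim_null_comparison[OF this lim2]
  have "(%n. l (ga s)-En n (s *R X)) ----> 0" .
  moreover have "(%n. l (ga s)-En n (s *R X)) ----> l (ga s)-EE (s *R X)" by (intro tendsto_diff tendsto_const EE_lim(1)) (use sX rC(1) in simp)
  ultimately have "l (ga s)-EE (s *R X) = 0" using LIMSEQ_unique by blast
  moreover have "ga s:U1" using eventually_happens'[OF sequentially_bot ev] by simp
  ultimately show ?thesis by (metis ex_def eq_iff_diff_eq_0 u_l)
 qed
 moreover have "expG (t *R X) = ex ((1/real (2 ^ m)) *R (t *R X)) [^] (2 ^ m :: nat)"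
 proof (intro expG_eq)
  have "norm (t *R X)/real (2 ^ m) = \<bar>t\<bar> * norm X/2 ^ m" by simp
  thus "norm (t *R X)/real (2 ^ m) <= rr/4" using m rC(1) by linarith
 qed auto
 ultimately show ?thesis using pow[of "2 ^ m" s] by (simp add: s_def)
qed

lemma lie_exp_eq: "lie_exp L X = expG X"
proof -
 have "(THE ga. one_parameter_subgroup L X ga) = (%t. expG (t *R X))" using one_parameter_expG one_parameter_unique by auto
 thus ?thesis by (simp add: lie_exp_def)
qed

text \<open>Squaring is doubling up to a small Lipschitz error: since \<open>CC * norm a\<close> and
  \<open>CC * norm b\<close> are at most \<open>1/4\<close>, equal squares give
  \<open>2 * norm (a - b) <= (1/2) * norm (a - b)\<close>.\<close>

lemma mu_square_inj:
 assumes ab: "norm a <= rr/4" "norm b <= rr/4" and eq: "mu a a = mu b b"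
 shows "a = b"
proof -
 have r: "norm a <= rr" "norm b <= rr" using ab rC(1) by auto
 have q: "CC * norm c <= 1/4" if "norm c <= rr/4" for c :: 'l using mult_left_mono[OF that, of CC] rC(2,3) by linarith
 have "- (2 *R (a-b)) = (mu a a-mu b a-(a-b))+(mu b a-mu b b-(a-b))" using eq by (simp add: scaleR_2)
 hence "norm (2 *R (a-b)) <= norm (mu a a-mu b a-(a-b))+norm (mu b a-mu b b-(a-b))"
  by (subst norm_minus_cancel[symmetric]) (simp only: norm_triangle_ineq)
 moreover have "norm (2 *R (a-b)) = 2 * norm (a-b)" by simp
 ultimately have "norm (a-b) <= 0" using rC(7)[OF r(2,1,2)] mult_right_mono[OF q[OF ab(2)] norm_ge_zero[of "a-b"]] rC(6)[OF r(1,2,1)] mult_right_mono[OF q[OF ab(1)] norm_ge_zero[of "a-b"]] by linarith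
 thus ?thesis by simp
qed

text \<open>Injectivity of squaring lets the equality descend to \<open>x / 2^n\<close> and
  \<open>y / 2^n\<close>. There \<open>EE\<close> is the identity up to second order, so
  \<open>norm (x - y)\<close> is at most a constant times \<open>1/2^n\<close> for every
  \<open>n\<close>.\<close>

lemma EE_inj:
 assumes "norm x <= rr/8" "norm y <= rr/8" "EE x = EE y"
 shows "x = y"
proof -
 have half: "EE ((1/2) *R x) = EE ((1/2) *R y)" if "norm x <= rr/8" "norm y <= rr/8" "EE x = EE y" for x y
 proof -
  have *: "EE z = mu (EE ((1/2) *R z)) (EE ((1/2) *R z))" "norm (EE ((1/2) *R z)) <= rr/4" if z: "norm z <= rr/8" for z
  proof -
   have z2: "real 2 * norm ((1/2) *R z) <= rr/4" "norm ((1/2) *R z) <= rr/4" using z rC(1) by auto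
   show E: "norm (EE ((1/2) *R z)) <= rr/4" using EE_lim(3)[OF z2(2)] z rC(1) by simp
   show "EE z = mu (EE ((1/2) *R z)) (EE ((1/2) *R z))" using EE_nat_mult[OF z2(1)] E rC(1) by (simp add: pw_def mu_def numeral_2_eq_2)
  qed
  show ?thesis by (rule mu_square_inj[OF *(2)[OF that(1)] *(2)[OF that(2)]])
    (simp only: *(1)[OF that(1), symmetric] *(1)[OF that(2), symmetric] that(3))
 qed
 define D where "D = 24 * CC * ((norm x)\<^sup>2+(norm y)\<^sup>2)"
 have all: "norm ((1/2 ^ n) *R x) <= rr/8&norm ((1/2 ^ n) *R y) <= rr/8 &
   EE ((1/2 ^ n) *R x) = EE ((1/2 ^ n) *R y)" for n
 proof (induction n)
  case 0
  thus ?case using assms by simp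
 next
  case (Suc n)
  have e: "(1/2 ^ Suc n) *R z = (1/2) *R ((1/2 ^ n) *R z)" for z :: 'l by simp
  have h: "norm ((1/2) *R z) <= rr/8" if "norm z <= rr/8" for z :: 'l using that norm_ge_zero[of z] unfolding norm_scaleR by linarith
  show ?case unfolding e using half Suc h by blast
 qed
 have "norm (x-y) <= D * (1/2) ^ n" for n
 proof -
  let ?x = "(1/2 ^ n) *R x" and ?y = "(1/2 ^ n) *R y"
  have "norm (EE ?x-?x) <= 24 * CC * (norm ?x)\<^sup>2" "norm (EE ?y-?y) <= 24 * CC * (norm ?y)\<^sup>2"
   using all[of n] rC(1) by (intro EE_lim(2); linarith)+
  moreover have "norm (?x-?y) = norm (x-y)/2 ^ n" by (simp flip: scaleR_right_diff_distrib)
  ultimately have "2 ^ n * (norm (x-y)/2 ^ n) <= 2 ^ n * (24 * CC * (norm ?x)\<^sup>2+24 * CC * (norm ?y)\<^sup>2)" using all norm_triangle_ineq4[of "EE ?y-?y" "EE ?x-?x"] by (intro mult_left_mono) auto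
  also have "... = 24 * CC * (2 ^ n * (norm x/2 ^ n)\<^sup>2+2 ^ n * (norm y/2 ^ n)\<^sup>2)" by (simp add: algebra_simps)
  also have "... = D * (1/2) ^ n" unfolding two_power_mult_square D_def by (simp add: algebra_simps)
  finally show ?thesis by simp
 qed
 moreover have "(%n. D * (1/2) ^ n) ----> 0" by (rule tendsto_mult_right_zero[OF LIMSEQ_realpow_zero]) auto
 ultimately show ?thesis using LIMSEQ_le_const by fastforce
qed

lemma expG_inj:
 assumes "norm x <= rr/8" "norm y <= rr/8" "expG x = expG y"
 shows "x = y"
proof -
 have "norm x <= rr/4" "norm y <= rr/4" using assms rC(1) by linarith+
 thus ?thesis using EE_inj assms expG_small l_ex by (metis)
qed

section \<open>Tangents of families of group elements through the identity\<close>

lemma openin_nbhd_one: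
 assumes "open S"
 shows "openin G {g:U1. l g:S}"
proof -
 have "{g:topspace (subtopology G U1). l g:S} = {g:U1. l g:S}" using U1_carrier by auto
 thus ?thesis using openin_continuous_map_preimage[OF continuous_map_l, of S] assms openin_trans_full U1(1) by simp
qed

text \<open>A curve (or family) through the identity with prescribed derivative there.\<close>

definition tang :: "('a::real_normed_vector => 'g) => ('a => 'l) => 'a => bool" where
 "tang f F x \<longleftrightarrow> f x = \<one>&(\<forall>\<^sub>F y in nhds x. f y:U1)&((%y. l (f y)) hasD F) (at x)"

lemma tangI:
 assumes "cmap (top_of_set S) G f" "open S" "x:S" "f x = \<one>"
  "((%y. l (f y)) hasD F) (at x)"
 shows "tang f F x"
proof -
 have "openin (top_of_set S) {y:topspace (top_of_set S). f y:U1}" by (rule openin_continuous_map_preimage[OF assms(1) U1(1)])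
 hence "\<forall>\<^sub>F y in nhds x. y : {y:S. f y:U1}" using assms(2) openin_open_trans assms(3,4) chart1(2) by (intro eventually_nhds_in_open) auto
 thus ?thesis using assms(4,5) by (auto simp: tang_def eventually_mono)
qed

lemma tang_expG: "tang expG (%X. X) 0"
proof (rule tangI[of UNIV])
 show "expG 0 = \<one>" using expG_small[of 0] rC(1) by simp
qed (use l_expG_has_derivative cmap_expG in auto)

lemma tang_u: "tang u (%X. X) 0"
proof (rule tangI[OF continuous_map_u open_V1 zero_V1])
 show "((%y. l (u y)) hasD (%X. X)) (at 0)" by (rule has_derivative_transform_within_open[OF has_derivative_ident open_V1 zero_V1]) auto
qed auto

lemma tang_unique: "tang f F x ==> tang f F' x ==> F = F'" by (auto simp: tang_def has_derivative_unique)

lemma tang_cong: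
 assumes "tang f F x" "\<forall>\<^sub>F y in nhds x. f y = h y"
 shows "tang h F x"
proof -
 have fx: "f x = \<one>" "\<forall>\<^sub>F y in nhds x. f y:U1" "((%y. l (f y)) hasD F) (at x)" using assms(1) by (auto simp: tang_def)
 have hx: "f x = h x" using eventually_nhds_x_imp_x[OF assms(2)] .
 have "\<forall>\<^sub>F y in at x. l (f y) = l (h y)" using assms(2) by (auto simp: eventually_at_filter eventually_mono)
 hence "((%y. l (h y)) hasD F) (at x)" using has_derivative_transform_eventually[OF fx(3)] hx by simp
 moreover have "\<forall>\<^sub>F y in nhds x. h y:U1" using fx(2) assms(2) by eventually_elim simp
 ultimately show ?thesis using fx(1) hx by (simp add: tang_def)
qed

lemma tang_compose:
 assumes "tang f F (h x)" "(h hasD H) (at x)"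
 shows "tang (%y. f (h y)) (%y. F (H y)) x"
proof -
 have "filterlim h (nhds (h x)) (nhds x)" using has_derivative_continuous[OF assms(2)] by (simp add: continuous_at tendsto_at_iff_tendsto_nhds)
 thus ?thesis using assms has_derivative_compose by (auto simp: tang_def dest: eventually_compose_filterlim)
qed

lemma has_derivative_mu: "((%(a,b). mu a b) hasD (%(a,b). a+b)) (at (0,0))"
proof (rule has_derivativeI_sandwich[of rr _ _ _ _ "%z. CC * norm z"])
 show "bounded_linear (%(a,b). a+b :: 'l)" using bounded_linear_add[OF bounded_linear_fst bounded_linear_snd] by (simp add: split_def)
 fix z :: "'l \<times> 'l" assume z: "z:UNIV" "z ~= (0,0)" "dist z (0,0) < rr"
 obtain a b where ab: "z = (a,b)" by fastforce
 have n: "norm a <= norm z" "norm b <= norm z" "norm z < rr" using z norm_fst_le norm_snd_le by (auto simp: ab zero_prod_def[symmetric])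
 hence "norm (mu a b-a-b) <= CC * norm a * norm b" using rC(7)[of a b 0] mu_zero(1) rC(1) by simp
 also have "... <= CC * norm z * norm z" using n rC(2) by (intro mult_mono) auto
 finally have "norm (mu a b-a-b) <= CC * norm z * norm z" .
 moreover have "norm z > 0" using z(2) by (simp add: zero_prod_def)
 ultimately show "norm ((case z of (a,b) => mu a b)-(case (0,0) of (a,b) => mu a b) -
   (case z-(0,0) of (a,b) => a+b))/norm (z-(0,0)) <= CC * norm z"
  using mu_zero(1) rC(1) by (simp add: ab pos_divide_le_eq algebra_simps flip: zero_prod_def)
   (simp add: zero_prod_def)
next
 have "((%z. CC * norm z) \<longlongrightarrow> CC * norm (0 :: 'l \<times> 'l)) (at (0 :: 'l \<times> 'l))"
  by (intro tendsto_mult tendsto_const tendsto_norm tendsto_ident_at)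
 thus "((%z. CC * norm z) \<longlongrightarrow> 0) (at (0 :: 'l,0 :: 'l))" by (simp add: zero_prod_def)
qed (use rC(1) in auto)

lemma small_mult_U1: "\<forall>\<^sub>F z in nhds (0,0). u (fst z)**u (snd z):U1"
proof -
 have "\<forall>\<^sub>F z in nhds (0,0). z:ball 0 rr \<times> ball 0 rr" using rC(1) by (intro eventually_nhds_in_open open_Times) auto
 thus ?thesis by eventually_elim (auto simp: rC(5))
qed

lemma tang_mult:
 assumes "tang f F x" "tang h H x"
 shows "tang (%y. f y**h y) (%y. F y+H y) x"
proof -
 have f: "f x = \<one>" "((%y. l (f y)) hasD F) (at x)" "\<forall>\<^sub>F y in nhds x. f y:U1"
  and h: "h x = \<one>" "((%y. l (h y)) hasD H) (at x)" "\<forall>\<^sub>F y in nhds x. h y:U1" using assms by (auto simp: tang_def)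
 have pr: "((%y. (l (f y),l (h y))) hasD (%y. (F y,H y))) (at x)" by (intro has_derivative_Pair f h)
 have lim: "filterlim (%y. (l (f y),l (h y))) (nhds (0,0)) (nhds x)" using has_derivative_continuous[OF pr] f(1) h(1)
   tendsto_at_iff_tendsto_nhds[of "%y. (l (f y),l (h y))" x] by (simp add: continuous_at)
 have eq: "\<forall>\<^sub>F y in nhds x. mu (l (f y)) (l (h y)) = l (f y**h y)" using f(3) h(3) by eventually_elim (simp add: mu_def)
 have "\<forall>\<^sub>F y in nhds x. f y**h y:U1" using eventually_compose_filterlim[OF small_mult_U1 lim] f(3) h(3) by eventually_elim simp
 moreover have "((%y. mu (l (f y)) (l (h y))) hasD (%y. F y+H y)) (at x)"
  using has_derivative_compose[OF pr, of "%(a,b). mu a b" "%(a,b). a+b"] has_derivative_mu f(1) h(1) by simp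
 hence "((%y. l (f y**h y)) hasD (%y. F y+H y)) (at x)" by (rule has_derivative_transform_eventually)
   (use eq eventually_nhds_x_imp_x in "auto simp: eventually_at_filter elim: eventually_mono")
 ultimately show ?thesis using f(1) h(1) by (simp add: tang_def)
qed

text \<open>The derivative is known at \<open>0\<close> only, which is too little for the inverse
  function theorem. The open mapping theorem for a continuous map with surjective derivative at one
  point still yields a neighbourhood of the identity.\<close>

lemma tang_nhd:
 fixes f :: "'l => 'g"
 assumes f: "cmap euclidean G f" "tang f (%X. X) 0" and e: "e > 0"
 obtains W where "openin G W" "\<one>:W" "W <= f ` ball 0 e"
proof -
 define S where "S = {x. f x:U1}"
 have S: "open S" using openin_continuous_map_preimage[OF f(1) U1(1)] by (simp add: S_def)
 have f0: "f 0 = \<one>" using f(2) by (simp add: tang_def)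
 hence S0: "0:S" using chart1(2) by (simp add: S_def)
 have "cmap (top_of_set S) (subtopology G U1) f" using continuous_map_from_subtopology[OF f(1)] by (auto simp: continuous_map_in_subtopology S_def)
 from continuous_map_compose[OF this continuous_map_l] have "continuous_on S (%x. l (f x))" by (simp add: o_def)
 moreover have "((%x. l (f x)) hasD (%X. X)) (at 0)" using f(2) by (simp add: tang_def)
 ultimately have "l (f 0):interior ((%x. l (f x)) ` (ball 0 e \<inter> S))" using S S0 e by (intro sussmann_open_mapping)
   (auto simp: interior_open)
 hence "0:interior ((%x. l (f x)) ` (ball 0 e \<inter> S))" by (simp add: f0)
 moreover have "f ` ball 0 e \<supseteq> {g:U1. l g:interior ((%x. l (f x)) ` (ball 0 e \<inter> S))}" using interior_subset S_def l_inj by blast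
 moreover have "openin G {g:U1. l g:interior ((%x. l (f x)) ` (ball 0 e \<inter> S))}" by (rule openin_nbhd_one) simp
 ultimately show thesis using chart1(2) by (intro that) auto
qed

lemma charts_cover: "g:CL ==> EX V rb. (V,rb):charts L&g:V"
proof -
 assume "g:CL"
 hence "g:(\<Union>(U,kp) \<in> charts L. U)" using lie by (metis lie_group_def)
 thus ?thesis by auto
qed

text \<open>Smoothness of the product is given between charts, so conjugation is factored: left
  multiplication into a chart around \<open>g\<close>, followed by right multiplication by
  \<open>inv g\<close> back into the chart at the identity.\<close>

lemma has_derivative_conj_ex:
 assumes g: "g:CL"
 shows "EX F. ((%x. loc L (g**unloc L x**inv g)) hasD F) (at e1)"
proof -
 obtain V rb where V: "(V,rb):charts L" "g:V" using charts_cover g by blast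
 obtain V' rb' where V': "(V',rb'):charts L" "inv g:V'" using charts_cover g by blast
 note m1 = chart_mult[OF V(1) chart1(1) V(1)] and m2 = chart_mult[OF V(1) V'(1) chart1(1)]
 have inv1: "inv_into V rb (rb h) = h" if "h:V" for h using chart(4)[OF V(1)] that by simp
 have inv2: "inv_into V' rb' (rb' (inv g)) = inv g" using chart(4)[OF V'(1)] V'(2) by simp
 have e: "e1:loc L ` U1" "unloc L e1 = \<one>" using chart1(2) u_zero by (auto simp: e1_def u_def)
 let ?S1 = "{(x,y). x:rb ` V&y:loc L ` U1&inv_into V rb x**inv_into U1 (loc L) y:V}"
 have in1: "(rb g,e1):?S1" using V(2) e g by (simp add: inv1 unloc_eq)
 have "((%(x,y). rb (inv_into V rb x**inv_into U1 (loc L) y)) hasD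
   frechet_derivative (%(x,y). rb (inv_into V rb x**inv_into U1 (loc L) y)) (at (rb g,e1))) (at (rb g,e1))" by (rule smooth_hasD[OF m1(2,1) in1])
 from hasD_slice_r[OF this]
 obtain F1 where F1: "((%y. rb (g**unloc L y)) hasD F1) (at e1)" using V(2) by (auto simp: inv1 unloc_eq)
 let ?S2 = "{(x,y). x:rb ` V&y:rb' ` V'&inv_into V rb x**inv_into V' rb' y:U1}"
 have in2: "(rb g,rb' (inv g)):?S2" using V(2) V'(2) g chart1(2) by (simp add: inv1 inv2)
 have "((%(x,y). loc L (inv_into V rb x**inv_into V' rb' y)) hasD
   frechet_derivative (%(x,y). loc L (inv_into V rb x**inv_into V' rb' y)) (at (rb g,rb' (inv g)))) (at (rb g,rb' (inv g)))"
  by (rule smooth_hasD[OF m2(2,1) in2])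
 from hasD_slice_l[OF this]
 obtain F2 where F2: "((%x. loc L (inv_into V rb x**inv g)) hasD F2) (at (rb g))" by (auto simp: inv2)
 have F: "((%x. loc L (inv_into V rb (rb (g**unloc L x))**inv g)) hasD (%x. F2 (F1 x))) (at e1)"
  using has_derivative_compose[OF F1, of "%x. loc L (inv_into V rb x**inv g)" F2] F2 e(2) g by simp
 have "open ((%y. (rb g,y)) -` ?S1)" by (intro open_vimage m1(1)) (auto intro!: continuous_intros)
 hence "((%x. loc L (g**unloc L x**inv g)) hasD (%x. F2 (F1 x))) (at e1)"
  by (rule has_derivative_transform_within_open[OF F]) (use in1 V(2) in "auto simp: inv1 unloc_eq")
 thus ?thesis by blast
qed

lemma hasD_shift:
 assumes "(f hasD F) (at (c+a))"
 shows "((%x. f (c+x)) hasD F) (at a)"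
proof -
 have "((%x. c+x) hasD (%x. x)) (at a)" by (auto intro!: derivative_eq_intros)
 from has_derivative_compose[OF this assms] show ?thesis .
qed

lemma has_derivative_Ad:
 assumes "g:CL"
 shows "((%x. l (g**u x**inv g)) hasD AD g) (at 0)"
proof -
 have "((%x. loc L (g**unloc L x**inv g)) hasD AD g) (at (e1+0))" using has_derivative_conj_ex[OF assms] unfolding Ad_def e1_def
  by (simp add: frechet_derivative_works[symmetric] differentiable_def)
 from hasD_shift[OF this] show ?thesis unfolding l_def u_def by (auto intro!: derivative_eq_intros)
qed

lemma bounded_linear_Ad: "g:CL ==> bounded_linear (AD g)" using has_derivative_Ad by auto

lemma linear_Ad: "g:CL ==> linear (AD g)" using bounded_linear_Ad bounded_linear.linear by auto

lemma tang_conj_u: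
 assumes g: "g:CL"
 shows "tang (%x. g**u x**inv g) (AD g) 0"
proof (rule tangI[OF _ open_V1 zero_V1])
 show "cmap (top_of_set V1) G (%x. g**u x**inv g)" using g by (intro cmap_mult continuous_map_u) auto
qed (use g has_derivative_Ad in auto)

lemma tang_conj:
 assumes g: "g:CL" and f: "tang f F x"
 shows "tang (%y. g**f y**inv g) (%y. AD g (F y)) x"
proof -
 have fx: "f x = \<one>" "\<forall>\<^sub>F y in nhds x. f y:U1" "((%y. l (f y)) hasD F) (at x)" using f by (auto simp: tang_def)
 have eq: "\<forall>\<^sub>F y in nhds x. g**u (l (f y))**inv g = g**f y**inv g" using fx(2) by eventually_elim simp
 thus ?thesis using tang_compose[of "%x. g**u x**inv g" "AD g" "%y. l (f y)" x F] tang_conj_u[OF g] fx tang_cong by simp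
qed

section \<open>The adjoint representation and the bracket\<close>

lemma eventually_V1: "\<forall>\<^sub>F x in nhds 0. x:V1" by (rule eventually_nhds_in_open[OF open_V1 zero_V1])

lemma u_carrier: "x:V1 ==> u x:CL" using u_in_U1 U1_carrier by blast

lemma Adm:
 assumes "g:CL" "h:CL"
 shows "AD (g**h) X = AD g (AD h X)"
proof -
 have "\<forall>\<^sub>F x in nhds 0. g**(h**u x**inv h)**inv g = (g**h)**u x**inv (g**h)"
  using eventually_V1 by eventually_elim (use assms u_carrier in "simp add: m_assoc inv_mult_group")
 hence "tang (%x. (g**h)**u x**inv (g**h)) (%x. AD g (AD h x)) 0" by (rule tang_cong[OF tang_conj[OF assms(1) tang_conj_u[OF assms(2)]]])
 from fun_cong[OF tang_unique[OF tang_conj_u[OF m_closed[OF assms]] this], of X] show ?thesis .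
qed

lemma Ad_one [simp]: "AD \<one> X = X"
proof -
 have "\<forall>\<^sub>F x in nhds 0. \<one>**u x**inv \<one> = u x" using eventually_V1 by eventually_elim (use u_carrier in simp)
 hence "tang u (AD \<one>) 0" by (rule tang_cong[OF tang_conj_u[OF one_closed]])
 from fun_cong[OF tang_unique[OF this tang_u], of X] show ?thesis .
qed

lemma Ad_inv [simp]:
 assumes "g:CL"
 shows "AD (inv g) (AD g X) = X" "AD g (AD (inv g) X) = X" using assms Adm[of "inv g" g X] Adm[of g "inv g" X] by auto

lemma Ad_inj: "g:CL ==> AD g X = AD g Y ==> X = Y" by (metis Ad_inv(1))

lemma Adlin:
 assumes "g:CL"
 shows "AD g (X+Y) = AD g X+AD g Y" "AD g (c *R X) = c *R AD g X"
  "AD g (X-Y) = AD g X-AD g Y" "AD g (- X) =-AD g X" "AD g 0 = 0"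
 using linear_Ad[OF assms] by (simp_all add: linear_add linear_scale linear_diff linear_neg linear_0)

text \<open>Differentiating \<open>u x ** u y = (u x ** u y ** inv (u x)) ** u x\<close> in
  \<open>y\<close> gives \<open>D2 x v = D1 x (AD (u x) v)\<close>, where \<open>D2 x\<close> and
  \<open>D1 x\<close> are the differentials of left and right multiplication by \<open>u x\<close>.
  Both are the identity at \<open>x = 0\<close> and depend differentiably on \<open>x\<close>, so
  the relation can be solved for \<open>AD (u x) Y\<close> to first order.\<close>

lemma Ad_u_has_derivative_ex: "EX F. ((%x. AD (u x) Y) hasD F) (at 0)"
proof -
 define f where "f = (%(x,y). loc L (unloc L x**unloc L y))"
 obtain S where S: "open S" "(e1,e1):S" "smooth_on S f" using mult_chart_smooth by (auto simp: f_def)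
 obtain R where R: "R > 0" "cball (e1,e1) R <= S" using S open_contains_cball by blast
 define P where "P z = frechet_derivative f (at z)" for z
 obtain K where K: "K >= 0" "!!x y v. x:cball (e1,e1) R ==> y:cball (e1,e1) R ==>
   norm (P x v-P y v) <= K * norm (x-y) * norm v" using smooth_on_derivative_lipschitz[OF S(3,1) R(2)] unfolding P_def by blast
 define D1 where "D1 x v = P (e1,e1+x) (v,0)" for x v
 define D2 where "D2 x v = P (e1+x,e1) (0,v)" for x v
 have mu: "mu a b = f (e1+a,e1+b)-e1" for a b by (simp add: mu_def l_def u_def f_def)
 have near: "(e1,e1+x):cball (e1,e1) R" "(e1+x,e1):cball (e1,e1) R" if "norm x <= R" for x using that by (auto simp: dist_norm)
 have derf: "(f hasD P z) (at z)" if "z:S" for z unfolding P_def by (rule smooth_hasD[OF S(3,1) that])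
 have De: "D1 x = (%v. P (e1,e1+x) (v,0))" "D2 x = (%v. P (e1+x,e1) (0,v))" for x by (auto simp: D1_def D2_def)
 have d1: "((%a. mu a x) hasD D1 x) (at 0)" if x: "norm x <= R" for x
 proof -
  have "((%a. f (a,e1+x)) hasD D1 x) (at (e1+0))" unfolding De add_0_right using near(1)[OF x] R(2) by (intro hasD_slice_l derf) blast
  from hasD_shift[OF this] show ?thesis unfolding mu by (auto intro!: derivative_eq_intros)
 qed
 have d2: "((%b. mu x b) hasD D2 x) (at 0)" if x: "norm x <= R" for x
 proof -
  have "((%b. f (e1+x,b)) hasD D2 x) (at (e1+0))" unfolding De add_0_right using near(2)[OF x] R(2) by (intro hasD_slice_r derf) blast
  from hasD_shift[OF this] show ?thesis unfolding mu by (auto intro!: derivative_eq_intros)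
 qed
 have D10: "D1 0 v = v" for v
 proof -
  have "((%a. mu a 0) hasD (%a. a)) (at 0)" by (rule has_derivative_transform_within_open[OF has_derivative_ident, of "ball 0 rr"])
    (use rC(1) mu_zero in auto)
  from has_derivative_unique[OF d1[of 0] this] R(1) show ?thesis by (auto dest: fun_cong)
 qed
 have D20: "D2 0 v = v" for v
 proof -
  have "((%a. mu 0 a) hasD (%a. a)) (at 0)" by (rule has_derivative_transform_within_open[OF has_derivative_ident, of "ball 0 rr"])
    (use rC(1) mu_zero in auto)
  from has_derivative_unique[OF d2[of 0] this] R(1) show ?thesis by (auto dest: fun_cong)
 qed
 have D1: "norm (D1 x v-v) <= K * norm x * norm v" if x: "norm x <= R" for x v
  using K(2)[OF near(1)[OF x] near(1)[of 0], of "(v,0)"] R(1) D10 by (simp add: D1_def)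
 have D1_lin: "D1 x (v-w) = D1 x v-D1 x w" if x: "norm x <= R" for x v w
  using has_derivative_bounded_linear[OF d1[OF x]] by (simp add: bounded_linear.linear linear_diff)
 have key: "D2 x v = D1 x (AD (u x) v)" if x: "norm x <= R" "x:V1" for x v
 proof -
  have ux: "u x:CL" using u_carrier x(2) by blast
  note t = tang_conj_u[OF ux]
  have "((%y. l (u x**u y**inv (u x))) hasD AD (u x)) (at 0)" using t by (simp add: tang_def)
  from has_derivative_compose[OF this, of "%a. mu a x" "D1 x"] d1[OF x(1)] ux
  have c: "((%y. mu (l (u x**u y**inv (u x))) x) hasD (%v. D1 x (AD (u x) v))) (at 0)" by simp
  have ev: "\<forall>\<^sub>F y in nhds 0. mu (l (u x**u y**inv (u x))) x = mu x y"
  proof -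
   have "\<forall>\<^sub>F y in nhds 0. u x**u y**inv (u x):U1" using t by (simp add: tang_def)
   thus ?thesis using eventually_V1 by eventually_elim (use ux u_carrier in "simp add: mu_def m_assoc")
  qed
  have "((%y. mu x y) hasD (%v. D1 x (AD (u x) v))) (at 0)" by (rule has_derivative_transform_eventually[OF c])
    (use ev eventually_nhds_x_imp_x[OF ev] in "auto simp: eventually_at_filter elim: eventually_mono")
  from has_derivative_unique[OF d2[OF x(1)] this] show ?thesis by meson
 qed
 obtain G1 where G1: "((%x. D1 x Y) hasD G1) (at 0)"
 proof -
  obtain G where "((%z. P z (Y,0)) hasD G) (at (e1,e1))" using smooth_on_derivative_has_derivative[OF S(3,1,2)] unfolding P_def by auto
  from hasD_slice_r[OF this] have "((%x. P (e1,x) (Y,0)) hasD (%v. G (0,v))) (at (e1+0))" by simp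
  from hasD_shift[OF this] show ?thesis using that unfolding D1_def by blast
 qed
 obtain G2 where G2: "((%x. D2 x Y) hasD G2) (at 0)"
 proof -
  obtain G where "((%z. P z (0,Y)) hasD G) (at (e1,e1))" using smooth_on_derivative_has_derivative[OF S(3,1,2)] unfolding P_def by auto
  from hasD_slice_l[OF this] have "((%x. P (x,e1) (0,Y)) hasD (%v. G (v,0))) (at (e1+0))" by simp
  from hasD_shift[OF this] show ?thesis using that unfolding D2_def by blast
 qed
 define A where "A x = AD (u x) Y" for x
 \<comment> \<open>The error of treating \<open>D1 x\<close> as the identity on the increment of
   \<open>A\<close>. It is a product of two quantities that vanish at \<open>0\<close>, the first of
   order \<open>norm x\<close>, hence has derivative zero there.\<close>
 define Rm where "Rm x = D1 x (A x-Y)-(A x-Y)" for x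
 obtain d where d: "d > 0" "d <= R" "ball 0 d <= V1" "K * d <= 1/2"
 proof -
  obtain d0 where "d0 > 0" "ball 0 d0 <= V1" using open_V1 zero_V1 open_contains_ball by blast
  show thesis
  proof
   let ?d = "min (min d0 R) (1/(2 * (K+1)))"
   show "?d > 0" "?d <= R" "ball 0 ?d <= V1" using \<open>d0 > 0\<close> \<open>ball 0 d0 <= V1\<close> R(1) K(1) by auto
   have "K * ?d <= K * (1/(2 * (K+1)))" using K(1) by (intro mult_left_mono) auto
   also have "... <= 1/2" using K(1) by (simp add: field_simps)
   finally show "K * ?d <= 1/2" .
  qed
 qed
 have eqA: "A x = D2 x Y-(D1 x Y-Y)-Rm x" if "norm x < d" for x
 proof -
  show ?thesis using that d key[of x Y] D1_lin by (auto simp: Rm_def A_def)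
 qed
 have bR: "norm (Rm x) <= norm x * (2 * K * norm (D2 x Y-D1 x Y))" if x: "norm x < d" for x
 proof -
  have xR: "norm x <= R" using x d by auto
  have r: "norm (Rm x) <= K * norm x * norm (A x-Y)" unfolding Rm_def by (rule D1[OF xR])
  have "K * norm x <= 1/2" using mult_left_mono[of "norm x" d K] x d(4) K(1) by simp
  from mult_right_mono[OF this norm_ge_zero[of "A x-Y"]]
  have "norm (Rm x) <= 1/2 * norm (A x-Y)" using r by linarith
  moreover have "norm (A x-Y) <= norm (D2 x Y-D1 x Y)+norm (Rm x)" using eqA[OF x] by (simp add: norm_triangle_ineq4)
  ultimately have "K * norm x * norm (A x-Y) <= K * norm x * (2 * norm (D2 x Y-D1 x Y))" using K(1) by (intro mult_left_mono) auto
  with r show ?thesis by (simp add: mult_ac)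
 qed
 have "(Rm hasD (%_. 0)) (at 0)"
 proof (rule has_derivativeI_sandwich[of d _ _ _ _ "%x. 2 * K * norm (D2 x Y-D1 x Y)"])
  fix y :: 'l assume y: "y:UNIV" "y ~= 0" "dist y 0 < d"
  thus "norm (Rm y-Rm 0-0)/norm (y-0) <= 2 * K * norm (D2 y Y-D1 y Y)" using bR[of 0] d(1) bR by (simp add: pos_divide_le_eq mult_ac)
 next
  have "isCont (%x. 2 * K * norm (D2 x Y-D1 x Y)) 0" using has_derivative_continuous G1 G2 by (intro continuous_intros)
  thus "((%x. 2 * K * norm (D2 x Y-D1 x Y)) \<longlongrightarrow> 0) (at 0)" using D10 D20 by (simp add: isCont_def)
 qed (use d in auto)
 hence "((%x. D2 x Y-(D1 x Y-Y)-Rm x) hasD (%v. G2 v-(G1 v-0)-0)) (at 0)" by (intro has_derivative_diff has_derivative_const G1 G2)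
 hence "(A hasD (%v. G2 v-(G1 v-0)-0)) (at 0)" by (rule has_derivative_transform_within_open[of _ _ _ _ "ball 0 d"]) (use eqA d(1) in auto)
 thus ?thesis unfolding A_def by blast
qed

lemma hasD_bk: "((%x. AD (u x) Y) hasD (%X. bk X Y)) (at 0)"
proof -
 obtain F where F: "((%x. AD (u x) Y) hasD F) (at 0)" using Ad_u_has_derivative_ex by blast
 have "(%X. bk X Y) = F" unfolding bracket_def e1_def[symmetric] using hasD_shift[of "%x. AD (u x) Y" F "- e1" e1] F frechet_derivative_at by (auto simp: u_def)
 with F show ?thesis by simp
qed

lemma bracket_tang:
 assumes "tang f F x"
 shows "((%y. AD (f y) Y) hasD (%v. bk (F v) Y)) (at x)"
proof -
 have f: "f x = \<one>" "\<forall>\<^sub>F y in nhds x. f y:U1" "((%y. l (f y)) hasD F) (at x)" using assms by (auto simp: tang_def)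
 have c: "((%y. AD (u (l (f y))) Y) hasD (%v. bk (F v) Y)) (at x)"
  using has_derivative_compose[OF f(3), of "%x. AD (u x) Y" "%X. bk X Y"] hasD_bk f(1) by simp
 show ?thesis using f(2) by (intro has_derivative_transform_eventually[OF c])
   (auto simp: eventually_at_filter f(1) eventually_mono)
qed

lemma bounded_linear_bracket_left: "bounded_linear (%X. bk X Y)" using hasD_bk by auto

lemma bracket_add_right: "bk X (Y+Z) = bk X Y+bk X Z"
proof -
 have "((%x. AD (u x) Y+AD (u x) Z) hasD (%X. bk X Y+bk X Z)) (at 0)" by (intro has_derivative_add hasD_bk)
 hence "((%x. AD (u x) (Y+Z)) hasD (%X. bk X Y+bk X Z)) (at 0)"
  by (rule has_derivative_transform_within_open[OF _ open_V1 zero_V1]) (simp add: Adlin u_carrier)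
 from has_derivative_unique[OF hasD_bk this] show ?thesis by meson
qed

lemma bracket_scaleR_right: "bk X (c *R Y) = c *R bk X Y"
proof -
 have "((%x. c *R AD (u x) Y) hasD (%X. c *R bk X Y)) (at 0)" by (intro has_derivative_scaleR_right hasD_bk)
 hence "((%x. AD (u x) (c *R Y)) hasD (%X. c *R bk X Y)) (at 0)"
  by (rule has_derivative_transform_within_open[OF _ open_V1 zero_V1]) (simp add: Adlin u_carrier)
 from has_derivative_unique[OF hasD_bk this] show ?thesis by meson
qed

sublocale br: bounded_bilinear "bk"
proof -
 show "bounded_bilinear (bk)" by (metis bilinear_def bounded_linear.linear linearI bilinear_conv_bounded_bilinear bounded_linear_bracket_left bracket_add_right bracket_scaleR_right)
qed

lemma expG_0 [simp]: "expG 0 = \<one>" using tang_expG by (simp add: tang_def)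

lemma expG_minus: "expG (- X) = inv (expG X)"
proof -
 have "expG ((-1) *R X)**expG (1 *R X) = expG ((-1+1) *R X)" by (rule expG_add)
 thus ?thesis by (intro inv_equality[symmetric]) auto
qed

lemma expG_pow: "expG (real k *R X) = expG X [^] k"
proof (induction k)
 case (Suc k)
 have "expG (real k *R X)**expG (1 *R X) = expG ((real k+1) *R X)" by (rule expG_add)
 thus ?case using Suc by (simp add: add.commute)
qed simp

lemma cmap_expGc: "cmap T euclidean f ==> cmap T G (%x. expG (f x))" using continuous_map_compose[OF _ cmap_expG] by (simp add: o_def)

lemma tang_expG_line: "tang (%t. expG (t *R X)) (%t. t *R X) 0" using tang_compose[of expG "%X. X" "%t. t *R X" 0 "%t. t *R X"] tang_expG
  has_derivative_scaleR_left[OF has_derivative_ident, of X] by simp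

lemma one_parameterI:
 assumes "cmap euclideanreal G ga" "!!s t. ga (s+t) = ga s**ga t" "tang ga (%t. t *R X) 0"
 shows "one_parameter_subgroup L X ga" using assms unfolding one_parameter_subgroup_def has_vector_derivative_def loc_eq tang_def
 by (auto intro!: derivative_eq_intros)

lemma conj_expG:
 assumes g: "g:CL"
 shows "g**expG X**inv g = expG (AD g X)"
proof -
 have "one_parameter_subgroup L (AD g X) (%t. g**expG (t *R X)**inv g)"
 proof (rule one_parameterI)
  show "cmap euclideanreal G (%t. g**expG (t *R X)**inv g)" using g by (intro cmap_mult cmap_expGc) (auto intro!: continuous_intros)
  show "g**expG ((s+t) *R X)**inv g = g**expG (s *R X)**inv g**(g**expG (t *R X)**inv g)" for s t
  proof -
   have "inv g**(g**x) = x" if "x:CL" for x using g that by (simp add: m_assoc[symmetric])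
   thus ?thesis using g by (simp add: m_assoc expG_add[symmetric])
  qed
  show "tang (%t. g**expG (t *R X)**inv g) (%t. t *R AD g X) 0" using tang_conj[OF g tang_expG_line] g by (simp add: Adlin)
 qed
 from one_parameter_unique[OF this, of 1] show ?thesis by simp
qed

lemma mult_expG:
 assumes g: "g:CL"
 shows "g**expG X = expG (AD g X)**g"
proof -
 have "g**expG X**inv g**g = g**expG X" using g by (simp add: m_assoc)
 thus ?thesis by (simp add: conj_expG[OF g])
qed

lemma Ad_bracket:
 assumes g: "g:CL"
 shows "AD g (bk X Y) = bk (AD g X) (AD g Y)"
proof -
 have "((%t. AD g (AD (expG (t *R X)) Y)) hasD (%t. AD g (bk (t *R X) Y))) (at 0)"
  by (intro bounded_linear.has_derivative[OF bounded_linear_Ad[OF g]] bracket_tang tang_expG_line)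
 moreover have "AD g (AD (expG (t *R X)) Y) = AD (expG (t *R AD g X)) (AD g Y)" for t
 proof -
  have "AD g (AD (expG (t *R X)) Y) = AD (g**expG (t *R X)) Y" using g by (simp only: Adm expGc)
  also have "... = AD (expG (t *R AD g X)) (AD g Y)" using g by (simp only: mult_expG Adm expGc Adlin)
  finally show ?thesis .
 qed
 ultimately have "((%t. AD (expG (t *R AD g X)) (AD g Y)) hasD (%t. AD g (bk (t *R X) Y))) (at 0)" by simp
 from has_derivative_unique[OF this bracket_tang[OF tang_expG_line]]
 have "AD g (bk (1 *R X) Y) = bk (1 *R AD g X) (AD g Y)" by meson
 thus ?thesis by simp
qed

lemma hasV_Ad_expG:
 "((%t. AD (expG (t *R X)) Y) hasV bk X (AD (expG (t *R X)) Y)) (at t)"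
proof -
 have "((%s. AD (expG (s *R X)) (AD (expG (t *R X)) Y)) hasD
   (%s. bk (s *R X) (AD (expG (t *R X)) Y))) (at (- t+t))" using bracket_tang[OF tang_expG_line] by simp
 from hasD_shift[OF this] show ?thesis unfolding has_vector_derivative_def br.scaleR_left Adm[OF expGc expGc, symmetric] expG_add by simp
qed

lemma Ad_expG_self: "AD (expG (t *R X)) X = X"
proof -
 have "expG (AD (expG (t *R X)) (s *R X)) = expG (s *R X)" for s
 proof -
  have "expG (t *R X)**expG (s *R X)**expG ((- t) *R X) = expG (s *R X)" by (simp only: expG_add) simp
  thus ?thesis unfolding conj_expG[OF expGc, symmetric] scaleR_minus_left expG_minus .
 qed
 hence "tang (%s. expG (s *R AD (expG (t *R X)) X)) (%s. s *R X) 0" using tang_expG_line by (simp only: Adlin(2)[OF expGc])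
 from fun_cong[OF tang_unique[OF this tang_expG_line], of 1] show ?thesis by simp
qed

lemma bracket_self [simp]: "bk X X = 0"
proof -
 have "((%t. AD (expG (t *R X)) X) hasV 0) (at 0)" by (simp add: Ad_expG_self)
 thus ?thesis using hasV_Ad_expG[of X X 0] vector_derivative_unique_at by simp
qed

lemma bk_anti: "bk X Y =-bk Y X"
proof -
 have 0: "bk (X+Y) (X+Y) = bk X Y+bk Y X"
 proof -
  have "bk (X+Y) (X+Y) = (bk X X+bk X Y)+(bk Y X+bk Y Y)" by (subst br.add_left) (simp only: br.add_right)
  thus ?thesis by simp
 qed
 have "bk X Y+bk Y X = 0" unfolding 0[symmetric] by simp
 thus ?thesis by (simp only: eq_neg_iff_add_eq_0)
qed

text \<open>The adjoint action preserves brackets; this is the derivative of that identity along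
  \<open>expG (t X)\<close> at \<open>t = 0\<close>.\<close>

lemma jacobi: "bk X (bk Y Z) = bk (bk X Y) Z+bk Y (bk X Z)"
proof -
 have d: "((%t. AD (expG (t *R X)) W) hasV bk X W) (at 0)" for W using hasV_Ad_expG[of X W 0] by simp
 show ?thesis by (rule trans[OF sym add.commute]) (use d[of "bk Y Z"] bounded_bilinear.has_vector_derivative[OF br.bounded_bilinear_axioms d d, of Y Z] vector_derivative_unique_at in "(simp add: Ad_bracket)")
qed

text \<open>Uniqueness for the linear equation \<open>f' = [X, f]\<close>: applying
  \<open>AD (expG (- t X))\<close> to \<open>f t\<close> produces a curve with zero derivative. The
  expansion in a basis serves to differentiate an operator and its argument, both depending on
  \<open>t\<close>.\<close>

lemma Ad_expG_flow:
 assumes f: "!!t. (f hasV bk X (f t)) (at t)"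
 shows "f t = AD (expG (t *R X)) (f 0)"
proof -
 define E where "E t Y = AD (expG ((- t) *R X)) Y" for t Y
 have lin: "linear (E t)" for t unfolding E_def by (intro linear_Ad) simp
 have dE: "((%t. E t Y) hasV-bk X (E t Y)) (at t)" for t Y
 proof -
  have "((%t. AD (expG (t *R (- X))) Y) hasV bk (- X) (AD (expG (t *R (- X))) Y)) (at t)" by (rule hasV_Ad_expG)
  thus ?thesis by (simp add: E_def br.minus_left)
 qed
 have rep: "E t Y = (\<Sum>b\<in>Basis. (Y \<bullet> b) *R E t b)" for t Y
 proof -
  have "E t Y = E t (\<Sum>b\<in>Basis. (Y \<bullet> b) *R b)" by (simp add: euclidean_representation)
  thus ?thesis using lin by (simp add: linear_sum linear_scale)
 qed
 have "((%t. E t (f t)) hasV 0) (at t)" for t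
 proof -
  have "((%t. \<Sum>b\<in>Basis. (f t \<bullet> b) *R E t b) hasV
   (\<Sum>b\<in>Basis. (f t \<bullet> b) *R-bk X (E t b)+(bk X (f t) \<bullet> b) *R E t b)) (at t)"
  proof (rule has_vector_derivative_sum)
   fix b :: 'l
   have "((%t. f t \<bullet> b) has_field_derivative bk X (f t) \<bullet> b) (at t)" unfolding has_real_derivative_iff_has_vector_derivative
    by (rule bounded_linear.has_vector_derivative[OF bounded_linear_inner_left f])
   from has_vector_derivative_scaleR[OF this dE]
   show "((%t. (f t \<bullet> b) *R E t b) hasV
    (f t \<bullet> b) *R-bk X (E t b)+(bk X (f t) \<bullet> b) *R E t b) (at t)" .
  qed
  moreover have "(\<Sum>b\<in>Basis. (f t \<bullet> b) *R-bk X (E t b)+(bk X (f t) \<bullet> b) *R E t b) = 0"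
  proof -
   have "bk X (E t (f t)) = (\<Sum>b\<in>Basis. (f t \<bullet> b) *R bk X (E t b))" by (subst rep) (simp only: br.sum_right br.scaleR_right)
   moreover have "E t (bk X (f t)) = bk X (E t (f t))" unfolding E_def Ad_bracket[OF expGc] Ad_expG_self ..
   ultimately show ?thesis by (simp only: sum.distrib scaleR_minus_right sum_negf rep[symmetric] left_minus)
  qed
  moreover have "(%t. E t (f t)) = (%t. \<Sum>b\<in>Basis. (f t \<bullet> b) *R E t b)" by (intro ext rep)
  ultimately show ?thesis by (simp only:)
 qed
 hence "((%t. E t (f t)) hasV 0) (at t within UNIV)" for t by (simp only:)
 then obtain c where c: "!!s. s:UNIV ==> E s (f s) = c" using has_vector_derivative_zero_constant[of UNIV "%t. E t (f t)"] by auto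
 have "AD (expG (t *R X)) (E t (f t)) = AD (expG (t *R X)) (f 0)" using c c[of 0] by (simp add: E_def)
 thus ?thesis unfolding E_def Adm[OF expGc expGc, symmetric] expG_add by simp
qed

lemma Ad_expG_eigen:
 assumes "bk X Y = c *R Y"
 shows "AD (expG (t *R X)) Y = exp (c * t) *R Y"
proof -
 have "((%t. exp (c * t) *R Y) hasV bk X (exp (c * t) *R Y)) (at t)" for t by (auto intro!: derivative_eq_intros simp: br.scaleR_right assms)
 from Ad_expG_flow[of "%t. exp (c * t) *R Y", OF this, of t] show ?thesis by simp
qed

lemma continuous_map_Ad_const: "cmap G euclidean (%g. AD g Y)" unfolding continuous_map_def
proof (intro conjI allI impI)
 fix O' :: "'l set" assume O': "openin euclidean O'"
 have "EX T. openin G T&g:T&T <= {g:topspace G. AD g Y:O'}" if g: "g:CL" "AD g Y:O'" for g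
 proof -
  have "isCont (%x. AD g (AD (u x) Y)) 0" using hasD_bk has_derivative_continuous bounded_linear.isCont[OF bounded_linear_Ad[OF g(1)]] by blast
  then obtain S where S: "open S" "0:S" "!!x. x:S ==> AD g (AD (u x) Y):O'" using tendsto_at_iff_tendsto_nhds[of "%x. AD g (AD (u x) Y)" 0] O' g(2) topological_tendstoD by (fastforce simp: eventually_nhds isCont_def)
  let ?T = "{h:topspace G. inv g**h : {k:U1. l k:S}}"
  have "cmap G G (%h. inv g**h)" using g by (intro cmap_mult) auto
  from openin_continuous_map_preimage[OF this openin_nbhd_one[OF S(1)]]
  have "openin G ?T" .
  moreover have "AD h Y:O'" if h: "h:?T" for h using h g g(1) Adm S(3) by force
  ultimately show ?thesis using g S(2) chart1(2) by (intro exI) auto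
 qed
 thus "openin G {g:topspace G. AD g Y:O'}" by (subst openin_subopen) auto
qed auto

lemma continuous_map_Ad:
 assumes "cmap T G f" "cmap T euclidean h"
 shows "cmap T euclidean (%x. AD (f x) (h x))"
proof -
 have eq: "(\<Sum>b\<in>Basis. (h x \<bullet> b) *R AD (f x) b) = AD (f x) (h x)" if "x:topspace T" for x
 proof -
  have "AD (f x) (h x) = AD (f x) (\<Sum>b\<in>Basis. (h x \<bullet> b) *R b)" by (simp add: euclidean_representation)
  thus ?thesis using linear_Ad[OF continuous_map_carrier[OF assms(1) that]] by (simp add: linear_sum linear_scale)
 qed
 have "cmap T euclidean (%x. (h x \<bullet> b) *R AD (f x) b)" for b
 proof -
  have "cmap T (prod_topology euclidean euclidean) (%x. (h x,AD (f x) b))" using continuous_map_compose[OF assms(1) continuous_map_Ad_const] assms(2) continuous_map_pairedI by force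
  from continuous_map_compose[OF this, of euclidean "%(y,z). (y \<bullet> b) *R z"] show ?thesis by (simp add: o_def split_def continuous_intros)
 qed
 hence "cmap T euclidean (%x. \<Sum>b\<in>Basis. (h x \<bullet> b) *R AD (f x) b)" by (intro continuous_map_sum) auto
 thus ?thesis by (rule continuous_map_eq) (rule eq)
qed

end

no_notation Matrix.scalar_prod (infix "\<bullet>" 70)
hide_const (open) Matrix.orthogonal
hide_fact (open) Matrix.orthogonal_def

section \<open>The Cartan decomposition and the root space decomposition\<close>

definition pral :: "'a::real_vector set => 'a set => 'a => 'a" where
 "pral V W x = (THE v. v:V&x-v:W)"

lemma pral:
 assumes V: "subspace V" and W: "subspace W" and VW: "V \<inter> W = {0}" and UN: "{x+y | x y. x:V&y:W} = UNIV"
 shows "pral V W x:V" "x-pral V W x:W" "linear (pral V W)"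
  "v:V ==> pral V W v = v" "w:W ==> pral V W w = 0"
  "pral V W x+pral W V x = x"
proof -
 have uniq: "v = v'" if "v:V" "x-v:W" "v':V" "x-v':W" for x v v'
 proof -
  have "v-v' = (x-v')-(x-v)" by simp
  hence "v-v':V \<inter> W" using that subspace_diff[OF V] subspace_diff[OF W] by (metis IntI)
  thus ?thesis using VW by simp
 qed
 have "EX v. v:V&x-v:W" for x
 proof -
  have "x : {x+y | x y. x:V&y:W}" unfolding UN by simp
  thus ?thesis by auto
 qed
 hence ex1: "EX! v. v:V&x-v:W" for x using uniq by blast
 have p: "pral V W x:V&x-pral V W x:W" for x unfolding pral_def by (rule theI') (rule ex1)
 thus "pral V W x:V" "x-pral V W x:W" by auto
 have eq: "pral V W x = v" if "v:V" "x-v:W" for x v using uniq p that by blast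
 show "linear (pral V W)"
 proof (rule linearI)
  fix x y c
  have "x+y-(pral V W x+pral V W y) = (x-pral V W x)+(y-pral V W y)" by simp
  thus "pral V W (x+y) = pral V W x+pral V W y" using p subspace_add[OF V] subspace_add[OF W] by (intro eq) metis+
  have "c *R x-c *R pral V W x = c *R (x-pral V W x)" by (simp add: scaleR_diff_right)
  thus "pral V W (c *R x) = c *R pral V W x" using p subspace_scale[OF V] subspace_scale[OF W] by (intro eq) metis+
 qed
 show "v:V ==> pral V W v = v" "w:W ==> pral V W w = 0" using subspace_0[OF V] subspace_0[OF W] by (auto intro!: eq)
 have "pral W V x = x-pral V W x" unfolding pral_def[of W V]
 proof (rule the_equality)
  fix v assume v: "v:W&x-v:V"
  hence "pral V W x = x-v" by (intro eq) auto
  thus "v = x-pral V W x" by simp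
 qed (use p in auto)
 thus "pral V W x+pral W V x = x" by simp
qed

text \<open>A point of the chamber is what defines positivity throughout. In the final theorem the
  chamber is nonempty because its closure contains \<open>HMo\<close>.\<close>

locale flag_grp =
 fixes L :: "('g,'l::euclidean_space) lie_data" (structure)
 assumes flag: "flag_data L" and chamber_nonempty: "chamber L ~= {}"
begin

lemma reductive: "reductive_lie_group L" using flag by (simp add: flag_data_def)

sublocale lie_grp L using reductive by unfold_locales (simp add: reductive_lie_group_def)

lemma subsp: "subspace (kk L)" "subspace (ss L)" "subspace (aL)" and kk_ss: "kk L \<inter> ss L = {0}" "{X+Y | X Y. X:kk L&Y:ss L} = UNIV"
 and br_kk: "!!X Y. X:kk L ==> Y:kk L ==> bk X Y:kk L"
  "!!X Y. X:kk L ==> Y:ss L ==> bk X Y:ss L"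
  "!!X Y. X:ss L ==> Y:ss L ==> bk X Y:kk L" and bilinear_form: "bilinear (fo)" and form_sym: "!!X Y. fo X Y = fo Y X"
 and form_Ad: "!!g X Y. g:CL ==> fo (AD g X) (AD g Y) = fo X Y" and form_kk_ss: "!!X Y. X:kk L ==> Y:ss L ==> fo X Y = 0"
 and form_kk: "!!X. X:kk L ==> X ~= 0 ==> fo X X < 0" and form_ss: "!!X. X:ss L ==> X ~= 0 ==> fo X X > 0"
 and subgroup_KK: "subgroup (KL) L" and compact_KK: "compactin (gtop L) (KL)" and aa_ss: "aL <= ss L"
 and br_aa: "!!X Y. X:aL ==> Y:aL ==> bk X Y = 0" and aa_maximal: "!!V. abelian_in L V (ss L) ==> aL <= V ==> V = aL"
 and simple: "simple_system L (sL)" using flag unfolding flag_data_def reductive_lie_group_def abelian_in_def by auto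

lemma polar: "homeomorphic_map (prod_topology (subtopology (gtop L) (KL)) (top_of_set (ss L))) (gtop L)
   (%(k,X). k**expG X)" using reductive by (simp add: reductive_lie_group_def lie_exp_eq)

sublocale fm: bounded_bilinear "fo" using bilinear_form by (simp add: bilinear_conv_bounded_bilinear)

definition pk :: "'l => 'l" where "pk = pral (kk L) (ss L)"
definition ps :: "'l => 'l" where "ps = pral (ss L) (kk L)"
text \<open>The Cartan involution. The form \<open>B\<close> built from it is positive definite,
  invariant under \<open>K\<close>, and makes brackets with elements of \<open>ss\<close> symmetric;
  the Euclidean inner product of the type has none of these invariances.\<close>

definition th :: "'l => 'l" where "th X = pk X-ps X"
definition B :: "'l => 'l => real" where "B X Y =-fo X (th Y)"

lemma pk_ps: "pk X:kk L" "ps X:ss L" "pk X+ps X = X" and pk_id: "X:kk L ==> pk X = X" "X:ss L ==> pk X = 0"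
 and ps_id: "X:ss L ==> ps X = X" "X:kk L ==> ps X = 0" and linear_pk: "linear pk" and linear_ps: "linear ps"
proof -
 have eq: "{X+Y | X Y. X:ss L&Y:kk L} = UNIV" using kk_ss(2) by (simp add: set_eq_iff) (metis add.commute)
 have i: "ss L \<inter> kk L = {0}" using kk_ss(1) by blast
 note 1 = pral[OF subsp(1,2) kk_ss, folded pk_def] and 2 = pral[OF subsp(2,1) i eq, folded ps_def]
 show "pk X:kk L" "ps X:ss L" "linear pk" "linear ps"
  "X:kk L ==> pk X = X" "X:ss L ==> pk X = 0" "X:ss L ==> ps X = X" "X:kk L ==> ps X = 0" using 1 2 by blast+
 show "pk X+ps X = X" using pral(6)[OF subsp(1,2) kk_ss] by (simp add: pk_def ps_def)
qed

lemma linear_th: "linear th" unfolding th_def by (intro linear_compose_sub linear_pk linear_ps)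

lemmas th_simps = linear_add[OF linear_th] linear_diff[OF linear_th] linear_neg[OF linear_th] linear_scale[OF linear_th]
 linear_0[OF linear_th]

lemma th_kk: "X:kk L ==> th X = X" and th_ss: "X:ss L ==> th X =-X" by (simp_all add: th_def pk_id ps_id)

lemma kkI: "th X = X ==> X:kk L" and ssI: "th X =-X ==> X:ss L"
proof -
 have e: "th X = X-2 *R ps X" "th X = 2 *R pk X-X"
  using pk_ps(3) unfolding th_def scaleR_2 by (metis add_diff_cancel_right add.commute, metis add_diff_cancel_left)
 { assume "th X = X"
  thus "X:kk L" using e(1) pk_ps(1,3)[of X] by simp }
 { assume "th X =-X"
  thus "X:ss L" using e(2) pk_ps(2,3)[of X] by simp }
qed

lemma th_th [simp]: "th (th X) = X" using pk_ps by (simp add: th_def linear_diff[OF linear_pk] linear_diff[OF linear_ps] pk_id ps_id)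

lemma kk_part: "X+th X:kk L" and ss_part: "X-th X:ss L" by (intro kkI ssI; simp add: th_simps)+

lemma th_bracket: "th (bk X Y) = bk (th X) (th Y)"
proof -
 define a b c d where "a = pk X" and "b = ps X" and "c = pk Y" and "d = ps Y"
 have m: "a:kk L" "b:ss L" "c:kk L" "d:ss L" and XY: "X = a+b" "Y = c+d" using pk_ps by (simp_all add: a_def b_def c_def d_def)
 show ?thesis unfolding XY using bk_anti[of b c] m br_kk by (simp add: th_simps th_kk th_ss br.add_left br.add_right br.diff_left br.diff_right)
qed

lemma form_th: "fo (th X) (th Y) = fo X Y"
proof -
 have XY: "fo X Y = fo (pk X+ps X) (pk Y+ps Y)" by (simp add: pk_ps)
 show ?thesis unfolding XY th_def using form_kk_ss[OF pk_ps(1,2), of X Y] form_kk_ss[OF pk_ps(1,2), of Y X] form_sym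
  by (simp add: fm.add_left fm.add_right fm.diff_left fm.diff_right)
qed

lemma B_sym: "B X Y = B Y X" using form_th[of X "th Y"] form_sym by (simp add: B_def)

sublocale Bf: bounded_bilinear B
proof -
 have "bilinear B" unfolding bilinear_def B_def by (auto intro!: linearI simp: fm.add_left fm.add_right fm.scaleR_left fm.scaleR_right th_simps)
 thus "bounded_bilinear B" by (simp add: bilinear_conv_bounded_bilinear)
qed

lemma B_pos: "X ~= 0 ==> B X X > 0"
proof -
 assume X: "X ~= 0"
 have e: "B X X = fo (ps X) (ps X)-fo (pk X) (pk X)" using form_sym by (smt (verit) B_def th_def pk_ps fm.add_left fm.diff_right)
 show ?thesis unfolding e using form_ss[OF pk_ps(2), of X] form_kk[OF pk_ps(1), of X] fm.zero_left X pk_ps(3)[of X] by force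
qed

lemma B_nonneg: "B X X >= 0" using B_pos[of X] Bf.zero_left by fastforce

lemma B_eq_0: "B X X = 0 \<longleftrightarrow> X = 0" using B_pos Bf.zero_left by fastforce

lemma B_ss: "Y:ss L ==> B X Y = fo X Y" by (simp add: B_def th_ss fm.minus_right)

lemma form_bracket: "fo (bk X Y) Z =-fo Y (bk X Z)"
proof -
 have d: "((%t. AD (expG (t *R X)) W) hasV bk X W) (at 0)" for W using hasV_Ad_expG[of X W 0] by simp
 have "((%t. fo (AD (expG (t *R X)) Y) (AD (expG (t *R X)) Z)) hasV 0) (at 0)" by (simp add: form_Ad)
 thus ?thesis using bounded_bilinear.has_vector_derivative[OF fm.bounded_bilinear_axioms d d, of Y Z] vector_derivative_unique_at by fastforce
qed

lemma B_bracket_ss: "H:ss L ==> B (bk H Y) Z = B Y (bk H Z)" by (simp add: B_def form_bracket th_bracket th_ss br.minus_left fm.minus_right)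

lemma B_riesz: "EX v. ALL x. B v x = x \<bullet> y"
proof -
 define T where "T v = (\<Sum>b\<in>Basis. B v b *R b)" for v
 have Ti: "x \<bullet> T v = B v x" for v x
 proof -
  have "B v x = B v (\<Sum>b\<in>Basis. (x \<bullet> b) *R b)" by (simp add: euclidean_representation)
  thus ?thesis by (simp add: T_def inner_sum_right Bf.sum_right Bf.scaleR_right mult.commute)
 qed
 have "linear T" unfolding T_def by (intro linearI) (simp_all add: Bf.add_left Bf.scaleR_left scaleR_add_left sum.distrib scaleR_sum_right)
 moreover have "inj T"
 proof -
  have "v = 0" if "T v = 0" for v using Ti[of v v] that B_eq_0 by simp
  thus ?thesis using \<open>linear T\<close> linear_injective_0 by auto
 qed
 ultimately obtain v where "T v = y" using linear_injective_imp_surjective surj_def by (metis)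
 thus ?thesis using Ti by metis
qed

lemma B_orthogonal_exists:
 assumes "subspace W" "W ~= UNIV"
 shows "EX v. v ~= 0&(ALL w:W. B v w = 0)"
proof -
 have "span W = W" using assms(1) by simp
 hence "dim W < DIM('l)" using assms(2) dim_eq_full dim_subset_UNIV[of W] by fastforce
 then obtain y where y: "y ~= 0" "!!w. w:span W ==> orthogonal y w" using orthogonal_to_subspace_exists by auto
 obtain v where v: "!!x. B v x = x \<bullet> y" using B_riesz by blast
 have "v ~= 0" using v[of y] y(1) Bf.zero_left by auto
 moreover have "B v w = 0" if "w:W" for w using y(2)[OF span_base[OF that]] v by (simp add: orthogonal_def inner_commute)
 ultimately show ?thesis by blast
qed

end

section \<open>The power series of the adjoint action\<close>

lemma suminf_lincomb:
 fixes f :: "'i => nat => real"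
 assumes "!!i. summable (f i)"
 shows "(\<Sum>i\<in>I. c i * (\<Sum>n. f i n)) = (\<Sum>n. \<Sum>i\<in>I. c i * f i n)" by (subst suminf_sum) (simp_all add: suminf_mult assms)

lemma sum_mult_quotient: "(\<Sum>i\<in>I. c i * (a i/d * s)) = (\<Sum>i\<in>I. c i * a i)/d * s" for d s :: real
 by (simp add: sum_divide_distrib sum_distrib_right mult.assoc)

context lie_grp
begin

definition ad_pow :: "'l => nat => 'l => 'l" where "ad_pow X n Y = ((bk X) ^^ n) Y"

lemma ad_pow_simps [simp]: "ad_pow X 0 Y = Y" "ad_pow X (Suc n) Y = bk X (ad_pow X n Y)" by (simp_all add: ad_pow_def)

lemma ad_pow_norm_ex: "EX K>=0. ALL n. norm (ad_pow X n Y) <= K ^ n * norm Y"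
proof -
 obtain K where K: "K >= 0" "!!a b. norm (bk a b) <= norm a * norm b * K" using br.nonneg_bounded by blast
 have "norm (ad_pow X n Y) <= (norm X * K) ^ n * norm Y" for n
 proof (induction n)
  case (Suc n)
  have "norm (ad_pow X (Suc n) Y) <= norm X * norm (ad_pow X n Y) * K" using K(2) by simp
  also have "... = (norm X * K) * norm (ad_pow X n Y)" by simp
  also have "... <= (norm X * K) * ((norm X * K) ^ n * norm Y)" using Suc K(1) by (intro mult_left_mono) auto
  finally show ?case by simp
 qed simp
 thus ?thesis using K(1) by (intro exI[of _ "norm X * K"]) auto
qed

lemma summable_ad_pow_inner: "summable (%n. (ad_pow X n Y \<bullet> b)/fact n * t ^ n)"
proof -
 obtain K where K: "K >= 0" "!!n. norm (ad_pow X n Y) <= K ^ n * norm Y" using ad_pow_norm_ex by blast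
 have s: "summable (%n. norm Y * norm b * (inverse (fact n) * (K * \<bar>t\<bar>) ^ n))" by (intro summable_mult summable_exp)
 show ?thesis
 proof (rule summable_comparison_test'[OF s, of 0])
  fix n
  have "\<bar>ad_pow X n Y \<bullet> b\<bar> * (inverse (fact n) * \<bar>t\<bar> ^ n) <= K ^ n * norm Y * norm b * (inverse (fact n) * \<bar>t\<bar> ^ n)" using Cauchy_Schwarz_ineq2[of "ad_pow X n Y" b] mult_right_mono[OF K(2)[of n] norm_ge_zero[of b]] by (intro mult_right_mono) auto
  thus "norm ((ad_pow X n Y \<bullet> b)/fact n * t ^ n) <= norm Y * norm b * (inverse (fact n) * (K * \<bar>t\<bar>) ^ n)"
   by (simp add: abs_mult power_abs power_mult_distrib divide_inverse mult_ac)
 qed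
qed

text \<open>Both sides are a coordinate of the solution of \<open>f' = [X, f]\<close> starting at
  \<open>Y\<close>. The coordinate form is the one that later extends to entire functions of
  \<open>t\<close>.\<close>

lemma Ad_expG_inner: "AD (expG (t *R X)) Y \<bullet> b = (\<Sum>n. (ad_pow X n Y \<bullet> b)/fact n * t ^ n)"
proof -
 define F where "F Y b t = (\<Sum>n. (ad_pow X n Y \<bullet> b)/fact n * t ^ n)" for Y b and t :: real
 define f where "f t = (\<Sum>b\<in>Basis. F Y b t *R b)" for t
 have Fder: "((%t. F Y b t) has_field_derivative F (bk X Y) b t) (at t)" for Y b t
 proof -
  have "((%x. \<Sum>n. (%n. (ad_pow X n Y \<bullet> b)/fact n) n * x ^ n) has_field_derivative
    (\<Sum>n. diffs (%n. (ad_pow X n Y \<bullet> b)/fact n) n * t ^ n)) (at t)"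
   by (rule termdiffs_strong_converges_everywhere) (rule summable_ad_pow_inner)
  moreover have "diffs (%n. (ad_pow X n Y \<bullet> b)/fact n) n = (ad_pow X n (bk X Y) \<bullet> b)/fact n" for n
  proof -
   have "ad_pow X (Suc n) Y = ad_pow X n (bk X Y)" unfolding ad_pow_def by (simp only: funpow_Suc_right o_apply)
   moreover have "fact (Suc n) = real (Suc n) * fact n" by simp
   ultimately show ?thesis unfolding diffs_def by simp
  qed
  ultimately show ?thesis unfolding F_def by simp
 qed
 have brF: "bk X (f t) = (\<Sum>b\<in>Basis. F (bk X Y) b t *R b)" for t
 proof (rule euclidean_eqI)
  fix b :: 'l assume b: "b:Basis"
  have "bk X (f t) \<bullet> b = (\<Sum>i\<in>Basis. (bk X i \<bullet> b) * F Y i t)"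
   by (simp add: f_def br.sum_right br.scaleR_right inner_sum_left mult.commute)
  also have "... = (\<Sum>n. \<Sum>i\<in>Basis. (bk X i \<bullet> b) * ((ad_pow X n Y \<bullet> i)/fact n * t ^ n))"
   unfolding F_def by (rule suminf_lincomb) (rule summable_ad_pow_inner)
  also have "... = (\<Sum>n. (ad_pow X n (bk X Y) \<bullet> b)/fact n * t ^ n)"
  proof (rule suminf_cong)
   fix n
   have "ad_pow X n (bk X Y) = bk X (ad_pow X n Y)" unfolding ad_pow_def by (simp add: funpow_swap1)
   also have "... = bk X (\<Sum>i\<in>Basis. (ad_pow X n Y \<bullet> i) *R i)" by (simp only: euclidean_representation)
   also have "... \<bullet> b = (\<Sum>i\<in>Basis. (ad_pow X n Y \<bullet> i) * (bk X i \<bullet> b))"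
    by (simp add: br.sum_right br.scaleR_right inner_sum_left)
   finally show "(\<Sum>i\<in>Basis. (bk X i \<bullet> b) * ((ad_pow X n Y \<bullet> i)/fact n * t ^ n))
     = (ad_pow X n (bk X Y) \<bullet> b)/fact n * t ^ n" unfolding sum_mult_quotient by (simp only: mult.commute)
  qed
  finally show "bk X (f t) \<bullet> b = (\<Sum>b\<in>Basis. F (bk X Y) b t *R b) \<bullet> b" using b by (simp add: F_def)
 qed
 have "(f hasV bk X (f t)) (at t)" for t
 proof -
  have "((%t. F Y b t *R b) hasV F (bk X Y) b t *R b) (at t)" for b using has_vector_derivative_scaleR[OF Fder has_vector_derivative_const] by simp
  from has_vector_derivative_sum[of Basis "%b t. F Y b t *R b", OF this]
  show ?thesis unfolding brF unfolding f_def .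
 qed
 from Ad_expG_flow[of f, OF this, of t]
 have "AD (expG (t *R X)) (f 0) = f t" ..
 moreover have "f 0 = Y"
 proof -
  have "F Y b 0 = Y \<bullet> b" for b unfolding F_def by (subst suminf_finite[of "{0}"]) auto
  thus ?thesis by (simp add: f_def euclidean_representation)
 qed
 ultimately have ft: "AD (expG (t *R X)) Y = f t" by simp
 have "F Y b t = (\<Sum>n. \<Sum>i\<in>Basis. (b \<bullet> i) * ((ad_pow X n Y \<bullet> i)/fact n * t ^ n))" unfolding F_def sum_mult_quotient
  by (subst euclidean_inner) (simp only: mult.commute)
 also have "... = (\<Sum>i\<in>Basis. (b \<bullet> i) * F Y i t)" unfolding F_def by (rule suminf_lincomb[symmetric]) (rule summable_ad_pow_inner)
 finally show ?thesis unfolding ft F_def[symmetric] by (simp add: f_def inner_sum_left inner_commute[of b] mult.commute)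
qed

text \<open>All terms of the series beyond the zeroth lie in \<open>V\<close>, and functionals
  vanishing on \<open>V\<close> detect membership. Assuming \<open>bk X Y\<close> in
  \<open>V\<close>, rather than \<open>Y\<close>, makes the lemma apply to displacements such as
  \<open>AD n H - H\<close>.\<close>

lemma Ad_expG_subspace:
 assumes V: "subspace V" "!!Y. Y:V ==> bk X Y:V" and Y: "bk X Y:V"
 shows "AD (expG (t *R X)) Y-Y:V"
proof -
 have p: "ad_pow X (Suc n) Y:V" for n by (induction n) (use V Y in auto)
 have "W = 0 | W:V" if orth: "!!b. (!!v. v:V ==> v \<bullet> b = 0) ==> W \<bullet> b = 0" for W
 proof -
  obtain v w where vw: "v:span V" "!!z. z:span V ==> orthogonal w z" "W = v+w" using orthogonal_subspace_decomp_exists by blast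
  have sV: "span V = V" using V(1) by (simp add: span_eq_iff)
  have "W \<bullet> w = 0" "v \<bullet> w = 0" using orth vw sV by (auto simp: orthogonal_def inner_commute)
  thus ?thesis using vw sV by (simp add: inner_add_left)
 qed
 moreover have "(AD (expG (t *R X)) Y-Y) \<bullet> b = 0" if b: "!!v. v:V ==> v \<bullet> b = 0" for b
 proof -
  have "(ad_pow X n Y \<bullet> b)/fact n * t ^ n = 0" if "n ~: {0}" for n using that b[OF p[of "n-1"]] by simp
  hence "(\<Sum>n. (ad_pow X n Y \<bullet> b)/fact n * t ^ n) = Y \<bullet> b" by (subst suminf_finite[of "{0}"]) auto
  thus ?thesis using Ad_expG_inner by (simp add: inner_diff_left)
 qed
 ultimately show ?thesis using subspace_0[OF V(1)] by metis
qed

lemma Ad_expG_in_subspace: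
 assumes V: "subspace V" "!!Y. Y:V ==> bk X Y:V" and Y: "Y:V"
 shows "AD (expG X) Y:V" using subspace_add[OF V(1) Ad_expG_subspace[OF V V(2)[OF Y], of 1] Y] by simp

end

context flag_grp
begin

lemma dual_aaD:
 assumes "ro:dual_aa L"
 shows "H:aL ==> H':aL ==> ro (H+H') = ro H+ro H'" "H:aL ==> ro (c *R H) = c * ro H"
  "H ~: aL ==> ro H = 0" "ro 0 = 0" "H:aL ==> H':aL ==> ro (H-H') = ro H-ro H'"
proof -
 show 1: "ro (H+H') = ro H+ro H'" if "H:aL" "H':aL" for H H' using assms that by (simp add: dual_aa_def)
 show 2: "ro (c *R H) = c * ro H" if "H:aL" for c H using assms that by (simp add: dual_aa_def)
 show "H ~: aL ==> ro H = 0" using assms by (simp add: dual_aa_def)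
 show "ro 0 = 0" using 2[of 0 0] subspace_0[OF subsp(3)] by simp
 show "ro (H-H') = ro H-ro H'" if "H:aL" "H':aL" using 1[of "H-H'" H'] subspace_diff[OF subsp(3)] that by simp
qed

lemma dual_aaI:
 assumes "!!H H'. H:aL ==> H':aL ==> ro (H+H') = ro H+ro H'"
  "!!c H. H:aL ==> ro (c *R H) = c * ro H" "!!H. H ~: aL ==> ro H = 0"
 shows "ro:dual_aa L" using assms by (simp add: dual_aa_def)

lemma dual_aa_zero: "(%_. 0):dual_aa L" by (rule dual_aaI) auto

lemma dual_aa_add: "ro:dual_aa L ==> rb:dual_aa L ==> (%H. ro H+rb H):dual_aa L" by (rule dual_aaI) (simp_all add: dual_aaD algebra_simps)

lemma dual_aa_neg: "ro:dual_aa L ==> (%H.-ro H):dual_aa L" by (rule dual_aaI) (simp_all add: dual_aaD)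

lemma subspace_root_space: "subspace (rsp ro)"
 by (rule subspaceI) (simp_all add: root_space_def br.zero_right br.add_right br.scaleR_right scaleR_add_right)

section \<open>Simultaneous eigenvectors and the weight space decomposition\<close>

lemma B_riesz_on:
 assumes V: "subspace V" and f: "!!x y. x:V ==> y:V ==> f (x+y) = f x+f y" "!!c x. x:V ==> f (c *R x) = c * f x"
 shows "EX v:V. ALL x:V. B v x = f x"
proof -
 obtain b where b: "b <= V" "independent b" "V <= span b" by (rule basis_exists[of V])
 have fb: "finite b" using b(2) by (rule independent_imp_finite)
 have sb: "span b = V" using span_minimal[OF b(1) V] b(3) by simp
 \<comment> \<open>\<open>T\<close> records the products with a basis of \<open>V\<close>.
   Positivity of \<open>B\<close> makes it injective on \<open>V\<close>, and by dimension it maps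
   onto \<open>V\<close>, so prescribed products with the basis are attained.\<close>
 define T where "T x = (\<Sum>c\<in>b. B x c *R c)" for x
 have lin: "linear T" unfolding T_def by (intro linearI) (simp_all add: Bf.add_left Bf.scaleR_left scaleR_add_left sum.distrib scaleR_sum_right)
 have TV: "T ` V <= V"
 proof
  fix y assume "y:T ` V"
  then obtain x where "y = T x" by blast
  thus "y:V" unfolding T_def using b(1) by (auto intro!: subspace_sum[OF V] subspace_scale[OF V])
 qed
 have coeff: "p c = q c" if "(\<Sum>c\<in>b. p c *R c) = (\<Sum>c\<in>b. q c *R c)" "c:b" for p q c
 proof -
  have "(\<Sum>c\<in>b. (p c-q c) *R c) = 0" using that(1) by (simp add: scaleR_diff_left sum_subtractf)
  from independentD[OF b(2) fb subset_refl this that(2)] show ?thesis by simp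
 qed
 have ext: "x = 0" if x: "x:V" "!!c. c:b ==> B x c = 0" for x
 proof -
  have "B x y = 0" if "y:span b" for y using that
  proof (induction rule: span_induct_alt)
   case (step c y z)
   thus ?case using x(2) by (simp add: Bf.add_right Bf.scaleR_right)
  qed (simp add: Bf.zero_right)
  thus ?thesis using x(1) sb B_eq_0 by blast
 qed
 have "inj_on T V"
 proof (rule inj_onI)
  fix x y assume xy: "x:V" "y:V" "T x = T y"
  hence "T (x-y) = 0" by (simp add: linear_diff[OF lin])
  hence "B (x-y) c = 0" if "c:b" for c using coeff[of "%c. B (x-y) c" "%_. 0" c] that by (simp add: T_def)
  thus "x = y" using ext[of "x-y"] subspace_diff[OF V] xy by simp
 qed
 moreover have "span V = V" using V by (simp add: span_eq_iff)
 ultimately have "dim (T ` V) = dim V" by (intro dim_image_eq[OF lin]) (simp only:)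
 hence "T ` V = V" using TV subspace_dim_equal[OF linear_subspace_image[OF lin V] V] by simp
 moreover have "(\<Sum>c\<in>b. f c *R c):V" using b(1) by (auto intro!: subspace_sum[OF V] subspace_scale[OF V])
 ultimately obtain v where v: "v:V" "T v = (\<Sum>c\<in>b. f c *R c)" by (blast dest: sym)
 have bc: "B v c = f c" if "c:b" for c using coeff v(2) that by (simp add: T_def)
 have "B v x = f x" if "x:V" for x
 proof -
  have "x:span b" using that sb by simp
  hence "x:V&B v x = f x"
  proof (induction rule: span_induct_alt)
   case base
   thus ?case using f(2)[of 0 0] subspace_0[OF V] by (simp add: Bf.zero_right)
  next
   case (step c x y)
   thus ?case using b(1) subspace_scale[OF V] f subspace_add[OF V] bc by (auto simp: Bf.add_right Bf.scaleR_right)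
  qed
  thus ?thesis ..
 qed
 with v(1) show ?thesis by blast
qed

lemma quadratic_nonneg_linear_zero:
 fixes a q :: real
 assumes "!!t. 2 * t * a+t\<^sup>2 * q >= 0" "q >= 0"
 shows "a = 0"
proof -
 \<comment> \<open>The minimum would be at \<open>- a / q\<close>. The denominator
   \<open>q + 1\<close> avoids the case \<open>q = 0\<close> and still gives a negative value unless
   \<open>a = 0\<close>.\<close>
 have "2 * (- a/(q+1)) * a+(- a/(q+1))\<^sup>2 * q >= 0" by (rule assms(1))
 moreover have "2 * (- a/(q+1)) * a+(- a/(q+1))\<^sup>2 * q =-(a\<^sup>2 * (q+2))/(q+1)\<^sup>2"
 proof -
  have "2 * (- a/(q+1)) * a =-(2 * a\<^sup>2 * (q+1))/(q+1)\<^sup>2" by (simp add: power2_eq_square)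
  moreover have "(- a/(q+1))\<^sup>2 * q = (a\<^sup>2 * q)/(q+1)\<^sup>2" by (simp add: power_divide)
  ultimately show ?thesis by (simp only: add_divide_distrib[symmetric]) (simp add: algebra_simps)
 qed
 ultimately have "a\<^sup>2 * (q+2)/(q+1)\<^sup>2 <= 0" by simp
 thus ?thesis using assms(2) by (simp add: mult_le_0_iff divide_le_0_iff)
qed

text \<open>At a maximizer \<open>v\<close> of the Rayleigh quotient, the quadratic form
  \<open>Q\<close> is nonnegative on \<open>V\<close> and zero at \<open>v\<close>. So its first
  variation in the direction \<open>c v - T v\<close> vanishes, and that variation is the square of
  this direction for \<open>B\<close>. The Euclidean sphere only supplies compactness.\<close>

lemma symmetric_eigenvector:
 assumes V: "subspace V" "V ~= {0}" and T: "linear T" "!!x. x:V ==> T x:V" and sym: "!!x y. B (T x) y = B x (T y)"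
 shows "EX c. EX v:V. v ~= 0&T v = c *R v"
proof -
 define S where "S = sphere 0 1 \<inter> V"
 have "S ~= {}"
 proof -
  obtain x where "x:V" "x ~= 0" using V(2) subspace_0[OF V(1)] by auto
  hence "(1/norm x) *R x:S" using V(1) by (simp add: S_def subspace_scale)
  thus ?thesis by blast
 qed
 moreover have "continuous_on S (%x. B (T x) x/B x x)"
 proof (intro continuous_on_divide Bf.continuous_on continuous_intros linear_continuous_on)
  show "bounded_linear T" using T(1) by (rule linear_conv_bounded_linear[THEN iffD1])
  show "ALL x:S. B x x ~= 0"
  proof
   fix x assume "x:S"
   hence "x ~= 0" by (auto simp: S_def)
   thus "B x x ~= 0" by (simp only: B_eq_0 simp_thms)
  qed
 qed
 ultimately obtain v where v: "v:S" "!!x. x:S ==> B (T x) x/B x x <= B (T v) v/B v v" unfolding S_def using continuous_attains_sup compact_Int_closed[OF compact_sphere closed_subspace[OF V(1)]] by (smt (verit))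
 define c where "c = B (T v) v/B v v"
 have vV: "v:V" "v ~= 0" using v(1) by (auto simp: S_def)
 define Q where "Q x = B (c *R x-T x) x" for x
 have Q: "Q x >= 0" if "x:V" for x
 proof (cases "x = 0")
  case False
  hence xs: "(1/norm x) *R x:S" using V(1) that by (simp add: S_def subspace_scale)
  show ?thesis using v(2)[OF xs] False B_pos by (simp add: Q_def Bf.diff_left Bf.scaleR_left pos_divide_le_eq c_def linear_scale[OF T(1)] Bf.scaleR_right)
 qed (simp add: Q_def Bf.zero_right)
 let ?w = "c *R v-T v"
 have wV: "?w:V" using V(1) T(2) vV(1) by (intro subspace_diff subspace_scale)
 have Q0: "Q v = 0" using B_pos[OF vV(2)] by (simp add: Q_def c_def Bf.diff_left Bf.scaleR_left)
 have "2 * t * B ?w ?w+t\<^sup>2 * Q ?w >= 0" for t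
 proof -
  have "Q (v+t *R y) = Q v+2 * t * B ?w y+t\<^sup>2 * Q y" for y
  proof -
   show ?thesis using sym B_sym[of y "T v"] B_sym[of y v] by (simp add: Q_def linear_add[OF T(1)] linear_scale[OF T(1)] Bf.add_left Bf.add_right Bf.diff_left Bf.scaleR_left
     Bf.scaleR_right algebra_simps power2_eq_square)
  qed
  thus ?thesis using V(1) vV wV Q0 Q subspace_add subspace_scale by (smt (verit))
 qed
 hence "B ?w ?w = 0" using quadratic_nonneg_linear_zero Q[OF wV] by auto
 hence "T v = c *R v" using B_eq_0 by simp
 thus ?thesis using vV by blast
qed

text \<open>On a nonzero invariant subspace of least dimension every \<open>bk H\<close> acts by a
  scalar, because its eigenspaces are again invariant: the operators \<open>bk H\<close> commute by
  the Jacobi identity.\<close>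

lemma common_eigenvector:
 assumes V: "subspace V" "V ~= {0}" and inv: "!!H x. H:aL ==> x:V ==> bk H x:V"
 shows "EX v:V. v ~= 0&(EX ro:dual_aa L. v:rsp ro)"
proof -
 define P where "P U \<longleftrightarrow> subspace U&U ~= {0}&U <= V&(ALL H:aa L. ALL x:U. bk H x:U)" for U
 obtain U where U: "P U" "!!W. P W ==> dim U <= dim W" using V inv ex_has_least_nat[of P V dim] by (auto simp: P_def)
 have "EX c. ALL x:U. bk H x = c *R x" if H: "H:aL" for H
 proof -
  have "EX c. EX v:U. v ~= 0&bk H v = c *R v"
  proof (rule symmetric_eigenvector)
   show "linear (bk H)" using br.bounded_linear_right bounded_linear.linear by auto
   show "B (bk H x) y = B x (bk H y)" for x y using B_bracket_ss H aa_ss by blast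
  qed (use U(1) H in "auto simp: P_def")
  then obtain c v where cv: "v:U" "v ~= 0" "bk H v = c *R v" by blast
  let ?W = "{x:U. bk H x = c *R x}"
  have sU: "subspace U" using U(1) by (simp add: P_def)
  have "bk H' x:?W" if "H':aL" "x:?W" for H' x
  proof -
   have "bk H (bk H' x) = c *R bk H' x" using that H jacobi by (simp add: br_aa br.zero_left br.scaleR_right)
   thus ?thesis using that U(1) by (simp add: P_def)
  qed
  hence "P ?W" using cv U(1) by (auto simp: P_def subspace_def br.zero_right br.add_right br.scaleR_right scaleR_add_right)
  hence "?W = U" using U(2) sU by (intro subspace_dim_equal) (auto simp: P_def)
  thus ?thesis by blast
 qed
 then obtain lam where lam: "!!H x. H:aL ==> x:U ==> bk H x = lam H *R x" by metis
 define ro where "ro H = (if H:aL then lam H else 0)" for H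
 obtain v where v: "v:U" "v ~= 0" using U(1) subspace_0 by (auto simp: P_def)
 have ev: "bk H v = ro H *R v" if "H:aL" for H using lam v that by (simp add: ro_def)
 have "ro:dual_aa L"
 proof (rule dual_aaI)
  fix H H' assume HH: "H:aL" "H':aL"
  hence "ro (H+H') *R v = (ro H+ro H') *R v" using ev ev[OF subspace_add[OF subsp(3) HH]] by (simp add: br.add_left scaleR_add_left)
  thus "ro (H+H') = ro H+ro H'" using v(2) by simp
 next
  fix c H assume H: "H:aL"
  hence "ro (c *R H) *R v = (c * ro H) *R v" unfolding ev[OF subspace_scale[OF subsp(3) H, of c], symmetric] br.scaleR_left ev[OF H] by simp
  thus "ro (c *R H) = c * ro H" using v(2) by simp
 qed (simp add: ro_def)
 moreover have "v:rsp ro" using ev by (simp add: root_space_def)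
 ultimately show ?thesis using v U(1) by (auto simp: P_def)
qed

definition sp :: "(('l => real) => bool) => 'l set" where
 "sp P = span (\<Union>ro\<in>{ro:dual_aa L. P ro}. rsp ro)"

lemma sub_sp: "subspace (sp P)" by (simp add: sp_def)

lemma root_space_sp: "ro:dual_aa L ==> P ro ==> x:rsp ro ==> x:sp P" unfolding sp_def by (intro span_base) blast

lemma sp_induct [consumes 1, case_names zero base add]:
 assumes "x:sp P" "Q 0" "!!ro x. ro:dual_aa L ==> P ro ==> x:rsp ro ==> Q x"
  "!!x y. Q x ==> Q y ==> Q (x+y)"
 shows "Q x" using assms(1) unfolding sp_def
proof (induction rule: span_induct_alt)
 case base
 show ?case by (rule assms(2))
next
 case (step c x y)
 then obtain ro where a: "ro:dual_aa L" "P ro" "x:rsp ro" by auto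
 thus ?case using subspace_scale[OF subspace_root_space] assms(3,4) step by simp
qed

lemma sp_mono: "x:sp P ==> (!!ro. ro:dual_aa L ==> P ro ==> Q ro) ==> x:sp Q"
 by (induction rule: sp_induct) (auto intro: root_space_sp subspace_add[OF sub_sp] subspace_0[OF sub_sp])

text \<open>The \<open>B\<close>-orthogonal complement is invariant, so if nonzero it would contain
  a simultaneous eigenvector, which already belongs to the sum.\<close>

lemma sp_total: "x:sp (%_. True)"
proof (rule ccontr)
 let ?W = "sp (%_. True)"
 define V where "V = {v. ALL w:?W. B v w = 0}"
 assume "x ~: ?W"
 then obtain v where "v ~= 0" "v:V" using B_orthogonal_exists[OF sub_sp] by (auto simp: V_def)
 have inv: "bk H w:?W" if "H:aL" "w:?W" for H w using that(2)
 proof (induction rule: sp_induct)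
  case (base ro x)
  thus ?case using that(1) root_space_sp subspace_scale[OF sub_sp] by (simp add: root_space_def)
 qed (auto simp: br.zero_right br.add_right intro: subspace_add[OF sub_sp] subspace_0[OF sub_sp])
 have "EX v:V. v ~= 0&(EX ro:dual_aa L. v:rsp ro)"
 proof (rule common_eigenvector)
  show "subspace V" by (auto simp: V_def subspace_def Bf.zero_left Bf.add_left Bf.scaleR_left)
  show "V ~= {0}" using \<open>v ~= 0\<close> \<open>v : V\<close> by blast
  show "bk H x:V" if "H:aL" "x:V" for H x using that inv B_bracket_ss aa_ss by (auto simp: V_def)
 qed
 then obtain w where "w:V" "w ~= 0" "w:?W" using root_space_sp[of _ "%_. True"] by auto
 thus False using B_eq_0 by (auto simp: V_def)
qed

lemma root_space_orthogonal:
 assumes "ro:dual_aa L" "rb:dual_aa L" "ro ~= rb" "x:rsp ro" "y:rsp rb"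
 shows "B x y = 0"
proof -
 obtain H where H: "ro H ~= rb H" using assms(3) by blast
 hence Ha: "H:aL" using dual_aaD(3)[OF assms(1), of H] dual_aaD(3)[OF assms(2), of H] by argo
 have "ro H * B x y = B (bk H x) y" using assms(4) Ha by (simp add: root_space_def Bf.scaleR_left)
 also have "... = rb H * B x y" using B_bracket_ss Ha aa_ss assms(5) by (auto simp: root_space_def Bf.scaleR_right)
 finally show ?thesis using H by simp
qed

lemma sp_orthogonal:
 assumes "x:sp P" "y:sp Q" "!!ro. ro:dual_aa L ==> P ro ==> Q ro ==> False"
 shows "B x y = 0" using assms(1)
proof (induction rule: sp_induct)
 case (base ro x)
 show ?case using assms(2)
 proof (induction rule: sp_induct)
  case (base rb y)
  thus ?case using root_space_orthogonal \<open>ro : dual_aa L\<close> \<open>P ro\<close> \<open>x : rsp ro\<close> assms(3) by blast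
 qed (auto simp: Bf.zero_right Bf.add_right)
qed (auto simp: Bf.zero_left Bf.add_left)

lemma sp_split:
 assumes "x:sp (%ro. P ro | Q ro)"
 shows "EX y:sp P. EX z:sp Q. x = y+z" using assms
proof (induction rule: sp_induct)
 case zero
 thus ?case using subspace_0[OF sub_sp] by force
next
 case (base ro x)
 thus ?case using root_space_sp subspace_0[OF sub_sp] by (metis add.right_neutral add.left_neutral)
next
 case (add x y)
 then obtain a b c d where "a:sp P" "b:sp Q" "c:sp P" "d:sp Q" "x = a+b" "y = c+d" by blast
 thus ?case by (intro bexI[of _ "a+c"] bexI[of _ "b+d"]) (auto intro: subspace_add[OF sub_sp])
qed

lemma sp_disjoint:
 assumes "x:sp P" "x:sp Q" "!!ro. ro:dual_aa L ==> P ro ==> Q ro ==> False"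
 shows "x = 0"
proof -
 show ?thesis using B_eq_0 sp_orthogonal[OF assms] by simp
qed

lemma sp_bracket:
 assumes X: "X:sp P" and Y: "Y:sp Q" and R: "!!ro rb. ro:dual_aa L ==> rb:dual_aa L ==> P ro ==> Q rb ==> R (%H. ro H+rb H)"
 shows "bk X Y:sp R" using X
proof (induction rule: sp_induct)
 case (base ro X)
 note a = base
 show ?case using Y
 proof (induction rule: sp_induct)
  case (base rb Y)
  have "bk H (bk X Y) = (ro H+rb H) *R bk X Y" if "H:aL" for H using jacobi a(3) base(3) that
   by (simp add: root_space_def br.scaleR_left br.scaleR_right scaleR_add_left)
  thus ?case using root_space_sp[of "%H. ro H+rb H" R] dual_aa_add R a base by (simp add: root_space_def)
 qed (auto simp: br.zero_right br.add_right intro: subspace_add[OF sub_sp] subspace_0[OF sub_sp])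
qed (auto simp: br.zero_left br.add_left intro: subspace_add[OF sub_sp] subspace_0[OF sub_sp])

lemma sp_eigen:
 assumes "x:sp (%ro. ro H = c)" "H:aL"
 shows "bk H x = c *R x" using assms(1)
proof (induction rule: sp_induct)
 case (base ro x)
 thus ?case using assms(2) by (simp add: root_space_def)
qed (auto simp: br.zero_right br.add_right scaleR_add_right)

text \<open>The component \<open>z\<close> along the weights with \<open>ro H \<noteq> c\<close> is
  again an eigenvector with eigenvalue \<open>c\<close>, hence orthogonal to all weight spaces that
  could contain it.\<close>

lemma eigen_sp:
 assumes H: "H:aL" and x: "bk H x = c *R x"
 shows "x:sp (%ro. ro H = c)"
proof -
 obtain y z where yz: "y:sp (%ro. ro H = c)" "z:sp (%ro. ro H ~= c)" "x = y+z" using sp_total sp_split[of x "%ro. ro H = c" "%ro. ro H ~= c"] by auto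
 have "B z w = 0" if "w:sp (%ro. ro H ~= c)" for w using that
 proof (induction rule: sp_induct)
  case (base ro w)
  have "c * B z w = B (bk H z) w" using x sp_eigen[OF yz(1) H] yz(3) by (simp add: Bf.scaleR_left br.add_right scaleR_add_right)
  also have "... = ro H * B z w" using B_bracket_ss H aa_ss base by (auto simp: root_space_def Bf.scaleR_right)
  finally show ?case using base by simp
 qed (auto simp: Bf.zero_right Bf.add_right)
 thus ?thesis using yz(2) B_eq_0 yz by fastforce
qed

lemma th_root_space: "x:rsp ro ==> th x:rsp (%H.-ro H)"
proof -
 assume x: "x:rsp ro"
 have "bk H (th x) =-ro H *R th x" if "H:aL" for H
 proof -
  show ?thesis using th_bracket[of H x] th_ss aa_ss that x by (auto simp: root_space_def br.minus_left th_simps)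
 qed
 thus ?thesis by (simp add: root_space_def)
qed

lemma th_sp: "x:sp P ==> th x:sp (%ro. P (%H.-ro H))"
proof (induction rule: sp_induct)
 case (base ro x)
 thus ?case using root_space_sp[of "%H.-ro H" "%ro. P (%H.-ro H)"] th_root_space dual_aa_neg by simp
qed (auto simp: th_simps intro: subspace_add[OF sub_sp] subspace_0[OF sub_sp])

definition g0 :: "'l set" where "g0 = {X. ALL H:aa L. bk H X = 0}"

lemma subspace_g0: "subspace g0" by (auto simp: subspace_def g0_def br.zero_right br.add_right br.scaleR_right)

lemma aa_g0: "aL <= g0" by (auto simp: g0_def br_aa)

lemma g0_sp: "g0 = sp (%ro. ro = (%_. 0))"
proof
 show "g0 <= sp (%ro. ro = (%_. 0))" using root_space_sp[OF dual_aa_zero, of "%ro. ro = (%_. 0)"] by (auto simp: g0_def root_space_def)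
 show "sp (%ro. ro = (%_. 0)) <= g0"
 proof
  fix x assume "x:sp (%ro. ro = (%_. 0))"
  hence "x:sp (%ro. ro H = 0)" for H by (rule sp_mono) simp
  thus "x:g0" using sp_eigen[of x _ 0] by (auto simp: g0_def)
 qed
qed

text \<open>Together with \<open>aL\<close>, such an \<open>X\<close> spans an abelian subspace of
  \<open>ss\<close>; maximality of \<aa> applies.\<close>

lemma g0_ss: "X:g0 ==> X:ss L ==> X:aL"
proof -
 assume X: "X:g0" "X:ss L"
 let ?V = "span (insert X (aL))"
 have comm: "bk Y Z = 0" if "Y:insert X (aL)" "Z:insert X (aL)" for Y Z using that X(1) br_aa bk_anti[of X] by (auto simp: g0_def)
 have 1: "bk Y Z = 0" if "Y:insert X (aL)" "Z:?V" for Y Z using that(2)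
 proof (induction rule: span_induct_alt)
  case (step c x y)
  thus ?case using comm that(1) by (simp add: br.add_right br.scaleR_right)
 qed (simp add: br.zero_right)
 have 2: "bk Y Z = 0" if "Y:?V" "Z:?V" for Y Z using that(1)
 proof (induction rule: span_induct_alt)
  case (step c x y)
  thus ?case using 1[OF _ that(2)] by (simp add: br.add_left br.scaleR_left)
 qed (simp add: br.zero_left)
 have "?V <= ss L" using X(2) aa_ss subsp(2) by (intro span_minimal) auto
 hence "abelian_in L ?V (ss L)" using 2 by (auto simp: abelian_in_def)
 moreover have "aL <= ?V" using span_superset[of "insert X (aL)"] by simp
 ultimately show ?thesis using span_base[of X "insert X (aL)"] aa_maximal by auto
qed

lemma th_g0: "X:g0 ==> th X:g0"
proof -
 assume "X:g0"
 hence "th X:sp (%ro. (%H.-ro H) = (%_. 0))" unfolding g0_sp by (rule th_sp)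
 thus ?thesis unfolding g0_sp by (rule) (auto simp: fun_eq_iff)
qed

lemma g0_parts: "X:g0 ==> ps X:aL" "X:g0 ==> pk X:g0"
proof -
 assume X: "X:g0"
 have "X-th X = (pk X+ps X)-(pk X-ps X)" "X+th X = (pk X+ps X)+(pk X-ps X)" by (simp_all only: pk_ps th_def)
 hence e: "ps X = (1/2) *R (X-th X)" "pk X = (1/2) *R (X+th X)" by (simp_all)
 hence "ps X:g0" "pk X:g0" using X th_g0 subspace_g0 by (auto intro: subspace_scale subspace_diff subspace_add)
 thus "ps X:aL" "pk X:g0" using g0_ss pk_ps(2) by auto
qed

section \<open>Roots, reflections and conjugation into the maximal abelian subspace\<close>

lemma rootsD: "ro:rL ==> ro:dual_aa L" "ro:rL ==> EX E:root_space L ro. E ~= 0"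
 "ro:rL ==> ro ~= (%_. 0)" using subspace_0[OF subspace_root_space] by (auto simp: roots_def)

lemma not_root: "ro:dual_aa L ==> ro ~= (%_. 0) ==> ro ~: rL ==> rsp ro = {0}" by (auto simp: roots_def)

lemma sp_mono_roots:
 assumes "x:sp P" "!!ro. ro:rL ==> P ro ==> Q ro" "P (%_. 0) ==> Q (%_. 0)"
 shows "x:sp Q" using assms(1)
proof (induction rule: sp_induct)
 case (base ro x)
 show ?case
 proof (cases "ro:rL | ro = (%_. 0)")
  case True
  thus ?thesis using assms(2,3) base root_space_sp by auto
 next
  case False
  thus ?thesis using not_root base subspace_0[OF sub_sp] by simp
 qed
qed (auto intro: subspace_add[OF sub_sp] subspace_0[OF sub_sp])

text \<open>Root vectors of different roots are \<open>B\<close>-orthogonal, hence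
  independent.\<close>

lemma finite_roots: "finite (rL)"
proof -
 obtain v where v: "!!ro. ro:rL ==> v ro:rsp ro&v ro ~= 0" using rootsD(2) by metis
 have orth: "B (v ro) (v rb) = 0" if "ro:rL" "rb:rL" "ro ~= rb" for ro rb
  using root_space_orthogonal[OF rootsD(1)[OF that(1)] rootsD(1)[OF that(2)] that(3)] v that by simp
 have inj: "inj_on v (rL)"
 proof (rule inj_onI, rule ccontr)
  fix ro rb assume a: "ro:rL" "rb:rL" "v ro = v rb" "ro ~= rb"
  thus False using orth[of ro rb] B_eq_0 v by simp
 qed
 have "independent (v ` rL)" unfolding independent_explicit_finite_subsets
 proof (intro allI impI ballI)
  fix S c w assume S: "S <= v ` rL" "finite S" "(\<Sum>w\<in>S. c w *R w) = 0" "w:S"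
  have Bw: "B w w' = 0" if "w':S" "w' ~= w" for w'
  proof -
   obtain ro rb where "w = v ro" "w' = v rb" "ro:rL" "rb:rL" using S(1,4) \<open>w' : S\<close> by blast
   thus ?thesis using orth[of ro rb] that(2) by auto
  qed
  have "0 = B w (\<Sum>w\<in>S. c w *R w)" by (simp add: S(3) Bf.zero_right)
  also have "... = (\<Sum>w'\<in>S. c w' * B w w')" by (simp add: Bf.sum_right Bf.scaleR_right)
  also have "... = (\<Sum>w'\<in>S. if w' = w then c w * B w w else 0)" using Bw by (intro sum.cong) auto
  also have "... = c w * B w w" using S(2,4) by simp
  finally have "c w * B w w = 0" by simp
  moreover have "w ~= 0" using S(1,4) v by auto
  ultimately show "c w = 0" using B_eq_0[of w] by simp
 qed
 thus ?thesis using inj finite_imageD independent_imp_finite by auto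
qed

lemma finite_simple: "finite (sL)" and simple_roots: "sL <= rL"
 and root_comb: "!!rb. rb:rL ==> EX c::('l => real) => int. rb = (%H. \<Sum>si\<in>simple L. of_int (c si) * si H) &
    ((ALL si:simple L. c si >= 0) | (ALL si:simple L. c si <= 0))" using simple by (auto simp: simple_system_def)

lemma chamber_aa: "H:chamber L ==> H:aL" by (simp add: chamber_def)

text \<open>The coefficients of a root in the simple roots have one sign and do not all vanish, so
  its value at a chamber point has that sign. Positivity of roots becomes the sign of their value at
  a single point.\<close>

lemma pos_roots_chamber:
 assumes H: "H:chamber L" and rb: "rb:rL"
 shows "rb:pos_roots L \<longleftrightarrow> rb H > 0" "rb H ~= 0"
proof -
 obtain c :: "('l => real) => int" where c: "rb = (%H. \<Sum>si\<in>simple L. of_int (c si) * si H)"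
  "(ALL si:simple L. c si >= 0) | (ALL si:simple L. c si <= 0)" using root_comb[OF rb] by blast
 obtain si0 where s0: "si0:sL" "c si0 ~= 0"
 proof (rule ccontr)
  assume "~ thesis"
  thus False using that rootsD(3)[OF rb] by (fastforce simp: c(1))
 qed
 have sH: "si H > 0" if "si:sL" for si using H that by (simp add: chamber_def)
 have nonneg: "ga H >= 0" if g: "ga:pos_roots L" for ga
 proof -
  obtain n :: "('l => real) => nat" where n: "ga = (%H. \<Sum>si\<in>simple L. of_nat (n si) * si H)" using g unfolding pos_roots_def by auto
  have "0 <= real (n si) * si H" if "si:sL" for si using sH[OF that] by simp
  thus ?thesis unfolding n by (intro sum_nonneg) auto
 qed
 have "(rb:pos_roots L \<longleftrightarrow> rb H > 0)&rb H ~= 0" using c(2)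
 proof
  assume p: "ALL si:simple L. c si >= 0"
  have "0 < of_int (c si0) * si0 H" using p s0 sH by force
  also have "... <= rb H" unfolding c(1)
  proof (rule member_le_sum[of si0 "sL" "%si. of_int (c si) * si H"])
   fix si assume "si:sL - {si0}"
   thus "0 <= of_int (c si) * si H" using p sH[of si] by simp
  qed (use s0 finite_simple in auto)
  finally have "rb H > 0" .
  moreover have "rb:pos_roots L"
  proof -
   have "rb = (%H. \<Sum>si\<in>simple L. of_nat (nat (c si)) * si H)" unfolding c(1) using p by simp
   thus ?thesis using rb by (auto simp: pos_roots_def)
  qed
  ultimately show ?thesis by simp
 next
  assume p: "ALL si:simple L. c si <= 0"
  have "0 < - of_int (c si0) * si0 H" using p s0 sH by (simp add: mult_less_0_iff) force
  also have "... <= (\<Sum>si\<in>simple L. - of_int (c si) * si H)"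
  proof (rule member_le_sum[of si0 "sL" "%si. - of_int (c si) * si H"])
   fix si assume "si:sL - {si0}"
   thus "0 <= - of_int (c si) * si H" using p sH[of si] by (intro mult_nonneg_nonneg) auto
  qed (use s0 finite_simple in auto)
  also have "... =-rb H" by (simp add: c(1) sum_negf)
  finally have "rb H < 0" by simp
  thus ?thesis using nonneg[of rb] by force
 qed
 thus "rb:pos_roots L \<longleftrightarrow> rb H > 0" "rb H ~= 0" by auto
qed

lemma pos_roots_roots: "ro:pos_roots L ==> ro:rL" by (simp add: pos_roots_def)

lemma simple_pos: "ro:sL ==> ro:pos_roots L" using chamber_nonempty pos_roots_chamber(1) simple_roots by (auto simp: chamber_def)

text \<open>A point satisfying the weak inequalities becomes a chamber point after adding a small
  multiple of one, hence is a limit of chamber points.\<close>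

lemma clch: "H:cch \<longleftrightarrow> H:aL&(ALL ro:simple L. ro H >= 0)"
proof
 assume H: "H:cch"
 have ha: "H:aL" using closure_minimal[of "chamber L" "aL"] closed_subspace[OF subsp(3)] H chamber_aa by auto
 have "ro H >= 0" if a: "ro:sL" for ro
 proof -
  have ad: "ro:dual_aa L" using a simple_roots rootsD(1) by auto
  obtain v where v: "!!x. x:aL ==> B v x = ro x" using B_riesz_on[OF subsp(3), of ro] dual_aaD(1,2)[OF ad] by blast
  have "closed {x. 0 <= B v x}" by (intro closed_Collect_le Bf.continuous_on continuous_intros)
  moreover have "chamber L <= {x. 0 <= B v x}" using v a by (force simp: chamber_def)
  ultimately have "H : {x. 0 <= B v x}" using closure_minimal H by blast
  thus ?thesis using v[OF ha] by simp
 qed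
 thus "H:aL&(ALL ro:simple L. ro H >= 0)" using ha by simp
next
 assume H: "H:aL&(ALL ro:simple L. ro H >= 0)"
 obtain H' where H': "H':chamber L" using chamber_nonempty by blast
 have "H+inverse (real (Suc n)) *R H':chamber L" for n
 proof -
  have "H+inverse (real (Suc n)) *R H':aL" using H H' subsp(3) by (intro subspace_add subspace_scale) (auto simp: chamber_def)
  moreover have "ro (H+inverse (real (Suc n)) *R H') > 0" if "ro:sL" for ro
  proof -
   have "ro:dual_aa L" using that simple_roots rootsD(1) by auto
   hence "ro (H+inverse (real (Suc n)) *R H') = ro H+inverse (real (Suc n)) * ro H'"
    using H H' subspace_scale[OF subsp(3)] by (simp add: dual_aaD chamber_def)
   moreover have "inverse (real (Suc n)) * ro H' > 0" using H' that by (intro mult_pos_pos) (auto simp: chamber_def)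
   ultimately show ?thesis using H that by auto
  qed
  ultimately show ?thesis by (simp add: chamber_def)
 qed
 moreover have "(%n. H+inverse (real (Suc n)) *R H') ----> H+0 *R H'"
  by (intro tendsto_add tendsto_const tendsto_scaleR LIMSEQ_inverse_real_of_nat)
 ultimately show "H:cch" unfolding closure_sequential by fastforce
qed

lemma dominant_pos_roots:
 assumes "H:cch" "rb:pos_roots L"
 shows "rb H >= 0"
proof -
 obtain n :: "('l => real) => nat" where "rb = (%H. \<Sum>si\<in>simple L. of_nat (n si) * si H)" using assms(2) by (auto simp: pos_roots_def)
 thus ?thesis using assms(1) by (auto simp: clch sum_nonneg)
qed

text \<open>A chosen point of the chamber; it grades the Lie algebra by the eigenvalues of its adjoint.\<close>

definition H1 :: 'l where "H1 = (SOME H. H:chamber L)"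

lemma H1: "H1:chamber L" "H1:aL"
proof -
 show "H1:chamber L" unfolding H1_def using chamber_nonempty by (intro someI_ex[of "%H. H:chamber L"]) blast
 thus "H1:aL" by (rule chamber_aa)
qed

lemma roots_H1: "rb:rL ==> rb H1 ~= 0" "rb:rL ==> rb:pos_roots L \<longleftrightarrow> rb H1 > 0" using pos_roots_chamber[OF H1(1)] by auto

lemma g0_regular:
 assumes "H:aL" "!!ro. ro:rL ==> ro H ~= 0" "bk H X = 0"
 shows "X:g0"
proof -
 have "X:sp (%ro. ro H = 0)" using eigen_sp[of H X 0] assms by simp
 thus ?thesis unfolding g0_sp by (rule sp_mono_roots) (use assms(2) in auto)
qed

lemma nn_sp: "nn L = sp (%ro. ro H1 > 0)"
proof
 show "nn L <= sp (%ro. ro H1 > 0)" unfolding nn_def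
 by (rule span_minimal[OF _ sub_sp], rule UN_least) (use root_space_sp rootsD(1) pos_roots_roots roots_H1(2) in fastforce)+
 show "sp (%ro. ro H1 > 0) <= nn L"
 proof
  fix x assume "x:sp (%ro. ro H1 > 0)"
  thus "x:nn L"
  proof (induction rule: sp_induct)
   case (base ro x)
   show ?case
   proof (cases "ro:rL")
    case True
    thus ?thesis unfolding nn_def using base roots_H1(2) by (intro span_base) auto
   next
    case False
    thus ?thesis using not_root base by (fastforce simp: nn_def span_0)
   qed
  qed (auto simp: nn_def span_0 span_add)
 qed
qed

lemma parabolic_algebra_sp: "parabolic_algebra L {} = sp (%ro. ro H1 >= 0)"
proof -
 have no: "span_roots L {} = {}" using rootsD(3) by (auto simp: span_roots_def)
 have nsub: "rsp ro <= sp (%ro. ro H1 >= 0)" if "ro:pos_roots L" for ro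
  using root_space_sp[of ro "%ro. ro H1 >= 0"] rootsD(1) pos_roots_roots[OF that] roots_H1(2) that by auto
 have gsub: "g0 <= sp (%ro. ro H1 >= 0)" unfolding g0_sp by (auto elim!: sp_mono)
 let ?S = "{X:kk L. ALL H:aa L. bk H X = 0} \<union> aL \<union> (\<Union>ro\<in>pos_roots L. rsp ro)"
 have mg: "{X:kk L. ALL H:aa L. bk H X = 0} <= g0" by (auto simp: g0_def)
 have "span ?S <= sp (%ro. ro H1 >= 0)" using nsub gsub mg aa_g0 by (intro span_minimal sub_sp) blast
 moreover have "sp (%ro. ro H1 >= 0) <= span ?S"
 proof
  fix x assume "x:sp (%ro. ro H1 >= 0)"
  thus "x:span ?S"
  proof (induction rule: sp_induct)
   case (base ro x)
   consider "ro:pos_roots L" | "ro = (%_. 0)" | "ro ~: rL" "ro ~= (%_. 0)" using roots_H1 base(2) by force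
   thus ?case
   proof cases
    case 1
    thus ?thesis using base by (intro span_base) auto
   next
    case 2
    hence "ps x:aL" "pk x : {X:kk L. ALL H:aa L. bk H X = 0}" using base g0_parts pk_ps(1) by (auto simp: g0_def root_space_def)
    hence "pk x+ps x:span ?S" by (intro span_add span_base) auto
    thus ?thesis by (simp add: pk_ps)
   next
    case 3
    thus ?thesis using not_root base by (simp add: span_0)
   qed
  qed (auto simp: span_0 span_add)
 qed
 ultimately show ?thesis by (simp add: parabolic_algebra_def no)
qed

lemma KK_eq: "KL = expG ` kk L" by (simp add: KK_def lie_exp_eq)

lemma KKc: "k:KL ==> k:CL" by (auto simp: KK_eq)

lemma KK_mult: "k:KL ==> k':KL ==> k**k':KL" and KK_inv: "k:KL ==> inv k:KL" and KK_one: "\<one>:KL"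
 using subgroup_KK by (auto simp: subgroup.m_closed subgroup.m_inv_closed subgroup.one_closed)

lemma Ad_KK: assumes "k:KL"
 shows "X:kk L ==> AD k X:kk L" "X:ss L ==> AD k X:ss L" "th (AD k X) = AD k (th X)"
  "B (AD k X) (AD k Y) = B X Y"
proof -
 obtain Z where Z: "Z:kk L" "k = expG Z" using assms by (auto simp: KK_eq)
 show k: "AD k X:kk L" if "X:kk L" for X unfolding Z(2) using that Z(1) br_kk by (intro Ad_expG_in_subspace subsp)
 show s: "AD k X:ss L" if "X:ss L" for X unfolding Z(2) using that Z(1) br_kk by (intro Ad_expG_in_subspace subsp)
 show t: "th (AD k X) = AD k (th X)" for X
 proof -
  have c: "k:CL" using assms KKc by simp
  have "th (AD k (pk X+ps X)) = AD k (pk X-ps X)"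
   using th_kk[OF k[OF pk_ps(1)], of X] th_ss[OF s[OF pk_ps(2)], of X] by (simp add: Adlin[OF c] th_simps)
  thus ?thesis by (simp add: pk_ps th_def[of X])
 qed
 show "B (AD k X) (AD k Y) = B X Y" using form_Ad[OF KKc[OF assms]] by (simp add: B_def t)
qed

lemma root_vector:
 assumes "ro:rL"
 shows "rvec ro:aL" "H:aL ==> fo (rvec ro) H = ro H" "ro (rvec ro) > 0"
proof -
 note ad = rootsD(1)[OF assms]
 obtain v where v: "v:aL" "!!x. x:aL ==> fo v x = ro x"
 proof -
  obtain v where "v:aL" "!!x. x:aL ==> B v x = ro x" using B_riesz_on[OF subsp(3), of ro] dual_aaD(1,2)[OF ad] by auto
  moreover from this have "fo v x = ro x" if "x:aL" for x using B_ss[of x v] aa_ss that by force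
  ultimately show thesis using that by blast
 qed
 have "rvec ro = v" unfolding root_vector_def
 proof (rule the_equality)
  fix w assume w: "w:aL&(ALL H':aa L. fo w H' = ro H')"
  have "w-v = 0" using w v(1) subspace_diff[OF subsp(3)] v(2) form_ss[of "w-v"] aa_ss by (auto simp: fm.diff_left)
  thus "w = v" by simp
 qed (use v in auto)
 with v show "rvec ro:aL" "H:aL ==> fo (rvec ro) H = ro H" by auto
 have "v ~= 0"
 proof
  assume "v = 0"
  hence "ro x = 0" for x using v(2) dual_aaD(3)[OF ad, of x] fm.zero_left by auto
  thus False using rootsD(3)[OF assms] by auto
 qed
 thus "ro (rvec ro) > 0" using v form_ss[of v] aa_ss \<open>root_vector L ro = v\<close> by auto
qed

lemma rfl_aa: "ro:rL ==> H:aL ==> rfl ro H:aL" using root_vector(1) subsp(3) by (simp add: root_reflection_def subspace_diff subspace_scale)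

lemma form_root_reflection:
 assumes "ro:rL" "H:aL" "H':aL"
 shows "fo H (rfl ro H') = fo H H'-2 * ro H * ro H'/ro (rvec ro)" using root_vector(2)[OF assms(1,2)] form_sym
 by (simp add: root_reflection_def fm.diff_right fm.scaleR_right)

text \<open>The bracket commutes with \<aa> and is negated by \<open>th\<close>, so it lies in
  \<aa>. Invariance of the form makes its difference from the claimed vector orthogonal to
  itself.\<close>

lemma root_brackets:
 assumes "ro:rL" "E:rsp ro"
 shows "bk E (th E) =-B E E *R rvec ro"
proof -
 note ad = rootsD(1)[OF assms(1)]
 have E: "!!H. H:aL ==> bk H E = ro H *R E" "!!H. H:aL ==> bk H (th E) =-ro H *R th E"
  using assms(2) th_root_space by (auto simp: root_space_def)
 let ?Z = "bk E (th E)"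
 have "?Z:g0" unfolding g0_def using jacobi E by (auto simp: br.scaleR_left br.scaleR_right br.minus_right)
 hence Z: "?Z:aL" using bk_anti[of "th E" E] ssI g0_ss by (simp add: th_bracket)
 let ?W = "?Z+B E E *R rvec ro"
 have W: "?W:aL" using Z root_vector(1)[OF assms(1)] subsp(3) by (simp add: subspace_add subspace_scale)
 have "fo ?Z ?W =-fo (th E) (bk E ?W)" by (rule form_bracket)
 also have "bk E ?W =-ro ?W *R E" using E(1)[OF W] bk_anti[of E ?W] by simp
 also have "- fo (th E) (- ro ?W *R E) = ro ?W * fo E (th E)" by (simp add: fm.scaleR_right fm.minus_right form_sym)
 also have "... =-(ro ?W * B E E)" by (simp add: B_def)
 finally have "fo ?W ?W = 0" using root_vector(2)[OF assms(1) W] by (simp add: fm.add_left fm.scaleR_left)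
 thus ?thesis using form_ss[of ?W] W aa_ss by (auto simp: add_eq_0_iff2)
qed

text \<open>The rotation generated by \<open>E + th0E\<close> in the plane spanned by the root vector and \<open>E - th0E\<close>.\<close>

lemma reflection_in_KK:
 assumes ro: "ro:rL"
 shows "EX k:KK L. ALL H:aa L. AD k H = rfl ro H"
proof -
 note ad = rootsD(1)[OF ro] and rv = root_vector[OF ro]
 obtain E where Er: "E:rsp ro" "E ~= 0" using rootsD(2)[OF ro] by blast
 have E: "!!H. H:aL ==> bk H E = ro H *R E" "!!H. H:aL ==> bk H (th E) =-ro H *R th E" using Er(1) th_root_space by (auto simp: root_space_def)
 let ?v = "rvec ro"
 define c a2 where "c = B E E" and "a2 = ro ?v"
 have pos: "c > 0" "a2 > 0" using B_pos[OF Er(2)] rv(3) by (auto simp: c_def a2_def)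
 define Z Y where "Z = E+th E" and "Y = E-th E"
 have Zk: "Z:kk L" using kk_part by (simp add: Z_def)
 have ZH: "bk Z H =-ro H *R Y" if "H:aL" for H using E[OF that] bk_anti[of Z H] by (simp add: Z_def Y_def br.add_right algebra_simps)
 have ZY: "bk Z Y = (2 * c) *R ?v" using root_brackets[OF ro Er(1)] bk_anti[of "th E" E]
  by (simp add: Z_def Y_def br.add_left br.diff_right c_def scaleR_2[symmetric])
 \<comment> \<open>The frequency of the rotation. At time \<open>pi / w\<close> the sine term
   vanishes and the cosine is \<open>-1\<close>, which leaves exactly the reflection.\<close>
 define w where "w = sqrt (2 * c * a2)"
 have w: "w > 0" "w * w = 2 * c * a2" using pos by (auto simp: w_def)
 have "AD (expG (t *R Z)) H = H+((ro H/a2) * cos (w * t)-ro H/a2) *R ?v-(ro H/a2 * w/(2 * c) * sin (w * t)) *R Y" if H: "H:aL" for H t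
 proof -
  define f where "f t = H+((ro H/a2) * cos (w * t)-ro H/a2) *R ?v-(ro H/a2 * w/(2 * c) * sin (w * t)) *R Y" for t
  have "(f hasV bk Z (f t)) (at t)" for t
  proof -
   have b: "bk Z (f t) = (- (ro H/a2 * w * sin (w * t))) *R ?v-(ro H * cos (w * t)) *R Y" using pos by (simp add: algebra_simps f_def br.add_right br.diff_right br.scaleR_right ZH[OF H] ZH[OF rv(1)] ZY a2_def)
   have "ro H/a2 * w/(2 * c) * (cos (w * t) * w) = ro H * cos (w * t)"
   proof -
    have "ro H/a2 * w/(2 * c) * (cos (w * t) * w) = ro H * cos (w * t) * (w * w)/(2 * c * a2)" by (simp add: mult_ac)
    thus ?thesis using pos by (simp add: w(2))
   qed
   note e = this
   have "((%t. (ro H/a2) * cos (w * t)-ro H/a2) has_real_derivative-(ro H/a2 * w * sin (w * t))) (at t)"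
    "((%t. ro H/a2 * w/(2 * c) * sin (w * t)) has_real_derivative ro H * cos (w * t)) (at t)"
   proof -
    have "((%t. K * cos (w * t)-K) has_real_derivative-(K * w * sin (w * t))) (at t)"
     "((%t. K * sin (w * t)) has_real_derivative K * (cos (w * t) * w)) (at t)" for K by (auto intro!: derivative_eq_intros)
    note this(1)[of "ro H/a2"] this(2)[of "ro H/a2 * w/(2 * c)", unfolded e]
    thus "((%t. (ro H/a2) * cos (w * t)-ro H/a2) has_real_derivative-(ro H/a2 * w * sin (w * t))) (at t)"
     "((%t. ro H/a2 * w/(2 * c) * sin (w * t)) has_real_derivative ro H * cos (w * t)) (at t)" by auto
   qed
   from has_vector_derivative_scaleR[OF this(1) has_vector_derivative_const[of ?v]]
    has_vector_derivative_scaleR[OF this(2) has_vector_derivative_const[of Y]]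
   have "((%t. H+((ro H/a2) * cos (w * t)-ro H/a2) *R ?v-(ro H/a2 * w/(2 * c) * sin (w * t)) *R Y)
    hasV (0+(- (ro H/a2 * w * sin (w * t))) *R ?v-(ro H * cos (w * t)) *R Y)) (at t)"
    by (intro has_vector_derivative_diff has_vector_derivative_add) simp_all
   thus ?thesis unfolding b unfolding f_def by simp
  qed
  from Ad_expG_flow[of f, OF this, of t] show ?thesis by (simp add: f_def)
 qed
 from this[of _ "pi/w"] have "AD (expG ((pi/w) *R Z)) H = rfl ro H" if "H:aL" for H using that w(1) by (simp add: root_reflection_def a2_def)
 moreover have "expG ((pi/w) *R Z):KL" using Zk subspace_scale[OF subsp(1)] by (auto simp: KK_eq)
 ultimately show ?thesis by blast
qed

definition KH :: "'l => 'g set" where "KH H = {k:KL. AD k H = H}"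

lemma KHs: "k:KH H ==> k:KL" "k:KH H ==> AD k H = H" "k:KH H ==> k:CL"
 "\<one>:KH H" "k:KH H ==> k':KH H ==> k**k':KH H" "k:KH H ==> inv k:KH H"
 "KH 0 = KL" using KKc KK_one KK_mult KK_inv Ad_inv(1)[of k H] by (auto simp: KH_def Adm Adlin(5))

lemma compact_KH: "compactin G (KH H)"
proof -
 have "closedin G {g:topspace G. AD g H : {H}}" by (rule closedin_continuous_map_preimage[OF continuous_map_Ad_const]) simp
 hence "compactin G (KL \<inter> {g:topspace G. AD g H : {H}})" by (rule compact_Int_closedin[OF compact_KK])
 moreover have "KL \<inter> {g:topspace G. AD g H : {H}} = KH H" using KKc by (auto simp: KH_def)
 ultimately show ?thesis by simp
qed

lemma expG_KH: "Z:kk L ==> bk Z H = 0 ==> expG (t *R Z):KH H"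
 using subspace_scale[OF subsp(1)] Ad_expG_eigen[of Z H 0 t] by (auto simp: KH_def KK_eq)

lemma continuous_attains_sup_group:
 assumes "compactin G K" "K ~= {}" "cmap G euclideanreal f"
 shows "EX k:K. ALL k':K. f k' <= f k"
proof -
 have "compact (f ` K)" using image_compactin[OF assms(1,3)] by simp
 from compact_attains_sup[OF this] assms(2) show ?thesis by auto
qed

lemma continuous_form_Ad: "cmap G euclideanreal (%g. fo H0 (AD g X))"
 using continuous_map_compose[OF continuous_map_Ad_const, of euclideanreal "fo H0"] by (simp add: o_def fm.continuous_on)

text \<open>Let \<open>W\<close> maximize the pairing with the regular element \<open>H0\<close>
  over the orbit under \<open>KH H\<close>. The derivative in the direction \<open>bk H0 W\<close>,
  an element of \<open>kk\<close>, is up to sign the form on that element; since it vanishes,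
  \<open>W\<close> commutes with \<open>H0\<close> and lies in \<aa>. Comparison with the
  reflections in roots vanishing at \<open>H\<close>, which belong to \<open>KH H\<close>, gives the
  signs.\<close>

theorem conj_into_aa:
 assumes H: "H:aL" and X: "X:ss L" "bk H X = 0" and H0: "H0:aL" "!!ro. ro:rL ==> ro H0 ~= 0"
 obtains k where "k:KH H" "AD k X:aL" "!!k'. k':KH H ==> fo H0 (AD k' X) <= fo H0 (AD k X)"
  "!!ro. ro:rL ==> ro H = 0 ==> ro H0 * ro (AD k X) >= 0"
proof -
 obtain k where k: "k:KH H" "!!k'. k':KH H ==> fo H0 (AD k' X) <= fo H0 (AD k X)"
  using continuous_attains_sup_group[OF compact_KH _ continuous_form_Ad, of H H0 X] KHs(4) by auto
 define W where "W = AD k X"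
 have kc: "k:CL" using KHs(3) k by blast
 have W: "W:ss L" using Ad_KK(2) KHs(1) k X by (simp add: W_def)
 have HW: "bk H W = 0" using KHs(2)[OF k(1)] X(2) by (metis Adlin[OF kc] W_def Ad_bracket[OF kc])
 let ?V = "bk H0 W"
 have V: "?V:kk L" using br_kk(3) H0(1) aa_ss W by blast
 have VH: "bk ?V H = 0" using jacobi HW br_aa[OF H H0(1)] bk_anti[of ?V H] by (simp add: br.zero_left br.zero_right)
 have "((%t. fo H0 (AD (expG (t *R ?V)) W)) has_real_derivative fo H0 (bk ?V W)) (at 0)"
  using bounded_linear.has_vector_derivative[OF fm.bounded_linear_right hasV_Ad_expG[of ?V W 0], of H0]
  by (simp add: has_real_derivative_iff_has_vector_derivative)
 moreover have "fo H0 (AD (expG (t *R ?V)) W) <= fo H0 (AD (expG (0 *R ?V)) W)" for t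
 proof -
  have "expG (t *R ?V)**k:KH H" using KHs(5) expG_KH[OF V VH] k(1) by simp
  from k(2)[OF this] show ?thesis by (simp add: W_def Adm kc)
 qed
 ultimately have "fo H0 (bk ?V W) = 0" by (intro DERIV_local_max[of _ _ 0 1]) auto
 hence Wa: "W:aL" using form_bracket[of ?V H0 W] form_bracket[of H0 W ?V] bk_anti[of ?V H0] form_sym form_kk[OF V] g0_regular H0 g0_ss W by (fastforce simp: fm.minus_right)
 have "ro H0 * ro W >= 0" if a: "ro:rL" "ro H = 0" for ro
 proof -
  obtain q where q: "q:KL" "!!H. H:aL ==> AD q H = rfl ro H" using reflection_in_KK[OF a(1)] by auto
  have "q**k:KH H" using q H a(2) KHs(5) k(1) by (fastforce simp: KH_def root_reflection_def)
  from k(2)[OF this] have "fo H0 (rfl ro W) <= fo H0 W" using q Wa kc KKc by (simp add: W_def Adm)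
  thus ?thesis using root_vector(3)[OF a(1)] by (simp add: zero_le_divide_iff form_root_reflection[OF a(1) H0(1) Wa])
 qed
 thus thesis using that[OF k(1) _ k(2)] Wa by (simp add: W_def)
qed

end

section \<open>Dominance under conjugation by the maximal compact subgroup\<close>

text \<open>Real functions that extend to entire functions, so that the identity theorem applies to them.\<close>

definition entr :: "(real => real) => bool" where
 "entr f \<longleftrightarrow> (EX F. F holomorphic_on UNIV&(ALL t. F (complex_of_real t) = complex_of_real (f t)))"

lemma entire_real_const: "entr (%_. c)" unfolding entr_def by force

lemma entire_real_add: "entr f ==> entr g ==> entr (%t. f t+g t)" unfolding entr_def
proof (elim exE conjE)
 fix F G assume "F holomorphic_on UNIV" "ALL t. F (complex_of_real t) = complex_of_real (f t)"
  "G holomorphic_on UNIV" "ALL t. G (complex_of_real t) = complex_of_real (g t)"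
 thus "EX F. F holomorphic_on UNIV&(ALL t. F (complex_of_real t) = complex_of_real (f t+g t))"
  by (intro exI[of _ "%z. F z+G z"]) (auto intro: holomorphic_intros)
qed

lemma entire_real_mult: "entr f ==> entr g ==> entr (%t. f t * g t)" unfolding entr_def
proof (elim exE conjE)
 fix F G assume "F holomorphic_on UNIV" "ALL t. F (complex_of_real t) = complex_of_real (f t)"
  "G holomorphic_on UNIV" "ALL t. G (complex_of_real t) = complex_of_real (g t)"
 thus "EX F. F holomorphic_on UNIV&(ALL t. F (complex_of_real t) = complex_of_real (f t * g t))"
  by (intro exI[of _ "%z. F z * G z"]) (auto intro: holomorphic_intros)
qed

lemma entire_real_sum: "(!!i. i:I ==> entr (f i)) ==> entr (%t. \<Sum>i\<in>I. f i t)"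
 by (induction rule: infinite_finite_induct) (simp_all add: entire_real_const entire_real_add)

lemma entire_real_prod: "(!!i. i:I ==> entr (f i)) ==> entr (%t. \<Prod>i\<in>I. f i t)"
 by (induction rule: infinite_finite_induct) (simp_all add: entire_real_const entire_real_mult)

lemma entire_real_powser:
 fixes c :: "nat => real"
 assumes "!!t. summable (%n. c n * t ^ n)"
 shows "entr (%t. \<Sum>n. c n * t ^ n)"
proof -
 have s: "summable (%n. complex_of_real (c n) * z ^ n)" for z
 proof (rule powser_inside)
  show "summable (%n. complex_of_real (c n) * complex_of_real (norm z+1) ^ n)"
   using summable_of_real[OF assms[of "norm z+1"], where 'a = complex] by simp
  show "norm z < norm (complex_of_real (norm z+1))" unfolding norm_of_real by simp
 qed
 have "(\<Sum>n. complex_of_real (c n) * complex_of_real t ^ n) = complex_of_real (\<Sum>n. c n * t ^ n)" for t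
  using suminf_of_real[OF assms[of t], where 'a = complex] by simp
 thus ?thesis unfolding holomorphic_on_def field_differentiable_def entr_def using termdiffs_strong_converges_everywhere[OF s] by auto
qed

lemma entire_real_identity:
 assumes f: "entr f" and e: "e > 0" "!!t. \<bar>t\<bar> < e ==> f t = 0"
 shows "f t = 0"
proof -
 obtain F where F: "F holomorphic_on UNIV" "!!t. F (complex_of_real t) = complex_of_real (f t)" using f by (auto simp: entr_def)
 have "(0::complex) islimpt (complex_of_real ` {0<..<e})" unfolding islimpt_approachable
 proof (intro allI impI)
  fix d :: real assume "d > 0"
  thus "EX x':complex_of_real ` {0<..<e}. x' ~= 0&dist x' 0 < d"
   using e(1) by (intro bexI[of _ "complex_of_real (min d e/2)"]) (auto simp del: of_real_divide)
 qed
 hence "F (complex_of_real t) = 0" by (rule analytic_continuation[OF F(1) open_UNIV connected_UNIV subset_UNIV UNIV_I])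
   (use F(2) e(2) in auto)
 thus ?thesis using F(2) by simp
qed

lemma entire_real_differentiable:
 assumes "entr f"
 shows "EX f'. (f has_real_derivative f') (at t)"
proof -
 obtain F where F: "F holomorphic_on UNIV" "!!t. F (complex_of_real t) = complex_of_real (f t)" using assms by (auto simp: entr_def)
 obtain F' where F': "(F has_field_derivative F') (at (complex_of_real t))" using F(1) by (metis UNIV_I field_differentiable_def holomorphic_on_def)
 from has_vector_derivative_real_field[OF this]
 have "((%x. complex_of_real (f x)) hasV F') (at t)" by (simp add: F(2))
 from bounded_linear.has_vector_derivative[OF bounded_linear_Re this]
 have "(f has_real_derivative Re F') (at t)" by (simp add: has_real_derivative_iff_has_vector_derivative)
 thus ?thesis by blast
qed

lemma entire_real_det:
 assumes "!!t. A t:carrier_mat n n" "!!i j. i < n ==> j < n ==> entr (%t. A t $$ (i,j))"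
 shows "entr (%t. det (A t))"
proof -
 have "det (A t) = (\<Sum>p\<in>{p. p permutes {0..<n}}. signof p * (\<Prod>i=0..<n. A t $$ (i,p i)))" for t by (rule det_def'[OF assms(1)])
 moreover have "entr (%t. \<Sum>p\<in>{p. p permutes {0..<n}}. signof p * (\<Prod>i=0..<n. A t $$ (i,p i)))"
  using assms(2) by (intro entire_real_sum entire_real_mult entire_real_const entire_real_prod) fastforce
 ultimately show ?thesis by simp
qed

text \<open>Cramer's rule: \<open>D\<close> is the determinant and \<open>C\<close> the adjugate.
  Solutions of \<open>T t y = x\<close> become quotients of entire functions with the common
  denominator \<open>D\<close>.\<close>

lemma entire_real_cramer:
 fixes T :: "real => 'a::euclidean_space => 'a"
 assumes lin: "!!t. linear (T t)" and ent: "!!b c. entr (%t. T t b \<bullet> c)"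
 obtains D C where "entr D" "!!x b. entr (%t. C t x \<bullet> b)" "!!t x. T t (C t x) = D t *R x"
  "!!t. inj (T t) ==> D t ~= 0"
proof -
 obtain bs :: "'a list" where bs: "set bs = Basis" "distinct bs" using finite_distinct_list[OF finite_Basis] by auto
 define n where "n = length bs"
 have bij: "bij_betw ((!) bs) {0..<n} Basis" using bs by (simp add: bij_betw_nth n_def atLeast0LessThan)
 define A where "A t = mat n n (%(i,j). T t (bs ! j) \<bullet> (bs ! i))" for t
 have Ac: "A t:carrier_mat n n" for t by (simp add: A_def)
 have entA: "entr (%t. A t $$ (i,j))" if "i < n" "j < n" for i j using that by (simp add: A_def ent)
 define D where "D t = det (A t)" for t
 define C where "C t x = (\<Sum>k=0..<n. (\<Sum>i=0..<n. adj_mat (A t) $$ (k,i) * (x \<bullet> bs ! i)) *R bs ! k)" for t x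
 have adjc: "adj_mat (A t):carrier_mat n n" "A t * adj_mat (A t) = det (A t) \<cdot>\<^sub>m 1\<^sub>m n" for t using adj_mat[OF Ac] by auto
 have entadj: "entr (%t. adj_mat (A t) $$ (k,i))" if ki: "k < n" "i < n" for k i
 proof -
  have "adj_mat (A t) $$ (k,i) = (-1) ^ (i+k) * det (mat_delete (A t) i k)" for t using ki Ac[of t] by (simp add: adj_mat_def cofactor_def)
  moreover have "entr (%t. (-1) ^ (i+k) * det (mat_delete (A t) i k))"
  proof (rule entire_real_mult[OF entire_real_const entire_real_det])
   show "mat_delete (A t) i k:carrier_mat (n-1) (n-1)" for t by (rule mat_delete_carrier[OF Ac])
   show "entr (%t. mat_delete (A t) i k $$ (p,q))" if "p < n-1" "q < n-1" for p q
   proof -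
    have "mat_delete (A t) i k $$ (p,q) = A t $$ (if p < i then p else Suc p,if q < k then q else Suc q)" for t
     using that Ac[of t] by (simp add: mat_delete_def)
    thus ?thesis using that entA by auto
   qed
  qed
  ultimately show ?thesis by simp
 qed
 have bb: "bs ! k \<bullet> bs ! m = (if k = m then 1 else 0)" if "k < n" "m < n" for k m
  using that bs(1) nth_mem[of k bs] nth_mem[of m bs] nth_eq_iff_index_eq[OF bs(2), of k m] inner_Basis[of "bs ! k" "bs ! m"] unfolding n_def by simp
 have eqI: "x = y" if "!!m. m < n ==> x \<bullet> bs ! m = y \<bullet> bs ! m" for x y :: 'a
 proof (rule euclidean_eqI)
  fix b :: 'a assume "b:Basis"
  then obtain m where "m < n" "b = bs ! m" using bs(1) by (metis in_set_conv_nth n_def)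
  thus "x \<bullet> b = y \<bullet> b" using that by simp
 qed
 have Tx: "T t (\<Sum>k=0..<n. c k *R bs ! k) \<bullet> bs ! m = (\<Sum>k=0..<n. A t $$ (m,k) * c k)" if "m < n" for t c m
  using that by (simp add: linear_sum[OF lin] linear_scale[OF lin] inner_sum_left A_def mult.commute)
 have TC: "T t (C t x) = D t *R x" for t x
 proof -
  have "T t (C t x) \<bullet> bs ! m = (D t *R x) \<bullet> bs ! m" if m: "m < n" for m
  proof -
   have "T t (C t x) \<bullet> bs ! m = (\<Sum>i=0..<n. (\<Sum>k=0..<n. A t $$ (m,k) * adj_mat (A t) $$ (k,i)) * (x \<bullet> bs ! i))" unfolding C_def using Tx[OF m] by (simp add: sum_distrib_left sum_distrib_right mult.assoc) (rule sum.swap)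
   also have "... = (\<Sum>i=0..<n. (A t * adj_mat (A t)) $$ (m,i) * (x \<bullet> bs ! i))"
   proof (intro sum.cong refl arg_cong2[where f = "(*)"])
    fix i assume "i : {0..<n}"
    thus "(\<Sum>k=0..<n. A t $$ (m,k) * adj_mat (A t) $$ (k,i)) = (A t * adj_mat (A t)) $$ (m,i)"
     using m Ac[of t] adjc(1)[of t] by (simp add: scalar_prod_def)
   qed
   also have "... = (\<Sum>i=0..<n. if i = m then D t * (x \<bullet> bs ! m) else 0)" unfolding adjc(2) using m by (intro sum.cong) (auto simp: D_def)
   also have "... = (D t *R x) \<bullet> bs ! m" using m by simp
   finally show ?thesis .
  qed
  thus ?thesis by (rule eqI)
 qed
 have "entr D" unfolding D_def by (rule entire_real_det[OF Ac entA])
 moreover have "entr (%t. C t x \<bullet> b)" for x b unfolding C_def inner_sum_left inner_scaleR_left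
  by (intro entire_real_sum entire_real_mult entire_real_const entadj) auto
 moreover have "D t ~= 0" if inj: "inj (T t)" for t
 proof
  assume "D t = 0"
  then obtain v where v: "v:carrier_vec n" "v ~= 0\<^sub>v n" "A t *\<^sub>v v = 0\<^sub>v n"
   using det_0_iff_vec_prod_zero_field[OF Ac] by (auto simp: D_def)
  let ?x = "\<Sum>k=0..<n. (v $ k) *R bs ! k"
  have "T t ?x \<bullet> bs ! m = 0" if "m < n" for m
  proof -
   have "T t ?x \<bullet> bs ! m = (A t *\<^sub>v v) $ m" using that Ac[of t] v(1) by (simp add: Tx scalar_prod_def)
   thus ?thesis using that by (simp add: v(3))
  qed
  hence "T t ?x = 0" by (intro eqI) simp
  hence x0: "?x = 0" using inj linear_0[OF lin[of t]] by (metis injD)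
  have "v $ m = 0" if "m < n" for m
  proof -
   have "?x \<bullet> bs ! m = (\<Sum>k=0..<n. if k = m then v $ m else 0)" unfolding inner_sum_left using that by (intro sum.cong) (auto simp: bb)
   thus ?thesis using x0 that by simp
  qed
  thus False using v(1) v(2) by auto
 qed
 ultimately show thesis using that TC by blast
qed

context lie_grp
begin

lemma has_vector_derivative_Ad_expG_curve:
 assumes "(v hasV v') (at t)"
 shows "((%t. AD (expG (t *R X)) (v t)) hasV AD (expG (t *R X)) (bk X (v t)+v')) (at t)"
proof -
 define E where "E t Y = AD (expG (t *R X)) Y" for t Y
 have lin: "linear (E t)" for t unfolding E_def by (intro linear_Ad) simp
 have rep: "E t Y = (\<Sum>b\<in>Basis. (Y \<bullet> b) *R E t b)" for t Y
 proof -
  have "E t Y = E t (\<Sum>b\<in>Basis. (Y \<bullet> b) *R b)" by (simp add: euclidean_representation)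
  thus ?thesis using lin by (simp add: linear_sum linear_scale)
 qed
 have dE: "((%t. E t Y) hasV E t (bk X Y)) (at t)" for t Y using hasV_Ad_expG Ad_bracket Ad_expG_self by (simp add: E_def)
 have "((%t. \<Sum>b\<in>Basis. (v t \<bullet> b) *R E t b) hasV
  (\<Sum>b\<in>Basis. (v t \<bullet> b) *R E t (bk X b)+(v' \<bullet> b) *R E t b)) (at t)"
 proof (rule has_vector_derivative_sum)
  fix b :: 'l
  have "((%t. v t \<bullet> b) has_field_derivative v' \<bullet> b) (at t)" unfolding has_real_derivative_iff_has_vector_derivative
   by (rule bounded_linear.has_vector_derivative[OF bounded_linear_inner_left assms])
  from has_vector_derivative_scaleR[OF this dE]
  show "((%t. (v t \<bullet> b) *R E t b) hasV
    (v t \<bullet> b) *R E t (bk X b)+(v' \<bullet> b) *R E t b) (at t)" .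
 qed
 moreover have "(\<Sum>b\<in>Basis. (v t \<bullet> b) *R E t (bk X b)+(v' \<bullet> b) *R E t b) = E t (bk X (v t)+v')"
 proof -
  have "E t (bk X (v t)) = E t (bk X (\<Sum>b\<in>Basis. (v t \<bullet> b) *R b))" by (simp add: euclidean_representation)
  also have "... = (\<Sum>b\<in>Basis. (v t \<bullet> b) *R E t (bk X b))"
   by (simp add: br.sum_right br.scaleR_right linear_sum[OF lin] linear_scale[OF lin])
  finally show ?thesis by (simp only: sum.distrib rep[symmetric] linear_add[OF lin])
 qed
 ultimately show ?thesis using ext rep by (metis (no_types, lifting) E_def)
qed

end

section \<open>Dominant elements and orbits of the maximal compact subgroup\<close>

context flag_grp
begin

abbreviation pp :: "'l set" where "pp == sp (%ro. ro H1 >= 0)"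
abbreviation nm :: "'l set" where "nm == sp (%ro. ro H1 < 0)"

lemma form_sp:
 assumes "x:sp P" "y:sp Q" "!!ro. ro:dual_aa L ==> P ro ==> Q (%H.-ro H) ==> False"
 shows "fo x y = 0"
proof -
 have "B x (th y) = 0" by (rule sp_orthogonal[OF assms(1) th_sp[OF assms(2)] assms(3)])
 thus ?thesis by (simp add: B_def)
qed

lemma pp_nm: "pp \<inter> nm = {0}" "{x+y | x y. x:pp&y:nm} = UNIV"
proof -
 show "pp \<inter> nm = {0}" using sp_disjoint subspace_0[OF sub_sp] by auto
 have "x : {x+y | x y. x:pp&y:nm}" for x
 proof -
  have "x:sp (%ro. ro H1 >= 0 | ro H1 < 0)" using sp_total by (rule sp_mono) auto
  from sp_split[OF this] show ?thesis by blast
 qed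
 thus "{x+y | x y. x:pp&y:nm} = UNIV" by blast
qed

lemma aa_sp: "H:aL ==> P (%_. 0) ==> H:sp P" using aa_g0 unfolding g0_sp by (auto intro: sp_mono)

text \<open>
 For \<open>k = exp Z\<close> preserving the minimal parabolic subalgebra, follow \<open>exp (t Z)\<close> from \<open>0\<close> to \<open>1\<close>:
 the \<open>\<aa>\<close>-component of the solution \<open>y\<close> of \<open>Ad (exp t Z) (y\<^sub>p) + y\<^sub>- = b\<close> has derivative zero
 near \<open>t = 0\<close>, and by analyticity it takes the same value at \<open>t = 1\<close>.
\<close>

lemma KK_fixes_form:
 assumes k: "k:KL" "!!X. X:pp ==> AD k X:pp" and b: "b:aL" and H: "H:aL"
 shows "fo H (AD (inv k) b) = fo H b"
proof -
 obtain Z where Z: "Z:kk L" "k = expG Z" using k by (auto simp: KK_eq)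
 define P M where "P = pral pp nm" and "M = pral nm pp"
 have nm_pp: "nm \<inter> pp = {0}" "{x+y | x y. x:nm&y:pp} = UNIV" using pp_nm by (simp_all add: Int_commute set_eq_iff) (metis add.commute)
 note p1 = pral[OF sub_sp sub_sp pp_nm, folded P_def] and p2 = pral[OF sub_sp sub_sp nm_pp, folded M_def]
 have PM: "P x+M x = x" for x using p1(6) by (simp add: M_def)
 define A where "A t = AD (expG (t *R Z))" for t
 have linA: "linear (A t)" for t unfolding A_def by (intro linear_Ad) simp
 \<comment> \<open>\<open>T 0\<close> is the identity, and \<open>T 1\<close> is injective because
   \<open>AD k\<close> preserves \<open>pp\<close>, which meets \<open>nm\<close> in
   \<open>0\<close> only. In between \<open>T t\<close> may degenerate, so the solution
   \<open>y\<close> cannot simply be followed along the interval.\<close>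
 define T where "T t x = A t (P x)+M x" for t x
 have linT: "linear (T t)" for t unfolding T_def using linA p1(3) p2(3) by (intro linear_compose_add linear_compose[of P "A t", unfolded o_def])
 have entT: "entr (%t. T t x \<bullet> c)" for x c
 proof -
  have "entr (%t. \<Sum>n. (ad_pow Z n (P x) \<bullet> c)/fact n * t ^ n)" by (rule entire_real_powser) (rule summable_ad_pow_inner)
  thus ?thesis unfolding T_def inner_add_left A_def Ad_expG_inner by (intro entire_real_add entire_real_const)
 qed
 obtain D C where D: "entr D" and C: "!!x b. entr (%t. C t x \<bullet> b)" and TC: "!!t x. T t (C t x) = D t *R x"
  and inj: "!!t. inj (T t) ==> D t ~= 0" using entire_real_cramer[of T, OF linT entT] by auto
 have T0: "T 0 x = x" for x by (simp add: T_def A_def PM)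
 have D0: "D 0 ~= 0" using inj T0 by (simp add: inj_def)
 have D1: "D 1 ~= 0"
 proof (rule inj, rule linear_injective_0[OF linT, THEN iffD2], intro allI impI)
  fix x assume "T 1 x = 0"
  hence e: "AD k (P x) =-M x" by (simp add: T_def A_def Z(2) eq_neg_iff_add_eq_0)
  have "AD k (P x):nm" unfolding e by (rule subspace_neg[OF sub_sp p2(1)])
  hence "AD k (P x) = 0" using pp_nm(1) k(2)[OF p1(1)] by blast
  thus "x = 0" using e Ad_inj[OF KKc[OF k(1)], of "P x" 0] Adlin(5)[OF KKc[OF k(1)]] PM[of x] by simp
 qed
 have isD: "isCont D t" for t using entire_real_differentiable[OF D, of t] DERIV_isCont by auto
 obtain e where e: "e > 0" "!!t. \<bar>t\<bar> < e ==> D t ~= 0"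
 proof -
  show thesis using isD D0 tendsto_imp_eventually_ne[of D "D 0" "nhds 0" 0] tendsto_at_iff_tendsto_nhds[of D 0] that by (auto simp: eventually_nhds_metric isCont_def)
 qed
 define y where "y t = (1/D t) *R C t b" for t
 have Ty: "T t (y t) = b" if "\<bar>t\<bar> < e" for t using e(2)[OF that] TC by (simp add: y_def linear_scale[OF linT])
 have injT: "inj (T t)" if "\<bar>t\<bar> < e" for t
 proof -
  have "surj (T t)" unfolding surj_def using TC[of t] e(2)[OF that] linear_scale[OF linT, of t]
   by (metis divide_self_if scaleR_one scaleR_scaleR times_divide_eq_left mult_1)
  thus ?thesis using linear_surjective_imp_injective[OF linT] by simp
 qed
 have formP: "fo H x = fo H (P x)" for x
 proof -
  have "fo H (M x) = 0" by (rule form_sp[OF aa_sp[OF H, of "%ro. ro = (%_. 0)"] p2(1)]) auto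
  thus ?thesis using PM fm.add_right[of H "P x" "M x"] by simp
 qed
 have const: "((%t. fo H (y t)) has_real_derivative 0) (at t)" if t: "\<bar>t\<bar> < e" for t
 proof -
  have "EX w. (y hasV w) (at t)"
  proof -
   obtain D' where D': "(D has_real_derivative D') (at t)" using entire_real_differentiable[OF D] by auto
   have "EX c. ((%t. C t b \<bullet> i) has_real_derivative c) (at t)" for i using entire_real_differentiable[OF C] by simp
   then obtain c where c: "!!i. ((%t. C t b \<bullet> i) has_real_derivative c i) (at t)" by metis
   have "((%t. (C t b \<bullet> i) *R i) hasV c i *R i) (at t)" for i
    using has_vector_derivative_scaleR[OF c has_vector_derivative_const, of i i] by simp
   from has_vector_derivative_sum[of Basis "%i t. (C t b \<bullet> i) *R i", OF this]
   have C': "((%t. C t b) hasV (\<Sum>i\<in>Basis. c i *R i)) (at t)" by (simp add: euclidean_representation)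
   have "((%t. 1/D t) has_real_derivative ((0 * D t-1 * D')/(D t * D t))) (at t)" by (rule DERIV_divide[OF DERIV_const D' e(2)[OF t]])
   from has_vector_derivative_scaleR[OF this C'] show ?thesis unfolding y_def by blast
  qed
  then obtain w where w: "(y hasV w) (at t)" by blast
  have linP: "bounded_linear P" "bounded_linear M" using p1(3) p2(3) by (simp_all add: linear_conv_bounded_linear)
  have "((%t. A t (P (y t))+M (y t)) hasV A t (bk Z (P (y t))+P w)+M w) (at t)"
   unfolding A_def by (intro has_vector_derivative_add has_vector_derivative_Ad_expG_curve
    bounded_linear.has_vector_derivative[OF linP(1) w] bounded_linear.has_vector_derivative[OF linP(2) w])
  moreover have "((%t. A t (P (y t))+M (y t)) hasV 0) (at t)"
  proof (rule has_vector_derivative_transform_within_open[of "%_. b" 0 t "{-e<..<e}"])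
   fix s assume "s : {-e<..<e}"
   thus "b = A s (P (y s))+M (y s)" using Ty by (auto simp: T_def)
  qed (use t in auto)
  ultimately have z: "A t (bk Z (P (y t))+P w)+M w = 0" by (rule vector_derivative_unique_at)
  \<comment> \<open>Decomposing \<open>Z\<close> by \<open>T t\<close> and using
    \<open>A t Z = Z\<close> splits the transported bracket with \<open>Z\<close> into
    \<open>A t\<close> applied to an element of \<open>pp\<close> and a bracket with an element of
    \<open>nm\<close>. Injectivity of \<open>T t\<close> then forces the two parts to vanish
    separately.\<close>
  obtain x where x: "T t x = Z" using TC e(2)[OF t] linear_scale[OF linT, of t "1/D t" "C t Z"] by auto
  have br: "A t (bk u v) = bk (A t u) (A t v)" for u v unfolding A_def by (rule Ad_bracket) simp
  have "A t (bk Z (P (y t))) = A t (bk (P x) (P (y t)))+bk (M x) (A t (P (y t)))" using br x A_def Ad_expG_self by (metis T_def br.add_left)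
  also have "A t (P (y t)) = b-M (y t)" using Ty[OF t] by (simp add: T_def algebra_simps)
  finally have e1: "A t (bk (P x) (P (y t))+P w)+(bk (M x) (b-M (y t))+M w) = 0" using z by (simp add: linear_add[OF linA] algebra_simps)
  have m1: "bk (P x) (P (y t))+P w:pp" by (intro subspace_add[OF sub_sp] p1(1) sp_bracket[OF p1(1) p1(1)]) auto
  have m2: "bk (M x) (b-M (y t))+M w:nm"
  proof (intro subspace_add[OF sub_sp] p2(1) sp_bracket[OF p2(1)])
   show "b-M (y t):sp (%ro. ro H1 <= 0)"
   proof (rule subspace_diff[OF sub_sp])
    show "b:sp (%ro. ro H1 <= 0)" using b by (rule aa_sp) simp
    show "M (y t):sp (%ro. ro H1 <= 0)" using p2(1) by (rule sp_mono) simp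
   qed
  qed auto
  define q r where "q = bk (P x) (P (y t))+P w" and "r = bk (M x) (b-M (y t))+M w"
  have qr: "q:pp" "r:nm" "A t q+r = 0" using m1 m2 e1 by (auto simp: q_def r_def)
  have "T t (q+r) = T t 0" using p1(4)[OF qr(1)] p1(5)[OF qr(2)] p2(4)[OF qr(2)] p2(5)[OF qr(1)] qr(3) linear_0[OF linT] by (simp add: T_def linear_add[OF p1(3)] linear_add[OF p2(3)])
  hence Pw: "P w =-bk (P x) (P (y t))" using injT[OF t] injD qr pp_nm(1) subspace_neg[OF sub_sp qr(2)] IntI add_eq_0_iff2 singletonD q_def add.commute by (metis (no_types, lifting))
  have "fo H (bk (P x) (P (y t))) = fo (bk H (P x)) (P (y t))"
   using form_bracket[of "P x" H "P (y t)"] bk_anti[of "P x" H] by (simp add: fm.minus_left)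
  also have "... = 0"
  proof -
   have "P x:sp (%ro. ro = (%_. 0) | ro H1 > 0)" using p1(1) by (rule sp_mono_roots) (use roots_H1(1) in force)+
   from sp_split[OF this] obtain u v where uv: "u:g0" "v:sp (%ro. ro H1 > 0)" "P x = u+v" by (auto simp: g0_sp)
   have "bk H v:sp (%ro. ro H1 > 0)" by (rule sp_bracket[OF aa_sp[OF H, of "%ro. ro = (%_. 0)"] uv(2)]) auto
   moreover have "bk H (P x) = bk H v" using uv H by (simp add: br.add_right g0_def)
   ultimately have "bk H (P x):sp (%ro. ro H1 > 0)" by simp
   from form_sp[OF this p1(1)] show ?thesis by auto
  qed
  finally have "fo H (P w) = 0" by (simp add: Pw fm.minus_right)
  moreover have "((%t. fo H (y t)) has_real_derivative fo H w) (at t)" using bounded_linear.has_vector_derivative[OF fm.bounded_linear_right w]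
   by (simp add: has_real_derivative_iff_has_vector_derivative)
  ultimately show ?thesis using formP[of w] by simp
 qed
 have near: "fo H (y t) = fo H b" if t: "\<bar>t\<bar> < e" for t
 proof -
  have "EX c. ALL s:{-e<..<e}. fo H (y s) = c"
  proof (rule has_field_derivative_zero_constant)
   fix s assume "s : {-e<..<e}"
   thus "((%s. fo H (y s)) has_field_derivative 0) (at s within {-e<..<e})" using has_field_derivative_at_within[OF const] by auto
  qed (rule convex_real_interval)
  moreover have "t : {-e<..<e}" "0 : {-e<..<e}" using t e(1) by auto
  ultimately have "fo H (y t) = fo H (y 0)" by metis
  moreover have "y 0 = b" using Ty[of 0] T0 e by simp
  ultimately show ?thesis by simp
 qed
 \<comment> \<open>Multiplying the identity for \<open>y\<close> by \<open>D\<close> yields an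
   entire function, so possible zeros of \<open>D\<close> on the way to \<open>t = 1\<close> do no
   harm.\<close>
 define f where "f t = fo H (C t b)+(- fo H b) * D t" for t
 have "entr f"
 proof -
  have "fo H (C t b) = (\<Sum>i\<in>Basis. fo H i * (C t b \<bullet> i))" for t
  proof -
   have "fo H (C t b) = fo H (\<Sum>i\<in>Basis. (C t b \<bullet> i) *R i)" by (simp add: euclidean_representation)
   thus ?thesis by (simp add: fm.sum_right fm.scaleR_right mult.commute)
  qed
  thus ?thesis unfolding f_def by (simp only:) (intro entire_real_add entire_real_sum entire_real_mult entire_real_const C D)
 qed
 moreover have "f t = 0" if "\<bar>t\<bar> < e" for t using near[OF that] e(2)[OF that] by (simp add: f_def y_def fm.scaleR_right field_simps)
 ultimately have "f 1 = 0" using entire_real_identity e(1) by blast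
 hence f1: "fo H (C 1 b) = D 1 * fo H b" by (simp add: f_def)
 have kc: "k:CL" using KKc k by blast
 have T1: "AD k (P (C 1 b))+M (C 1 b) = D 1 *R b" using TC[of 1 b] by (simp add: T_def A_def Z(2))
 have "D 1 *R b-AD k (P (C 1 b)):pp"
  using aa_sp[OF b, of "%ro. ro H1 >= 0"] k(2)[OF p1(1)] by (intro subspace_diff[OF sub_sp] subspace_scale[OF sub_sp]) auto
 hence "M (C 1 b):pp" using T1 ssubst by (smt (verit) algebra_simps)
 hence "M (C 1 b) = 0" using p2(1) pp_nm(1) by blast
 hence "P (C 1 b) = D 1 *R AD (inv k) b" using T1 Ad_inv(1)[OF kc, of "P (C 1 b)"] Adlin(2) kc by simp
 thus ?thesis using f1 formP[of "C 1 b"] D1 by (simp add: fm.scaleR_right)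
qed

lemma aa_form_eq:
 assumes "x:aL" "y:aL" "!!H. H:aL ==> fo H x = fo H y"
 shows "x = y"
proof -
 have d: "x-y:aL" using assms subspace_diff[OF subsp(3)] by simp
 show ?thesis using assms(3) form_ss[of "x-y"] d aa_ss by (auto simp: fm.diff_right)
qed

text \<open>A maximizer \<open>W\<close> of the pairing lies in \<aa> with nonnegative positive
  roots. It is the conjugate of a regular element, so its centralizer in \<open>ss\<close> is an
  image of \<aa>; by maximality that image is \<aa> itself, and \<open>W\<close> is regular and lies
  in the chamber. Hence the conjugating element preserves \<open>pp\<close>, which identifies
  \<open>W\<close> with \<open>b\<close>.\<close>

lemma form_dominant_chamber:
 assumes b: "b:chamber L" and H0: "H0:chamber L" and k: "k:KL"
 shows "fo H0 (AD k b) <= fo H0 b"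
proof -
 have aa: "b:aL" "H0:aL" "b:ss L" using b H0 chamber_aa aa_ss by auto
 obtain q where q: "q:KH 0" "AD q b:aL" and mx: "!!k'. k':KH 0 ==> fo H0 (AD k' b) <= fo H0 (AD q b)"
  and dom: "!!ro. ro:rL ==> ro 0 = 0 ==> ro H0 * ro (AD q b) >= 0" by (rule conj_into_aa[of 0 b H0])
   (use aa subspace_0[OF subsp(3)] pos_roots_chamber(2)[OF H0] in "auto simp: br.zero_left")
 define W where "W = AD q b"
 have qK: "q:KL" "q:CL" using KHs(1,3)[OF q(1)] by auto
 have Wa: "W:aL" using q(2) by (simp add: W_def)
 have brW: "bk W (AD q X) = AD q (bk b X)" for X by (simp add: W_def Ad_bracket[OF qK(2)])
 have cent: "X:AD q ` aL" if X: "X:ss L" "bk W X = 0" for X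
 proof -
  let ?Y = "AD (inv q) X"
  show ?thesis using brW[of ?Y] X(2) qK(2) Ad_inj[OF qK(2)] Adlin(5)[OF qK(2)] g0_regular[OF aa(1)] pos_roots_chamber(2)[OF b] g0_ss Ad_KK(2)[OF KK_inv[OF qK(1)] X(1)] Ad_inv(2)[OF qK(2), of X] imageI by (metis (no_types, lifting))
 qed
 have "AD q ` aL = aL"
 proof (rule aa_maximal)
  show "abelian_in L (AD q ` aL) (ss L)" unfolding abelian_in_def
   using linear_subspace_image[OF linear_Ad[OF qK(2)] subsp(3)] Ad_KK(2)[OF qK(1)] aa_ss br_aa Adlin(5)[OF qK(2)]
   by (auto simp: Ad_bracket[OF qK(2), symmetric])
  show "aL <= AD q ` aL"
  proof
   fix H assume "H:aL"
   thus "H:AD q ` aL" using cent br_aa[OF Wa] aa_ss by auto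
  qed
 qed
 have reg: "ro W ~= 0" if a: "ro:rL" for ro
 proof
  assume 0: "ro W = 0"
  obtain E where E: "E:rsp ro" "E ~= 0" using rootsD(2)[OF a] by blast
  have e: "bk H (E-th E) = ro H *R (E+th E)" "bk H E = ro H *R E" if "H:aL" for H
   using E(1) th_root_space[OF E(1)] that by (auto simp: root_space_def br.diff_right scaleR_add_right)
  have "ro H1 *R (E+th E) = 0" "bk H1 (E-th E) = 0" using cent[OF ss_part[of E]] e(1)[OF Wa] 0 \<open>Ad L q ` aL = aL\<close> e(1)[OF H1(2)] br_aa[OF H1(2)] by auto
  hence "E-th E = 2 *R E" using roots_H1(1)[OF a] by (simp add: scaleR_2) (metis add.commute eq_neg_iff_add_eq_0)
  thus False using \<open>bracket L H1 (E - th E) = 0\<close> e(2)[OF H1(2)] roots_H1(1)[OF a] E(2) by (simp add: br.scaleR_right)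
 qed
 have Wpos: "ro W > 0" if "ro:pos_roots L" for ro
 proof -
  show ?thesis using that pos_roots_roots pos_roots_chamber(1)[OF H0] dom reg dual_aaD(4)[OF rootsD(1)] by (fastforce simp: W_def zero_le_mult_iff)
 qed
 hence Wc: "W:chamber L" using Wa simple_pos by (simp add: chamber_def)
 have "AD q X:pp" if "X:pp" for X
 proof -
  have "X:sp (%ro. ro b >= 0)" using that
  proof (rule sp_mono_roots)
   fix ro assume "ro:rL" "0 <= ro H1"
   thus "0 <= ro b" using roots_H1[of ro] pos_roots_chamber[OF b, of ro] by simp
  qed simp
  hence "AD q X:sp (%ro. ro W >= 0)"
  proof (induction rule: sp_induct)
   case (base ro X)
   have "AD q X:sp (%rb. rb W = ro b)" using base aa(1) eigen_sp[OF Wa] by (simp add: brW root_space_def Adlin[OF qK(2)])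
   thus ?case by (rule sp_mono) (use base in simp)
  qed (auto simp: Adlin[OF qK(2)] intro: subspace_add[OF sub_sp] subspace_0[OF sub_sp])
  thus ?thesis
  proof (rule sp_mono_roots)
   fix ro assume "ro:rL" "0 <= ro W"
   thus "0 <= ro H1" using roots_H1 pos_roots_chamber[OF Wc, of ro] by simp
  qed simp
 qed
 from KK_fixes_form[OF qK(1) this Wa] have "fo H b = fo H W" if "H:aL" for H using that Ad_inv(1)[OF qK(2), of b] by (simp add: W_def)
 thus ?thesis using aa_form_eq aa(1) Wa mx[of k] k by (fastforce simp: KHs(7) W_def)
qed

theorem form_dominant:
 assumes b: "b:cch" and H0: "H0:cch" and k: "k:KL"
 shows "fo H0 (AD k b) <= fo H0 b"
proof -
 obtain bs where bs: "!!n. bs n:chamber L" "bs ----> b" using b by (auto simp: closure_sequential)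
 obtain hs where hs: "!!n. hs n:chamber L" "hs ----> H0" using H0 by (auto simp: closure_sequential)
 have "(%n. fo (hs n) (AD k (bs n))) ----> fo H0 (AD k b)" by (intro fm.tendsto hs bounded_linear.tendsto[OF bounded_linear_Ad[OF KKc[OF k]]] bs)
 moreover have "(%n. fo (hs n) (bs n)) ----> fo H0 b" by (intro fm.tendsto hs bs)
 ultimately show ?thesis using form_dominant_chamber[OF bs(1) hs(1) k] by (intro LIMSEQ_le) auto
qed

text \<open>Every element of \<aa> is a difference of two dominant ones, \<open>H + c H1\<close> and
  \<open>c H1\<close>.\<close>

lemma aa_form_eq_chamber:
 assumes "x:aL" "y:aL" "!!H. H:cch ==> fo H x = fo H y"
 shows "x = y"
proof (rule aa_form_eq[OF assms(1,2)])
 fix H assume H: "H:aL"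
 define c where "c = (\<Sum>si\<in>simple L. \<bar>si H/si H1\<bar>)"
 have "H+c *R H1:cch" unfolding clch
 proof (intro conjI ballI)
  show "H+c *R H1:aL" using H H1(2) subsp(3) by (intro subspace_add subspace_scale)
  fix ro assume a: "ro:sL"
  hence ad: "ro:dual_aa L" and ap: "ro H1 > 0" using simple_roots rootsD(1) H1(1) by (auto simp: chamber_def)
  have "\<bar>ro H/ro H1\<bar> <= c" unfolding c_def using finite_simple a by (intro member_le_sum) auto
  hence "(- ro H)/ro H1 <= c" by linarith
  hence "- ro H <= c * ro H1" unfolding pos_divide_le_eq[OF ap] .
  thus "ro (H+c *R H1) >= 0" using H H1(2) subspace_scale[OF subsp(3)] by (simp add: dual_aaD[OF ad])
 qed
 moreover have "H1:cch" using H1(1) closure_subset by blast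
 ultimately show "fo H x = fo H y" using assms(3)[of "H+c *R H1"] assms(3) by (simp add: fm.add_left fm.scaleR_left)
qed

lemma dominant_unique:
 assumes "b:cch" "AD k b:cch" "k:KL"
 shows "AD k b = b"
proof (rule aa_form_eq_chamber)
 fix H assume H: "H:cch"
 have "fo H (AD (inv k) (AD k b)) <= fo H (AD k b)" by (rule form_dominant[OF assms(2) H KK_inv[OF assms(3)]])
 thus "fo H (AD k b) = fo H b" using form_dominant[OF assms(1) H assms(3)] KKc[OF assms(3)] by simp
qed (use assms clch in auto)

text \<open>\<open>AD k H\<close> lies both in \<open>pp\<close> and in \<open>ss\<close>. As
  \<open>th\<close> exchanges opposite weights, only weight zero remains, so it is in \<aa>, where
  its pairings with \<aa> identify it with \<open>H\<close>.\<close>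

lemma KK_parabolic_centralizes:
 assumes k: "k:KL" "!!X. X:pp ==> AD k X:pp" and H: "H:aL"
 shows "AD k H = H"
proof -
 have kc: "k:CL" using k KKc by blast
 have "AD k H:pp" using k(2) aa_sp[OF H] by simp
 moreover have "th (AD k H) =-AD k H" using Ad_KK(3)[OF k(1), of H] th_ss H aa_ss Adlin(4)[OF kc] by auto
 ultimately have m: "AD k H:pp" "AD k H:sp (%ro.-ro H1 >= 0)" using th_sp[OF \<open>Ad L k H : pp\<close>] subspace_neg[OF sub_sp, of "- AD k H"] by auto
 have "AD k H:g0"
 proof -
  have "AD k H:sp (%ro. ro H1 > 0 | ro = (%_. 0))" using m(1) by (rule sp_mono_roots) (use roots_H1(1) in force)+
  from sp_split[OF this] obtain u v where uv: "u:sp (%ro. ro H1 > 0)" "v:g0" "AD k H = u+v" by (auto simp: g0_sp)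
  have "v:sp (%ro.-ro H1 >= 0)" using uv(2) unfolding g0_sp by (rule sp_mono) auto
  thus ?thesis using subspace_diff[OF sub_sp m(2)] sp_disjoint[OF uv(1)] add_diff_cancel_right' uv by force
 qed
 hence aa: "AD k H:aL" using g0_ss Ad_KK(2)[OF k(1)] H aa_ss by auto
 have "fo H' H = fo H' (AD k H)" if "H':aL" for H' using KK_fixes_form[OF k aa that] kc by simp
 thus ?thesis using aa_form_eq[OF aa H] by auto
qed

section \<open>The Iwasawa decomposition\<close>

lemma th_Ad_expG_ss: "X:ss L ==> th (AD (expG X) Y) = AD (expG (- X)) (th Y)"
proof -
 assume X: "X:ss L"
 have "((%t. th (AD (expG (t *R X)) Y)) hasV bk (- X) (th (AD (expG (t *R X)) Y))) (at t)" for t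
  using bounded_linear.has_vector_derivative[OF linear_conv_bounded_linear[THEN iffD1, OF linear_th] hasV_Ad_expG[of X Y t]]
  by (simp add: th_bracket th_ss[OF X])
 from Ad_expG_flow[of "%t. th (AD (expG (t *R X)) Y)", OF this, of 1] show ?thesis by simp
qed

lemma B_Ad_expG_ss: "X:ss L ==> B (AD (expG X) Y) Z = B Y (AD (expG X) Z)"
 using form_Ad[of "expG X" Y "AD (inv (expG X)) (th Z)"] by (simp add: B_def th_Ad_expG_ss expG_minus)

lemma sp_centralized:
 assumes c: "c:CL" and H: "H:aL" "AD c H = H" and x: "x:sp (%ro. Q (ro H))"
 shows "AD c x:sp (%ro. Q (ro H))" using x
proof (induction rule: sp_induct)
 case (base ro x)
 have "bk H (AD c x) = ro H *R AD c x" using base(3) H Ad_bracket[OF c, of H x] Adlin(2)[OF c] by (simp add: root_space_def)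
 from eigen_sp[OF H(1) this] show ?case by (rule sp_mono) (use base(2) in simp)
qed (use Adlin[OF c] subspace_add[OF sub_sp] subspace_0[OF sub_sp] in auto)

lemma Ad_AA: "H:aL ==> H':aL ==> AD (expG H) H' = H'" using Ad_expG_eigen[of H H' 0 1] br_aa by simp

lemma Ad_root_space: "H:aL ==> x:rsp ro ==> AD (expG H) x = exp (ro H) *R x" using Ad_expG_eigen[of H x "ro H" 1] by (simp add: root_space_def)

lemma expG_aa_add: assumes "H:aL" "H':aL" shows "expG (H+H') = expG H**expG H'"
proof -
 have sc: "c *R H:aL" "c *R H':aL" for c using assms subspace_scale[OF subsp(3)] by auto
 have comm: "expG (s *R H)**expG (t *R H') = expG (t *R H')**expG (s *R H)" for s t
  using mult_expG[of "expG (s *R H)" "t *R H'"] Ad_AA[OF sc] by simp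
 have "one_parameter_subgroup L (H+H') (%t. expG (t *R H)**expG (t *R H'))"
 proof (rule one_parameterI)
  show "cmap euclideanreal G (%t. expG (t *R H)**expG (t *R H'))" by (intro cmap_mult cmap_expGc) (auto intro!: continuous_intros)
  show "tang (%t. expG (t *R H)**expG (t *R H')) (%t. t *R (H+H')) 0"
   using tang_mult[OF tang_expG_line tang_expG_line, of H H'] by (simp add: scaleR_add_right)
  fix s t
  have "expG ((s+t) *R H)**expG ((s+t) *R H') = expG (s *R H)**(expG (t *R H)**expG (s *R H'))**expG (t *R H')"
   by (simp add: expG_add[symmetric] m_assoc)
  also have "... = expG (s *R H)**expG (s *R H')**(expG (t *R H)**expG (t *R H'))" unfolding comm[of t s] by (simp add: m_assoc)
  finally show "expG ((s+t) *R H)**expG ((s+t) *R H') = expG (s *R H)**expG (s *R H')**(expG (t *R H)**expG (t *R H'))" .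
 qed
 from one_parameter_unique[OF this, of 1] show ?thesis by simp
qed

text \<open>Conjugation by the element with exponent \<open>- j H1\<close>, which contracts the
  positive root spaces as \<open>j\<close> grows.\<close>

definition cj :: "nat => 'g => 'g" where
 "cj j g = expG ((- real j) *R H1)**g**inv (expG ((- real j) *R H1))"

lemma H1_scale: "c *R H1:aL" using H1(2) subspace_scale[OF subsp(3)] by simp

lemma cj_expG: "cj j (expG Y) = expG (AD (expG ((- real j) *R H1)) Y)" unfolding cj_def by (rule conj_expG) simp

lemma cj_mult: "g:CL ==> h:CL ==> cj j (g**h) = cj j g**cj j h" by (simp add: cj_def m_assoc inv_solve_left)

text \<open>Against a weight vector with \<open>ro H1 <= 0\<close> the pairing does not decrease in
  absolute value under the symmetric operator, so a contracted vector is orthogonal to all of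
  those.\<close>

lemma Ad_contracts_iff:
 "(%j. AD (expG ((- real j) *R H1)) v) ----> 0 \<longleftrightarrow> v:nn L"
proof
 assume lim: "(%j. AD (expG ((- real j) *R H1)) v) ----> 0"
 have orth: "B v x = 0" if "x:sp (%ro. ro H1 <= 0)" for x using that
 proof (induction rule: sp_induct)
  case (base ro x)
  have "\<bar>B v x\<bar> <= \<bar>B (AD (expG ((- real j) *R H1)) v) x\<bar>" for j
  proof -
   have "exp (- real j * ro H1) >= 1" using base(2) by (simp add: mult_nonneg_nonpos)
   thus ?thesis using B_Ad_expG_ss H1_scale[of "- real j"] aa_ss Ad_root_space[OF H1_scale base(3), of "- real j"] dual_aaD(2)[OF base(1) H1(2), of "- real j"] by (auto simp: abs_mult mult_le_cancel_right1 Bf.scaleR_right)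
  qed
  thus ?case using tendsto_0_le[of "%j. B (AD (expG ((- real j) *R H1)) v) x" sequentially "%j. \<bar>B v x\<bar>" 1] Bf.tendsto[OF lim tendsto_const] by (simp add: LIMSEQ_const_iff Bf.zero_left)
 qed (simp_all add: Bf.zero_right Bf.add_right)
 have "v:sp (%ro. ro H1 > 0 | ro H1 <= 0)" using sp_total by (rule sp_mono) auto
 from sp_split[OF this] obtain p m where pm: "p:sp (%ro. ro H1 > 0)" "m:sp (%ro. ro H1 <= 0)" "v = p+m" by blast
 have "B p m = 0" by (rule sp_orthogonal[OF pm(1,2)]) auto
 thus "v:nn L" using orth[OF pm(2)] pm B_eq_0 nn_sp by (simp add: Bf.add_left)
next
 assume "v:nn L"
 thus "(%j. AD (expG ((- real j) *R H1)) v) ----> 0" unfolding nn_sp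
 proof (induction rule: sp_induct)
  case (base ro x)
  have "(%j. exp (- real j * ro H1) *R x) ----> 0 *R x"
  proof (rule tendsto_scaleR[OF _ tendsto_const])
   have "(%j. exp (- ro H1) ^ j) ----> 0" using base(2) by (intro LIMSEQ_power_zero) simp
   thus "(%j. exp (- real j * ro H1)) ----> 0" by (simp add: exp_of_nat_mult[symmetric])
  qed
  moreover have "AD (expG ((- real j) *R H1)) x = exp (- real j * ro H1) *R x" for j
   using Ad_root_space[OF H1_scale base(3), of "- real j"] dual_aaD(2)[OF base(1) H1(2), of "- real j"] by simp
  ultimately show ?case by simp
 next
  case (add x y)
  from tendsto_add[OF add.IH] show ?case by (simp add: Adlin)
 qed (simp add: Adlin)
qed

lemma NN_eq: "NN L = expG ` nn L" by (simp add: NN_def lie_exp_eq)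
lemma NNc: "n:NN L ==> n:CL" by (auto simp: NN_eq)

text \<open>\<open>N\<close> is the subgroup contracted by \<open>exp (- j H1)\<close>, hence a group.\<close>

lemma NN_contracting: "n:NN L \<longleftrightarrow> n:CL&limitin G (%j. cj j n) \<one> sequentially"
proof (intro iffI conjI; (elim conjE)?)
 assume n: "n:NN L"
 thus "n:CL" by (rule NNc)
 obtain Y where Y: "Y:nn L" "n = expG Y" using n by (auto simp: NN_eq)
 have "limitin euclidean (%j. AD (expG ((- real j) *R H1)) Y) 0 sequentially" using Y(1) Ad_contracts_iff by simp
 from continuous_map_limit[OF cmap_expG this] show "limitin G (%j. cj j n) \<one> sequentially" by (simp add: Y(2) cj_expG o_def)
next
 assume n: "n:CL" and lim: "limitin G (%j. cj j n) \<one> sequentially"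
 define f where "f = AD (expG (- H1))"
 have f: "bounded_linear f" unfolding f_def by (rule bounded_linear_Ad) simp
 obtain K where K: "K > 0" "!!x. norm (f x) <= norm x * K" using bounded_linear.pos_bounded[OF f] by auto
 \<comment> \<open>Within radius \<open>e\<close> both \<open>Y j\<close> and \<open>f (Y j)\<close>
   stay in the ball of radius \<open>rr/8\<close> on which \<open>expG\<close> is injective. So the
   relation between successive conjugates holds for the logarithms themselves.\<close>
 define e where "e = rr/(8 * (K+1))"
 have e: "e > 0" "e <= rr/8" "e * K <= rr/8"
 proof -
  show "e > 0" using rC(1) K(1) by (simp add: e_def)
  have "e * (8 * (K+1)) = rr" using K(1) unfolding e_def by simp
  hence "e * K+e = rr/8" by (simp add: algebra_simps)
  thus "e <= rr/8" "e * K <= rr/8" using \<open>e > 0\<close> K(1) mult_pos_pos[of e K] by linarith+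
 qed
 have ev: "\<forall>\<^sub>F j in sequentially. cj j n:expG ` ball 0 e'" if "e' > 0" for e'
 proof -
  obtain W where W: "openin G W" "\<one>:W" "W <= expG ` ball 0 e'" by (rule tang_nhd[OF cmap_expG tang_expG \<open>e' > 0\<close>])
  hence "\<forall>\<^sub>F j in sequentially. cj j n:W" using lim by (simp add: limitin_def)
  thus ?thesis by (rule eventually_mono) (use W(3) in blast)
 qed
 obtain j0 where j0: "!!j. j >= j0 ==> cj j n:expG ` ball 0 e" using ev[OF e(1)] by (auto simp: eventually_sequentially)
 have "EX y. j >= j0 --> norm y < e&cj j n = expG y" for j using j0 by force
 then obtain Y where "!!j. j >= j0 --> norm (Y j) < e&cj j n = expG (Y j)" by metis
 hence Y: "norm (Y j) < e&cj j n = expG (Y j)" if "j >= j0" for j using that by blast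
 have step: "Y (Suc j) = f (Y j)" if j: "j >= j0" for j
 proof (rule expG_inj)
  show "norm (f (Y j)) <= rr/8" using K(2)[of "Y j"] mult_right_mono[of "norm (Y j)" e K] Y[OF j] K(1) e(3) by linarith
  show "norm (Y (Suc j)) <= rr/8" using Y[of "Suc j"] j e(2) by simp
  have s: "expG ((- real (Suc j)) *R H1) = expG (- H1)**expG ((- real j) *R H1)" using expG_add[of "-1" H1 "- real j"] by simp
  have "cj (Suc j) n = expG (- H1)**cj j n**inv (expG (- H1))" unfolding cj_def s using n by (simp add: m_assoc inv_mult_group)
  thus "expG (Y (Suc j)) = expG (f (Y j))" using Y j by (simp add: conj_expG f_def)
 qed
 have it: "Y (j0+i) = AD (expG ((- real i) *R H1)) (Y j0)" for i
 proof (induction i)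
  case (Suc i)
  have s: "expG ((- real (Suc i)) *R H1) = expG (- H1)**expG ((- real i) *R H1)" using expG_add[of "-1" H1 "- real i"] by simp
  show ?case using step Suc unfolding s by (simp add: Adm f_def)
 qed simp
 have "Y ----> 0" unfolding LIMSEQ_def dist_0_norm
 proof (intro allI impI)
  fix r :: real assume r: "r > 0"
  obtain N where N: "!!j. j >= N ==> cj j n:expG ` ball 0 (min r e)" using ev[of "min r e"] r e(1) by (auto simp: eventually_sequentially)
  show "EX N. ALL j>=N. dist (Y j) 0 < r"
  proof (intro exI allI impI)
   fix j assume j: "j >= max N j0"
   obtain y where y: "norm y < min r e" "cj j n = expG y" using N[of j] j by auto
   have "y = Y j" by (rule expG_inj) (use y Y[of j] j e(2) in auto)
   thus "dist (Y j) 0 < r" using y by simp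
  qed
 qed
 hence "(%i. Y (i+j0)) ----> 0" by (rule LIMSEQ_ignore_initial_segment)
 hence "Y j0:nn L" using it Ad_contracts_iff by (simp add: add.commute)
 define a where "a = expG ((- real j0) *R H1)"
 have a: "a:CL" "AD (inv a) H1 = H1" using Ad_AA[OF H1_scale H1(2), of "- real j0"] Ad_inv(1)[of a H1] by (simp_all add: a_def)
 have "a**n**inv a = expG (Y j0)" using Y by (simp add: cj_def a_def)
 hence "n = inv a**expG (Y j0)**inv (inv a)" using a(1) n by (metis inv_solve_left inv_solve_right m_assoc m_closed inv_closed)
 also have "... = expG (AD (inv a) (Y j0))" using a(1) by (intro conj_expG) simp
 finally show "n:NN L" using sp_centralized[OF _ H1(2) a(2), of "Y j0" "%c. c > 0"] \<open>Y j0 : nn L\<close> a(1) by (auto simp: NN_eq nn_sp)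
qed

lemma NN_mult: assumes "n:NN L" "n':NN L" shows "n**n':NN L"
proof -
 have "limitin (prod_topology G G) (%j. (cj j n,cj j n')) (\<one>,\<one>) sequentially"
  using assms by (simp add: limitin_pairwise NN_contracting o_def)
 moreover have "cmap (prod_topology G G) G (%p. fst p**snd p)" by (intro cmap_mult continuous_map_fst continuous_map_snd)
 ultimately show ?thesis using assms continuous_map_limit by (fastforce simp: NN_contracting cj_mult o_def)
qed

lemma NN_inv: "n:NN L ==> inv n:NN L" using subspace_neg[OF sub_sp] by (auto simp: NN_eq nn_sp expG_minus[symmetric])

lemma NN_one: "\<one>:NN L" using subspace_0[OF sub_sp] by (force simp: NN_eq nn_sp)

lemma NN_conj: "c:CL ==> AD c H1 = H1 ==> n:NN L ==> c**n**inv c:NN L" using sp_centralized H1(2) by (auto simp: NN_eq nn_sp conj_expG)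

lemma NN_conj': "c:CL ==> AD c H1 = H1 ==> n:NN L ==> EX n':NN L. n**c = c**n'"
proof -
 assume c: "c:CL" "AD c H1 = H1" "n:NN L"
 have "AD (inv c) H1 = H1" using Ad_inv(1)[OF c(1), of H1] c(2) by simp
 from NN_conj[OF _ this c(3)] have "inv c**n**c:NN L" using c(1) by simp
 moreover have "n**c = c**(inv c**n**c)" using c(1) NNc[OF c(3)] by (simp add: m_assoc[symmetric])
 ultimately show ?thesis by blast
qed

text \<open>Fixing \<open>H1\<close>, the element is left in place by the contracting conjugations;
  being contracted to the identity, it is the identity by the Hausdorff property.\<close>

lemma NN_trivial: assumes "n:NN L" "AD n H1 = H1" shows "n = \<one>"
proof -
 have n: "n:CL" using assms NNc by auto
 have "cj j n = n" for j using mult_expG assms(2) Adlin(2) n expGc inv_closed m_assoc r_inv r_one by (metis cj_def)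
 hence "limitin G (%j::nat. n) \<one> sequentially" using assms(1) by (simp add: NN_contracting)
 moreover have "limitin G (%j::nat. n) n sequentially" using n by (simp add: limitin_const)
 ultimately show ?thesis by (metis limitin_Hausdorff_unique Hausdorff_G sequentially_bot)
qed

lemma Ad_NN_diff:
 assumes "n:NN L" "H:aL"
 shows "AD n H-H:nn L"
proof -
 obtain Y where Y: "Y:sp (%ro. ro H1 > 0)" "n = expG Y" using assms by (auto simp: NN_eq nn_sp)
 have "AD (expG (1 *R Y)) H-H:sp (%ro. ro H1 > 0)"
 proof (rule Ad_expG_subspace[OF sub_sp])
  show "bk Y H:sp (%ro. ro H1 > 0)" by (rule sp_bracket[OF Y(1) aa_sp[OF assms(2), of "%ro. ro = (%_. 0)"]]) auto
  fix Z assume Z: "Z:sp (%ro. ro H1 > 0)"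
  show "bk Y Z:sp (%ro. ro H1 > 0)" by (rule sp_bracket[OF Y(1) Z]) auto
 qed
 thus ?thesis by (simp add: Y(2) nn_sp)
qed

lemma Ad_NN_pp: "n:NN L ==> X:pp ==> AD n X:pp" by (auto simp: NN_eq nn_sp Ad_expG_in_subspace[OF sub_sp] sp_bracket)

lemma Ad_AA_pp: "H:aL ==> X:pp ==> AD (expG H) X:pp" using sp_centralized Ad_AA H1(2) by simp

abbreviation "M0 == centralizer_aa L"

lemma KK_pp_M0: "k:KL ==> (!!X. X:pp ==> AD k X:pp) ==> k:M0" using KK_parabolic_centralizes by (simp add: centralizer_aa_def)

lemma polar_inj:
 assumes "k:KL" "k':KL" "X:ss L" "X':ss L" "k**expG X = k'**expG X'"
 shows "k = k'" "X = X'"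
proof -
 have "inj_on (%(k,X). k**expG X) (KL \<times> ss L)" using homeomorphic_imp_injective_map[OF polar] KKc by (simp add: Int_absorb1 subset_iff)
 from inj_onD[OF this, of "(k,X)" "(k',X')"] show "k = k'" "X = X'" using assms by auto
qed

lemma polar_ex: assumes "g:CL" shows "EX k:KK L. EX X:ss L. g = k**expG X"
proof -
 show ?thesis using homeomorphic_imp_surjective_map[OF polar] assms by force
qed

text \<open>An element of \<open>K\<close> lying in \<open>A N\<close> preserves \<open>pp\<close>,
  so it fixes \<aa>. Then \<open>n\<close> fixes \<open>H1\<close> and is trivial, and the polar
  decomposition separates \<open>k\<close> from \<open>expG a\<close>.\<close>

lemma KAN_trivial:
 assumes "k:KL" "a:aL" "n:NN L" "k = expG a**n"
 shows "k = \<one>" "a = 0" "n = \<one>"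
proof -
 have n: "n:CL" by (rule NNc[OF assms(3)])
 have "k:M0" by (rule KK_pp_M0[OF assms(1)]) (simp add: assms(4) Adm n Ad_AA_pp[OF assms(2)] Ad_NN_pp[OF assms(3)])
 hence "AD (expG a) (AD n H1) = AD (expG a) H1" using H1(2) Adm[OF expGc n, of a H1] assms Ad_AA by (simp add: centralizer_aa_def)
 thus n1: "n = \<one>" using NN_trivial assms(3) Ad_inj[OF expGc] by blast
 hence "k**expG 0 = \<one>**expG a" using assms KKc by simp
 from polar_inj[OF assms(1) KK_one _ _ this] show "k = \<one>" "a = 0" using assms(2) aa_ss subspace_0[OF subsp(2)] by auto
qed

lemma iwasawa_inj:
 assumes k: "k:KL" "k':KL" and a: "a:aL" "a':aL" and n: "n:NN L" "n':NN L" and e: "k**expG a**n = k'**expG a'**n'"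
 shows "k = k'" "a = a'"
proof -
 have c: "k:CL" "k':CL" "n:CL" "n':CL" using k n KKc NNc by auto
 have am: "- a:aL" "a'-a:aL" using a subspace_neg subspace_diff subsp(3) by auto
 obtain n2 where n2: "n2:NN L" "(n'**inv n)**expG (- a) = expG (- a)**n2"
  using NN_conj'[OF expGc Ad_AA[OF am(1) H1(2)] NN_mult[OF n(2) NN_inv[OF n(1)]]] by auto
 have "inv k'**k**expG a**n = inv k'**(k**expG a**n)" using c by (simp add: m_assoc)
 also have "... = expG a'**n'" unfolding e using c by (simp add: m_assoc[symmetric])
 finally have "inv k'**k = expG a'**n'**inv n**inv (expG a)" using c by (metis expGc inv_solve_right inv_closed m_closed)
 also have "... = expG a'**((n'**inv n)**expG (- a))" using c by (simp add: m_assoc expG_minus)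
 also have "... = expG (a'-a)**n2" using expG_aa_add[OF a(2) am(1)] NNc[OF n2(1)] by (simp add: n2(2) m_assoc)
 finally have "inv k'**k = expG (a'-a)**n2" .
 from KAN_trivial[OF KK_mult[OF KK_inv[OF k(2)] k(1)] am(2) n2(1) this]
 show "k = k'" "a = a'" using c by (auto simp: inv_solve_left')
qed

section \<open>Existence of the Iwasawa decomposition\<close>

lemma tang_small:
 assumes f: "tang f (%X. X) (0::'l)" and e: "e > 0"
 obtains de where "de > 0" "!!v. norm v < de ==> f v:U1&norm (l (f v)-v) <= e * norm v"
proof -
 have f0: "f 0 = \<one>" and fU: "\<forall>\<^sub>F v in nhds 0. f v:U1" and d: "((%v. l (f v)) hasD (%X. X)) (at 0)"
  using f by (auto simp: tang_def)
 obtain d1 where d1: "d1 > 0" "!!v. norm v < d1 ==> f v:U1" using fU by (auto simp: eventually_nhds_metric)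
 obtain d2 where d2: "d2 > 0" "!!v. norm v < d2 ==> norm (l (f v)-v) <= e * norm v" using d[unfolded has_derivative_at_alt] e f0 by auto
 show thesis by (rule that[of "min d1 d2"]) (use d1 d2 in auto)
qed

definition zp :: "'l => 'l" where "zp = pral (sp (%ro. ro H1 > 0)) (sp (%ro. ~ ro H1 > 0))"
definition zm :: "'l => 'l" where "zm = pral (sp (%ro. ro H1 < 0)) (sp (%ro. ~ ro H1 < 0))"

lemma proj_along_sp:
 fixes P :: "('l => real) => bool"
 defines "p == pral (sp P) (sp (%ro. ~ P ro))"
 shows "p x:sp P" "x-p x:sp (%ro. ~ P ro)" "linear p" "x:sp P ==> p x = x" "x:sp (%ro. ~ P ro) ==> p x = 0"
proof -
 have 1: "sp P \<inter> sp (%ro. ~ P ro) = {0}" using sp_disjoint subspace_0[OF sub_sp] by auto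
 have "x : {x+y | x y. x:sp P&y:sp (%ro. ~ P ro)}" for x
 proof -
  have "x:sp (%ro. P ro | ~ P ro)" using sp_total by simp
  from sp_split[OF this] show ?thesis by blast
 qed
 hence 2: "{x+y | x y. x:sp P&y:sp (%ro. ~ P ro)} = UNIV" by blast
 note p = pral[OF sub_sp sub_sp 1 2, folded p_def]
 show "p x:sp P" "x-p x:sp (%ro. ~ P ro)" "linear p" "x:sp P ==> p x = x" "x:sp (%ro. ~ P ro) ==> p x = 0" by (fact p)+
qed

lemmas zp = proj_along_sp[where P = "%ro. ro H1 > 0", folded zp_def]
lemmas zm = proj_along_sp[where P = "%ro. ro H1 < 0", folded zm_def]

definition z0 :: "'l => 'l" where "z0 x = x-zp x-zm x"

lemma z0: "z0 x:g0"
proof -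
 have 1: "z0 x:sp (%ro. ~ ro H1 > 0)" unfolding z0_def by (rule subspace_diff[OF sub_sp zp(2)], rule sp_mono[OF zm(1)]) auto
 have "x-zm x-zp x:sp (%ro. ~ ro H1 < 0)" by (rule subspace_diff[OF sub_sp zm(2)], rule sp_mono[OF zp(1)]) auto
 hence 2: "z0 x:sp (%ro. ~ ro H1 < 0)" by (simp add: z0_def algebra_simps)
 have "z0 x:sp (%ro. ro H1 < 0 | ro = (%_. 0))" using 1 by (rule sp_mono_roots) (use roots_H1(1) in force)+
 from sp_split[OF this] obtain y z where yz: "y:sp (%ro. ro H1 < 0)" "z:g0" "z0 x = y+z" by (auto simp: g0_sp)
 have "z:sp (%ro. ~ ro H1 < 0)" using yz(2) unfolding g0_sp by (rule sp_mono) auto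
 thus ?thesis using subspace_diff[OF sub_sp 2] sp_disjoint yz by fastforce
qed

text \<open>The local product of \<open>K\<close>, \<open>A\<close> and \<open>N\<close>. The
  negative part is rewritten as \<open>zm x = (zm x + th (zm x)) - th (zm x)\<close>, with one piece
  in \<open>kk\<close> and the other in \<open>nn\<close>. The three exponents add up to
  \<open>x\<close>, so the derivative at \<open>0\<close> is the identity and the values fill a
  neighbourhood of the identity.\<close>

definition psi :: "'l => 'g" where
 "psi x = expG (zm x+th (zm x)+pk (z0 x))**expG (ps (z0 x))**expG (zp x-th (zm x))"

lemma psi_parts: "zm x+th (zm x)+pk (z0 x):kk L" "ps (z0 x):aL" "zp x-th (zm x):nn L"
proof -
 show "zm x+th (zm x)+pk (z0 x):kk L" using kk_part pk_ps(1) subspace_add[OF subsp(1)] by simp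
 show "ps (z0 x):aL" using g0_parts(1)[OF z0] .
 show "zp x-th (zm x):nn L" using th_sp[OF zm(1), of x] subspace_diff[OF sub_sp zp(1)] by (simp add: nn_sp)
qed

lemma psi: "cmap euclidean G psi" "tang psi (%X. X) 0"
proof -
 have lin: "linear (%x. zm x+th (zm x)+pk (z0 x))" "linear (%x. ps (z0 x))" "linear (%x. zp x-th (zm x))"
 proof -
  have z: "linear z0" unfolding z0_def by (intro linear_compose_sub zp(3) zm(3) linear_id[unfolded id_def])
  have t: "linear (%x. th (zm x))" "linear (%x. pk (z0 x))" "linear (%x. ps (z0 x))"
   using linear_compose[OF zm(3) linear_th] linear_compose[OF z linear_pk] linear_compose[OF z linear_ps] by (simp_all add: o_def)
  show "linear (%x. zm x+th (zm x)+pk (z0 x))" "linear (%x. ps (z0 x))" "linear (%x. zp x-th (zm x))"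
   by (intro linear_compose_add linear_compose_sub zm(3) zp(3) t)+
 qed
 note bl = lin[THEN linear_conv_bounded_linear[THEN iffD1]]
 show "cmap euclidean G psi" unfolding psi_def by (intro cmap_mult cmap_expGc) (use bl in "auto intro: linear_continuous_on")
 have t: "tang (%y. expG (h y)) h 0" if "bounded_linear h" for h :: "'l => 'l" by (rule tang_compose[OF _ bounded_linear_imp_has_derivative[OF that]])
   (use tang_expG linear_0[OF bounded_linear.linear[OF that]] in simp)
 have "tang psi (%y. zm y+th (zm y)+pk (z0 y)+ps (z0 y)+(zp y-th (zm y))) 0" unfolding psi_def by (intro tang_mult t bl)
 moreover have "zm y+th (zm y)+pk (z0 y)+ps (z0 y)+(zp y-th (zm y)) = y" for y by (simp add: algebra_simps pk_ps(3) z0_def)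
 ultimately show "tang psi (%X. X) 0" by simp
qed

lemma norm_Ad_KK_bound: obtains C where "C > 0" "!!k. k:KL ==> norm (AD k X) <= C"
proof -
 obtain k0 where "ALL k:KK L. norm (AD k X) <= norm (AD k0 X)" using continuous_attains_sup_group[OF compact_KK] continuous_map_norm continuous_map_Ad_const by blast
 thus thesis by (intro that[of "norm (AD k0 X)+1"]) (auto simp: add_nonneg_pos)
qed

lemma expG_near_one:
 assumes W: "openin G W" "\<one>:W"
 shows "EX e>0. ALL x. norm x < e --> expG x:W"
proof -
 have "open {x. expG x:W}" using openin_continuous_map_preimage[OF cmap_expG W(1)] by simp
 moreover have "0 : {x. expG x:W}" using W(2) by simp
 ultimately obtain e where "e > 0" "ball 0 e <= {x. expG x:W}" by (meson open_contains_ball)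
 thus ?thesis by fastforce
qed

lemma expG_small_KK:
 assumes W: "openin G W" "\<one>:W"
 obtains N0 :: nat where "N0 > 0" "!!N k. N >= N0 ==> k:KL ==> expG (AD k ((1/real N) *R X)):W"
proof -
 obtain e where e: "e > 0" "!!x. norm x < e ==> expG x:W" using expG_near_one[OF W] by blast
 obtain C where C: "C > 0" "!!k. k:KL ==> norm (AD k X) <= C" using norm_Ad_KK_bound[of X] by blast
 obtain N0 :: nat where N0: "C/e < real N0" using reals_Archimedean2 by blast
 have pos: "real N0 > 0" using N0 C(1) e(1) by (meson divide_pos_pos less_trans)
 show thesis
 proof (rule that)
  show "N0 > 0" using pos by simp
  fix N k assume N: "N >= N0" and k: "k:KL"
  have "C < e * real N0" using N0 e(1) by (simp add: pos_divide_less_eq mult.commute)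
  also have "... <= e * real N" using N e(1) by simp
  finally have "C/real N < e" using N pos by (simp add: pos_divide_less_eq)
  moreover have "norm (AD k ((1/real N) *R X)) <= C/real N" using C(2)[OF k] KKc[OF k] by (simp add: Adlin divide_right_mono)
  ultimately show "expG (AD k ((1/real N) *R X)):W" using e(2) by simp
 qed
qed

text \<open>The polar part is a power of an element near the identity, and its factors are absorbed
  one by one. Moving the next factor past the current \<open>K\<close>-part conjugates its exponent;
  compactness of \<open>K\<close> keeps the conjugates inside the neighbourhood covered by
  \<open>psi\<close>.\<close>

lemma iwasawa_ex:
 assumes "g:CL"
 shows "EX k:KK L. EX a:aa L. EX n:NN L. g = k**expG a**n"
proof -
 have one: "(1::real) > 0" by simp
 obtain W where W: "openin G W" "\<one>:W" "W <= psi ` ball 0 1" by (rule tang_nhd[OF psi one])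
 obtain k0 X where kX: "k0:KL" "X:ss L" "g = k0**expG X" using polar_ex[OF assms] by blast
 obtain N where N: "N > 0" "!!N' k. N' >= N ==> k:KL ==> expG (AD k ((1/real N') *R X)):W" using expG_small_KK[OF W(1,2), of X] by auto
 let ?Y = "(1/real N) *R X"
 have "EX k:KK L. EX a:aa L. EX n:NN L. expG ?Y [^] j = k**expG a**n" for j :: nat
 proof (induction j)
  case 0
  show ?case by (rule bexI[OF _ KK_one], rule bexI[OF _ subspace_0[OF subsp(3)]], rule bexI[OF _ NN_one]) simp
 next
  case (Suc j)
  then obtain k a n where kan: "k:KL" "a:aL" "n:NN L" "expG ?Y [^] j = k**expG a**n" by blast
  note c = KKc[OF kan(1)] NNc[OF kan(3)]
  obtain v where "expG (AD (inv k) ?Y) = psi v" using N(2)[OF order_refl KK_inv[OF kan(1)]] W(3) by auto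
  then obtain k' a' n' where p: "k':KL" "a':aL" "n':NN L" "expG (AD (inv k) ?Y) = k'**expG a'**n'"
   using psi_parts[of v] by (auto simp: psi_def KK_eq NN_eq)
  note c' = KKc[OF p(1)] NNc[OF p(3)]
  obtain n2 where n2: "n2:NN L" "n'**expG a = expG a**n2" using NN_conj'[OF expGc Ad_AA[OF kan(2) H1(2)] p(3)] by auto
  have "expG ?Y [^] Suc j = expG ?Y**k**expG a**n" using kan(4) c by (subst nat_pow_Suc2) (simp_all add: m_assoc)
  also have "expG ?Y**k = k**expG (AD (inv k) ?Y)" using mult_expG c(1) by simp
  also have "k**expG (AD (inv k) ?Y)**expG a**n = k**k'**expG a'**(n'**expG a)**n" unfolding p(4) using c c' by (simp add: m_assoc)
  also have "... = k**k'**expG (a'+a)**(n2**n)" using c c' NNc[OF n2(1)] by (simp add: n2(2) expG_aa_add[OF p(2) kan(2)] m_assoc)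
  finally show ?case using KK_mult[OF kan(1) p(1)] subspace_add[OF subsp(3) p(2) kan(2)] NN_mult[OF n2(1) kan(3)] by auto
 qed
 from this[of N] obtain k a n where kan: "k:KL" "a:aL" "n:NN L" "expG ?Y [^] N = k**expG a**n" by blast
 have "g = (k0**k)**expG a**n" using expG_pow[of N ?Y] N(1) kan kX KKc NNc by (simp add: m_assoc)
 thus ?thesis using KK_mult[OF kX(1) kan(1)] kan by auto
qed

definition kG :: "'g => 'g" where "kG g = (SOME k. k:KL&(EX a:aa L. EX n:NN L. g = k**expG a**n))"
definition aG :: "'g => 'l" where "aG g = (SOME a. a:aL&(EX k:KK L. EX n:NN L. g = k**expG a**n))"

lemma iwasawa_unique:
 assumes "k:KL" "a:aL" "n:NN L"
 shows "kG (k**expG a**n) = k" "aG (k**expG a**n) = a"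
proof -
 show "kG (k**expG a**n) = k" unfolding kG_def by (rule) (use assms iwasawa_inj in blast)+
 show "aG (k**expG a**n) = a" unfolding aG_def by (rule) (use assms iwasawa_inj in blast)+
qed

lemma iwasawa:
 assumes "g:CL"
 obtains n where "kG g:KL" "aG g:aL" "n:NN L" "g = kG g**expG (aG g)**n"
proof -
 obtain k a n where "k:KL" "a:aL" "n:NN L" "g = k**expG a**n" using iwasawa_ex[OF assms] by blast
 thus thesis using iwasawa_unique that by simp
qed

lemma kG_KK: "g:CL ==> kG g:KL" and aG_aa: "g:CL ==> aG g:aL" by (rule iwasawa; assumption)+

text \<open>The cocycle rule for the Iwasawa projection: \<open>A\<close> normalizes
  \<open>N\<close>, so the \<open>A\<close>-part of \<open>h\<close> can be moved past the
  \<open>N\<close>-part and the logarithms add.\<close>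

lemma iwasawa_mult:
 assumes "g:CL" "h:CL"
 shows "kG (g**h) = kG (g**kG h)" "aG (g**h) = aG (g**kG h)+aG h"
proof -
 obtain n where h: "kG h:KL" "aG h:aL" "n:NN L" "h = kG h**expG (aG h)**n" by (rule iwasawa[OF assms(2)])
 note c = KKc[OF h(1)] NNc[OF h(3)]
 define g' where "g' = g**kG h"
 have g': "g':CL" using assms c by (simp add: g'_def)
 obtain n' where n': "kG g':KL" "aG g':aL" "n':NN L" "g' = kG g'**expG (aG g')**n'" by (rule iwasawa[OF g'])
 note c' = KKc[OF n'(1)] NNc[OF n'(3)]
 obtain n2 where n2: "n2:NN L" "n'**expG (aG h) = expG (aG h)**n2" using NN_conj'[OF expGc Ad_AA[OF h(2) H1(2)] n'(3)] by auto
 have "g**h = kG g'**expG (aG g')**n'**expG (aG h)**n" using assms c arg_cong[OF h(4)] n'(4) by (simp add: g'_def m_assoc)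
 also have "... = kG g'**expG (aG g'+aG h)**(n2**n)" using c c' NNc[OF n2(1)] by (simp add: n2(2) expG_aa_add[OF n'(2) h(2)] m_assoc)
 finally have e: "g**h = kG g'**expG (aG g'+aG h)**(n2**n)" .
 from iwasawa_unique[OF n'(1) subspace_add[OF subsp(3) n'(2) h(2)] NN_mult[OF n2(1) h(3)], folded e]
 show "kG (g**h) = kG (g**kG h)" "aG (g**h) = aG (g**kG h)+aG h" by (simp_all add: g'_def)
qed

lemma iwasawa_KK:
 assumes "k:KL" shows "kG k = k" "aG k = 0"
proof -
 show "kG k = k" "aG k = 0" using KKc[OF assms] iwasawa_unique[OF assms subspace_0[OF subsp(3)] NN_one] by auto
qed

lemma iwasawa_KK_left:
 assumes "k:KL" "g:CL" shows "kG (k**g) = k**kG g" "aG (k**g) = aG g"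
 using iwasawa_mult[OF KKc[OF assms(1)] assms(2)] iwasawa_KK[OF KK_mult[OF assms(1) kG_KK[OF assms(2)]]] by auto

lemma aG_expG_aa: "H:aL ==> aG (expG H) = H" "H:aL ==> kG (expG H) = \<one>" using iwasawa_unique[OF KK_one _ NN_one, of H] by auto

lemma aG_NN: "n:NN L ==> aG n = 0" "n:NN L ==> kG n = \<one>" using iwasawa_unique[OF KK_one subspace_0[OF subsp(3)], of n] NNc by auto

lemma aG_mult_expG: "g:CL ==> H:aL ==> aG (g**expG H) = aG g+H" using iwasawa_mult aG_expG_aa by simp

lemma aG_mult_NN: "g:CL ==> n:NN L ==> aG (g**n) = aG g" using iwasawa_mult aG_NN NNc by simp

lemma normalizer_conj_expG: "k:KL ==> expG H**k = k**expG (AD (inv k) H)" using mult_expG KKc by simp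

lemma aG_mult_M0:
 assumes "g:CL" "m:M0" shows "aG (g**m) = aG g"
proof -
 have m: "m:KL" "m:CL" "!!H. H:aL ==> AD m H = H" using assms KKc by (auto simp: centralizer_aa_def)
 obtain n where g: "kG g:KL" "aG g:aL" "n:NN L" "g = kG g**expG (aG g)**n" by (rule iwasawa[OF assms(1)])
 note c = KKc[OF g(1)] NNc[OF g(3)]
 obtain n2 where n2: "n2:NN L" "n**m = m**n2" using NN_conj'[OF m(2) m(3)[OF H1(2)] g(3)] by auto
 have "g**m = kG g**expG (aG g)**n**m" using g(4) by simp
 also have "... = kG g**(expG (aG g)**m)**n2" using c m(2) NNc[OF n2(1)] n2(2) by (simp add: m_assoc)
 also have "expG (aG g)**m = m**expG (aG g)" using mult_expG[OF m(2), of "aG g"] m(3)[OF g(2)] by simp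
 finally have "g**m = kG g**m**expG (aG g)**n2" using c m(2) by (simp add: m_assoc)
 thus ?thesis using iwasawa_unique(2)[OF KK_mult[OF g(1) m(1)] g(2) n2(1)] by simp
qed

text \<open>In the coordinates of \<open>psi\<close> the \<open>A\<close>-part is linear. Pairing
  with \<open>H0\<close> kills \<open>kk\<close> and the root spaces, so only the component in \<aa>
  of \<open>Y\<close> is seen to first order.\<close>

lemma aG_expG_first_order:
 assumes H0: "H0:aL" and e: "e > 0"
 obtains de where "de > 0" "!!Y. norm Y < de ==> \<bar>form L H0 (aG (expG Y))-fo H0 Y\<bar> <= e * norm Y"
proof -
 obtain K where K: "K > 0" "!!x. norm (fo H0 x) <= norm x * K" using bounded_linear.pos_bounded[OF fm.bounded_linear_right, of H0] by auto
 \<comment> \<open>The bound \<open>1/2\<close> yields \<open>norm v <= 3 * norm Y\<close>, hence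
   \<open>norm (v - Y) <= 4 * c * norm Y\<close>; the other bound absorbs this factor 4 and the
   bound \<open>K\<close> for the functional.\<close>
 define c where "c = min (1/2) (e/(4 * K))"
 have c: "c * (4 * K) <= e" "c > 0" "c <= 1/2" using e K(1) pos_le_divide_eq[of "4 * K" c e] by (simp, simp_all add: c_def)
 obtain d1 where d1: "d1 > 0" "!!v. norm v < d1 ==> psi v:U1&norm (l (psi v)-v) <= c * norm v" using tang_small[OF psi(2) c(2)] by auto
 obtain d2 where d2: "d2 > 0" "!!v. norm v < d2 ==> expG v:U1&norm (l (expG v)-v) <= c * norm v" using tang_small[OF tang_expG c(2)] by auto
 obtain W where W: "openin G W" "\<one>:W" "W <= psi ` ball 0 d1" by (rule tang_nhd[OF psi d1(1)])
 obtain d3 where d3: "d3 > 0" "!!x. norm x < d3 ==> expG x:W" using expG_near_one[OF W(1,2)] by auto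
 show thesis
 proof (rule that[of "min d2 d3"])
  show "min d2 d3 > 0" using d2 d3 by simp
  fix Y :: 'l assume Y: "norm Y < min d2 d3"
  obtain v where v: "norm v < d1" "expG Y = psi v" using d3(2)[of Y] Y W(3) by auto
  have "norm (v-Y) <= c * norm v+c * norm Y"
   using d1(2)[OF v(1)] d2(2)[of Y] Y v(2) norm_triangle_ineq4[of "l (expG Y)-Y" "l (expG Y)-v"] by simp
  moreover have "c * norm v <= (1/2) * norm v" using c(3) mult_right_mono norm_ge_zero by blast
  moreover have "c * norm Y <= (1/2) * norm Y" using c(3) mult_right_mono norm_ge_zero by blast
  moreover have "norm v <= norm Y+norm (v-Y)" by (metis norm_triangle_sub)
  ultimately have "c * norm v <= c * (3 * norm Y)" using c(2) by simp
  hence vY: "norm (v-Y) <= c * (4 * norm Y)" using \<open>norm (v - Y) <= c * norm v + c * norm Y\<close> by simp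
  have "aG (psi v) = ps (z0 v)" unfolding psi_def by (rule iwasawa_unique(2)) (use psi_parts in "auto simp: KK_eq NN_eq")
  moreover have "fo H0 v = fo H0 (ps (z0 v))"
  proof -
   have "fo H0 (zp v) = 0" by (rule form_sp[OF aa_sp[OF H0, of "%ro. ro = (%_. 0)"] zp(1)]) auto
   moreover have "fo H0 (zm v) = 0" by (rule form_sp[OF aa_sp[OF H0, of "%ro. ro = (%_. 0)"] zm(1)]) auto
   moreover have "fo H0 (pk (z0 v)) = 0" using form_kk_ss[of "pk (z0 v)" H0] pk_ps(1) H0 aa_ss form_sym by auto
   moreover have "v = zp v+zm v+(pk (z0 v)+ps (z0 v))" unfolding pk_ps(3) by (simp add: z0_def)
   ultimately show ?thesis by (metis add.left_neutral fm.add_right)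
  qed
  ultimately have "\<bar>form L H0 (aG (expG Y))-fo H0 Y\<bar> = norm (fo H0 (v-Y))" by (simp add: v(2) fm.diff_right)
  also have "... <= c * (4 * norm Y) * K" using K(2)[of "v-Y"] mult_right_mono[OF vY, of K] K(1) by linarith
  also have "... = c * (4 * K) * norm Y" by simp
  also have "... <= e * norm Y" using c(1) by (rule mult_right_mono) simp
  finally show "\<bar>form L H0 (aG (expG Y))-fo H0 Y\<bar> <= e * norm Y" .
 qed
qed

text \<open>
 Kostant's inequality: the derivative of \<open>s \<mapsto> form H0 (aG (exp (s X) k))\<close> is
 \<open>form H0 (Ad (k\<^sub>s\<^sup>-\<^sup>1) X)\<close>, where \<open>k\<^sub>s\<close> is the \<open>K\<close>-part.
\<close>

lemma kostant_bound:
 assumes X: "X:ss L" and k: "k:KL" and H0: "H0:aL" and c: "!!s. fo H0 (AD (inv (kG (expG (s *R X)**k))) X) <= c"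
 shows "fo H0 (aG (expG X**k)) <= c"
proof (rule field_le_epsilon)
 fix e :: real assume e: "e > 0"
 obtain C where C: "C > 0" "!!k. k:KL ==> norm (AD k X) <= C" using norm_Ad_KK_bound[of X] by blast
 obtain de where de: "de > 0" "!!Y. norm Y < de ==> \<bar>form L H0 (aG (expG Y))-fo H0 Y\<bar> <= e/C * norm Y"
  using aG_expG_first_order[OF H0, of "e/C"] e C(1) by auto
 obtain N :: nat where "C/de < real N" using reals_Archimedean2 by blast
 moreover hence N0: "real N > 0" using C(1) de(1) by (meson divide_pos_pos less_trans)
 ultimately have N: "C/real N < de" using de(1) by (simp add: field_simps)
 have kc: "k:CL" using KKc k by blast
 have "fo H0 (aG (expG ((real j/real N) *R X)**k)) <= real j * ((c+e)/real N)" for j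
 proof (induction j)
  case 0
  show ?case using iwasawa_KK[OF k] kc by (simp add: fm.zero_right)
 next
  case (Suc j)
  define g where "g = expG ((real j/real N) *R X)**k"
  have g: "g:CL" using kc by (simp add: g_def)
  have kg: "kG g:KL" "kG g:CL" using kG_KK[OF g] KKc by auto
  define Y where "Y = (1/real N) *R AD (inv (kG g)) X"
  have "expG ((real (Suc j)/real N) *R X) = expG ((1/real N) *R X)**expG ((real j/real N) *R X)"
   using expG_add by (simp add: add_divide_distrib)
  hence "aG (expG ((real (Suc j)/real N) *R X)**k) = aG (expG ((1/real N) *R X)**kG g)+aG g" using kc iwasawa_mult by (simp add: g_def m_assoc)
  also have "expG ((1/real N) *R X)**kG g = kG g**expG Y" using normalizer_conj_expG[OF kg(1)] kg(2) by (simp add: Y_def Adlin)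
  finally have 1: "fo H0 (aG (expG ((real (Suc j)/real N) *R X)**k)) = fo H0 (aG (expG Y))+fo H0 (aG g)"
   using iwasawa_KK_left(2)[OF kg(1)] by (simp add: fm.add_right)
  have nY: "norm Y <= C/real N" using C(2)[OF KK_inv[OF kg(1)]] by (simp add: Y_def divide_right_mono)
  have "fo H0 (aG (expG Y)) <= fo H0 Y+e/C * norm Y" using de(2)[of Y] nY N by linarith
  also have "fo H0 Y <= c/real N" using c by (simp add: Y_def g_def fm.scaleR_right divide_right_mono)
  also have "e/C * norm Y <= e/C * (C/real N)" using nY e C(1) by (intro mult_left_mono) auto
  also have "e/C * (C/real N) = e/real N" using C(1) by simp
  finally have "fo H0 (aG (expG Y)) <= (c+e)/real N" by (simp add: add_divide_distrib)
  moreover have "real (Suc j) * ((c+e)/real N) = (c+e)/real N+real j * ((c+e)/real N)" by (simp add: distrib_right add_divide_distrib)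
  ultimately show ?case using Suc 1 unfolding g_def by simp
 qed
 from this[of N] show "fo H0 (aG (expG X**k)) <= c+e" using N0 by simp
qed

section \<open>The norm invariant under the maximal compact subgroup\<close>

definition nB :: "'l => real" where "nB x = sqrt (B x x)"

lemma nB_sq: "nB x * nB x = B x x" and nB_nonneg: "nB x >= 0" using B_nonneg by (simp_all add: nB_def)

lemma B_le_nB: "B x y <= nB x * nB y"
proof (cases "y = 0")
 case False
 hence p: "B y y > 0" by (rule B_pos)
 define t where "t = B x y/B y y"
 have "0 <= B (x-t *R y) (x-t *R y)" by (rule B_nonneg)
 also have "... = B x x-B x y * B x y/B y y" by (simp add: t_def Bf.diff_right Bf.scaleR_right B_sym)
 finally have "(B x y)\<^sup>2 <= B x x * B y y" using p by (simp add: pos_divide_le_eq power2_eq_square)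
 thus ?thesis using real_sqrt_le_mono by (fastforce simp: nB_def real_sqrt_mult)
qed (simp add: Bf.zero_right nB_def)

lemma nB_minus: "nB (- x) = nB x" by (simp add: nB_def Bf.minus_left Bf.minus_right)

lemma abs_B_le_nB: "\<bar>B x y\<bar> <= nB x * nB y" using B_le_nB[of x y] B_le_nB[of "- x" y] by (simp add: nB_minus Bf.minus_left)

lemma norm_le_nB: obtains C where "C > 0" "!!x. norm x <= C * nB x"
proof -
 have "EX v. ALL x. B v x = x \<bullet> b" for b using B_riesz by blast
 then obtain v where v: "!!b x. B (v b) x = x \<bullet> b" by metis
 have "norm x <= ((\<Sum>b\<in>Basis. nB (v b))+1) * nB x" for x
 proof -
  have "norm x <= (\<Sum>b\<in>Basis. \<bar>x \<bullet> b\<bar>)" by (rule norm_le_l1)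
  also have "... <= (\<Sum>b\<in>Basis. nB (v b) * nB x)" using abs_B_le_nB[of "v _" x] by (intro sum_mono) (simp add: v)
  also have "... <= ((\<Sum>b\<in>Basis. nB (v b))+1) * nB x" by (simp add: sum_distrib_right distrib_right nB_nonneg)
  finally show ?thesis .
 qed
 thus thesis using that[of "(\<Sum>b\<in>Basis. nB (v b))+1"] by (simp add: add_nonneg_pos sum_nonneg nB_nonneg)
qed

lemma nB_add: "nB (x+y) <= nB x+nB y"
proof -
 have "(nB (x+y))\<^sup>2 <= (nB x+nB y)\<^sup>2" using B_le_nB[of x y] nB_sq[of x] nB_sq[of y] nB_sq[of "x+y"]
  by (simp add: power2_eq_square Bf.add_right B_sym algebra_simps)
 thus ?thesis by (rule power2_le_imp_le) (simp add: nB_nonneg)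
qed

lemma nB_scaleR: "nB (c *R x) = \<bar>c\<bar> * nB x" by (simp add: nB_def Bf.scaleR_left Bf.scaleR_right real_sqrt_mult)

lemma nB_0: "nB 0 = 0" by (simp add: nB_def Bf.zero_left)

lemma continuous_nB: "continuous_on UNIV nB" unfolding nB_def by (intro continuous_intros Bf.continuous_on)

lemma nB_KK: "k:KL ==> nB (AD k X) = nB X" by (simp add: nB_def Ad_KK(4))

subsection \<open>The minimal parabolic subgroup\<close>

text \<open>\<open>A\<close> and \<open>N\<close> preserve \<open>pp\<close>, so the
  \<open>K\<close>-part of an element preserving \<open>pp\<close> does so as well and therefore
  centralizes \<aa>.\<close>

lemma parabolic_eq: "parabolic L {} = {m**expG a**n | m a n. m:M0&a:aL&n:NN L}"
proof (rule subset_antisym; rule subsetI)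
 fix g assume g: "g:parabolic L {}"
 hence gc: "g:CL" and gp: "!!X. X:pp ==> AD g X:pp" by (auto simp: parabolic_def parabolic_algebra_sp)
 obtain n where i: "kG g:KL" "aG g:aL" "n:NN L" "g = kG g**expG (aG g)**n" by (rule iwasawa[OF gc])
 have c: "n:CL" "kG g:CL" using i KKc NNc by auto
 have k: "kG g = g**inv n**expG (- aG g)" using c i(4) by (metis expGc expG_minus inv_solve_right m_closed)
 have "kG g:M0"
 proof (rule KK_pp_M0[OF i(1)])
  fix X assume "X:pp"
  thus "AD (kG g) X:pp" unfolding k using gc c gp Ad_NN_pp[OF NN_inv[OF i(3)]] Ad_AA_pp[OF subspace_neg[OF subsp(3) i(2)]] by (simp add: Adm)
 qed
 thus "g : {m**expG a**n | m a n. m:M0&a:aL&n:NN L}" using i by blast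
next
 fix g assume "g : {m**expG a**n | m a n. m:M0&a:aL&n:NN L}"
 then obtain m a n where g: "g = m**expG a**n" and man: "m:M0" "a:aL" "n:NN L" by blast
 have m: "m:CL" "AD m H1 = H1" "AD (inv m) H1 = H1" using man(1) H1(2) KKc Ad_inv(1)[of m H1] by (auto simp: centralizer_aa_def)
 have c: "n:CL" "g:CL" using NNc man(3) m by (auto simp: g)
 have 1: "AD g X:pp" if "X:pp" for X
  using sp_centralized[OF m(1) H1(2) m(2), of _ "%c. c >= 0"] Ad_AA_pp[OF man(2)] Ad_NN_pp[OF man(3) that] m(1) c by (simp add: g Adm)
 have 2: "AD (inv g) X:pp" if "X:pp" for X
 proof -
  have ig: "inv g = inv n**(expG (- a)**inv m)" using m(1) c by (simp add: g inv_mult_group expG_minus)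
  show ?thesis unfolding ig using sp_centralized[OF _ H1(2) m(3), of X "%c. c >= 0"] Ad_AA_pp[OF subspace_neg[OF subsp(3) man(2)]]
    Ad_NN_pp[OF NN_inv[OF man(3)]] m(1) c(1) that by (simp add: Adm)
 qed
 have "AD g ` pp = pp"
 proof
  show "pp <= AD g ` pp" using 2 Ad_inv(2)[OF c(2)] by (metis image_eqI subsetI)
 qed (use 1 in auto)
 thus "g:parabolic L {}" using c by (simp add: parabolic_def parabolic_algebra_sp)
qed

abbreviation "PP == parabolic L {}"

lemma M0_simps: "m:M0 ==> m:KL" "m:M0 ==> m:CL" "m:M0 ==> H:aL ==> AD m H = H"
 "\<one>:M0" using KKc KK_one by (auto simp: centralizer_aa_def)

lemma PP_carrier: "p:PP ==> p:CL" by (simp add: parabolic_def)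

lemma PP_mult: "p:PP ==> p':PP ==> p**p':PP"
proof -
 assume p: "p:PP" "p':PP"
 hence c: "p:CL" "p':CL" by (simp_all add: parabolic_def)
 have "AD (p**p') ` V = AD p ` AD p' ` V" for V using Adm[OF c] by auto
 thus "p**p':PP" using p c by (simp add: parabolic_def)
qed

lemma PP_inv: "p:PP ==> inv p:PP"
proof -
 assume p: "p:PP"
 hence c: "p:CL" "AD p ` parabolic_algebra L {} = parabolic_algebra L {}" by (simp_all add: parabolic_def)
 have "AD (inv p) ` AD p ` V = V" for V using Ad_inv(1)[OF c(1)] by (simp add: image_image)
 hence "AD (inv p) ` parabolic_algebra L {} = parabolic_algebra L {}" using c(2) by metis
 thus "inv p:PP" using c(1) by (simp add: parabolic_def)
qed

lemma PP_one: "\<one>:PP" by (simp add: parabolic_def)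

lemma NN_PP: "n:NN L ==> n:PP"
proof -
 assume n: "n:NN L"
 thus ?thesis unfolding parabolic_eq using NNc M0_simps(4) subspace_0[OF subsp(3)] n by force
qed

lemma AA_PP: "H:aL ==> expG H:PP" unfolding parabolic_eq using M0_simps(4) NN_one by force

lemma subgroup_PP: "subgroup PP L" using PP_carrier PP_mult PP_inv PP_one by (intro subgroupI) auto

lemma aG_mult_PP: assumes "g:CL" "p:PP" shows "aG (g**p) = aG g+aG p"
proof -
 obtain m a n where p: "p = m**expG a**n" "m:M0" "a:aL" "n:NN L" using assms(2) by (auto simp: parabolic_eq)
 have c: "m:CL" "n:CL" using p M0_simps NNc by auto
 have "g**p = g**m**expG a**n" using assms(1) c by (simp add: p(1) m_assoc)
 thus ?thesis using assms(1) c p iwasawa_unique(2)[OF M0_simps(1)[OF p(2)] p(3,4)] by (simp add: aG_mult_NN aG_mult_expG aG_mult_M0)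
qed

lemma Ad_PP_diff: assumes "p:PP" "H:aL" shows "AD p H-H:nn L"
proof -
 obtain m a n where p: "p = m**expG a**n" "m:M0" "a:aL" "n:NN L" using assms(1) by (auto simp: parabolic_eq)
 have c: "m:CL" "n:CL" "m**expG a:CL" using p M0_simps NNc by auto
 have f: "AD (m**expG a) H' = H'" if "H':aL" for H' using that c M0_simps(3)[OF p(2)] Ad_AA[OF p(3)] by (simp add: Adm)
 show ?thesis using sp_centralized[OF c(3) H1(2) f[OF H1(2)], of _ "%c. c > 0"] Ad_NN_diff[OF p(4) assms(2)] c f[OF assms(2)] Adm by (fastforce simp: p(1) Adlin(3) nn_sp)
qed

subsection \<open>Bounds for the Iwasawa projection\<close>

lemma Ad_kostant_le:
 assumes "X:ss L" "k:KL" shows "fo H0 (AD k X) <= nB H0 * nB X"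
 using B_le_nB[of H0 "AD k X"] B_ss[OF Ad_KK(2)[OF assms(2,1)]] nB_KK[OF assms(2)] by simp

lemma form_aa: "x:aL ==> fo y x = B y x" using B_ss aa_ss by auto

text \<open>Kostant's bound is tested against the projection itself and combined with the
  Cauchy-Schwarz inequality.\<close>

lemma nB_aG_expG: assumes X: "X:ss L" and k: "k:KL" shows "nB (aG (expG X**k)) <= nB X"
proof -
 define a where "a = aG (expG X**k)"
 have a: "a:aL" unfolding a_def using KKc[OF k] by (intro aG_aa) simp
 have "fo a a <= nB a * nB X" by (subst (2) a_def, rule kostant_bound[OF X k a])
   (use KKc[OF k] in "auto intro!: Ad_kostant_le X KK_inv kG_KK")
 hence "nB a * nB a <= nB a * nB X" using form_aa[OF a] nB_sq by simp
 thus ?thesis unfolding a_def[symmetric] using nB_nonneg[of a] nB_nonneg by (cases "nB a = 0") (simp_all)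
qed

definition pX :: "'g => 'l" where "pX g = (SOME X. X:ss L&(EX k:KK L. g = k**expG X))"

lemma pX_eq: "k:KL ==> X:ss L ==> pX (k**expG X) = X" unfolding pX_def by (rule) (use polar_inj(2) in blast)+

lemma pX: assumes "g:CL" obtains k where "k:KL" "pX g:ss L" "g = k**expG (pX g)" using polar_ex[OF assms] pX_eq by auto

lemma continuous_pX: "cmap G euclidean pX"
proof -
 obtain h where h: "homeomorphic_maps (prod_topology (subtopology G (KL)) (top_of_set (ss L))) G (%(k,X). k**expG X) h"
  using polar homeomorphic_map_maps by blast
 have hc: "cmap G (prod_topology (subtopology G (KL)) (top_of_set (ss L))) h" and hi: "!!g. g:CL ==> (%(k,X). k**expG X) (h g) = g"
  using h by (auto simp: homeomorphic_maps_def)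
 have "cmap G euclidean (snd \<circ> h)" using continuous_map_into_fulltopology continuous_map_compose[OF hc continuous_map_snd] by auto
 thus ?thesis
 proof (rule continuous_map_eq)
  fix g assume "g:topspace G"
  hence g: "g:CL" by simp
  obtain k X where kX: "h g = (k,X)" by (cases "h g")
  show "(snd \<circ> h) g = pX g" using continuous_map_image_subset_topspace[OF hc] g hi[OF g] kX pX_eq by auto
 qed
qed

text \<open>Geometrically the distance by which \<open>g\<close> moves the base point of the
  symmetric space of \<open>K\<close>-cosets. It is invariant under \<open>K\<close> on both sides
  and under inversion, and subadditive.\<close>

definition nX :: "'g => real" where "nX g = nB (pX g)"

lemma continuous_nX: "cmap G euclideanreal nX"
 unfolding nX_def using continuous_map_compose[OF continuous_pX, of euclideanreal nB] continuous_nB by (simp add: o_def)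

lemma nX_KK: assumes "k:KL" "g:CL" shows "nX (k**g) = nX g" "nX (g**k) = nX g" "nX (inv g) = nX g"
proof -
 obtain k0 where g: "k0:KL" "pX g:ss L" "g = k0**expG (pX g)" by (rule pX[OF assms(2)])
 have c: "k:CL" "k0:CL" using assms g KKc by auto
 show "nX (k**g) = nX g" using g(3) c pX_eq[OF KK_mult[OF assms(1) g(1)] g(2)] m_assoc by (simp add: nX_def)
 show "nX (g**k) = nX g" by (metis nX_def g(3) c expGc m_assoc pX_eq[OF KK_mult[OF g(1) assms(1)] Ad_KK(2)[OF KK_inv[OF assms(1)] g(2)]] nB_KK[OF KK_inv[OF assms(1)]] normalizer_conj_expG[OF assms(1)])
 have "inv g = expG (- pX g)**inv k0" using arg_cong[OF g(3), of "m_inv L"] c by (simp add: inv_mult_group expG_minus)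
 also have "... = inv k0**expG (AD k0 (- pX g))" using normalizer_conj_expG[OF KK_inv[OF g(1)]] c by simp
 finally show "nX (inv g) = nX g"
  using pX_eq[OF KK_inv[OF g(1)] Ad_KK(2)[OF g(1) subspace_neg[OF subsp(2) g(2)]]] nB_KK[OF g(1)] by (simp add: nX_def nB_minus)
qed

lemma nB_aG: assumes "g:CL" "k:KL" shows "nB (aG (g**k)) <= nX g"
proof -
 obtain k0 where g: "k0:KL" "pX g:ss L" "g = k0**expG (pX g)" by (rule pX[OF assms(1)])
 have "g**k = k0**(expG (pX g)**k)" using g(3) KKc g(1) assms(2) by (metis expGc m_assoc)
 thus ?thesis using nB_aG_expG[OF g(2) assms(2)] iwasawa_KK_left(2)[OF g(1), of "expG (pX g)**k"] KKc[OF assms(2)] by (simp add: nX_def)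
qed

lemma nX_one: "nX \<one> = 0" using pX_eq[OF KK_one subspace_0[OF subsp(2)]] by (simp add: nX_def nB_0)

lemma continuous_map_nX:
 assumes C: "C > 0" and f: "!!g g0. g:CL ==> g0:CL ==> norm (f g-f g0) <= C * nX (g**inv g0)"
 shows "cmap G euclidean (f :: 'g => 'l)" unfolding continuous_map_eq_topcontinuous_at topcontinuous_at_def
proof (intro ballI conjI allI impI; (elim conjE)?)
 fix g0 U assume "g0:topspace G" and U: "openin euclidean U" "f g0:U"
 hence g0: "g0:CL" by simp
 obtain e where e: "e > 0" "!!y. dist y (f g0) < e ==> y:U" using U by (auto simp: open_dist)
 have cont: "cmap G euclideanreal (%g. nX (g**inv g0))"
 proof -
  have "cmap G G (%g. g**inv g0)" using g0 by (intro cmap_mult) auto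
  from continuous_map_compose[OF this continuous_nX] show ?thesis by (simp add: o_def)
 qed
 show "EX V. openin G V&g0:V&(ALL y:V. f y:U)"
 proof (intro exI conjI ballI)
  show "openin G {g:topspace G. nX (g**inv g0) : {..<e/C}}" by (rule openin_continuous_map_preimage[OF cont]) simp
  show "g0 : {g:topspace G. nX (g**inv g0) : {..<e/C}}" using g0 nX_one e(1) C by simp
  fix g assume "g : {g:topspace G. nX (g**inv g0) : {..<e/C}}"
  hence g: "g:CL" "nX (g**inv g0) * C < e" using C by (auto simp: pos_less_divide_eq)
  show "f g:U" using f[OF g(1) g0] g(2) e(2) by (simp add: dist_norm mult.commute)
 qed
qed auto

subsection \<open>Stabilizers of dominant elements\<close>

text \<open>\<open>AD (expG X) H\<close> is conjugate to \<open>H\<close> under \<open>K\<close>,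
  hence lies in \<open>ss\<close>; applying \<open>th\<close> shows that it equals
  \<open>AD (expG (- X)) H\<close>. So \<open>g\<close> agrees at \<open>1\<close> and
  \<open>-1\<close>, while its derivative is a squared \<open>B\<close>-norm. By the mean value
  theorem that square vanishes somewhere, and with it the bracket of \<open>X\<close> and
  \<open>H\<close>.\<close>

lemma stabilizer_polar:
 assumes H: "H:aL" and z: "z:stabilizer L H"
 obtains k X where "k:KH H" "X:ss L" "bk H X = 0" "z = k**expG X"
proof -
 have zc: "z:CL" "AD z H = H" using z by (auto simp: stabilizer_def)
 obtain k X where kX: "k:KL" "X:ss L" "z = k**expG X" using polar_ex[OF zc(1)] by blast
 have kc: "k:CL" using kX KKc by blast
 have Hs: "H:ss L" using H aa_ss by blast
 have e1: "AD (expG X) H = AD (inv k) H" using zc(2) kX(3) kc Adm[OF kc expGc] Ad_inv(1) by metis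
 hence s: "AD (expG X) H:ss L" using Ad_KK(2)[OF KK_inv[OF kX(1)] Hs] by simp
 define v where "v = bk X H"
 define g where "g t = B (AD (expG (t *R X)) H) v" for t
 have g': "(g has_real_derivative B (AD (expG ((t/2) *R X)) v) (AD (expG ((t/2) *R X)) v)) (at t)" for t
 proof -
  have "bk X (AD (expG (t *R X)) H) = AD (expG ((t/2) *R X)) (AD (expG ((t/2) *R X)) v)" using Ad_bracket expG_add Adm[of "expG ((t/2) *R X)" "expG ((t/2) *R X)" v] by (simp add: Ad_expG_self v_def)
  hence "((%t. AD (expG (t *R X)) H) hasV AD (expG ((t/2) *R X)) (AD (expG ((t/2) *R X)) v)) (at t)" using hasV_Ad_expG[of X H t] by simp
  from bounded_linear.has_vector_derivative[OF Bf.bounded_linear_left this, of v] show ?thesis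
   using B_Ad_expG_ss[OF subspace_scale[OF subsp(2) kX(2)], of "t/2"] by (simp add: g_def[abs_def] has_real_derivative_iff_has_vector_derivative)
 qed
 obtain c where c: "g 1-g (-1) = 2 * B (AD (expG ((c/2) *R X)) v) (AD (expG ((c/2) *R X)) v)"
  using MVT2[of "-1" 1 g "%t. B (AD (expG ((t/2) *R X)) v) (AD (expG ((t/2) *R X)) v)"] g' by auto
 have "v = 0" using th_Ad_expG_ss[OF kX(2), of H] th_ss[OF s] th_ss[OF Hs] c B_eq_0 Ad_inj[of "expG ((c/2) *R X)" v 0] by (simp add: g_def Adlin)
 hence b: "bk H X = 0" using bk_anti[of H X] by (simp add: v_def)
 hence "AD k H = H" using \<open>v = 0\<close> Ad_expG_eigen[of X H 0 1] e1 Ad_inv(2)[OF kc, of H] by (simp add: v_def)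
 thus thesis using that kX b by (simp add: KH_def)
qed

text \<open>The closed chamber of the stabilizer of \<open>H\<close>: only the simple roots
  vanishing at \<open>H\<close> impose a sign. For \<open>H = 0\<close> it is the ordinary closed
  chamber.\<close>

definition rdom :: "'l => 'l => bool" where
 "rdom H b \<longleftrightarrow> b:aL&(ALL ro:simple L. ro H = 0 --> ro b >= 0)"

text \<open>The Cartan decomposition inside the stabilizer. The polar factor is conjugated into
  \<aa> by an element fixing \<open>H\<close>; taking \<open>H1\<close> as the regular element makes
  the resulting signs those of \<open>rdom\<close>.\<close>

lemma stabilizer_KAK:
 assumes H: "H:aL" and z: "z:stabilizer L H"
 obtains k b k' where "k:KH H" "k':KH H" "rdom H b" "z = k**expG b**k'"
proof -
 obtain k X where kX: "k:KH H" "X:ss L" "bk H X = 0" "z = k**expG X" by (rule stabilizer_polar[OF assms])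
 obtain q where q: "q:KH H" "AD q X:aL" "!!ro. ro:rL ==> ro H = 0 ==> ro H1 * ro (AD q X) >= 0"
  using conj_into_aa[OF H kX(2,3) H1(2)] roots_H1(1) by metis
 have c: "k:CL" "q:CL" using kX q KHs(3) by auto
 have r: "rdom H (AD q X)" unfolding rdom_def
 proof (intro conjI ballI impI q(2))
  fix ro assume a: "ro:sL" "ro H = 0"
  show "ro (AD q X) >= 0" using H1(1) a q(3)[of ro] simple_roots by (fastforce simp: zero_le_mult_iff chamber_def)
 qed
 have "expG X = inv q**expG (AD q X)**q" using c conj_expG[of "inv q" "AD q X"] by simp
 hence "z = (k**inv q)**expG (AD q X)**q" using c by (simp add: kX(4) m_assoc)
 thus thesis using that[OF KHs(5)[OF kX(1) KHs(6)[OF q(1)]] q(1) r] by simp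
qed

text \<open>The factor \<open>a n\<close> displaces \<open>H\<close> by some \<open>Y\<close> in
  \<open>nn\<close>, while \<open>H + Y\<close> is conjugate to \<open>H\<close> under
  \<open>K\<close> and so lies in \<open>ss\<close>. An element of \<open>nn\<close> lying in
  \<open>ss\<close> is zero, because \<open>th\<close> takes \<open>nn\<close> to the opposite root
  spaces.\<close>

lemma KG_stabilizer:
 assumes H: "H:aL" and z: "z:stabilizer L H" shows "kG z:KH H"
proof -
 have zc: "z:CL" "AD z H = H" using z by (auto simp: stabilizer_def)
 obtain n where i: "kG z:KL" "aG z:aL" "n:NN L" "z = kG z**expG (aG z)**n" by (rule iwasawa[OF zc(1)])
 have c: "kG z:CL" "n:CL" using i KKc NNc by auto
 have an: "expG (aG z)**n:PP" using AA_PP[OF i(2)] NN_PP[OF i(3)] PP_mult by simp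
 define Y where "Y = AD (expG (aG z)**n) H-H"
 have Y: "Y:nn L" unfolding Y_def by (rule Ad_PP_diff[OF an H])
 have "AD (kG z) (AD (expG (aG z)**n) H) = H" using zc(2) i(4) c Adm[of "kG z" "expG (aG z)**n" H] by (simp add: m_assoc)
 hence e: "AD (inv (kG z)) H = H+Y" using Ad_inv(1)[OF c(1)] by (metis Y_def add.commute diff_add_cancel)
 have "H+Y:ss L" using Ad_KK(2)[OF KK_inv[OF i(1)]] H aa_ss e by fastforce
 hence "Y = 0" using subspace_diff[OF subsp(2), of "H+Y" H] H aa_ss th_sp[of Y "%ro. ro H1 > 0"] th_ss Y subspace_neg[OF sub_sp, of "- Y"] sp_disjoint[of Y "%ro. ro H1 > 0" "%ro.-ro H1 > 0"] by (force simp: nn_sp)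
 thus ?thesis using e Ad_inv(2)[OF c(1), of H] i(1) by (simp add: KH_def)
qed

lemma chamber_shift:
 assumes H: "H:cch" and b: "rdom H b"
 obtains s where "s >= 0" "!!t. t >= s ==> b+t *R H:cch"
proof -
 have Ha: "H:aL" "!!ro. ro:sL ==> ro H >= 0" using H clch by auto
 have ba: "b:aL" using b by (simp add: rdom_def)
 define s where "s = (\<Sum>si\<in>simple L. \<bar>si b/si H\<bar>)"
 show thesis
 proof (rule that)
  show "s >= 0" by (simp add: s_def sum_nonneg)
  fix t assume t: "t >= s"
  show "b+t *R H:cch" unfolding clch
  proof (intro conjI ballI)
   show "b+t *R H:aL" using ba Ha subsp(3) by (intro subspace_add subspace_scale)
   fix ro assume a: "ro:sL"
   hence ad: "ro:dual_aa L" using simple_roots rootsD(1) by auto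
   have al: "ro (b+t *R H) = ro b+t * ro H" using ba Ha subspace_scale[OF subsp(3)] by (simp add: dual_aaD[OF ad])
   show "ro (b+t *R H) >= 0"
   proof (cases "ro H = 0")
    case False
    hence p: "ro H > 0" using Ha(2)[OF a] by simp
    have "\<bar>ro b/ro H\<bar> <= s" unfolding s_def using finite_simple a by (intro member_le_sum) auto
    hence "(- ro b)/ro H <= t" using t by linarith
    hence "- ro b <= t * ro H" unfolding pos_divide_le_eq[OF p] .
    thus ?thesis by (simp add: al)
   qed (use a b al in "simp add: rdom_def")
  qed
 qed
qed

text \<open>Adding a large multiple of \<open>H\<close> makes both arguments dominant. Since
  \<open>k\<close> fixes \<open>H\<close>, the added terms are the same on both sides.\<close>

lemma form_rdom:
 assumes H: "H:cch" and b: "rdom H b" and H0: "rdom H H0" and k: "k:KH H"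
 shows "fo H0 (AD k b) <= fo H0 b"
proof -
 obtain s where s: "!!t. t >= s ==> b+t *R H:cch" using chamber_shift[OF H b] by blast
 obtain s' where s': "!!t. t >= s' ==> H0+t *R H:cch" using chamber_shift[OF H H0] by blast
 define t where "t = max s s'"
 have kc: "k:KL" "k:CL" "AD k H = H" using k KHs by auto
 have "fo (H0+t *R H) (AD k (b+t *R H)) <= fo (H0+t *R H) (b+t *R H)" by (rule form_dominant[OF s s' kc(1)]) (simp_all add: t_def)
 thus ?thesis using form_Ad[OF kc(2), of H b] kc(3) by (simp add: Adlin[OF kc(2)] fm.add_left fm.add_right fm.scaleR_left)
qed

text \<open>The path in Kostant's argument stays in the stabilizer of \<open>H\<close>, so its
  \<open>K\<close>-parts stay in \<open>KH H\<close> and dominance relative to \<open>H\<close> is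
  enough.\<close>

lemma kostant_stabilizer:
 assumes H: "H:cch" and b: "rdom H b" and H0: "rdom H H0" and k: "k:KH H" and w: "w:KH H" "AD w H0:aL"
 shows "fo (AD w H0) (aG (expG b**k)) <= fo H0 b"
proof (rule kostant_bound)
 have Ha: "H:aL" using H clch by auto
 show "b:ss L" using b aa_ss by (auto simp: rdom_def)
 show "k:KL" using k KHs by auto
 fix s
 have "bk (s *R b) H = 0 *R H" using br_aa b Ha subspace_scale[OF subsp(3)] by (simp add: rdom_def)
 from Ad_expG_eigen[OF this, of 1] have "expG (s *R b)**k:stabilizer L H" using k KHs(2,3) by (simp add: stabilizer_def Adm)
 from KG_stabilizer[OF Ha this] have q: "kG (expG (s *R b)**k):KH H" (is "?q : _") .
 have c: "w:CL" "?q:CL" using w q KHs(3) by blast+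
 have "fo (AD w H0) (AD (inv ?q) b) = fo H0 (AD (inv w**inv ?q) b)" using form_Ad[OF c(1), of H0 "AD (inv w**inv ?q) b"] c by (simp add: Adm)
 also have "... <= fo H0 b" by (rule form_rdom[OF H b H0]) (intro KHs(5,6) w(1) q)
 finally show "fo (AD w H0) (AD (inv ?q) b) <= fo H0 b" .
qed (rule w)

text \<open>\<open>b'\<close> is its own Iwasawa projection, which the cocycle rule splits along the
  product. The outer terms are bounded by \<open>nX\<close>, the middle one by Kostant's
  inequality.\<close>

lemma cartan_perturbation:
 assumes b: "b:cch" "b':cch" "H0:cch" and c: "c1:CL" "c2:CL" and e: "expG b' = c1**expG b**c2"
 shows "fo H0 b' <= fo H0 b+nB H0 * (nX c1+nX c2)"
proof -
 have aa: "b:aL" "b':aL" "H0:aL" using b clch by auto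
 let ?k = "kG c2" let ?k' = "kG (expG b**?k)"
 have k: "?k:KL" "?k':KL" using c kG_KK KKc by auto
 have kc: "?k:CL" using k KKc by blast
 have "b' = aG (c1**?k')+(aG (expG b**?k)+aG (c2**\<one>))" using aG_expG_aa(1)[OF aa(2)] e c iwasawa_mult(1) iwasawa_mult(2) by (simp add: m_assoc)
 hence 1: "fo H0 b' = fo H0 (aG (c1**?k'))+(fo H0 (aG (expG b**?k))+fo H0 (aG (c2**\<one>)))" by (simp add: fm.add_right)
 have bound: "fo H0 (aG (g**k)) <= nB H0 * nX g" if "g:CL" "k:KL" for g k
 proof -
  have "fo H0 (aG (g**k)) <= nB H0 * nB (aG (g**k))" using B_le_nB form_aa aG_aa that KKc by simp
  also have "... <= nB H0 * nX g" by (intro mult_left_mono nB_aG that nB_nonneg)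
  finally show ?thesis .
 qed
 have "fo H0 (aG (expG b**?k)) <= fo H0 b"
 proof (rule kostant_bound[OF _ k(1) aa(3)])
  show "b:ss L" using aa aa_ss by blast
  show "fo H0 (AD (inv (kG (expG (s *R b)**?k))) b) <= fo H0 b" for s by (intro form_dominant[OF b(1,3)] KK_inv kG_KK) (use kc in simp)
 qed
 thus ?thesis using 1 bound[OF c(1) k(2)] bound[OF c(2) KK_one] by (simp add: distrib_left)
qed

lemma aa_coordinates: "EX v. ALL b. v b:aL&(ALL x:aa L. fo (v b) x = x \<bullet> b)"
proof -
 have "EX v:aa L. ALL x:aa L. B v x = x \<bullet> b" for b by (rule B_riesz_on[OF subsp(3)]) (simp_all add: inner_add_left)
 then obtain v where "!!b. v b:aL&(ALL x:aa L. B (v b) x = x \<bullet> b)" by metis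
 thus ?thesis by (intro exI[of _ v]) (simp add: form_aa)
qed

text \<open>Coordinates are pairings with elements of \<aa>, and each of these is a difference of a
  dominant element and a nonnegative multiple of \<open>H1\<close>.\<close>

lemma dominant_norm:
 obtains C where "!!x D. x:aL ==> (!!H0. H0:cch ==> \<bar>form L H0 x\<bar> <= nB H0 * D) ==> norm x <= C * D"
proof -
 obtain v where "ALL b. v b:aL&(ALL x:aa L. fo (v b) x = x \<bullet> b)" using aa_coordinates by (rule exE)
 hence v: "v b:aL" "x:aL ==> fo (v b) x = x \<bullet> b" for b x by auto
 have H1c: "H1:cch" using H1(1) closure_subset by blast
 have "EX t>=0. v b+t *R H1:cch" if b: "b:Basis" for b
 proof -
  have r: "rdom H1 (v b)" using v(1) H1(1) by (auto simp: rdom_def chamber_def)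
  show ?thesis by (rule chamber_shift[OF H1c r]) (auto)+
 qed
 then obtain t where t: "!!b. b:Basis ==> t b >= 0&v b+t b *R H1:cch" by metis
 define C where "C = (\<Sum>b\<in>Basis. nB (v b+t b *R H1)+t b * nB H1)"
 show thesis
 proof (rule that[of C])
  fix x D assume x: "x:aL" and D: "!!H0. H0:cch ==> \<bar>form L H0 x\<bar> <= nB H0 * D"
  have "norm x <= (\<Sum>b\<in>Basis. \<bar>x \<bullet> b\<bar>)" by (rule norm_le_l1)
  also have "... <= (\<Sum>b\<in>Basis. (nB (v b+t b *R H1)+t b * nB H1) * D)"
  proof (rule sum_mono)
   fix b :: 'l assume b: "b:Basis"
   have "\<bar>t b * fo H1 x\<bar> <= t b * (nB H1 * D)" unfolding abs_mult using D[OF H1c] t[OF b] by (simp add: mult_left_mono)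
   thus "\<bar>x \<bullet> b\<bar> <= (nB (v b+t b *R H1)+t b * nB H1) * D" using v(2)[OF x, of b] D[of "v b+t b *R H1"] t[OF b] by (simp add: distrib_right fm.add_left fm.scaleR_left)
  qed
  also have "... = C * D" by (simp add: C_def sum_distrib_right)
  finally show "norm x <= C * D" .
 qed
qed

text \<open>\<open>AD (expG (- Y)) H\<close> is exactly \<open>H - ro H Y\<close>, a nonzero
  displacement in a negative root space, whereas the parabolic subgroup displaces \<open>H\<close>
  only by elements of \<open>nn\<close>.\<close>

lemma negative_root_moves:
 assumes ro: "ro:sL"
 obtains Y where "Y:rsp (%H.-ro H)"
  "!!H p. H:aL ==> ro H ~= 0 ==> p:PP ==> AD (expG (- Y)) H ~= AD p H"
proof -
 have a: "ro:rL" "ro H1 > 0" using ro simple_roots H1(1) by (auto simp: chamber_def)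
 obtain E where E: "E:rsp ro" "E ~= 0" using rootsD(2)[OF a(1)] by blast
 define Y where "Y = th E"
 have Y: "Y:rsp (%H.-ro H)" unfolding Y_def by (rule th_root_space[OF E(1)])
 have Y0: "Y ~= 0" using E(2) th_th linear_0[OF linear_th] unfolding Y_def by metis
 show thesis
 proof (rule that[OF Y])
  fix H p assume H: "H:aL" "ro H ~= 0" and p: "p:PP"
  have HY: "bk Y H = ro H *R Y" using Y H(1) bk_anti[of Y H] by (simp add: root_space_def)
  define f where "f t = H-(t * ro H) *R Y" for t
  have "(f hasV bk (- Y) (f t)) (at t)" for t
   unfolding f_def by (auto intro!: derivative_eq_intros simp: br.minus_left br.diff_right br.scaleR_right HY)
  from Ad_expG_flow[of f, OF this, of 1] have 1: "AD (expG (- Y)) H = H-ro H *R Y" by (simp add: f_def)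
  show "AD (expG (- Y)) H ~= AD p H"
  proof
   assume e: "AD (expG (- Y)) H = AD p H"
   have "AD (expG (- Y)) H-H:nn L" unfolding e by (rule Ad_PP_diff[OF p H(1)])
   hence "(- 1/ro H) *R (- (ro H *R Y)):nn L" unfolding nn_sp using subspace_scale[OF sub_sp] by (fastforce simp: 1)
   hence "Y:sp (%rb. rb H1 > 0)" using H(2) by (simp add: nn_sp)
   moreover have "Y:sp (%rb. rb H1 < 0)" using a(2) Y by (intro root_space_sp[OF dual_aa_neg[OF rootsD(1)[OF a(1)]]]) auto
   ultimately show False using sp_disjoint[of Y] Y0 by force
  qed
 qed
qed

subsection \<open>The orbit of a dominant element is locally a quotient\<close>

text \<open>The logarithm of the \<open>N\<close>-part involves only roots nonnegative at
  \<open>H\<close>. Those vanishing at \<open>H\<close> commute with it, so the displacement lies in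
  the root spaces positive at \<open>H\<close>, which \<open>A\<close> preserves.\<close>

lemma Ad_orbit_form:
 assumes H: "H:cch" and g: "g:CL"
 obtains k Y where "k:KL" "Y:sp (%ro. ro H > 0)" "AD g H = AD k (H+Y)"
proof -
 have Ha: "H:aL" using H clch by auto
 obtain n where i: "kG g:KL" "aG g:aL" "n:NN L" "g = kG g**expG (aG g)**n" by (rule iwasawa[OF g])
 have c: "n:CL" "kG g:CL" using i KKc NNc by auto
 obtain Z where Z: "Z:sp (%ro. ro H1 > 0)" "n = expG Z" using i(3) by (auto simp: NN_eq nn_sp)
 have Z0: "Z:sp (%ro. ro H >= 0)" using Z(1) by (rule sp_mono_roots) (use roots_H1(2) dominant_pos_roots[OF H] in auto)
 have ZH: "bk Z H:sp (%ro. ro H > 0)" using Z0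
 proof (induction rule: sp_induct)
  case (base ro x)
  have "bk x H = (- ro H) *R x" using base(3) Ha bk_anti[of x H] by (simp add: root_space_def)
  thus ?case using base root_space_sp subspace_0[OF sub_sp] subspace_scale[OF sub_sp] by (cases "ro H = 0") (auto intro!: subspace_neg[OF sub_sp])
 qed (auto simp: br.zero_left br.add_left subspace_0[OF sub_sp] intro: subspace_add[OF sub_sp])
 have "AD (expG (1 *R Z)) H-H:sp (%ro. ro H > 0)"
 proof (rule Ad_expG_subspace[OF sub_sp _ ZH])
  fix W assume W: "W:sp (%ro. ro H > 0)"
  show "bk Z W:sp (%ro. ro H > 0)" by (rule sp_bracket[OF Z0 W]) auto
 qed
 hence Y: "AD (expG (aG g)) (AD n H-H):sp (%ro. ro H > 0)"
  using sp_centralized[OF expGc Ha Ad_AA[OF i(2) Ha], of _ "%c. c > 0"] by (simp add: Z(2))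
 have "AD g H = AD (kG g**expG (aG g)**n) H" using i(4) by simp
 also have "... = AD (kG g) (H+AD (expG (aG g)) (AD n H-H))" using c Ad_AA[OF i(2) Ha] by (simp add: Adm Adlin)
 finally show thesis using that[OF i(1) Y] by blast
qed

text \<open>The orbit map is supplemented by the identity in the complementary directions, so that
  the derivative at \<open>0\<close> becomes bijective and the open mapping theorem applies. A value
  without complementary component comes from an argument without one.\<close>

lemma expG_covers_orbit:
 assumes H: "H:aL"
 obtains de where "de > 0" "!!Y. Y:sp (%ro. ro H > 0) ==> norm Y < de ==> EX Z:cball 0 1. H+Y = AD (expG Z) H"
proof -
 define P :: "('l => real) => bool" where "P ro \<longleftrightarrow> ro H > 0" for ro
 define p where "p = pral (sp P) (sp (%ro. ~ P ro))"
 note p = proj_along_sp[where P = P, folded p_def]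
 obtain K where K: "K > 0" "!!x. norm (p x) <= norm x * K"
  using bounded_linear.pos_bounded[OF linear_conv_bounded_linear[THEN iffD1, OF p(3)]] by auto
 define f where "f X = AD (expG (p X)) H-H+(X-p X)" for X
 define f' where "f' X = bk (p X) H+(X-p X)" for X
 have bp: "bounded_linear p" using p(3) by (simp add: linear_conv_bounded_linear)
 have d: "(f hasD f') (at 0)"
 proof -
  have "tang (%X. expG (p X)) p 0" by (rule tang_compose[OF _ bounded_linear_imp_has_derivative[OF bp]]) (use tang_expG linear_0[OF p(3)] in simp)
  from bracket_tang[OF this, of H] have "((%X. AD (expG (p X)) H-H) hasD (%X. bk (p X) H)) (at 0)"
   using has_derivative_diff[OF _ has_derivative_const, of _ _ "at 0" H] by simp
  from has_derivative_add[OF this has_derivative_diff[OF has_derivative_ident bounded_linear_imp_has_derivative[OF bp]]]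
  show ?thesis unfolding f_def f'_def .
 qed
 have eig: "bk H x:sp P" if "x:sp P" for x by (rule sp_bracket[OF aa_sp[OF H, of "%ro. ro = (%_. 0)"] that]) auto
 have "inj f'"
 proof (rule linear_injective_0[THEN iffD2, rule_format])
  show "linear f'" using d has_derivative_linear by blast
  fix X assume f0: "f' X = 0"
  have 1: "bk (p X) H:sp P" using subspace_neg[OF sub_sp eig[OF p(1)[of X]]] bk_anti[of "p X" H] by simp
  have X: "X-p X = 0" using f0 subspace_neg[OF sub_sp 1] sp_disjoint[OF _ p(2), of X P] f'_def eq_neg_iff_add_eq_0 add.commute by metis
  hence "bk H (p X) = 0 *R p X" using f0 bk_anti[of H "p X"] by (simp add: f'_def)
  from eigen_sp[OF H this] have "p X = 0" using sp_disjoint[OF p(1)[of X]] by (auto simp: P_def)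
  thus "X = 0" using X by simp
 qed
 then obtain g' where g': "linear g'" "f' \<circ> g' = id"
  using linear_surjective_right_inverse[OF has_derivative_linear[OF d] linear_injective_imp_surjective[OF has_derivative_linear[OF d]]] by auto
 define e where "e = 1/(K+1)"
 have e: "e > 0" "e * K <= 1" using K(1) by (simp_all add: e_def)
 have cf: "continuous_on UNIV f"
 proof -
  have "cmap euclidean euclidean (%X. AD (expG (p X)) H)" by (intro continuous_map_Ad cmap_expGc) (use linear_continuous_on[OF bp] in auto)
  thus ?thesis unfolding f_def using linear_continuous_on[OF bp] by (auto intro!: continuous_intros)
 qed
 have "f 0:interior (f ` ball 0 e)" by (rule sussmann_open_mapping[OF open_UNIV cf _ d _ g'(2)])
   (use g'(1) e in "auto simp: linear_conv_bounded_linear interior_open")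
 moreover have "f 0 = 0" using linear_0[OF p(3)] by (simp add: f_def)
 ultimately obtain de where de: "de > 0" "ball 0 de <= f ` ball 0 e" by (auto simp: mem_interior)
 show thesis
 proof (rule that[OF de(1)])
  fix Y assume Y: "Y:sp (%ro. ro H > 0)" "norm Y < de"
  then obtain X where X: "norm X < e" "Y = f X" using de(2) by (auto simp: subset_iff)
  have "AD (expG (1 *R p X)) H-H:sp P"
  proof (rule Ad_expG_subspace[OF sub_sp])
   show "bk (p X) H:sp P" using subspace_neg[OF sub_sp eig[OF p(1)[of X]]] bk_anti[of "p X" H] by simp
   fix W assume W: "W:sp P"
   show "bk (p X) W:sp P" by (rule sp_bracket[OF p(1) W]) (simp add: P_def)
  qed
  hence "H+Y = AD (expG (p X)) H" using subspace_diff[OF sub_sp, of Y P] Y X sp_disjoint[OF _ p(2), of X P] by (fastforce simp: f_def P_def[abs_def])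
  moreover have "norm (p X) <= 1" using K(2) mult_right_mono X(1) K(1) e(2) by (smt (verit) )
  ultimately show "EX Z:cball 0 1. H+Y = AD (expG Z) H" by auto
 qed
qed

text \<open>Write the orbit point as \<open>AD k (H + Y)\<close>. As \<open>Y\<close> is orthogonal
  to \<open>H\<close> and \<open>k\<close> preserves \<open>B\<close>, its squared norm exceeds that
  of \<open>H\<close> by the squared norm of \<open>Y\<close>, so nearness to \<open>H\<close> makes
  \<open>Y\<close> small whatever \<open>k\<close> is.\<close>

lemma orbit_local:
 assumes H: "H:cch"
 obtains C de where "compactin G C" "de > 0"
  "!!g. g:CL ==> norm (AD g H-H) < de ==> EX c:C. AD g H = AD c H"
proof -
 have Ha: "H:aL" using H clch by auto
 obtain e where e: "e > 0" "!!Y. Y:sp (%ro. ro H > 0) ==> norm Y < e ==> EX Z:cball 0 1. H+Y = AD (expG Z) H"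
  using expG_covers_orbit[OF Ha] by auto
 obtain C where C: "C > 0" "!!x. norm x <= C * nB x" using norm_le_nB by blast
 have "open {D. B D D < B H H+(e/C)\<^sup>2}" by (intro open_Collect_less Bf.continuous_on continuous_intros)
 moreover have "H : {D. B D D < B H H+(e/C)\<^sup>2}" using e(1) C(1) by simp
 ultimately obtain de where de: "de > 0" "ball H de <= {D. B D D < B H H+(e/C)\<^sup>2}" by (meson open_contains_ball)
 define CC where "CC = (%(k,Z). k**expG Z) ` (KL \<times> cball 0 1)"
 have "compactin G CC" unfolding CC_def
 proof (rule image_compactin)
  show "compactin (prod_topology G euclidean) (KL \<times> cball (0::'l) 1)" using compact_KK by (simp add: compactin_Times)
  show "cmap (prod_topology G euclidean) G (%(k,Z). k**expG Z)" by (simp add: case_prod_unfold) (intro cmap_mult cmap_expGc continuous_map_fst continuous_map_snd)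
 qed
 thus thesis
 proof (rule that[OF _ de(1)])
  fix g assume g: "g:CL" "norm (AD g H-H) < de"
  obtain k Y where kY: "k:KL" "Y:sp (%ro. ro H > 0)" "AD g H = AD k (H+Y)" by (rule Ad_orbit_form[OF H g(1)])
  have "B H Y = 0" by (rule sp_orthogonal[OF aa_sp[OF Ha, of "%ro. ro = (%_. 0)"] kY(2)]) auto
  hence "B (AD g H) (AD g H) = B H H+B Y Y" by (simp add: kY(3) Ad_KK(4)[OF kY(1)] Bf.add_right B_sym)
  moreover have "AD g H:ball H de" using g(2) by (simp add: dist_norm norm_minus_commute)
  ultimately have "(nB Y)\<^sup>2 < (e/C)\<^sup>2" using de(2) nB_sq by (auto simp: power2_eq_square)
  hence "nB Y < e/C" by (rule power2_less_imp_less) (use e(1) C(1) in simp)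
  then obtain Z where Z: "Z:cball 0 1" "H+Y = AD (expG Z) H" using C(2)[of Y] C(1) e(2)[OF kY(2)] by (auto simp: pos_less_divide_eq mult.commute)
  show "EX c:CC. AD g H = AD c H" using Z kY KKc by (intro bexI) (auto simp: CC_def Adm)
 qed
qed

subsection \<open>Weyl group orbits\<close>

text \<open>Weyl group orbits, generated by simple reflections without reference to cosets.\<close>

inductive_set RO :: "('l => real) set => 'l => 'l set" for Th X where
 RO_base: "X:RO Th X"
| RO_step: "x:RO Th X ==> ro:Th ==> rfl ro x:RO Th X"

lemma RO_trans: "y:RO Th x ==> x:RO Th X ==> y:RO Th X" by (induction rule: RO.induct) (auto intro: RO_step)

text \<open>Reflections in roots that vanish at \<open>H\<close> fix \<open>H\<close>, so their
  representatives in \<open>K\<close> may be multiplied inside \<open>KH H\<close>.\<close>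

lemma RO_KH:
 assumes "Th = {ro:sL. ro H = 0}" "H:aL" "X:aL" "x:RO Th X"
 shows "x:aL&(EX k:KH H. (ALL Y:aa L. AD k Y:aL)&AD k X = x)" using assms(4)
proof induction
 case RO_base
 thus ?case using KHs(4) assms(3) by force
next
 case (RO_step x ro)
 then obtain k where k: "k:KH H" "!!Y. Y:aL ==> AD k Y:aL" "AD k X = x" and x: "x:aL" by blast
 have a: "ro:rL" "ro H = 0" using RO_step.hyps(2) assms(1) simple_roots by auto
 obtain q where q: "q:KL" "!!H. H:aL ==> AD q H = rfl ro H" using reflection_in_KK[OF a(1)] by auto
 have "q**k:KH H" using q a assms(2) KHs(5) k(1) by (fastforce simp: KH_def root_reflection_def)
 moreover have "AD (q**k) Y = rfl ro (AD k Y)" if "Y:aL" for Y using q k that KHs(3) KKc by (simp add: Adm)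
 ultimately show ?case using rfl_aa[OF a(1)] k assms(3) by (intro conjI bexI) auto
qed

lemma RO_aa: assumes "Th <= sL" "X:aL" "x:RO Th X" shows "x:aL" using assms(3) by induction (use assms(1,2) simple_roots rfl_aa in auto)

lemma root_reflection_involution:
 assumes "ro:rL" "H:aL" shows "rfl ro (rfl ro H) = H"
proof -
 define c where "c = 2 * ro H/ro (rvec ro)"
 note r = root_vector[OF assms(1)] and d = dual_aaD[OF rootsD(1)[OF assms(1)]]
 have rH: "rfl ro H = H-c *R rvec ro" by (simp add: root_reflection_def c_def)
 show ?thesis unfolding rH by (simp add: root_reflection_def) (use d(5)[OF assms(2) subspace_scale[OF subsp(3) r(1)]] d(2)[OF r(1)] in "(simp add: c_def)")
qed

lemma reflected_root:
 assumes "ro:rL" "rb:rL" shows "EX ga:roots L. ALL H:aa L. ga H = rb (rfl ro H)"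
proof -
 obtain q where q: "q:KL" "!!H. H:aL ==> AD q H = rfl ro H" using reflection_in_KK[OF assms(1)] by auto
 have qc: "q:CL" using q KKc by blast
 have qa: "AD q H:aL" if "H:aL" for H using q(2)[OF that] rfl_aa[OF assms(1) that] by simp
 define ga where "ga H = (if H:aL then rb (AD q H) else 0)" for H
 note b = rootsD[OF assms(2)]
 obtain E where E: "E:rsp rb" "E ~= 0" using b(2) by blast
 have "ga:dual_aa L" using qa subspace_add[OF subsp(3)] subspace_scale[OF subsp(3)]
  by (intro dual_aaI) (auto simp: ga_def dual_aaD[OF b(1)] Adlin[OF qc])
 moreover have "AD (inv q) E:rsp ga" unfolding root_space_def
 proof (intro CollectI ballI)
  fix H assume H: "H:aL"
  show "bk H (AD (inv q) E) = ga H *R AD (inv q) E" using E(1) qa qc Ad_inv(1)[OF qc, of "bk H (AD (inv q) E)"] H by (simp add: ga_def Adlin Ad_bracket root_space_def)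
 qed
 moreover have "ga ~= (%_. 0)"
 proof
  assume g0: "ga = (%_. 0)"
  have "rb H = 0" if H: "H:aL" for H
  proof -
   show ?thesis using rfl_aa[OF assms(1) H] q(2) root_reflection_involution[OF assms(1) H] g0 by (metis ga_def)
  qed
  thus False using dual_aaD(3)[OF b(1)] b(3) by blast
 qed
 ultimately show ?thesis using E(2) Ad_inv(2)[OF qc, of E] Adlin(5)[OF qc] q(2) by (intro bexI[of _ ga]) (auto simp: roots_def ga_def)
qed

text \<open>Differences of orbit points lie in the span of the simple root vectors, so the values of
  the simple roots determine a point. Reflections permute roots, so these values are among the
  finitely many values of roots at \<open>X\<close>.\<close>

lemma finite_RO: assumes Th: "Th <= sL" and X: "X:aL" shows "finite (RO Th X)"
proof -
 define V where "V = span (rvec ` sL)"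
 have 1: "x-X:V&(ALL rb:roots L. EX ga:roots L. rb x = ga X)" if "x:RO Th X" for x using that
 proof induction
  case RO_base
  thus ?case using span_0 by (auto simp: V_def)
 next
  case (RO_step x ro)
  have a: "ro:rL" "ro:sL" using RO_step.hyps(2) Th simple_roots by auto
  have "(2 * ro x/ro (rvec ro)) *R rvec ro:V" unfolding V_def using a(2) by (intro span_scale span_base) auto
  hence "rfl ro x-X:V" using RO_step.IH span_diff[of "x-X" "rvec ` sL" "(2 * ro x/ro (rvec ro)) *R rvec ro"]
   by (simp add: root_reflection_def V_def algebra_simps)
  moreover have "EX ga:roots L. rb (rfl ro x) = ga X" if "rb:rL" for rb
   using reflected_root[OF a(1) that] RO_step.IH RO_aa[OF Th X RO_step.hyps(1)] by metis
  ultimately show ?case by blast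
 qed
 have "inj_on (%x. \<lambda>si\<in>simple L. si x) (RO Th X)"
 proof (rule inj_onI)
  fix x y assume xy: "x:RO Th X" "y:RO Th X" "(\<lambda>si\<in>simple L. si x) = (\<lambda>si\<in>simple L. si y)"
  have aa: "x:aL" "y:aL" using RO_aa[OF Th X] xy by auto
  have d: "x-y:aL" using aa subspace_diff[OF subsp(3)] by simp
  have xyV: "x-y:V" using 1[OF xy(1)] 1[OF xy(2)] span_diff[of "x-X" _ "y-X"] by (simp add: V_def)
  have "fo w (x-y) = 0" if "w:V" for w using that unfolding V_def
  proof (induction rule: span_induct_alt)
   case (step c v z)
   obtain si where s: "si:sL" "v = rvec si" using step by blast
   have "si x = si y" using xy(3) s(1) by (metis restrict_apply)
   thus ?case using root_vector(2) s simple_roots d dual_aaD(5)[OF rootsD(1) aa, of si] step by (auto simp: fm.add_left fm.scaleR_left)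
  qed (simp add: fm.zero_left)
  from this[OF xyV] have "x-y = 0" using form_ss d aa_ss by force
  thus "x = y" by simp
 qed
 moreover have "(%x. \<lambda>si\<in>simple L. si x) ` RO Th X <= sL \<rightarrow>\<^sub>E (%ga. ga X) ` rL" using 1 simple_roots by force
 moreover have "finite (sL \<rightarrow>\<^sub>E (%ga. ga X) ` rL)" using finite_simple finite_roots by (intro finite_PiE) auto
 ultimately show ?thesis using inj_on_finite by blast
qed

text \<open>A point of the finite orbit with the largest pairing with \<open>H1\<close> cannot be
  improved by a reflection of \<open>Th\<close>.\<close>

lemma RO_rdom:
 assumes Th: "Th = {ro:sL. ro H = 0}" and X: "X:aL"
 obtains x where "x:RO Th X" "rdom H x"
proof -
 have Ths: "Th <= sL" using Th by auto
 have fin: "finite ((%x. fo H1 x) ` RO Th X)" using finite_RO[OF Ths X] by simp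
 have "Max ((%x. fo H1 x) ` RO Th X):(%x. fo H1 x) ` RO Th X" using fin RO_base by (intro Max_in) auto
 then obtain x where x: "x:RO Th X" "Max ((%x. fo H1 x) ` RO Th X) = fo H1 x" by blast
 have xa: "x:aL" using RO_aa[OF Ths X x(1)] .
 have "rdom H x" unfolding rdom_def
 proof (intro conjI ballI impI xa)
  fix ro assume a: "ro:sL" "ro H = 0"
  hence r: "ro:rL" "ro H1 > 0" using simple_roots H1(1) by (auto simp: chamber_def)
  have "fo H1 (rfl ro x) <= fo H1 x" using RO_step[OF x(1)] a Th Max_ge[OF fin] x(2) by auto
  thus "ro x >= 0" using form_root_reflection[OF r(1) H1(2) xa] r(2) root_vector(3)[OF r(1)] by (simp add: zero_le_divide_iff zero_le_mult_iff)
 qed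
 thus thesis using that x by blast
qed

lemma norm_aas:
 assumes "k:normalizer_aa L"
 shows "k:KL" "k:CL" "H:aL ==> AD k H:aL" "H:aL ==> AD (inv k) H:aL"
proof -
 show 1: "k:KL" "k:CL" using assms KKc by (auto simp: normalizer_aa_def)
 show "H:aL ==> AD k H:aL" using assms by (auto simp: normalizer_aa_def)
 show "AD (inv k) H:aL" if "H:aL"
 proof -
  have "H:AD k ` aL" using assms that by (simp add: normalizer_aa_def)
  thus ?thesis using Ad_inv(1)[OF 1(2)] by auto
 qed
qed

lemma normalizer_aaI:
 assumes "k:KL" "!!H. H:aL ==> AD k H:aL" "!!H. H:aL ==> AD (inv k) H:aL"
 shows "k:normalizer_aa L"
proof -
 have "aL <= AD k ` aL"
 proof
  fix H assume "H:aL"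
  thus "H:AD k ` aL" using assms(3) Ad_inv(2)[OF KKc[OF assms(1)], of H] by force
 qed
 thus ?thesis using assms(1,2) by (auto simp: normalizer_aa_def)
qed

lemma subgroup_normalizer: "subgroup (normalizer_aa L) L"
proof (rule subgroupI)
 show "normalizer_aa L <= CL" using norm_aas by auto
 have "\<one>:normalizer_aa L" by (rule normalizer_aaI) (simp_all add: KK_one)
 thus "normalizer_aa L ~= {}" by blast
 show "inv k:normalizer_aa L" if "k:normalizer_aa L" for k using norm_aas[OF that] by (intro normalizer_aaI KK_inv) auto
 show "k**k':normalizer_aa L" if "k:normalizer_aa L" "k':normalizer_aa L" for k k' using norm_aas[OF that(1)] norm_aas[OF that(2)]
  by (intro normalizer_aaI KK_mult) (auto simp: Adm inv_mult_group)
qed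

abbreviation "LN == L\<lparr>carrier := normalizer_aa L\<rparr>"

lemma group_LN: "group LN" by (rule subgroup.subgroup_is_group[OF subgroup_normalizer group_L])

lemma M0_normalizer: "m:M0 ==> m:normalizer_aa L" "m:M0 ==> H:aL ==> AD (inv m) H = H"
proof -
 assume m: "m:M0"
 show 1: "AD (inv m) H = H" if "H:aL" for H using Ad_inv(1)[OF M0_simps(2)[OF m], of H] M0_simps(3)[OF m that] by simp
 show "m:normalizer_aa L" using M0_simps(1-3)[OF m] 1 by (intro normalizer_aaI) auto
qed

lemma normal_M0: "normal M0 LN" unfolding group.normal_inv_iff[OF group_LN]
proof (intro conjI ballI)
 show "subgroup M0 LN"
 proof (rule group.subgroupI[OF group_LN])
  fix m assume m: "m:M0"
  show "inv\<^bsub>LN\<^esub> m:M0" using M0_normalizer(2)[OF m] KK_inv[OF M0_simps(1)[OF m]] m_inv_consistent[OF subgroup_normalizer M0_normalizer(1)[OF m]] by (simp add: centralizer_aa_def)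
  show "m \<otimes>\<^bsub>LN\<^esub> m':M0" if "m':M0" for m'
   using M0_simps(1-3)[OF m] M0_simps(1-3)[OF that] KK_mult by (simp add: centralizer_aa_def Adm)
 qed (use M0_normalizer(1) M0_simps(4) in auto)
 fix x h assume "x:carrier LN" and h: "h:M0"
 hence x: "x:normalizer_aa L" by simp
 show "x \<otimes>\<^bsub>LN\<^esub> h \<otimes>\<^bsub>LN\<^esub> inv\<^bsub>LN\<^esub> x:M0" using norm_aas[OF x] M0_simps(1-3)[OF h] m_inv_consistent[OF subgroup_normalizer x] by (simp add: centralizer_aa_def Adm KK_mult KK_inv)
qed

text \<open>All representatives in the coset \<open>w\<close> act on \<aa> by the one map
  \<open>f\<close>, which is what gives the definite description in \<open>weyl_act\<close> its
  value.\<close>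

definition ract :: "'g set => ('l => 'l) => bool" where
 "ract w f \<longleftrightarrow> w ~= {}&(ALL k:w. k:normalizer_aa L&(ALL X:aa L. AD k X = f X))"

lemma ract_aa: "ract w f ==> X:aL ==> f X:aL" using norm_aas(3) unfolding ract_def by fastforce

lemma weyl_act_eq: "ract w f ==> X:aL ==> weyl_act L w X = f X" unfolding weyl_act_def ract_def by auto

lemma ract_coset: "n:normalizer_aa L ==> ract (M0 #>\<^bsub>LN\<^esub> n) (AD n)"
proof -
 assume n: "n:normalizer_aa L"
 have "m**n:normalizer_aa L&(ALL X:aa L. AD (m**n) X = AD n X)" if "m:M0" for m
  using subgroup.m_closed[OF subgroup_normalizer M0_normalizer(1)[OF that] n] norm_aas[OF n] M0_simps(1-3)[OF that] by (simp add: Adm)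
 thus ?thesis using M0_simps(4) by (auto simp: ract_def r_coset_def)
qed

lemma weyl_carrier: "w:carrier (weyl_group L) ==> EX n:normalizer_aa L. w = M0 #>\<^bsub>LN\<^esub> n"
 by (auto simp: weyl_group_def FactGroup_def RCOSETS_def)

lemma ract_mult: "ract w f ==> ract w' f' ==> ract (w \<otimes>\<^bsub>weyl_group L\<^esub> w') (%X. f (f' X))"
proof -
 assume w: "ract w f" and w': "ract w' f'"
 have "k**k':normalizer_aa L&(ALL X:aa L. AD (k**k') X = f (f' X))" if "k:w" "k':w'" for k k'
 proof -
  show ?thesis using that w w' subgroup.m_closed[OF subgroup_normalizer] norm_aas ract_aa by (auto simp: ract_def Adm)
 qed
 thus ?thesis using w w' by (auto simp: weyl_group_def set_mult_def ract_def)
qed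

lemma weyl_orbit:
 assumes Th: "Th <= sL" and X: "X:aL"
 shows "{weyl_act L w X | w. w:weyl_subgroup L Th} = RO Th X"
proof (rule subset_antisym; rule subsetI)
 define S where "S = {w:carrier (weyl_group L). EX ro:Th. ALL H:aa L. weyl_act L w H = rfl ro H}"
 have S: "EX ro:Th. ract w (rfl ro)" if w: "w:S" for w
 proof -
  obtain ro where a: "ro:Th" "!!H. H:aL ==> weyl_act L w H = rfl ro H" using w by (auto simp: S_def)
  obtain n where n: "n:normalizer_aa L" "w = M0 #>\<^bsub>LN\<^esub> n" using weyl_carrier w by (auto simp: S_def)
  have "ract w (AD n)" using ract_coset n by simp
  moreover have "AD n H = rfl ro H" if "H:aL" for H using a(2)[OF that] weyl_act_eq[OF \<open>ract w (AD n)\<close> that] by simp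
  ultimately show ?thesis using a(1) by (auto simp: ract_def)
 qed
 {
  fix x assume "x : {weyl_act L w X | w. w:weyl_subgroup L Th}"
  then obtain w where w: "w:generate (weyl_group L) S" "x = weyl_act L w X" by (auto simp: weyl_subgroup_def S_def)
  have step: "rfl ro X:RO Th X" if "ro:Th" for ro X by (rule RO_step[OF RO_base that])
  from w(1) have "EX f. ract w f&(ALL X:aa L. f X:RO Th X)"
  proof induction
   case one
   show ?case using M0_simps M0_normalizer(1) RO_base by (auto simp: weyl_group_def ract_def)
  next
   case (incl h)
   thus ?case using S step by blast
  next
   case (inv h)
   \<comment> \<open>The inverse coset acts by the same reflection, since a reflection is an
     involution.\<close>
   obtain ro where a: "ro:Th" "ract h (rfl ro)" using S[OF inv] by blast
   have ar: "ro:rL" using a Th simple_roots by auto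
   have h: "h:carrier (LN Mod M0)" using inv by (simp add: S_def weyl_group_def)
   have hi: "inv\<^bsub>weyl_group L\<^esub> h = (%k. inv k) ` h" unfolding weyl_group_def using a(2) m_inv_consistent[OF subgroup_normalizer] normal.inv_FactGroup[OF normal_M0 h] by (auto simp: SET_INV_def ract_def)
   have "ract (inv\<^bsub>weyl_group L\<^esub> h) (rfl ro)" unfolding ract_def hi
   proof (intro conjI ballI)
    show "(%k. inv k) ` h ~= {}" using a(2) by (simp add: ract_def)
    fix k assume "k:(%k. inv k) ` h"
    then obtain q where q: "q:h" "k = inv q" by blast
    have qn: "q:normalizer_aa L" "!!X. X:aL ==> AD q X = rfl ro X" using a(2) q(1) by (auto simp: ract_def)
    show "k:normalizer_aa L" using subgroup.m_inv_closed[OF subgroup_normalizer qn(1)] q by simp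
    fix Y assume Y: "Y:aL"
    show "AD k Y = rfl ro Y" using qn(2) rfl_aa[OF ar Y] root_reflection_involution[OF ar Y] Ad_inv(1)[OF norm_aas(2)[OF qn(1)], of "rfl ro Y"] q by simp
   qed
   thus ?case using step a(1) by blast
  next
   case (eng h1 h2)
   then obtain f1 f2 where f: "ract h1 f1" "ract h2 f2" "!!X. X:aL ==> f1 X:RO Th X" "!!X. X:aL ==> f2 X:RO Th X" by blast
   show ?case by (rule exI[of _ "%X. f1 (f2 X)"]) (use ract_mult[OF f(1,2)] f(3)[OF ract_aa[OF f(2)]] f(4) RO_trans in blast)
  qed
  thus "x:RO Th X" using weyl_act_eq w(2) X by auto
 next
  fix x assume "x:RO Th X"
  hence "EX w:generate (weyl_group L) S. EX f. ract w f&x = f X"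
  proof induction
   case RO_base
   have "ract (\<one>\<^bsub>weyl_group L\<^esub>) (%X. X)" using M0_simps M0_normalizer(1) by (auto simp: weyl_group_def ract_def)
   thus ?case using generate.one by blast
  next
   case (RO_step x ro)
   then obtain w f where w: "w:generate (weyl_group L) S" "ract w f" "x = f X" by blast
   have ar: "ro:rL" using RO_step.hyps(2) Th simple_roots by auto
   obtain q where q: "q:KL" "!!H. H:aL ==> AD q H = rfl ro H" using reflection_in_KK[OF ar] by blast
   have "AD (inv q) Y = rfl ro Y" if Y: "Y:aL" for Y using Ad_inv(1)[OF KKc[OF q(1)], of "rfl ro Y"] q(2)[OF rfl_aa[OF ar Y]]
     root_reflection_involution[OF ar Y] by simp
   hence qn: "q:normalizer_aa L" using q rfl_aa[OF ar] by (intro normalizer_aaI) auto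
   define h where "h = M0 #>\<^bsub>LN\<^esub> q"
   have h: "ract h (rfl ro)" using ract_coset[OF qn] q(2) by (simp add: h_def ract_def)
   have "h:S" using qn weyl_act_eq[OF h] RO_step.hyps(2) by (auto simp: S_def h_def weyl_group_def FactGroup_def RCOSETS_def)
   thus ?case using generate.eng[OF generate.incl w(1)] ract_mult[OF h w(2)] w(3) by auto
  qed
  then obtain w f where w: "w:generate (weyl_group L) S" "ract w f" "x = f X" by blast
  hence "x = weyl_act L w X" using weyl_act_eq[OF w(2) X] by simp
  moreover have "w:weyl_subgroup L Th" using w(1) by (simp add: weyl_subgroup_def S_def)
  ultimately show "x : {weyl_act L w X | w. w:weyl_subgroup L Th}" by blast
 }
qed

end

section \<open>Uniquely ergodic maps of compact metric spaces\<close>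

text \<open>
 A compact metric space is coded by reals through the digits \<open>x \<in> U i\<close>, where \<open>U\<close> enumerates finite
 covers by small balls; the inverse of the code is uniformly continuous.
\<close>

lemma compact_code:
 assumes "compact (UNIV :: 'x::metric_space set)"
 obtains s :: "'x::metric_space => real" where "!!x. 0 <= s x&s x <= 3/2"
  "!!e. e > 0 ==> EX de>0. ALL x y. \<bar>s x-s y\<bar> < de --> dist x y < e"
proof -
 have "EX C. finite C&(UNIV :: 'x set) <= (\<Union>c\<in>C. ball c (1/real (Suc m)))" for m
  using assms unfolding compact_eq_totally_bounded by simp
 then obtain C where C: "!!m. finite (C m)" "!!m. (UNIV :: 'x set) <= (\<Union>c\<in>C m. ball c (1/real (Suc m)))" by metis
 define UU where "UU = (\<Union>m. (%c. ball c (1/real (Suc m))) ` C m)"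
 obtain c0 where "c0:C 0" using C(2)[of 0] by blast
 hence ne: "UU ~= {}" by (auto simp: UU_def)
 have cU: "countable UU" unfolding UU_def by (rule) (use C(1) in "simp_all add: countable_finite")
 define U where "U = from_nat_into UU"
 define c where "c x k = (if x:U k then 1 else 0 :: real)" for x k
 define s where "s x = (\<Sum>k. c x k * (1/3) ^ k)" for x
 have geo: "summable (%k. (1/3::real) ^ k)" "(\<Sum>k. (1/3::real) ^ k) = 3/2" by (simp_all add: suminf_geometric)
 have sm: "summable (%k. c x k * (1/3) ^ k)" for x by (rule summable_comparison_test'[OF geo(1)]) (simp add: c_def)
 have "0 <= s x&s x <= 3/2" for x unfolding s_def geo(2)[symmetric] by (intro conjI suminf_nonneg suminf_le sm) (auto simp: c_def)
 moreover have "EX de>0. ALL x y. \<bar>s x-s y\<bar> < de --> dist x y < e" if e: "e > 0" for e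
 proof -
  obtain m :: nat where m: "2/e < real (Suc m)" using reals_Archimedean2 by (metis less_Suc_eq less_trans of_nat_less_iff)
  hence me: "2 * (1/real (Suc m)) < e" using e by (simp add: field_simps)
  have sub: "(%c. ball c (1/real (Suc m))) ` C m <= UU" by (auto simp: UU_def)
  \<comment> \<open>\<open>N\<close> exceeds the index of every ball in the cover of level
    \<open>m\<close>, so two points agreeing in the digits below \<open>N\<close> share a ball of
    that level.\<close>
  define N where "N = Suc (Max (to_nat_on UU ` (%c. ball c (1/real (Suc m))) ` C m))"
  show ?thesis
  proof (intro exI[of _ "(1/3) ^ N/2"] conjI allI impI)
   fix x y assume xy: "\<bar>s x-s y\<bar> < (1/3) ^ N/2"
   \<comment> \<open>If the digits differed for the first time at \<open>k < N\<close>, that term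
     would have size \<open>(1/3)^k\<close> and all later ones together at most half of it. The
     codes would then be at least \<open>(1/3)^N / 2\<close> apart.\<close>
   have agree: "c x k = c y k" if "k < N" for k using that
   proof (induction k rule: less_induct)
    case (less k)
    define r where "r = (%i. (c x i-c y i) * (1/3) ^ i)"
    have sr: "summable r" unfolding r_def left_diff_distrib by (intro summable_diff sm)
    have "s x-s y = suminf r" unfolding s_def r_def left_diff_distrib by (rule suminf_diff[OF sm sm])
    also have "... = (\<Sum>i. r (i+Suc k))+(\<Sum>i<Suc k. r i)" by (rule suminf_split_initial_segment[OF sr])
    also have "(\<Sum>i<Suc k. r i) = r k" using less by (simp add: r_def)
    finally have 1: "s x-s y = (\<Sum>i. r (i+Suc k))+r k" .
    have "\<bar>r (i+Suc k)\<bar> <= (1/3) ^ Suc k * (1/3) ^ i" for i by (simp add: r_def c_def power_add abs_mult)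
    hence "\<bar>\<Sum>i. r (i+Suc k)\<bar> <= (\<Sum>i. (1/3) ^ Suc k * (1/3) ^ i)"
     using norm_suminf_le[of "%i. r (i+Suc k)" "%i. (1/3) ^ Suc k * (1/3) ^ i"] by simp
    also have "... = (1/3) ^ k/2" using suminf_mult[OF geo(1), of "(1/3) ^ Suc k"] geo(2) by simp
    finally have 2: "\<bar>\<Sum>i. r (i+Suc k)\<bar> <= (1/3) ^ k/2" .
    have "(1/3::real) ^ N <= (1/3) ^ k" using less by simp
    hence "\<bar>r k\<bar> < (1/3) ^ k" using 1 2 xy by linarith
    thus "c x k = c y k" by (auto simp: r_def c_def if_splits)
   qed
   obtain b where b: "b:C m" "x:ball b (1/real (Suc m))" using C(2)[of m] by blast
   define k where "k = to_nat_on UU (ball b (1/real (Suc m)))"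
   have "k < N" unfolding N_def k_def using b(1) C(1) by (intro le_imp_less_Suc) auto
   moreover have "U k = ball b (1/real (Suc m))" unfolding U_def k_def using sub b(1) by (intro from_nat_into_to_nat_on[OF cU]) auto
   ultimately show "dist x y < e" using agree[of k] b(2) me dist_triangle3[of x y b] by (simp add: c_def if_splits)
  qed simp
 qed
 ultimately show thesis using that by blast
qed

text \<open>The code need not be continuous, nor its range closed. Its inverse, being uniformly
  continuous, extends by sequential compactness to a continuous map on the closure of the range,
  which is where weak limits of coded measures live.\<close>

lemma compact_code_inverse:
 assumes "compact (UNIV :: 'x::metric_space set)"
 obtains s :: "'x::metric_space => real" and K p where "!!x. 0 <= s x&s x <= 3/2" "closed K" "continuous_on K p" "!!x. s x:K" "!!x. p (s x) = x"
proof -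
 obtain s :: "'x => real" where s: "!!x. 0 <= s x&s x <= 3/2"
  "!!e. e > 0 ==> EX de>0. ALL x y. \<bar>s x-s y\<bar> < de --> dist x y < e" using compact_code[OF assms] by blast
 define K where "K = closure (range s)"
 have "EX x. ALL e>0. EX de>0. ALL y. \<bar>s y-t\<bar> < de --> dist y x < e" if t: "t:K" for t
 proof -
  obtain z where z: "ALL n. z n:range s" "z ----> t" using t unfolding K_def closure_sequential by auto
  define y where "y n = (SOME y. z n = s y)" for n
  have "z n = s (y n)" for n using z(1) unfolding y_def by (intro someI_ex[of "%y. z n = s y"]) blast
  hence y: "(%n. s (y n)) ----> t" using z(2) by (metis (no_types) ext)
  obtain x r where x: "strict_mono r" "(y \<circ> r) ----> x" using assms[unfolded compact_eq_seq_compact_metric seq_compact_def] by blast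
  have y': "(%n. s (y (r n))) ----> t" using LIMSEQ_subseq_LIMSEQ[OF y x(1)] by (simp add: o_def)
  show ?thesis
  proof (rule exI[of _ x], intro allI impI)
   fix e :: real assume e: "e > 0"
   obtain de where d: "de > 0" "!!x y. \<bar>s x-s y\<bar> < de ==> dist x y < e/2" using s(2)[of "e/2"] e by auto
   have "\<forall>\<^sub>F n in sequentially. dist (s (y (r n))) t < de/2&dist (y (r n)) x < e/2"
    using tendstoD[OF y', of "de/2"] tendstoD[OF x(2), of "e/2"] d(1) e by (simp add: eventually_conj_iff)
   then obtain n where n: "dist (s (y (r n))) t < de/2" "dist (y (r n)) x < e/2" using eventually_happens by fastforce
   show "EX de>0. ALL z. \<bar>s z-t\<bar> < de --> dist z x < e"
   proof (intro exI[of _ "de/2"] conjI allI impI)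
    fix z assume "\<bar>s z-t\<bar> < de/2"
    hence "\<bar>s z-s (y (r n))\<bar> < de" using n(1) unfolding dist_real_def by linarith
    thus "dist z x < e" using d(2)[of z "y (r n)"] n(2) dist_triangle[of z x "y (r n)"] by simp
   qed (use d in simp)
  qed
 qed
 then obtain p where p: "!!t e. t:K ==> e > 0 ==> EX de>0. ALL y. \<bar>s y-t\<bar> < de --> dist y (p t) < e" by metis
 have near: "EX y. \<bar>s y-t\<bar> < d" if "t:K" "d > 0" for t d using that unfolding K_def closure_approachable by (auto simp: dist_real_def)
 have sK: "s x:K" for x unfolding K_def by (rule closure_subset[THEN subsetD]) simp
 have ps: "p (s x) = x" for x
 proof (rule ccontr)
  assume "p (s x) ~= x"
  hence "dist x (p (s x)) > 0" by auto
  from p[OF sK this] obtain d where "d > 0" "ALL y. \<bar>s y-s x\<bar> < d --> dist y (p (s x)) < dist x (p (s x))" by blast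
  from this(2)[rule_format, of x] this(1) show False by simp
 qed
 have "continuous_on K p" unfolding continuous_on_iff
 proof (intro ballI allI impI)
  fix t e :: real assume t: "t:K" and e: "e > 0"
  obtain d where d: "d > 0" "!!y. \<bar>s y-t\<bar> < d ==> dist y (p t) < e/2" using p[OF t, of "e/2"] e by auto
  show "EX d>0. ALL x':K. dist x' t < d --> dist (p x') (p t) < e"
  proof (intro exI[of _ "d/2"] conjI ballI impI)
   fix t' assume t': "t':K" "dist t' t < d/2"
   obtain d' where d': "d' > 0" "!!y. \<bar>s y-t'\<bar> < d' ==> dist y (p t') < e/2" using p[OF t'(1), of "e/2"] e by auto
   obtain y where y: "\<bar>s y-t'\<bar> < min d' (d/2)" using near[OF t'(1), of "min d' (d/2)"] d(1) d'(1) by auto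
   hence "\<bar>s y-t\<bar> < d" using t'(2) unfolding dist_real_def by linarith
   thus "dist (p t') (p t) < e" using d(2)[of y] d'(2)[of y] y dist_triangle3[of "p t'" "p t" y] by simp
  qed (use d in simp)
 qed
 thus thesis using that[of s K p] s(1) sK ps by (simp add: K_def)
qed

text \<open>The indicator of a closed set is a limit of the continuous functions \<open>g k\<close>,
  which take values in \<open>[0, 1]\<close>, and closed sets form a generator stable under
  intersection.\<close>

lemma borel_measure_eqI:
 fixes mea nu :: "'x::metric_space measure"
 assumes "prob_space mea" "prob_space nu" and sets: "sets mea = sets borel" "sets nu = sets borel"
  and eq: "!!g. continuous_on UNIV g ==> (!!x. \<bar>g x\<bar> <= 1) ==> integral\<^sup>L mea g = (integral\<^sup>L nu g :: real)"
 shows "mea = nu"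
proof (rule measure_eqI_generator_eq[of "Collect closed" UNIV _ _ "%_. UNIV"])
 interpret mea: prob_space mea by fact
 interpret nu: prob_space nu by fact
 show "sets mea = sigma_sets UNIV (Collect closed)" "sets nu = sigma_sets UNIV (Collect closed)" by (simp_all add: sets borel_eq_closed)
 fix C :: "'x set" assume "C:Collect closed"
 hence C: "closed C" by simp
 show "emeasure mea C = emeasure nu C"
 proof (cases "C = {}")
  case False
  define g where "g k x = max 0 (1-real k * infdist x C)" for k x
  have lim: "(%k. g k x) ----> indicator C x" for x
  proof (cases "x:C")
   case False
   hence d: "infdist x C > 0" using in_closed_iff_infdist_zero[OF C \<open>C ~= {}\<close>] infdist_nonneg[of x C] by simp
   obtain N :: nat where N: "1/infdist x C < real N" using reals_Archimedean2 by blast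
   have "g k x = 0" if "k >= N" for k
   proof -
    have "1/infdist x C < real k" using N that by simp
    thus ?thesis using d by (simp add: g_def field_simps)
   qed
   thus ?thesis using False by (intro tendsto_eventually) (auto simp: eventually_sequentially)
  qed (simp add: g_def)
  have cont: "continuous_on UNIV (g k)" for k unfolding g_def by (intro continuous_intros)
  have m: "g k:borel_measurable borel" for k by (rule borel_measurable_continuous_onI[OF cont])
  have CI: "C:sets borel" using C by simp
  have limM: "(%k. integral\<^sup>L M (g k)) ----> measure M C" if "prob_space M" "sets M = sets borel" for M
  proof -
   interpret prob_space M by fact
   have "(%k. integral\<^sup>L M (g k)) ----> integral\<^sup>L M (indicator C)" by (rule integral_dominated_convergence[where w = "%_. 1"])
     (use lim m CI in "auto simp: measurable_cong_sets[OF that(2) refl] g_def infdist_nonneg")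
   thus ?thesis using CI that by simp
  qed
  have "integral\<^sup>L mea (g k) = integral\<^sup>L nu (g k)" for k by (rule eq[OF cont]) (simp add: g_def infdist_nonneg)
  hence "(%k. integral\<^sup>L mea (g k)) ----> measure nu C" using limM[OF assms(2) sets(2)] by simp
  thus ?thesis by (simp add: mea.emeasure_eq_measure nu.emeasure_eq_measure) (rule LIMSEQ_unique[OF limM[OF assms(1) sets(1)]])
 qed simp
next
 interpret mea: prob_space mea by fact
 show "emeasure mea UNIV ~= \<infinity>" by (simp add: mea.emeasure_eq_measure)
qed (auto simp: Int_stable_def)

lemma tight_bounded:
 assumes "!!n. real_distribution (mea n)" "!!n. measure (mea n) {-1<..2::real} = 1"
 shows "tight mea" unfolding tight_def using assms by (intro conjI allI impI exI[of _ "-1"] exI[of _ 2]) auto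

text \<open>
 Otherwise a weak limit of empirical measures along orbits with large averages would be a second
 invariant probability.
\<close>

theorem uniquely_ergodic_average:
 fixes F :: "'x::metric_space => 'x" and g :: "'x => real"
 assumes comp: "compact (UNIV :: 'x set)" and F: "continuous_on UNIV F" and uniq: "!!mea. invariant_prob F mea ==> mea = nu"
  and g: "continuous_on UNIV g" and e: "e > 0"
 shows "EX N. ALL n>=N. ALL x. (\<Sum>i<n. g ((F ^^ i) x)) <= real n * (integral\<^sup>L nu g+e)"
proof (rule ccontr)
 assume "~ ?thesis"
 then obtain n x where nx: "!!N. n N >= Suc N" "!!N. (\<Sum>i<n N. g ((F ^^ i) (x N))) > real (n N) * (integral\<^sup>L nu g+e)" by (meson not_le)
 obtain s :: "'x => real" and K p where s: "!!x. 0 <= s x&s x <= 3/2" and K: "closed K" "continuous_on K p" "!!x. s x:K"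
  and p: "!!x. p (s x) = x" using compact_code_inverse[OF comp] by auto
 have bdd: "EX B. ALL x. \<bar>h x\<bar> <= B" if "continuous_on UNIV h" for h :: "'x => real"
  using compact_imp_bounded[OF compact_continuous_image[OF that comp]] by (auto simp: bounded_iff)
 have n0: "n j > 0" for j using nx(1)[of j] by simp
 \<comment> \<open>Empirical measures of the orbit pieces, transported to the line by the code. All
   their mass lies in \<open>(-1, 2]\<close>, so a weakly convergent subsequence exists.\<close>
 define mea where "mea j = distr (measure_pmf (pmf_of_set {..<n j})) borel (%i. s ((F ^^ i) (x j)))" for j
 have int: "integral\<^sup>L (mea j) f = (\<Sum>i<n j. f (s ((F ^^ i) (x j))))/real (n j)" if "f:borel_measurable borel" for f :: "real => real" and j
  unfolding mea_def using n0 that by (subst integral_distr) (auto simp: integral_pmf_of_set lessThan_empty_iff)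
 have rd: "real_distribution (mea j)" for j unfolding mea_def by (intro prob_space.real_distribution_distr measure_pmf.prob_space_axioms) simp
 have "measure (mea j) {-1<..2} = 1" for j
 proof -
  show ?thesis unfolding mea_def by (subst measure_distr) (use s in \<open>auto intro!: arg_cong2[where f = measure] simp: vimage_def order.strict_trans1 less_le_trans[of "-1" 0] order_trans[of _ "3/2" 2]\<close>)
 qed
 then obtain r M where r: "strict_mono r" "real_distribution M" "weak_conv_m (mea \<circ> id \<circ> r) M"
  using tight_imp_convergent_subsubsequence[OF tight_bounded[of mea, OF rd] strict_mono_id] by auto
 interpret M: real_distribution M by (rule r(2))
 have lim: "(%j. (\<Sum>i<n (r j). f (s ((F ^^ i) (x (r j)))))/real (n (r j))) ----> integral\<^sup>L M f"
  if f: "continuous_on UNIV f" "!!t. norm (f t) <= B" for f :: "real => real" and B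
 proof -
  have "(%j. integral\<^sup>L ((mea \<circ> id \<circ> r) j) f) ----> integral\<^sup>L M f"
   by (rule weak_conv_imp_integral_bdd_continuous_conv[OF _ r(2,3), of f B])
    (use rd f in "auto simp: continuous_on_eq_continuous_at")
  thus ?thesis using int[OF borel_measurable_continuous_onI[OF f(1)]] by simp
 qed
 have Kne: "K ~= {}" using K(3) by blast
 \<comment> \<open>A bounded continuous function vanishing exactly on \<open>K\<close> is zero at
   all codes, so its integral against the limit is zero.\<close>
 have AEK: "AE t in M. t:K"
 proof -
  define f where "f t = min 1 (infdist t K)" for t
  have cf: "continuous_on UNIV f" unfolding f_def by (intro continuous_intros)
  have fb: "norm (f t) <= 1" "f t >= 0" for t by (auto simp: f_def infdist_nonneg)
  have "f (s y) = 0" for y using K(3) by (simp add: f_def)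
  hence "integral\<^sup>L M f = 0" using lim[OF cf fb(1)] by (simp add: LIMSEQ_const_iff)
  moreover have "integrable M f" using borel_measurable_continuous_onI[OF cf] M.integrable_const_bound[OF AE_I2[OF fb(1)]] by fastforce
  ultimately have "AE t in M. f t = 0" using integral_nonneg_eq_0_iff_AE[of M f] fb(2) by simp
  thus ?thesis by (rule) (auto simp: f_def in_closed_iff_infdist_zero[OF K(1) Kne])
 qed
 define q where "q t = (if t:K then p t else p (s undefined))" for t
 have mq: "q:borel_measurable borel" unfolding q_def using K by (intro borel_measurable_continuous_on_if) auto
 define rh where "rh = distr M borel q"
 have rh: "prob_space rh" unfolding rh_def using mq by (intro M.prob_space_distr) simp
 \<comment> \<open>The function \<open>h\<close> is pulled back to \<open>K\<close> by
   \<open>p\<close> and extended to the line by Tietze's theorem, so that weak convergence on the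
   line applies to it.\<close>
 have limrh: "(%j. (\<Sum>i<n (r j). h ((F ^^ i) (x (r j))))/real (n (r j))) ----> integral\<^sup>L rh h"
  if h: "continuous_on UNIV h" for h :: "'x => real"
 proof -
  obtain B where B: "!!x. \<bar>h x\<bar> <= B" using bdd[OF h] by blast
  have B0: "B >= 0" using B[of undefined] by linarith
  obtain f where f: "continuous_on UNIV f" "!!t. t:K ==> f t = h (p t)" "!!t. norm (f t) <= B"
  proof (rule Tietze[of K "%t. h (p t)" UNIV B])
   show "continuous_on K (%t. h (p t))" using continuous_on_compose2[OF h K(2)] by simp
  qed (use K(1) B B0 that in auto)
  have "integral\<^sup>L rh h = integral\<^sup>L M (%t. h (q t))"
   unfolding rh_def using mq by (intro integral_distr borel_measurable_continuous_onI[OF h]) simp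
  also have "... = integral\<^sup>L M f"
  proof (rule integral_cong_AE)
   show "AE t in M. h (q t) = f t" using AEK by (rule) (simp add: f(2) q_def)
  qed (use measurable_compose[OF mq borel_measurable_continuous_onI[OF h]] borel_measurable_continuous_onI[OF f(1)] in auto)
  finally show ?thesis using lim[OF f(1,3)] by (simp add: f(2) K(3) p)
 qed
 have mF: "F:borel_measurable borel" by (rule borel_measurable_continuous_onI[OF F])
 have "distr rh borel F = rh"
 proof (rule borel_measure_eqI)
  show "prob_space (distr rh borel F)" using mF by (intro prob_space.prob_space_distr[OF rh]) (simp add: rh_def)
  fix h :: "'x => real" assume h: "continuous_on UNIV h" "!!x. \<bar>h x\<bar> <= 1"
  let ?a = "%h j. (\<Sum>i<n (r j). h ((F ^^ i) (x (r j))))/real (n (r j)) :: real"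
  have hF: "continuous_on UNIV (%x. h (F x))" using continuous_on_compose2[OF h(1) F] by simp
  \<comment> \<open>The two averages differ by two boundary terms divided by the length, which makes
    the limit measure invariant.\<close>
  have "\<bar>?a (%x. h (F x)) j-?a h j\<bar> <= 2/real (Suc j)" for j
  proof -
   have "real (Suc j) <= real (n (r j))" using nx(1)[of "r j"] seq_suble[OF r(1), of j] by simp
   thus ?thesis using sum_lessThan_telescope[of "%i. h ((F ^^ i) (x (r j)))" "n (r j)"] h(2)[of "(F ^^ n (r j)) (x (r j))"] h(2)[of "x (r j)"] by (simp add: frac_le diff_divide_distrib[symmetric] sum_subtractf)
  qed
  hence bnd: "ALL j. norm (?a (%x. h (F x)) j-?a h j) <= 2/real (Suc j)" unfolding real_norm_def by blast
  have "(%j. 2/real (Suc j)) ----> 0" using LIMSEQ_Suc[OF lim_const_over_n[of "2::real"]] by simp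
  from Lim_null_comparison[OF always_eventually[OF bnd] this]
  have lim0: "(%j. ?a (%x. h (F x)) j-?a h j) ----> 0" .
  show "integral\<^sup>L (distr rh borel F) h = integral\<^sup>L rh h" using LIMSEQ_unique[OF tendsto_diff[OF limrh[OF hF] limrh[OF h(1)]] lim0] mF borel_measurable_continuous_onI[OF h(1)] by (subst integral_distr) (simp_all add: rh_def)
 qed (use rh in "auto simp: rh_def")
 hence "rh = nu" using rh by (intro uniq) (simp add: invariant_prob_def rh_def)
 moreover have "integral\<^sup>L nu g+e <= integral\<^sup>L rh g"
 proof (rule LIMSEQ_le_const[OF limrh[OF g]], intro exI allI impI)
  fix j show "integral\<^sup>L nu g+e <= (\<Sum>i<n (r j). g ((F ^^ i) (x (r j))))/real (n (r j))"
   using nx(2)[of "r j"] n0 by (simp add: pos_le_divide_eq mult.commute)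
 qed
 ultimately show False using e by simp
qed

section \<open>Chains inside a chain component\<close>

locale compact_system = Metric_space E d for E :: "'e set" and d + fixes F :: "'e => 'e"
 assumes compact_E: "compact_space mtopology" and continuous_F: "cmap mtopology mtopology F"
begin

lemma F_E: "x:E ==> F x:E" using continuous_map_image_subset_topspace[OF continuous_F] by auto

lemma F_pow_E: "x:E ==> (F ^^ n) x:E" by (induction n) (auto simp: F_E)

lemma uniformly_F:
 assumes "e > 0" shows "EX de>0. ALL x:E. ALL y:E. d x y < de --> d (F x) (F y) < e"
proof -
 have "uniformly_continuous_map (metric (E,d)) (metric (E,d)) F"
  by (rule continuous_imp_uniformly_continuous_map) (simp add: compact_E continuous_F)
 thus ?thesis using assms unfolding uniformly_continuous_map_def by force
qed

text \<open>Chains that carry their total time and accumulated cocycle, so that concatenation simply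
  adds both; the indexed form is recovered by \<open>ch_chain\<close>.\<close>

inductive ch :: "real => real => 'e set => (nat => 'e => 'l::real_normed_vector) => 'e => nat => 'l => 'e => bool" for ep T M a where
 ch_single: "y:M ==> y':M ==> real n >= T ==> d ((F ^^ n) y) y' < ep ==> ch ep T M a y n (a n y) y'"
| ch_snoc: "ch ep T M a y t s z ==> y':M ==> real n >= T ==> d ((F ^^ n) z) y' < ep ==> ch ep T M a y (t+n) (s+a n z) y'"

lemma ch_trans: "ch ep T M a z t' s' y' ==> ch ep T M a y t s z ==> ch ep T M a y (t+t') (s+s') y'"
 by (induction rule: ch.induct) (auto simp: add.assoc[symmetric] ch_snoc)

lemma ch_M: "ch ep T M a y t s y' ==> y:M&y':M" by (induction rule: ch.induct) auto

lemma ch_end: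
 assumes "ch ep T M a y t s z" "M <= E" "y':M" "d z y' < ep'"
 shows "ch (ep+ep') T M a y t s y'"
proof -
 have le: "ep <= ep+ep'" using assms(4) nonneg[of z y'] by linarith
 have weak: "ch (ep+ep') T M a y t s z" if "ch ep T M a y t s z" for y t s z
  using that by induction (auto intro!: ch.intros order_less_le_trans[OF _ le])
 have tri: "d x y' < ep+ep'" if "x:E" "d x z < ep" "z:M" for x
 proof -
  have "d x y' <= d x z+d z y'" using that assms(2,3) by (intro triangle) auto
  thus ?thesis using that assms(4) by linarith
 qed
 show ?thesis using assms(1)
 proof cases
  case ch_single
  show ?thesis unfolding ch_single(1) using tri F_pow_E ch_single assms(2) assms(3) by (intro ch.ch_single) auto
 next
  case (ch_snoc t' s' x n)
  show ?thesis unfolding ch_snoc(1,2) using ch_M[OF ch_snoc(3)] tri F_pow_E ch_snoc assms(2) assms(3) by (intro ch.ch_snoc[OF weak]) auto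
 qed
qed

lemma ch_chain:
 assumes "ch ep T M a y t s y'"
 shows "EX m xi n. is_chain F d M ep T m xi n&xi 0 = y&xi m = y'&(\<Sum>i<m. n i) = t&(\<Sum>i<m. a (n i) (xi i)) = s" using assms
proof induction
 case (ch_single y y' n)
 thus ?case by (intro exI[of _ 1] exI[of _ "%i. if i = 0 then y else y'"]) (auto simp: is_chain_def)
next
 case (ch_snoc y t s z y' k)
 then obtain m xi n where c: "is_chain F d M ep T m xi n" "xi 0 = y" "xi m = z" "(\<Sum>i<m. n i) = t" "(\<Sum>i<m. a (n i) (xi i)) = s" by blast
 show ?case by (intro exI[of _ "Suc m"] exI[of _ "xi(Suc m := y')"] exI[of _ "n(m := k)"])
   (use c ch_snoc in "auto simp: is_chain_def less_Suc_eq le_Suc_eq")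
qed

text \<open>One step of a pseudo-orbit with a jump after a single iteration. Unlike chains with long
  times, such steps can be cut and regrouped at will.\<close>

definition RR :: "'e set => real => 'e rel" where
 "RR S de = {(x,y). x:S&y:S&d (F x) y < de}"

lemma RR_mono: "de <= de' ==> (x,y):(RR S de)\<^sup>+ ==> (x,y):(RR S de')\<^sup>+" by (erule trancl_mono) (auto simp: RR_def)

lemma chain_reach_RR:
 assumes "chain_reach F d E y y'" "de > 0" shows "(y,y'):(RR E de)\<^sup>+"
proof -
 have seg: "x:E ==> z:E ==> d ((F ^^ Suc n) x) z < de ==> (x,z):(RR E de)\<^sup>+" for x z n
 proof (induction n arbitrary: x)
  case 0
  thus ?case by (auto simp: RR_def)
 next
  case (Suc n)
  have "(F x,z):(RR E de)\<^sup>+" using Suc F_E by (simp add: funpow_swap1)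
  thus ?case using Suc.prems(1) F_E assms(2) by (fastforce intro: trancl_into_trancl2 simp: RR_def)
 qed
 have one: "(1::real) > 0" by simp
 obtain m xi n where c: "is_chain F d E de 1 m xi n" "xi 0 = y" "xi m = y'"
  using assms(1)[unfolded chain_reach_def, rule_format, OF assms(2) one] by auto
 have "i < m ==> (xi 0,xi (Suc i)):(RR E de)\<^sup>+" for i
 proof (induction i)
  case (Suc i)
  obtain k where "n (Suc i) = Suc k" using c(1) Suc.prems by (cases "n (Suc i)") (force simp: is_chain_def)+
  hence "(xi (Suc i),xi (Suc (Suc i))):(RR E de)\<^sup>+" using c(1) Suc.prems by (intro seg) (auto simp: is_chain_def del:)
  thus ?case using Suc by simp
 next
  case 0
  obtain k where "n 0 = Suc k" using c(1) by (cases "n 0") (force simp: is_chain_def)+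
  thus ?case using c(1) by (intro seg) (auto simp: is_chain_def del:)
 qed
 from this[of "m-1"] show ?thesis using c by (auto simp: is_chain_def)
qed

lemma RR_close:
 "e > 0 ==> EX de>0. de <= e&(ALL n<K. ALL x y. x:E --> (x,y):RR E de ^^ n --> d ((F ^^ n) x) y < e)"
proof (induction K arbitrary: e)
 case (Suc K)
 obtain et where et: "et > 0" "!!x y. x:E ==> y:E ==> d x y < et ==> d (F x) (F y) < e/2" using uniformly_F[of "e/2"] Suc.prems by auto
 obtain de where de: "de > 0" "de <= min et (e/2)"
  "!!n x y. n < K ==> x:E ==> (x,y):RR E de ^^ n ==> d ((F ^^ n) x) y < min et (e/2)" using Suc.IH[of "min et (e/2)"] et(1) Suc.prems by auto
 have "d ((F ^^ n) x) y < e" if n: "n < Suc K" "x:E" "(x,y):RR E de ^^ n" for n x y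
 proof (cases n)
  case 0
  thus ?thesis using n Suc.prems by simp
 next
  case (Suc k)
  obtain z where z: "(x,z):RR E de ^^ k" "z:E" "y:E" "d (F z) y < de" using n(3) Suc by (auto simp: RR_def)
  show ?thesis using de(3)[OF _ n(2) z(1)] n(1) Suc et(2)[OF F_pow_E[OF n(2)] z(2)] triangle[OF F_pow_E[OF n(2)] F_E[OF z(2)] z(3), of n] z(4) de(2) by force
 qed
 thus ?case using de by auto
qed auto

text \<open>The pseudo-orbit is cut into blocks of length \<open>N\<close>, the remainder being kept
  with the initial block so that every block has length at least \<open>N\<close> and less than
  \<open>2 N\<close>. Each block follows the true orbit closely enough to be one link of a
  chain.\<close>

lemma RR_block:
 assumes "N > 0" "T <= real N" "S <= E" "!!n x y. n < 2 * N ==> x:E ==> (x,y):RR E de ^^ n ==> d ((F ^^ n) x) y < ep"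
 shows "(x,y):RR S de ^^ n ==> n >= N ==> EX t s. ch ep T S a x t s y"
proof (induction n arbitrary: y rule: less_induct)
 case (less n)
 have pow: "(x,y):RR E de ^^ k" if "(x,y):RR S de ^^ k" for x y k using that assms(3) by (induction k arbitrary: y) (auto simp: RR_def)
 have S: "x:S&y:S" if "(x,y):RR S de ^^ k" "k > 0" for x y k
 proof -
  have "(x,y):(RR S de)\<^sup>+" using that by (auto simp: trancl_power)
  from tranclD[OF this] tranclD2[OF this] show ?thesis by (auto simp: RR_def)
 qed
 show ?case
 proof (cases "n < 2 * N")
  case True
  have "ch ep T S a x n (a n x) y" using S[OF less.prems(1)] less.prems(2) assms pow[OF less.prems(1)] True by (intro ch_single) auto
  thus ?thesis by blast
 next
  case False
  obtain z where z: "(x,z):RR S de ^^ (n-N)" "(z,y):RR S de ^^ N" using less.prems(1) relpow_add[of "n-N" N "RR S de"] False by auto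
  obtain t s where "ch ep T S a x t s z" using less.IH[of "n-N" z] z(1) False assms(1) by force
  moreover have "z:S" "y:S" using S[OF z(2) assms(1)] by auto
  ultimately have "ch ep T S a x (t+N) (s+a N z) y" using assms pow[OF z(2)] by (intro ch_snoc) auto
  thus ?thesis by blast
 qed
qed

text \<open>Going round a loop at \<open>y\<close> sufficiently often makes the pseudo-orbit long
  enough to be cut into blocks.\<close>

lemma RR_ch:
 assumes S: "S <= E" and R: "!!de. de > 0 ==> (y,y'):(RR S de)\<^sup>+&(y',y):(RR S de)\<^sup>+" and e: "ep > 0"
 shows "EX t s. ch ep T S a y t s y'"
proof -
 define N where "N = nat \<lceil>T\<rceil>+1"
 have N: "N > 0" "T <= real N" unfolding N_def by linarith+
 obtain de where de: "de > 0" "!!n x y. n < 2 * N ==> x:E ==> (x,y):RR E de ^^ n ==> d ((F ^^ n) x) y < ep"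
  using RR_close[OF e, of "2 * N"] by auto
 have "(y,y):(RR S de)\<^sup>+" using R[OF de(1)] by auto
 then obtain k where k: "k > 0" "(y,y):RR S de ^^ k" by (auto simp: trancl_power)
 have loop: "(y,y):RR S de ^^ (k * j)" for j by (induction j) (use k(2) in "auto simp: relpow_add relcomp_unfold")
 obtain l where l: "(y,y'):RR S de ^^ l" using R[OF de(1)] by (auto simp: trancl_power)
 have "(y,y'):RR S de ^^ (k * N+l)" using loop l by (auto simp: relpow_add)
 moreover have "k * N+l >= N" using k(1) by (simp add: trans_le_add1)
 ultimately show ?thesis using RR_block[OF N S de(2)] by blast
qed

context
 fixes M assumes M: "M:chain_components F d E"
begin

lemma component_E: "M <= E" using M by (auto simp: chain_components_def)

lemma component_RR: "p:M ==> q:M ==> de > 0 ==> (p,q):(RR E de)\<^sup>+"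
 using M chain_reach_RR unfolding chain_components_def by (blast intro: trancl_trans)

lemma component_I:
 assumes z: "z:E" "p:M" "!!de. de > 0 ==> (p,z):(RR E de)\<^sup>+&(z,p):(RR E de)\<^sup>+"
 shows "z:M"
proof -
 obtain et where et: "M = {ze:E. chain_reach F d E et ze&chain_reach F d E ze et}" "et:E" "chain_reach F d E et et"
  using M by (auto simp: chain_components_def)
 have "et:M" using et by blast
 hence R: "(et,z):(RR E de)\<^sup>+&(z,et):(RR E de)\<^sup>+" if "de > 0" for de
  using z(3)[OF that] component_RR[OF _ z(2) that] component_RR[OF z(2) _ that] by fastforce
 have "chain_reach F d E x y" if conn: "!!de. de > 0 ==> (x,y):(RR E de)\<^sup>+&(y,x):(RR E de)\<^sup>+" for x y unfolding chain_reach_def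
 proof (intro allI impI)
  fix ep T :: real assume "ep > 0"
  then obtain t s where "ch ep T E (%_ _. 0 :: real) x t s y" using RR_ch[OF subset_refl conn, of ep T "%_ _. 0"] by auto
  from ch_chain[OF this] show "EX m xi n. is_chain F d E ep T m xi n&xi 0 = x&xi m = y" by blast
 qed
 thus ?thesis using R et(1) z(1) by blast
qed

lemma RR_end:
 assumes "(p,z'):(RR E kp)\<^sup>+" "z:E" "d z' z < ep-kp" shows "(p,z):(RR E ep)\<^sup>+"
proof -
 have k: "kp <= ep" using assms(3) nonneg[of z' z] by linarith
 have "(x,z):RR E ep" if "(x,z'):RR E kp" for x using that assms(2,3) triangle[of "F x" z' z] F_E by (force simp: RR_def)
 thus ?thesis using assms(1) RR_mono[OF k] by (metis tranclE r_into_trancl' trancl_into_trancl)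
qed

lemma RR_start:
 assumes "(z',p):(RR E kp)\<^sup>+" "z:E" "d (F z) (F z') < ep-kp" shows "(z,p):(RR E ep)\<^sup>+"
proof -
 have k: "kp <= ep" using assms(3) nonneg[of "F z" "F z'"] by linarith
 have "(z,x):RR E ep" if "(z',x):RR E kp" for x using that assms(2,3) triangle[of "F z" "F z'" x] F_E by (force simp: RR_def)
 thus ?thesis using assms(1) RR_mono[OF k] by (metis converse_tranclE r_into_trancl' trancl_into_trancl2)
qed

text \<open>Otherwise offending points for ever smaller jumps accumulate at a point that is joined
  to the component in both directions by arbitrarily fine pseudo-orbits. That point belongs to the
  component, contrary to its distance from it.\<close>

lemma component_near:
 assumes "de > 0"
 shows "EX kp>0. kp <= de&(ALL z p q. p:M --> q:M --> (p,z):(RR E kp)\<^sup>+ --> (z,q):(RR E kp)\<^sup>+ --> (EX m:M. d z m < de))"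
proof (rule ccontr)
 assume neg: "~ ?thesis"
 define kp where "kp k = min de (1/real (Suc k))" for k
 have "kp k > 0&kp k <= de" for k using assms by (simp add: kp_def)
 hence "EX z p q. p:M&q:M&(p,z):(RR E (kp k))\<^sup>+&(z,q):(RR E (kp k))\<^sup>+ & ~ (EX m:M. d z m < de)" for k using neg by blast
 then obtain z p q where zpq: "!!k. p k:M" "!!k. q k:M" "!!k. (p k,z k):(RR E (kp k))\<^sup>+" "!!k. (z k,q k):(RR E (kp k))\<^sup>+"
  "!!k. ~ (EX m:M. d (z k) m < de)" by metis
 have zE: "z k:E" for k using tranclD[OF zpq(4)[of k]] by (auto simp: RR_def)
 then obtain w r where w: "w:E" "strict_mono r" "limitin mtopology (z \<circ> r) w sequentially"
  using compact_E unfolding compact_space_sequentially by blast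
 have near: "EX k. kp k < e&d (z k) w < e" if ee: "e > 0" for e
 proof -
  obtain N where N: "!!n. n >= N ==> d (z (r n)) w < e" using w(3) ee unfolding limit_metric_sequentially o_def by blast
  obtain N' where N': "1/real (Suc N') < e" by (rule nat_approx_posE[OF ee])
  define n where "n = max N N'"
  have "real (Suc N') <= real (Suc (r n))" using seq_suble[OF w(2), of n] by (simp add: n_def)
  hence "1/real (Suc (r n)) <= 1/real (Suc N')" by (intro divide_left_mono) auto
  hence "kp (r n) < e" using N' by (simp add: kp_def)
  thus ?thesis using N[of n] by (auto simp: n_def)
 qed
 have "w:M"
 proof (rule component_I[OF w(1) zpq(1)[of 0]], intro conjI)
  fix ep :: real assume e: "ep > 0"
  obtain k where k: "kp k < ep/2" "d (z k) w < ep/2" using near[of "ep/2"] e by auto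
  have "(p k,w):(RR E ep)\<^sup>+" by (rule RR_end[OF zpq(3) w(1)]) (use k in linarith)
  thus "(p 0,w):(RR E ep)\<^sup>+" using component_RR[OF zpq(1) zpq(1) e] by (rule trancl_trans[rotated])
  obtain et where et: "et > 0" "!!x y. x:E ==> y:E ==> d x y < et ==> d (F x) (F y) < ep/2" using uniformly_F[of "ep/2"] e by auto
  obtain l where l: "kp l < min et (ep/2)" "d (z l) w < min et (ep/2)" using near[of "min et (ep/2)"] e et(1) by auto
  have "d (F w) (F (z l)) < ep/2" using et(2)[OF w(1) zE[of l]] l(2) by (simp add: commute)
  hence "(w,q l):(RR E ep)\<^sup>+" by (intro RR_start[OF zpq(4) w(1)]) (use l in simp)
  thus "(w,p 0):(RR E ep)\<^sup>+" using component_RR[OF zpq(2) zpq(1) e] by (rule trancl_trans)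
 qed
 thus False using near[OF assms] zpq(5) by blast
qed

text \<open>A fine pseudo-orbit between points of \<open>M\<close> stays near \<open>M\<close>, so
  each of its points can be replaced by a nearby point of \<open>M\<close>. The three resulting
  errors, at the start, in the jump and at the end of a step, account for
  \<open>ep/3\<close>.\<close>

lemma component_internal:
 assumes y: "y:M" "y':M" and e: "ep > 0" shows "(y,y'):(RR M ep)\<^sup>+"
proof -
 obtain et where et: "et > 0" "!!x y. x:E ==> y:E ==> d x y < et ==> d (F x) (F y) < ep/3" using uniformly_F[of "ep/3"] e by auto
 define de where "de = min et (ep/3)"
 have de: "de > 0" using et(1) e by (simp add: de_def)
 obtain kp where kp: "kp > 0" "kp <= de" "!!z p q. p:M ==> q:M ==> (p,z):(RR E kp)\<^sup>+ ==> (z,q):(RR E kp)\<^sup>+ ==> EX m:M. d z m < de"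
  using component_near[OF de] by blast
 have step: "(m0,m):RR M ep" if "m0:M" "m:M" "d (F m0) (F z) < ep/3" "(z,w):RR E kp" "d w m < de" for m0 m z w
 proof -
  have E: "m0:E" "m:E" "z:E" "w:E" "d (F z) w < kp" using that component_E by (auto simp: RR_def)
  show ?thesis using triangle[of "F m0" "F z" m] triangle[of "F z" w m] E F_E that kp(2) by (simp add: RR_def de_def)
 qed
 have main: "m:M ==> d z m < de ==> (EX q:M. (z,q):(RR E kp)\<^sup>+) ==> (y,m):(RR M ep)\<^sup>+" if "(y,z):(RR E kp)\<^sup>+" for z m
  using that
 proof (induction arbitrary: m)
  case (base w)
  thus ?case using step[of y m y w] y(1) e component_E F_E by auto
 next
  case (step z w)
  obtain q where q: "q:M" "(w,q):(RR E kp)\<^sup>+" using step.prems(3) by blast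
  have zq: "(z,q):(RR E kp)\<^sup>+" using step.hyps(2) q(2) by simp
  obtain m0 where m0: "m0:M" "d z m0 < de" using kp(3)[OF y(1) q(1) step.hyps(1) zq] by auto
  have "(m0,m):RR M ep" using step.hyps(2) et(2) m0 component_E \<open>!!z w m0 m. m0 : M ==> m : M ==> d (F m0) (F z) < ep / 3 ==> (z, w) : RR E kp ==> d w m < de ==> (m0, m) : RR M ep\<close>[OF m0(1) step.prems(1) _ step.hyps(2) step.prems(2)] by (auto simp: de_def commute RR_def)
  moreover have "(y,m0):(RR M ep)\<^sup>+" using step.IH[OF m0] q(1) zq by blast
  ultimately show ?case by (rule trancl_into_trancl[rotated])
 qed
 show ?thesis by (rule main[OF component_RR[OF y kp(1)] y(2)]) (use de y component_E component_RR[OF y(2) y(2) kp(1)] in auto)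
qed

text \<open>A finite net reduces the joining chains to finitely many and so bounds their times. They
  start at a net point \<open>ze\<close> near \<open>y\<close> rather than at \<open>y\<close>,
  which suffices because a preceding jump can be made to land on \<open>ze\<close>.\<close>

lemma component_join:
 assumes tb: "mtotally_bounded M" and e: "ep > 0" "T > 0"
 shows "EX J. ALL y:M. ALL y':M. EX ze t s. ze:M&d y ze < ep&ch ep T M a ze t s y'&t <= J"
proof -
 obtain Z where Z: "finite Z" "Z <= M" "M <= (\<Union>x\<in>Z. mball x (ep/2))" using tb[unfolded mtotally_bounded_def, rule_format, of "ep/2"] e(1) by auto
 have "EX t s. ch (ep/2) T M a z t s z'" if "z:M" "z':M" for z z' by (rule RR_ch[OF component_E]) (use component_internal that e in auto)
 then obtain tt sg where ts: "!!z z'. z:M ==> z':M ==> ch (ep/2) T M a z (tt z z') (sg z z') z'" by metis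
 show ?thesis
 proof (intro exI[of _ "Max ((%(z,z'). tt z z') ` (Z \<times> Z))"] ballI)
  fix y y' assume y: "y:M" "y':M"
  obtain z z' where z: "z:Z" "y:mball z (ep/2)" "z':Z" "y':mball z' (ep/2)" using Z(3) y by blast
  have "ch (ep/2+ep/2) T M a z (tt z z') (sg z z') y'" by (rule ch_end[OF ts component_E y(2)]) (use z Z(2) in auto)
  moreover have "tt z z' <= Max ((%(z,z'). tt z z') ` (Z \<times> Z))" using z Z(1) by (intro Max_ge) auto
  ultimately show "EX ze t s. ze:M&d y ze < ep&ch ep T M a ze t s y'&t <= Max ((%(z,z'). tt z z') ` (Z \<times> Z))" using e(1) z Z(2) by (fastforce simp: commute)
 qed
qed

end

lemma ch_sum_bound:
 assumes "!!n y. y:M ==> norm (a n y) <= C * real n"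
 shows "ch ep T M a y t s y' ==> norm s <= C * real t"
proof (induction rule: ch.induct)
 case (ch_snoc y t s z y' n)
 thus ?case using norm_triangle_ineq[of s "a n z"] assms[of z n] ch_M by (fastforce simp: distrib_left)
qed (use assms in auto)

text \<open>Long runs along prescribed orbit pieces, joined by chains of bounded total length.\<close>

lemma ch_runs:
 assumes M: "M <= E" "!!n y. y:M ==> norm (a n y) <= C * real n" "C >= 0" "!!n y. y:M ==> (F ^^ n) y:M"
  and J: "!!y y'. y:M ==> y':M ==> EX ze t s. ze:M&d y ze < ep&ch ep T M a ze t s y'&t <= J"
 shows "y:M ==> real n >= T ==> (!!y n. (y,n):set ps ==> y:M&real n >= T) ==>
  EX t s y'. ch ep T M a y t s y'&n+sum_list (map snd ps) <= t&t <= n+sum_list (map snd ps)+J * Suc (length ps) &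
   norm (s-(a n y+sum_list (map (%(y,n). a n y) ps))) <= C * real J * real (Suc (length ps))"
proof (induction ps arbitrary: y n)
 case Nil
 obtain ze where ze: "ze:M" "d ((F ^^ n) y) ze < ep" using J[OF M(4)[OF Nil(1)] Nil(1)] by auto
 have "ch ep T M a y n (a n y) ze" by (rule) (use Nil ze in auto)
 thus ?case using M(3) by fastforce
next
 case (Cons p ps)
 obtain y1 n1 where p: "p = (y1,n1)" by (cases p)
 have p1: "y1:M" "real n1 >= T" using Cons.prems(3) by (auto simp: p)
 obtain ze t s where ze: "ze:M" "d ((F ^^ n) y) ze < ep" "ch ep T M a ze t s y1" "t <= J" using J[OF M(4)[OF Cons.prems(1)] p1(1)] by blast
 have 1: "ch ep T M a y n (a n y) ze" by (rule) (use Cons.prems ze in auto)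
 obtain t' s' y' where IH: "ch ep T M a y1 t' s' y'" "n1+sum_list (map snd ps) <= t'" "t' <= n1+sum_list (map snd ps)+J * Suc (length ps)"
  "norm (s'-(a n1 y1+sum_list (map (%(y,n). a n y) ps))) <= C * real J * real (Suc (length ps))"
  using Cons.IH[OF p1] Cons.prems(3) by (metis list.set_intros(2))
 have "norm ((a n y+s+s')-(a n y+sum_list (map (%(y,n). a n y) (p # ps)))) <= C * real J * real (Suc (length (p # ps)))" using ch_sum_bound[OF M(2) ze(3)] mult_left_mono[of "real t" "real J" C] ze(4) M(3) norm_triangle_ineq[of s "s'-(a n1 y1+sum_list (map (%(y,n). a n y) ps))"] IH(4) by (simp add: algebra_simps p)
 moreover have "ch ep T M a y (n+t+t') (a n y+s+s') y'" by (rule ch_trans[OF IH(1) ch_trans[OF ze(3) 1]])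
 ultimately show ?case using IH(2,3) ze(4) by (intro exI) (auto simp: p)
qed

text \<open>A convex combination is realized by spending time about \<open>u p * K\<close> on a run
  with exponent near \<open>p\<close>, for each \<open>p\<close>. Rounding and the joining chains
  cost an amount bounded independently of \<open>K\<close>.\<close>

theorem hull_subset_morse_spectrum:
 fixes a :: "nat => 'e => 'l::euclidean_space"
 assumes comp: "M:chain_components F d E" and tb: "mtotally_bounded M"
  and M: "!!n y. y:M ==> norm (a n y) <= C * real n" "C >= 0" "!!n y. y:M ==> (F ^^ n) y:M"
  and fin: "finite P" and P: "!!p e. p:P ==> e > 0 ==> EX N. ALL n>=N. EX y:M. norm (a n y-real n *R p) <= e * real n"
 shows "convex hull P <= morse_spectrum F d M a"
proof
 fix v assume "v:convex hull P"
 then obtain u where u: "!!p. p:P ==> u p >= 0" "sum u P = 1" "(\<Sum>p\<in>P. u p *R p) = v" by (auto simp: convex_hull_finite[OF fin])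
 obtain ps where ps: "set ps = P" "distinct ps" using finite_distinct_list[OF fin] by auto
 have "P ~= {}" using u(2) by auto
 have key: "EX m xi n. is_chain F d M ep T m xi n&norm ((1/real (\<Sum>i<m. n i)) *R (\<Sum>i<m. a (n i) (xi i))-v) <= 2 * ep"
  if e: "ep > 0" "T > 0" for ep T
 proof -
  obtain J where J: "!!y y'. y:M ==> y':M ==> EX ze t s. ze:M&d y ze < ep&ch ep T M a ze t s y'&t <= J"
   using component_join[OF comp tb e, of a] by blast
  have "ALL p:P. EX N. ALL n>=N. EX y:M. norm (a n y-real n *R p) <= ep * real n" using P e(1) by blast
  from bchoice[OF this] obtain N0 where N0: "!!p n. p:P ==> n >= N0 p ==> EX y:M. norm (a n y-real n *R p) <= ep * real n" by blast
  define N where "N = Max (N0 ` P)+nat \<lceil>T\<rceil>+1"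
  have N: "N >= N0 p" if "p:P" for p
  proof -
   have "N0 p <= Max (N0 ` P)" using that fin by (intro Max_ge) auto
   thus ?thesis by (simp add: N_def)
  qed
  have NT: "real N >= T" unfolding N_def by linarith
  define c where "c = real J * real (card P)"
  define Q where "Q = (\<Sum>p\<in>P. (real N+1) * (1+norm p))"
  \<comment> \<open>\<open>c\<close> bounds the total joining time and \<open>Q\<close> the effect
    of rounding. \<open>B\<close> gathers all errors other than the \<open>ep * K\<close> coming
    from the runs themselves, so \<open>B <= ep * K\<close> leaves a total error of
    \<open>2 * ep * K\<close>.\<close>
  define B where "B = C * c+ep * Q+Q+(Q+c) * norm v"
  obtain K where K0: "B/ep < real K" using reals_Archimedean2 by blast
  have Q0: "Q >= 0" unfolding Q_def by (intro sum_nonneg) simp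
  have "B >= 0" unfolding B_def using M(2) e(1) Q0 by (simp add: c_def)
  hence K: "B <= ep * real K" "real K > 0"
   using K0 e(1) by (simp_all add: pos_divide_less_eq mult.commute) (metis K0 divide_nonneg_pos less_le_trans not_less of_nat_0_less_iff)
  \<comment> \<open>The summand \<open>N\<close> makes every run long enough for its estimate and
    for \<open>T\<close>, even when the weight \<open>u p\<close> is zero.\<close>
  define n where "n p = nat \<lceil>u p * real K\<rceil>+N" for p
  define th0 where "th0 p = real (n p)-u p * real K" for p
  have n': "n p >= N" "real (n p) = u p * real K+th0 p" "0 <= th0 p" "th0 p <= real N+1" if "p:P" for p
  proof -
   have "real (nat \<lceil>u p * real K\<rceil>) >= u p * real K" by (rule real_nat_ceiling_ge)
   moreover have "real (nat \<lceil>u p * real K\<rceil>) <= u p * real K+1" using u(1)[OF that] by simp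
   ultimately show "n p >= N" "real (n p) = u p * real K+th0 p" "0 <= th0 p" "th0 p <= real N+1" by (simp_all add: th0_def n_def)
  qed
  have "EX y:M. norm (a (n p) y-real (n p) *R p) <= ep * real (n p)" if "p:P" for p using N0[OF that, of "n p"] N[OF that] n'(1)[OF that] by simp
  then obtain y where y: "!!p. p:P ==> y p:M" "!!p. p:P ==> norm (a (n p) (y p)-real (n p) *R p) <= ep * real (n p)" by metis
  obtain p0 qs where pq: "ps = p0 # qs" using ps \<open>P ~= {}\<close> by (cases ps) auto
  let ?l = "map (%p. (y p,n p)) qs"
  have p0: "p0:P" "!!q. q:set qs ==> q:P" using ps(1) by (auto simp: pq)
  have T: "real (n p) >= T" if "p:P" for p using n'(1)[OF that] NT by linarith
  obtain t s y' where r: "ch ep T M a (y p0) t s y'" "n p0+sum_list (map snd ?l) <= t" "t <= n p0+sum_list (map snd ?l)+J * Suc (length ?l)"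
   "norm (s-(a (n p0) (y p0)+sum_list (map (%(y,n). a n y) ?l))) <= C * real J * real (Suc (length ?l))"
   using ch_runs[OF component_E[OF comp] M(1,2,3) J, of "y p0" "n p0" ?l] y(1)[OF p0(1)] T[OF p0(1)] y(1) T p0(2) by auto blast
  have sl: "sum_list (map f ps) = (\<Sum>p\<in>P. f p)" for f :: "'l => 'b::comm_monoid_add"
   using ps sum_list_distinct_conv_sum_set[OF ps(2), of f] by simp
  have nn: "n p0+sum_list (map snd ?l) = (\<Sum>p\<in>P. n p)" "a (n p0) (y p0)+sum_list (map (%(y,n). a n y) ?l) = (\<Sum>p\<in>P. a (n p) (y p))"
   unfolding sl[symmetric] pq by (simp_all add: o_def)
  have sumn: "real (\<Sum>p\<in>P. n p) = real K+sum th0 P" using n'(2) u(2) by (simp add: sum.distrib sum_distrib_right[symmetric])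
  have S: "0 <= sum th0 P" "sum th0 P <= Q" "norm (\<Sum>p\<in>P. th0 p *R p) <= Q"
  proof -
   show "0 <= sum th0 P" using n'(3) by (intro sum_nonneg)
   have le: "th0 p * 1 <= (real N+1) * (1+norm p)" "th0 p * norm p <= (real N+1) * (1+norm p)" if "p:P" for p
    using n'(3,4)[OF that] by (intro mult_mono; simp)+
   show "sum th0 P <= Q" unfolding Q_def using le(1) by (intro sum_mono) simp
   show "norm (\<Sum>p\<in>P. th0 p *R p) <= Q" unfolding Q_def using le(2) n'(3) by (intro sum_norm_le) simp
  qed
  have t1: "real K <= real t" using r(2) sumn S(1) unfolding nn(1) by linarith
  have len': "Suc (length ?l) = card P" using ps distinct_card by (fastforce simp: pq)
  have "t <= (\<Sum>p\<in>P. n p)+J * card P" using r(3) unfolding nn(1) len' .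
  hence "real t <= real ((\<Sum>p\<in>P. n p)+J * card P)" by (rule of_nat_mono)
  hence t2: "real t-real K <= sum th0 P+c" using sumn by (simp add: c_def)
  have d1: "norm (s-(\<Sum>p\<in>P. a (n p) (y p))) <= C * c" using r(4) unfolding nn(2) len' by (simp add: c_def)
  have "norm ((\<Sum>p\<in>P. a (n p) (y p))-(\<Sum>p\<in>P. real (n p) *R p)) <= (\<Sum>p\<in>P. ep * real (n p))"
   unfolding sum_subtractf[symmetric] by (rule sum_norm_le) (rule y(2))
  also have "... <= ep * (real K+Q)" using sumn S(2) e(1) by (simp add: sum_distrib_left[symmetric])
  finally have d2: "norm ((\<Sum>p\<in>P. a (n p) (y p))-(\<Sum>p\<in>P. real (n p) *R p)) <= ep * real K+ep * Q" by (simp add: distrib_left)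
  have "norm ((\<Sum>p\<in>P. real (n p) *R p)-real t *R v) = norm ((\<Sum>p\<in>P. th0 p *R p)-(real t-real K) *R v)" by (simp add: algebra_simps) (use n'(2) u(3) in "(simp add: scaleR_add_left sum.distrib scaleR_sum_right[symmetric] mult.commute flip: scaleR_scaleR)")
  also have "... <= norm (\<Sum>p\<in>P. th0 p *R p)+(real t-real K) * norm v"
   using norm_triangle_ineq4[of "\<Sum>p\<in>P. th0 p *R p" "(real t-real K) *R v"] t1 by simp
  also have "... <= Q+(Q+c) * norm v" using S t2 by (intro add_mono mult_right_mono) auto
  finally have d3: "norm ((\<Sum>p\<in>P. real (n p) *R p)-real t *R v) <= Q+(Q+c) * norm v" .
  have "norm (s-real t *R v) <= 2 * ep * real K" using K(1) norm_diff_triangle_le[OF d1 norm_diff_triangle_le[OF d2 d3]] by (simp add: B_def)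
  also have "... <= 2 * ep * real t" using t1 e(1) by simp
  finally have st: "norm (s-real t *R v) <= 2 * ep * real t" .
  have tp: "real t > 0" using t1 K(2) by simp
  hence "(1/real t) *R s-v = (1/real t) *R (s-real t *R v)" by (simp add: scaleR_diff_right)
  hence "norm ((1/real t) *R s-v) <= 2 * ep" using st tp by (simp add: pos_divide_le_eq)
  moreover obtain m xi n where "is_chain F d M ep T m xi n" "(\<Sum>i<m. n i) = t" "(\<Sum>i<m. a (n i) (xi i)) = s" using ch_chain[OF r(1)] by blast
  ultimately show ?thesis by blast
 qed
 define good where "good j m xi n \<longleftrightarrow> is_chain F d M (1/real (Suc j)) (real (Suc j)) m xi n &
  norm ((1/real (\<Sum>i<m. n i)) *R (\<Sum>i<m. a (n i) (xi i))-v) <= 2 * (1/real (Suc j))" for j m xi n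
 have "ALL j. EX m xi n. good j m xi n" unfolding good_def by (intro allI key) auto
 then obtain m xi n where "!!j. good j (m j) (xi j) (n j)" by metis
 hence mxn: "!!j. is_chain F d M (1/real (Suc j)) (real (Suc j)) (m j) (xi j) (n j)"
  "!!j. norm ((1/real (\<Sum>i<m j. n j i)) *R (\<Sum>i<m j. a (n j i) (xi j i))-v) <= 2 * (1/real (Suc j))" by (simp_all add: good_def)
 have l0: "(%j. 1/real (Suc j)) ----> 0" using LIMSEQ_Suc[OF lim_const_over_n[of "1::real"]] by simp
 have "(%j. (1/real (\<Sum>i<m j. n j i)) *R (\<Sum>i<m j. a (n j i) (xi j i))-v) ----> 0"
  using tendsto_mult_left[OF l0, of 2] by (intro Lim_null_comparison[OF always_eventually[OF allI[OF mxn(2)]]]) simp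
 hence "(%j. (1/real (\<Sum>i<m j. n j i)) *R (\<Sum>i<m j. a (n j i) (xi j i))) ----> v" by (rule LIM_zero_cancel)
 moreover have "filterlim (%j. real (Suc j)) at_top sequentially" by real_asymp
 ultimately show "v:morse_spectrum F d M a" unfolding morse_spectrum_def using mxn(1) l0 by (intro CollectI exI) auto
qed

end

section \<open>The Cartan projection and its Lipschitz property\<close>

context flag_grp
begin

definition bp :: "'g => 'l" where
 "bp g = (SOME b. b:cch&(EX k:KK L. EX k':KK L. g = k**expG b**k'))"

lemma rdom_0: "rdom 0 b \<longleftrightarrow> b:cch" using simple_roots dual_aaD(4)[OF rootsD(1)] by (auto simp: rdom_def clch)

lemma bp_ex: assumes "g:CL" shows "EX b k k'. b:cch&k:KL&k':KL&g = k**expG b**k'"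
proof -
 have "g:stabilizer L 0" using assms by (simp add: stabilizer_def Adlin)
 from stabilizer_KAK[OF subspace_0[OF subsp(3)] this] show ?thesis unfolding rdom_0 KHs(7) by metis
qed

lemma polar_of_KAK:
 assumes "b:aL" "k:KL" "k':KL" shows "pX (k**expG b**k') = AD (inv k') b"
proof -
 show ?thesis using normalizer_conj_expG KKc assms pX_eq[OF KK_mult[OF assms(2,3)] Ad_KK(2)[OF KK_inv[OF assms(3)]]] aa_ss by (auto simp: m_assoc)
qed

text \<open>Two decompositions of one element have the same polar part, so their dominant elements
  are conjugate under \<open>K\<close> and hence equal.\<close>

lemma bp_eq:
 assumes "b:cch" "k:KL" "k':KL" shows "bp (k**expG b**k') = b" unfolding bp_def
proof (rule some_equality)
 fix c assume "c:cch&(EX q:KK L. EX q':KK L. k**expG b**k' = q**expG c**q')"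
 then obtain q q' where q: "c:cch" "q:KL" "q':KL" "k**expG b**k' = q**expG c**q'" by blast
 hence e: "AD (inv k') b = AD (inv q') c" using polar_of_KAK assms clch by metis
 have "AD (q'**inv k') b = AD q' (AD (inv k') b)" using assms(3) q(3) KKc by (simp add: Adm)
 also have "... = c" unfolding e using Ad_inv(2)[OF KKc[OF q(3)]] by simp
 finally show "c = b" using dominant_unique[OF assms(1) _ KK_mult[OF q(3) KK_inv[OF assms(3)]]] q(1) by simp
qed (use assms in blast)

lemma bp: assumes "g:CL" obtains k k' where "bp g:cch" "k:KL" "k':KL" "g = k**expG (bp g)**k'" using bp_ex[OF assms] bp_eq by metis

lemma bp_KK: assumes "k:KL" "g:CL" shows "bp (k**g) = bp g" "bp (g**k) = bp g"
proof -
 obtain q q' where q: "bp g:cch" "q:KL" "q':KL" "g = q**expG (bp g)**q'" by (rule bp[OF assms(2)])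
 note c = KKc[OF q(2)] KKc[OF q(3)] KKc[OF assms(1)]
 show "bp (k**g) = bp g" "bp (g**k) = bp g" using q(4) c bp_eq[OF q(1) KK_mult[OF assms(1) q(2)] q(3)] bp_eq[OF q(1,2) KK_mult[OF q(3) assms(1)]] by (metis expGc m_assoc m_closed)+
qed

lemma nX_bp: assumes "g:CL" shows "nX g = nB (bp g)"
proof -
 obtain q q' where q: "bp g:cch" "q:KL" "q':KL" "g = q**expG (bp g)**q'" by (rule bp[OF assms])
 show ?thesis using polar_of_KAK[of "bp g" q q'] q clch nB_KK[OF KK_inv[OF q(3)]] by (simp add: nX_def)
qed

text \<open>After removing a factor of \<open>K\<close> on the right, the dominant part of the
  product is an Iwasawa projection. The cocycle rule splits it into two, each bounded by the length
  of one factor.\<close>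

lemma nX_mult: assumes "g:CL" "h:CL" shows "nX (g**h) <= nX g+nX h"
proof -
 define b where "b = bp (g**h)"
 obtain q q' where q: "b:cch" "q:KL" "q':KL" "g**h = q**expG b**q'" unfolding b_def using bp[of "g**h"] assms by auto
 note c = KKc[OF q(2)] KKc[OF q(3)]
 have b: "b:aL" using q(1) clch by auto
 have e: "g**(h**inv q') = q**expG b" using q(4) assms c by (metis expGc inv_closed inv_solve_right m_assoc m_closed)
 have "b = aG (q**expG b)" using aG_mult_expG[OF c(1) b] iwasawa_KK[OF q(2)] by simp
 also have "... = aG (g**kG (h**inv q'))+aG (h**inv q')" unfolding e[symmetric] using iwasawa_mult(2) assms c by simp
 finally have "nB b <= nB (aG (g**kG (h**inv q')))+nB (aG (h**inv q'))" using nB_add by metis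
 also have "... <= nX g+nX h" using assms c by (intro add_mono nB_aG kG_KK KK_inv q(3)) auto
 finally show ?thesis using nX_bp assms by (simp add: b_def)
qed

lemma nX_inv: "g:CL ==> nX (inv g) = nX g" by (rule nX_KK(3)[OF KK_one])

text \<open>The relation between \<open>b\<close> and \<open>b'\<close> can be inverted, so the
  one-sided estimate holds in both directions and bounds the pairings of \<open>b' - b\<close> with
  all dominant elements.\<close>

lemma bp_perturb:
 obtains C where "C > 0" "!!b b' c1 c2. b:cch ==> b':cch ==> c1:CL ==> c2:CL ==>
  expG b' = c1**expG b**c2 ==> norm (b'-b) <= C * (nX c1+nX c2)"
proof -
 obtain C where C: "!!x D. x:aL ==> (!!H0. H0:cch ==> \<bar>form L H0 x\<bar> <= nB H0 * D) ==> norm x <= C * D" using dominant_norm by blast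
 show thesis
 proof (rule that[of "\<bar>C\<bar>+1"])
  fix b b' c1 c2 assume b: "b:cch" "b':cch" and c: "c1:CL" "c2:CL" and e: "expG b' = c1**expG b**c2"
  have ba: "b'-b:aL" using b clch subspace_diff[OF subsp(3)] by simp
  have e': "expG b = inv c1**expG b'**inv c2" unfolding e using c by (simp add: m_assoc) (simp add: m_assoc[symmetric])
  have "\<bar>form L H0 (b'-b)\<bar> <= nB H0 * (nX c1+nX c2)" if H0: "H0:cch" for H0
   using cartan_perturbation[OF b H0 c e] cartan_perturbation[OF b(2,1) H0 _ _ e'] c by (simp add: nX_inv fm.diff_right)
  hence "norm (b'-b) <= C * (nX c1+nX c2)" by (rule C[OF ba])
  also have "... <= (\<bar>C\<bar>+1) * (nX c1+nX c2)" by (intro mult_right_mono) (auto simp: nX_def nB_nonneg)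
  finally show "norm (b'-b) <= (\<bar>C\<bar>+1) * (nX c1+nX c2)" .
 qed simp
qed

lemma bp_KAK:
 assumes "g:CL" obtains k k' where "k:KL" "k':KL" "expG (bp g) = k**g**k'"
proof -
 obtain q q' where q: "bp g:cch" "q:KL" "q':KL" "g = q**expG (bp g)**q'" by (rule bp[OF assms])
 show thesis using q KKc that KK_inv expGc inv_closed inv_solve_left inv_solve_right m_assoc m_closed by (metis (no_types, lifting))
qed

lemma continuous_bp: "cmap G euclidean bp"
proof -
 obtain C where C: "C > 0" "!!b b' c1 c2. b:cch ==> b':cch ==> c1:CL ==> c2:CL ==>
  expG b' = c1**expG b**c2 ==> norm (b'-b) <= C * (nX c1+nX c2)" using bp_perturb by blast
 show ?thesis
 proof (rule continuous_map_nX[OF C(1)])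
  fix g g0 assume g: "g:CL" "g0:CL"
  obtain k k' where k: "k:KL" "k':KL" "expG (bp g) = k**g**k'" by (rule bp_KAK[OF g(1)])
  obtain q q' where q: "bp g0:cch" "q:KL" "q':KL" "g0 = q**expG (bp g0)**q'" by (rule bp[OF g(2)])
  note c = KKc[OF k(1)] KKc[OF k(2)] KKc[OF q(2)] KKc[OF q(3)]
  have "expG (bp g) = k**(g**inv g0)**g0**k'" using k(3) g c by (simp add: m_assoc)
  also have "... = (k**(g**inv g0)**q)**expG (bp g0)**(q'**k')" by (subst (2) q(4)) (use g c in "simp add: m_assoc")
  finally have "norm (bp g-bp g0) <= C * (nX (k**(g**inv g0)**q)+nX (q'**k'))" using bp q(1) g c by (intro C(2)) auto
  moreover have "nX (q'**k') = 0" using nX_KK(2)[OF KK_mult[OF q(3) k(2)], of \<one>] nX_one c by simp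
  ultimately show "norm (bp g-bp g0) <= C * nX (g**inv g0)" using nX_KK(1,2) k q g c by simp
 qed
qed

end

section \<open>Flag bundles\<close>

text \<open>The trivialization is repackaged as a local section \<open>si\<close> and a fibre
  coordinate \<open>ga\<close>, in one form for the whole bundle and for the
  \<open>K\<close>-subbundle.\<close>

lemma (in lie_grp) locally_trivial_sections:
 fixes act :: "'q::topological_space => 'g => 'q" and proj :: "'q => 'x::topological_space"
 assumes "locally_trivial L act proj P H" and H: "subgroup H L"
 shows "EX U ga si. open U&x:U&cmap (top_of_set (P \<inter> proj -` U)) G ga&continuous_on U si &
  (ALL y:U. si y:P&proj (si y) = y) &
  (ALL q:P. proj q:U --> ga q:H&q = act (si (proj q)) (ga q) &
   (ALL h:H. act q h:P&proj (act q h) = proj q&ga (act q h) = ga q**h))"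
proof -
 obtain U psh where U: "open U" "x:U" and hom: "homeomorphic_map (prod_topology (top_of_set U) (subtopology G H)) (top_of_set (P \<inter> proj -` U)) psh"
  and psh: "!!y h g. y:U ==> h:H ==> proj (psh (y,h)) = y" "!!y h g. y:U ==> h:H ==> g:H ==> psh (y,h**g) = act (psh (y,h)) g"
  using assms(1) unfolding locally_trivial_def by metis
 have Hc: "H <= CL" by (rule subgroup.subset[OF H])
 have H1: "\<one>:H" by (rule subgroup.one_closed[OF H])
 obtain et where et: "homeomorphic_maps (prod_topology (top_of_set U) (subtopology G H)) (top_of_set (P \<inter> proj -` U)) psh et"
  using hom homeomorphic_map_maps by blast
 have top: "topspace (prod_topology (top_of_set U) (subtopology G H)) = U \<times> H" using Hc by auto
 have cpsh: "cmap (prod_topology (top_of_set U) (subtopology G H)) (top_of_set (P \<inter> proj -` U)) psh"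
  and cet: "cmap (top_of_set (P \<inter> proj -` U)) (prod_topology (top_of_set U) (subtopology G H)) et"
  and i: "!!z. z:U \<times> H ==> et (psh z) = z" "!!q. q:P ==> proj q:U ==> psh (et q) = q"
  using et unfolding homeomorphic_maps_def top by auto
 have P: "psh (y,h):P" if "y:U" "h:H" for y h using continuous_map_image_subset_topspace[OF cpsh] that unfolding top by auto
 have etUH: "et q:U \<times> H" if "q:P" "proj q:U" for q using continuous_map_image_subset_topspace[OF cet] that unfolding top by auto
 show ?thesis
 proof (intro exI[of _ U] exI[of _ "%q. snd (et q)"] exI[of _ "%y. psh (y,\<one>)"] conjI ballI impI U)
  show "cmap (top_of_set (P \<inter> proj -` U)) G (%q. snd (et q))" using continuous_map_compose[OF cet continuous_map_snd] by (simp add: o_def continuous_map_into_fulltopology)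
  have "cmap (top_of_set U) (prod_topology (top_of_set U) (subtopology G H)) (%y. (y,\<one>))" using H1 by (auto simp: continuous_map_pairwise o_def)
  from continuous_map_compose[OF this cpsh] show "continuous_on U (%y. psh (y,\<one>))" by simp
  show "psh (y,\<one>):P" "proj (psh (y,\<one>)) = y" if "y:U" for y using P psh(1) H1 that by auto
  fix q assume q: "q:P" "proj q:U"
  obtain y h where yh: "et q = (y,h)" "y:U" "h:H" "psh (y,h) = q" using etUH[OF q] i(2)[OF q] by auto
  have y: "proj q = y" using psh(1) yh by auto
  show "snd (et q):H" using yh by simp
  show "q = act (psh (proj q,\<one>)) (snd (et q))" using psh(2)[OF yh(2) H1 yh(3)] yh y Hc by auto
  fix g assume g: "g:H"
  have a: "act q g = psh (y,h**g)" using psh(2)[OF yh(2,3) g] yh(4) by simp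
  have hg: "h**g:H" using subgroup.m_closed[OF H] yh(3) g by simp
  show "act q g:P" "proj (act q g) = proj q" "snd (et (act q g)) = snd (et q)**g" unfolding a y using P psh(1) i(1) yh hg by auto
 qed
qed

lemma continuous_on_locally:
 assumes "!!x. EX W. open W&x:W&continuous_on W f" shows "continuous_on UNIV f"
proof -
 have "x:\<Union>{W. open W&continuous_on W f}" for x using assms[of x] by blast
 hence "\<Union>{W. open W&continuous_on W f} = UNIV" by blast
 moreover have "continuous_on (\<Union>{W. open W&continuous_on W f}) f" by (rule continuous_on_open_Union) auto
 ultimately show ?thesis by simp
qed

locale flag_bundle_system = flag_grp L for L :: "('g,'l::euclidean_space) lie_data" (structure) +
 fixes act :: "'q::topological_space => 'g => 'q" and proj :: "'q => 'x::metric_space"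
  and R :: "'q set" and ph :: "'q => 'q" and de and ta :: "'x => ('q \<times> 'l) set" and H :: 'l
 assumes compact_X: "compact (UNIV :: 'x set)" and principal: "principal_bundle L act proj"
  and auto_ph: "bundle_automorphism L act ph" and subbundle: "K_subbundle L act proj R"
  and metrics: "flag_bundle_metrics L act de" and morse: "is_morse_data L act proj ph de ta H"
begin

lemma acts: "act q \<one> = q" "g:CL ==> h:CL ==> act (act q g) h = act q (g**h)" using principal by (auto simp: principal_bundle_def)

lemma continuous_act:
 assumes "cmap T euclidean f" "cmap T G h" shows "cmap T euclidean (%x. act (f x) (h x))"
proof -
 have "cmap T (prod_topology euclidean G) (%x. (f x,h x))" using assms by (simp add: continuous_map_pairwise o_def)
 from continuous_map_compose[OF this] show ?thesis using principal by (force simp: principal_bundle_def o_def)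
qed

lemma subgroup_G: "subgroup (CL) L" by (rule subgroup_self)

lemma sections_Q:
 obtains U ga si where "open U" "x:U" "cmap (top_of_set (proj -` U)) G ga" "continuous_on U si" "!!y. y:U ==> proj (si y) = y"
  "!!q. proj q:U ==> ga q:CL" "!!q. proj q:U ==> q = act (si (proj q)) (ga q)"
  "!!q h. proj q:U ==> h:CL ==> proj (act q h) = proj q&ga (act q h) = ga q**h"
proof -
 have "locally_trivial L act proj UNIV (CL)" using principal by (simp add: principal_bundle_def)
 from locally_trivial_sections[OF this subgroup_G, of x] show thesis by (elim exE conjE) (rule that, auto)
qed

lemma sections_R:
 obtains U ga si where "open U" "x:U" "continuous_on U si" "!!y. y:U ==> si y:R&proj (si y) = y"
  "!!q. q:R ==> proj q:U ==> ga q:KL&q = act (si (proj q)) (ga q)"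
proof -
 have "locally_trivial L act proj R (KL)" using subbundle by (simp add: K_subbundle_def)
 from locally_trivial_sections[OF this subgroup_KK, of x] show thesis by (elim exE conjE) (rule that, auto)
qed

lemma proj_act [simp]: "g:CL ==> proj (act q g) = proj q" using sections_Q[of "proj q"] by metis

lemma act_inj: assumes "g:CL" "h:CL" "act q g = act q h" shows "g = h"
proof -
 obtain U ga si where "proj q:U" "!!q. proj q:U ==> ga q:CL"
  "!!q h. proj q:U ==> h:CL ==> proj (act q h) = proj q&ga (act q h) = ga q**h" by (rule sections_Q) blast
 hence "ga q**g = ga q**h" "ga q:CL" using assms by metis+
 thus ?thesis using assms by simp
qed

lemma act_trans: assumes "proj q = proj q'" obtains g where "g:CL" "q' = act q g"
proof -
 obtain U ga si where U: "proj q:U" "!!q. proj q:U ==> ga q:CL" "!!q. proj q:U ==> q = act (si (proj q)) (ga q)" by (rule sections_Q) blast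
 define s where "s = si (proj q)"
 have q: "q = act s (ga q)" "q' = act s (ga q')" using U(3)[of q] U(3) U(1) assms by (simp_all add: s_def)
 have c: "ga q:CL" "ga q':CL" using U assms by auto
 have "act q (inv (ga q)**ga q') = act (act s (ga q)) (inv (ga q)**ga q')" using q(1) by simp
 also have "... = q'" using c q(2) by (simp add: acts(2) m_assoc[symmetric])
 finally show thesis using that[of "inv (ga q)**ga q'"] c by simp
qed

lemma R_KK: "r:R ==> k:KL ==> act r k:R" using subbundle by (simp add: K_subbundle_def)

lemma R_ex: "EX r:R. proj r = x" using sections_R[of x] by metis

lemma R_trans: assumes "r:R" "r':R" "proj r = proj r'" obtains k where "k:KL" "r' = act r k"
proof -
 obtain U ga si where U: "proj r:U" "!!q. q:R ==> proj q:U ==> ga q:KL&q = act (si (proj q)) (ga q)" by (rule sections_R) blast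
 define s where "s = si (proj r)"
 have q: "r = act s (ga r)" "r' = act s (ga r')" "ga r:KL" "ga r':KL" using U(2)[of r] U(2) U(1) assms by (auto simp: s_def)
 note c = KKc[OF q(3)] KKc[OF q(4)]
 have "act r (inv (ga r)**ga r') = act (act s (ga r)) (inv (ga r)**ga r')" using q(1) by simp
 also have "... = r'" using c q(2) by (simp add: acts(2) m_assoc[symmetric])
 finally show thesis using that KK_mult[OF KK_inv[OF q(3)] q(4)] by simp
qed

lemma R_rep: obtains r g where "r:R" "g:CL" "q = act r g" using R_ex act_trans by metis

text \<open>\<open>rg f\<close> is the function \<open>r g \<mapsto> f g\<close> on \<open>Q\<close>, for left \<open>K\<close>-invariant \<open>f\<close> and \<open>r\<close> in \<open>R\<close>.\<close>

definition rg :: "('g => 'a) => 'q => 'a" where "rg f q = f (SOME g. g:CL&(EX r:R. q = act r g))"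

lemma rg:
 assumes f: "!!k g. k:KL ==> g:CL ==> f (k**g) = f g" and "r:R" "g:CL" shows "rg f (act r g) = f g"
proof -
 define h where "h = (SOME h. h:CL&(EX r':R. act r g = act r' h))"
 have "h:CL&(EX r':R. act r g = act r' h)" unfolding h_def by (rule someI) (use assms in blast)
 then obtain r' where r': "h:CL" "r':R" "act r g = act r' h" by blast
 obtain k where k: "k:KL" "r' = act r k" using r' assms proj_act R_trans by metis
 have "g = k**h" using r'(3) k r'(1) KKc act_inj assms(3) by (simp add: acts)
 thus ?thesis using f[OF k(1) r'(1)] by (simp add: rg_def h_def)
qed

text \<open>The element carrying a local section of \<open>R\<close> to \<open>p\<close> is
  \<open>inv (ga (si' (proj p))) ** ga p\<close>, which depends continuously on \<open>p\<close>;
  locally \<open>rg f\<close> is \<open>f\<close> of it.\<close>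

lemma continuous_rg:
 fixes f :: "'g => 'a::topological_space"
 assumes f: "!!k g. k:KL ==> g:CL ==> f (k**g) = f g" and c: "cmap G euclidean f"
 shows "continuous_on UNIV (rg f)"
proof -
 have pc: "continuous_on UNIV proj" using principal by (simp add: principal_bundle_def)
 have "EX W. open W&q:W&continuous_on W (rg f)" for q
 proof -
  obtain U ga si where U: "open U" "proj q:U" "cmap (top_of_set (proj -` U)) G ga" "!!q. proj q:U ==> ga q:CL"
   "!!q h. proj q:U ==> h:CL ==> proj (act q h) = proj q&ga (act q h) = ga q**h" by (rule sections_Q) blast
  obtain U' si' where U': "open U'" "proj q:U'" "continuous_on U' si'" "!!y. y:U' ==> si' y:R&proj (si' y) = y" by (rule sections_R) blast
  define W where "W = proj -` (U \<inter> U')"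
  have W: "open W" "q:W" using U U' pc by (auto simp: W_def open_vimage)
  have s: "cmap (top_of_set W) (top_of_set (proj -` U)) (%p. si' (proj p))"
  proof -
   show ?thesis using continuous_on_compose2[OF U'(3) continuous_on_subset[OF pc subset_UNIV], of W] U'(4) by (auto simp: W_def)
  qed
  have m: "cmap (top_of_set W) G (%p. inv (ga (si' (proj p)))**ga p)"
   by (intro cmap_mult continuous_map_inv continuous_map_compose[OF s U(3), unfolded o_def]
    continuous_map_from_subtopology_mono[OF U(3)]) (auto simp: W_def)
  have eq: "f (inv (ga (si' (proj p)))**ga p) = rg f p" if p: "p:W" for p
  proof -
   define s where "s = si' (proj p)"
   have s: "s:R" "proj s = proj p" "proj p:U" using U'(4) p by (auto simp: W_def s_def)
   obtain g where g: "g:CL" "p = act s g" using act_trans[OF s(2)] by blast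
   have sU: "proj s:U" unfolding s(2) by (rule s(3))
   have "inv (ga s)**ga p = g" unfolding g(2) using U(5)[OF sU g(1)] U(4)[OF sU] g(1) by (simp add: m_assoc[symmetric])
   thus ?thesis using rg[OF f s(1) g(1)] by (simp only: s_def[symmetric] g(2)[symmetric])
  qed
  show ?thesis using continuous_map_compose[OF m c] continuous_on_cong[of W W "%p. f (inv (ga (si' (proj p)))**ga p)" "rg f", OF refl eq] W by auto
 qed
 thus ?thesis by (rule continuous_on_locally)
qed

lemma continuous_on_proj_lift:
 fixes f :: "'x => 'a::topological_space"
 assumes "continuous_on UNIV (%q. f (proj q))" shows "continuous_on UNIV f"
proof -
 have "EX W. open W&x:W&continuous_on W f" for x
 proof -
  obtain U si where U: "open U" "x:U" "continuous_on U si" "!!y. y:U ==> proj (si y) = y" by (rule sections_Q[of x]) blast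
  have "continuous_on U (%y. f (proj (si y)))" by (rule continuous_on_compose2[OF assms U(3)]) auto
  thus ?thesis using U by auto
 qed
 thus ?thesis by (rule continuous_on_locally)
qed

lemma compact_act_image: assumes "compact S" "compactin G C" shows "compact ((%(q,g). act q g) ` (S \<times> C))"
proof -
 have "compactin euclidean ((%(q,g). act q g) ` (S \<times> C))"
 by (rule image_compactin) (use assms principal in "auto simp: compactin_Times principal_bundle_def")+
 thus ?thesis by simp
qed

lemma compact_R: "compact R"
proof -
 have "EX V. open V&x:V&(EX S. compact S&S <= R&R \<inter> proj -` V <= S)" for x
 proof -
  obtain U ga si where U: "open U" "x:U" "continuous_on U si" "!!y. y:U ==> si y:R&proj (si y) = y"
   "!!q. q:R ==> proj q:U ==> ga q:KL&q = act (si (proj q)) (ga q)" by (rule sections_R[of x]) blast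
  obtain e where e: "e > 0" "cball x e <= U" using U(1,2) open_contains_cball by blast
  have "compact ((%(q,g). act q g) ` (si ` cball x e \<times> KL))" using compact_X closed_Int_compact[of "cball x e" UNIV] continuous_on_subset[OF U(3) e(2)] compact_continuous_image compact_act_image[OF _ compact_KK] by auto
  moreover have "(%(q,g). act q g) ` (si ` cball x e \<times> KL) <= R" using U(4) e(2) R_KK by auto
  moreover have "R \<inter> proj -` ball x e <= (%(q,g). act q g) ` (si ` cball x e \<times> KL)"
  proof
   fix q assume q: "q:R \<inter> proj -` ball x e"
   have "proj q:U" using q e(2) by auto
   thus "q:(%(q,g). act q g) ` (si ` cball x e \<times> KL)" using U(5) q by force
  qed
  ultimately show ?thesis using e(1) by (intro exI[of _ "ball x e"]) auto
 qed
 then obtain V where V: "!!x. open (V x)&x:V x&(EX S. compact S&S <= R&R \<inter> proj -` V x <= S)" by metis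
 then obtain S where S: "!!x. compact (S x)&S x <= R&R \<inter> proj -` V x <= S x" by metis
 obtain D where D: "finite D" "UNIV <= (\<Union>x\<in>D. V x)" by (rule compactE_image[OF compact_X, of UNIV V]) (use V in auto)
 have "r:(\<Union>x\<in>D. S x)" if "r:R" for r
 proof -
  obtain x where "x:D" "proj r:V x" using D(2) by blast
  thus ?thesis using S[of x] that by blast
 qed
 hence "R = (\<Union>x\<in>D. S x)" using S by blast
 thus ?thesis using D(1) S by (metis compact_UN)
qed

subsection \<open>The flow\<close>

lemma ph_act: "g:CL ==> ph (act q g) = act (ph q) g" using auto_ph by (simp add: bundle_automorphism_def)

lemma ph_pow_act: "g:CL ==> (ph ^^ n) (act q g) = act ((ph ^^ n) q) g" by (induction n) (simp_all add: ph_act)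

lemma continuous_ph: "continuous_on UNIV (ph ^^ n)"
proof -
 have "continuous_on UNIV ph" using auto_ph homeomorphic_imp_continuous_map by (force simp: bundle_automorphism_def)
 thus ?thesis by (induction n) (auto intro: continuous_on_compose2)
qed

abbreviation F :: "'x => 'x" where "F == base_map proj ph"

lemma F_proj: "F (proj q) = proj (ph q)" unfolding base_map_def by (rule the_equality) (use act_trans in "fastforce simp: ph_act")+

lemma F_pow_proj: "(F ^^ n) (proj q) = proj ((ph ^^ n) q)" by (induction n) (simp_all add: F_proj)

lemma continuous_F: "continuous_on UNIV F"
proof (rule continuous_on_proj_lift)
 show "continuous_on UNIV (%q. F (proj q))" using principal continuous_ph[of 1] by (auto simp: F_proj continuous_on_compose2 principal_bundle_def)
qed

text \<open>\<open>ka\<close> and \<open>kb\<close> are the Iwasawa and Cartan projections of a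
  frame measured against \<open>R\<close>. Both cocycles of the flow are expressed by their values
  along iterates of \<open>ph\<close>.\<close>

definition ka :: "'q => 'l" where "ka = rg aG"
definition kb :: "'q => 'l" where "kb = rg bp"

lemma ka: "r:R ==> g:CL ==> ka (act r g) = aG g" unfolding ka_def by (rule rg) (simp_all add: iwasawa_KK_left)
lemma kb: "r:R ==> g:CL ==> kb (act r g) = bp g" unfolding kb_def by (rule rg) (simp_all add: bp_KK)

lemma continuous_kb: "continuous_on UNIV kb" unfolding kb_def by (rule continuous_rg[OF _ continuous_bp]) (simp add: bp_KK)

lemma ka_PP: "p:PP ==> ka (act q p) = ka q+aG p" by (rule R_rep[of q]) (simp add: acts ka aG_mult_PP PP_carrier)

lemma ka_R: "r:R ==> ka r = 0" using ka[of r \<one>] acts(1) iwasawa_KK[OF KK_one] by simp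

lemma kb_KK: "k:KL ==> kb (act q k) = kb q" by (rule R_rep[of q]) (simp add: acts kb bp_KK KKc)

lemma nB_ka_kb: "nB (ka q) <= nB (kb q)"
proof (rule R_rep[of q])
 fix r g assume r: "r:R" "g:CL" "q = act r g"
 thus ?thesis using nB_aG[OF r(2) KK_one] by (simp add: ka kb nX_bp)
qed

text \<open>By subadditivity of \<open>nX\<close>, each iteration adds at most the maximum over the
  compact set \<open>R\<close> for one step.\<close>

lemma kb_growth: obtains C where "C >= 0" "!!n r. r:R ==> nB (kb ((ph ^^ n) r)) <= C * real n"
proof -
 have "continuous_on R (%r. nB (kb (ph r)))"
  using continuous_on_compose2[OF continuous_nB continuous_on_compose2[OF continuous_kb continuous_ph[of 1]]] continuous_on_subset by auto
 hence "bounded ((%r. nB (kb (ph r))) ` R)" using compact_R compact_continuous_image compact_imp_bounded by auto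
 then obtain C where C: "C > 0" "!!r. r:R ==> nB (kb (ph r)) <= C" unfolding bounded_pos by fastforce
 have "nB (kb ((ph ^^ n) r)) <= C * real n" if r: "r:R" for n r
 proof (induction n)
  case 0
  show ?case using kb[OF r, of \<one>] acts(1) nX_bp nX_one by simp
 next
  case (Suc n)
  obtain r1 g1 where 1: "r1:R" "g1:CL" "(ph ^^ n) r = act r1 g1" by (rule R_rep)
  obtain r2 g2 where 2: "r2:R" "g2:CL" "ph r1 = act r2 g2" by (rule R_rep)
  have "nB (kb ((ph ^^ Suc n) r)) = nX (g2**g1)" using 1 2 kb nX_bp by (simp add: ph_act acts)
  also have "... <= nX g2+nX g1" by (rule nX_mult[OF 2(2) 1(2)])
  also have "nX g2 <= C" using C(2)[OF 1(1)] kb[OF 2(1,2)] nX_bp[OF 2(2)] 2(3) by simp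
  also have "nX g1 <= C * real n" using Suc kb[OF 1(1,2)] nX_bp[OF 1(2)] 1(3) by simp
  finally show ?case by (simp add: distrib_left)
 qed
 thus thesis using that C(1) by (meson less_imp_le)
qed

lemma a_plus_eq: assumes "r:R" shows "a_plus L act R ph n r = kb ((ph ^^ n) r)"
proof -
 obtain r0 g where g: "r0:R" "g:CL" "(ph ^^ n) r = act r0 g" by (rule R_rep)
 show ?thesis unfolding a_plus_def
 proof (rule the_equality)
  obtain k k' where k: "bp g:cch" "k:KL" "k':KL" "g = k**expG (bp g)**k'" by (rule bp[OF g(2)])
  note c = KKc[OF k(2)] KKc[OF k(3)]
  define s where "s = inv k'**expG (bp g)**k'"
  have sS: "s:SS L" using conj_expG[of "inv k'" "bp g"] c Ad_KK(2)[OF KK_inv[OF k(3)]] k(1) clch aa_ss by (auto simp: SS_def lie_exp_eq s_def)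
  have "g = (k**k')**s" using c by (subst k(4)) (simp add: s_def m_assoc, simp add: m_assoc[symmetric])
  hence e: "(ph ^^ n) r = act (act r0 (k**k')) s" using g(3) c by (simp add: acts s_def)
  have kbn: "kb ((ph ^^ n) r) = bp g" unfolding g(3) by (rule kb[OF g(1,2)])
  have "s = inv k'**expG (bp g)**inv (inv k')" using c by (simp add: s_def)
  thus "kb ((ph ^^ n) r):cch&(EX r':R. EX s:SS L. EX k:KK L. (ph ^^ n) r = act r' s &
    s = k**lie_exp L (kb ((ph ^^ n) r))**inv k)" unfolding kbn lie_exp_eq using R_KK[OF g(1) KK_mult[OF k(2,3)]] sS KK_inv[OF k(3)] k(1) e by auto
 next
  fix H assume "H:cch&(EX r':R. EX s:SS L. EX k:KK L. (ph ^^ n) r = act r' s&s = k**lie_exp L H**inv k)"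
  then obtain r' k where h: "H:cch" "r':R" "k:KL" "(ph ^^ n) r = act r' (k**expG H**inv k)" by (auto simp: lie_exp_eq)
  thus "H = kb ((ph ^^ n) r)" using kb bp_eq[OF h(1,3) KK_inv[OF h(3)]] KKc by simp
 qed
qed

lemma a_cocycle_R_eq: assumes "r:R" shows "a_cocycle_R L act R ph n r = ka ((ph ^^ n) r)"
proof -
 obtain r0 g where g: "r0:R" "g:CL" "(ph ^^ n) r = act r0 g" by (rule R_rep)
 show ?thesis unfolding a_cocycle_R_def
 proof (rule the_equality)
  obtain m where i: "kG g:KL" "aG g:aL" "m:NN L" "g = kG g**expG (aG g)**m" by (rule iwasawa[OF g(2)])
  note c = KKc[OF i(1)] NNc[OF i(3)]
  have "(ph ^^ n) r = act (act r0 (kG g)) (expG (aG g)**m)" using g(3) i(4) c by (simp add: acts m_assoc)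
  moreover have kan: "ka ((ph ^^ n) r) = aG g" unfolding g(3) by (rule ka[OF g(1,2)])
  ultimately show "ka ((ph ^^ n) r):aL&(EX r':R. EX n':NN L. (ph ^^ n) r = act r' (lie_exp L (ka ((ph ^^ n) r))**n'))"
   unfolding kan lie_exp_eq using R_KK[OF g(1) i(1)] i(2,3) by auto
 next
  fix H assume "H:aL&(EX r':R. EX n':NN L. (ph ^^ n) r = act r' (lie_exp L H**n'))"
  then obtain r' m where h: "H:aL" "r':R" "m:NN L" "(ph ^^ n) r = act r' (expG H**m)" by (auto simp: lie_exp_eq)
  thus "H = ka ((ph ^^ n) r)" using ka aG_mult_NN aG_expG_aa(1) NNc by simp
 qed
qed

subsection \<open>The bundle of maximal flags\<close>

abbreviation ef :: "'q => ('q \<times> 'g set) set" where "ef q == flag_point L act q PP"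
abbreviation "ET == flag_bundle_topology L act {}"
abbreviation "EF == assoc_map ph"

lemma PP_subset: "PP <= CL" using PP_carrier by blast

lemma coset_PP: "g:CL ==> h:CL ==> g <# (h <# PP) = (g**h) <# PP" by (rule lcos_m_assoc[OF PP_subset])

text \<open>Absorbing the coset into the frame represents every flag as \<open>ef\<close> of a
  frame, so the bundle of maximal flags is treated as \<open>Q\<close> modulo the parabolic
  subgroup.\<close>

lemma flag_pt: assumes "g:CL" shows "flag_point L act q (g <# PP) = ef (act q g)"
proof (rule subset_antisym; rule subsetI)
 fix z assume "z:flag_point L act q (g <# PP)"
 then obtain h where h: "h:CL" "z = (act q h,inv h <# (g <# PP))" by (auto simp: assoc_point_def)
 hence "z = (act (act q g) (inv g**h),inv (inv g**h) <# PP)" using assms by (simp add: acts coset_PP inv_mult_group m_assoc[symmetric])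
 thus "z:ef (act q g)" unfolding assoc_point_def using assms h by auto
next
 fix z assume "z:ef (act q g)"
 then obtain h where h: "h:CL" "z = (act (act q g) h,inv h <# PP)" by (auto simp: assoc_point_def)
 thus "z:flag_point L act q (g <# PP)" unfolding assoc_point_def using assms by (auto simp: acts coset_PP inv_mult_group m_assoc)
qed

lemma ef_PP: "p:PP ==> ef (act q p) = ef q" using flag_pt[of p q] coset_join3[OF PP_carrier subgroup_PP, of p] PP_carrier by simp

lemma assoc_mem: "(q',D'):assoc_point L act rh q D \<longleftrightarrow> (EX g:carrier L. q' = act q g&D' = rh (inv g) D)"
 by (auto simp: assoc_point_def)

lemma ef_eq: assumes "ef q = ef q'" obtains p where "p:PP" "q' = act q p"
proof -
 have "(q',PP):ef q'" unfolding assoc_mem using lcos_mult_one[OF PP_subset] by (intro bexI[of _ \<one>]) (simp_all add: acts)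
 then obtain g where g: "g:CL" "q' = act q g" "PP = inv g <# PP" unfolding assms[symmetric] assoc_mem by auto
 have "inv g:PP" using PP_one g by (fastforce simp: l_coset_def)
 thus thesis using that PP_inv[of "inv g"] g by simp
qed

lemma topspace_flag: "topspace (flag_topology L {}) = (%g. g <# PP) ` CL"
 using quotient_imp_surjective_map[OF quotient_map_quotient_topology[of G "%g. g <# PP"]] by (simp add: flag_topology_def)

lemma topspace_E: "topspace ET = range ef"
proof -
 have "topspace ET = (%(q,f). flag_point L act q f) ` (UNIV \<times> (%g. g <# PP) ` CL)"
  using quotient_imp_surjective_map[OF quotient_map_quotient_topology[of "prod_topology euclidean (flag_topology L {})" "%(q,f). flag_point L act q f"]]
  by (simp add: flag_bundle_topology_def assoc_topology_def topspace_flag)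
 also have "... = range ef"
 proof (rule subset_antisym; rule subsetI)
  fix z assume "z:range ef"
  then obtain q where "z = ef (act q \<one>)" by (auto simp: acts)
  thus "z:(%(q,f). flag_point L act q f) ` (UNIV \<times> (%g. g <# PP) ` CL)" using flag_pt by blast
 qed (auto simp: flag_pt)
 finally show ?thesis .
qed

text \<open>The topology comes from two successive quotients; this identifies it with the quotient
  topology of \<open>ef\<close>. The point of the converse direction is that \<open>G\<close> maps
  openly to the flag manifold: the saturation of an open set is a union of right translates.\<close>

lemma openin_E: "openin ET V \<longleftrightarrow> V <= range ef & open (ef -` V)"
proof
 let ?T = "prod_topology (euclidean :: 'q topology) (flag_topology L {})" and ?f = "%(q,f). flag_point L act q f"
 have quo: "openin ET V \<longleftrightarrow> V <= ?f ` topspace ?T & openin ?T {x:topspace ?T. ?f x:V}" for V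
  unfolding flag_bundle_topology_def assoc_topology_def by (rule openin_quotient_topology)
 {
  assume V: "openin ET V"
  have "cmap euclidean ?T (%q. (q,PP))"
   using coset_join3[OF one_closed subgroup_PP PP_one] by (auto simp: continuous_map_pairwise o_def topspace_flag)
  hence "open {q. (q,PP) : {x:topspace ?T. ?f x:V}}" using V openin_continuous_map_preimage unfolding quo by force
  moreover have "(q,PP):topspace ?T" for q using coset_join3[OF one_closed subgroup_PP PP_one] by (auto simp: topspace_flag)
  ultimately show "V <= range ef & open (ef -` V)" using openin_subset[OF V] topspace_E by (simp add: vimage_def)
 next
  assume V: "V <= range ef & open (ef -` V)"
  let ?W = "{z:topspace (prod_topology euclidean G). (%(q,g). act q g) z:ef -` V}"
  have W: "openin (prod_topology euclidean G) ?W" by (rule openin_continuous_map_preimage) (use V principal in "auto simp: principal_bundle_def")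
  have "openin ?T {x:topspace ?T. ?f x:V}" unfolding openin_prod_topology_alt
  proof (intro allI impI)
   fix q f assume qf: "(q,f) : {x:topspace ?T. ?f x:V}"
   then obtain g where g: "g:CL" "f = g <# PP" by (auto simp: topspace_flag)
   then obtain A B where AB: "open A" "openin G B" "q:A" "g:B" "A \<times> B <= ?W" using qf flag_pt W[unfolded openin_prod_topology_alt, rule_format, of q g] by auto
   have Bc: "B <= CL" using openin_subset[OF AB(2)] by simp
   let ?B = "(%g. g <# PP) ` B"
   have "openin G (\<Union>p\<in>PP. {h:topspace G. h**p:B})"
   proof (intro openin_Union ballI, elim imageE)
    fix S p assume p: "S = {h:topspace G. h**p:B}" "p:PP"
    have "cmap G G (%h. h**p)" using PP_carrier[OF p(2)] by (intro cmap_mult) auto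
    thus "openin G S" unfolding p(1) using AB(2) by (rule openin_continuous_map_preimage)
   qed
   moreover have "(\<Union>p\<in>PP. {h:topspace G. h**p:B}) = {h:topspace G. h <# PP:?B}"
   proof (rule subset_antisym; rule subsetI)
    fix h assume "h:(\<Union>p\<in>PP. {h:topspace G. h**p:B})"
    then obtain p where p: "p:PP" "h:CL" "h**p:B" by auto
    show "h : {h:topspace G. h <# PP:?B}" using coset_PP[OF p(2) PP_carrier[OF p(1)]] coset_join3[OF PP_carrier[OF p(1)] subgroup_PP p(1)] p by auto
   next
    fix h assume "h : {h:topspace G. h <# PP:?B}"
    then obtain b where b: "h:CL" "b:B" "h <# PP = b <# PP" by auto
    have "b:h <# PP" unfolding b(3) using PP_one b(2) Bc by (auto simp: l_coset_def intro!: bexI)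
    then obtain p where "p:PP" "b = h**p" by (auto simp: l_coset_def)
    thus "h:(\<Union>p\<in>PP. {h:topspace G. h**p:B})" using b by auto
   qed
   ultimately have "openin (flag_topology L {}) ?B" unfolding flag_topology_def openin_quotient_topology using Bc by auto
   moreover have "A \<times> ?B <= {x:topspace ?T. ?f x:V}" using AB(5) by (auto simp: topspace_flag flag_pt)
   ultimately show "EX U V'. openin euclidean U & openin (flag_topology L {}) V'&q:U&f:V'&U \<times> V' <= {x:topspace ?T. ?f x:V}"
    using AB g by auto
  qed
  moreover have "V <= ?f ` topspace ?T"
   using V topspace_E quotient_imp_surjective_map[OF quotient_map_quotient_topology[of ?T ?f]] by (simp add: flag_bundle_topology_def assoc_topology_def)
  ultimately show "openin ET V" unfolding quo by blast
 }
qed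

lemma continuous_ef: "cmap euclidean ET ef" unfolding continuous_map_def using openin_E topspace_E by (auto simp: vimage_def)

lemma EF_ef: "EF (ef q) = ef (ph q)" unfolding assoc_map_def assoc_point_def by (auto simp: image_iff) (metis ph_act)+

lemma EF_pow_ef: "(EF ^^ n) (ef q) = ef ((ph ^^ n) q)" by (induction n) (simp_all add: EF_ef)

lemma ef_R: obtains r k where "r:R" "ef q = ef r"
proof -
 obtain r g where r: "r:R" "g:CL" "q = act r g" by (rule R_rep)
 obtain n where i: "kG g:KL" "aG g:aL" "n:NN L" "g = kG g**expG (aG g)**n" by (rule iwasawa[OF r(2)])
 have p: "expG (aG g)**n:PP" using AA_PP[OF i(2)] NN_PP[OF i(3)] PP_mult by simp
 have "q = act (act r (kG g)) (expG (aG g)**n)" using r(3) i KKc NNc by (simp add: acts m_assoc)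
 thus thesis using that[OF R_KK[OF r(1) i(1)]] ef_PP[OF p] by simp
qed

lemma compact_system: "compact_system (topspace ET) (de {}) EF" "Metric_space.mtopology (topspace ET) (de {}) = ET"
proof -
 have m: "Metric_space (topspace ET) (de {})" "Metric_space.mtopology (topspace ET) (de {}) = ET"
  using metrics by (auto simp: flag_bundle_metrics_def flag_bundle_def)
 show "Metric_space.mtopology (topspace ET) (de {}) = ET" by (rule m)
 have "topspace ET = ef ` R" unfolding topspace_E using ef_R by (metis (no_types, lifting) image_eqI image_subsetI rangeI subset_antisym)
 hence "compact_space ET" unfolding compact_space_def using image_compactin[of euclidean R ET ef] compact_R continuous_ef by simp
 moreover have "cmap ET ET EF" unfolding continuous_map_def
 proof (intro conjI allI impI)
  show "EF:topspace ET \<rightarrow> topspace ET" by (auto simp: topspace_E EF_ef)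
  fix U assume "openin ET U"
  hence "open (ef -` U)" by (simp add: openin_E)
  moreover have "ef -` {x:topspace ET. EF x:U} = ph -` (ef -` U)" by (auto simp: topspace_E EF_ef)
  ultimately show "openin ET {x:topspace ET. EF x:U}" using open_vimage[OF _ continuous_ph[of 1]] unfolding openin_E by (auto simp: topspace_E)
 qed
 ultimately show "compact_system (topspace ET) (de {}) EF" using m by (simp add: compact_system_def compact_system_axioms_def)
qed

subsection \<open>The Morse section\<close>

lemma assoc_Ad: assumes "g:CL" shows "assoc_point L act (AD) (act q g) (AD (inv g) D) = assoc_point L act (AD) q D"
proof (rule subset_antisym; rule subsetI)
 fix z assume "z:assoc_point L act (AD) (act q g) (AD (inv g) D)"
 then obtain h where h: "h:CL" "z = (act (act q g) h,AD (inv h) (AD (inv g) D))" by (auto simp: assoc_point_def)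
 thus "z:assoc_point L act (AD) q D" unfolding assoc_point_def using assms by (auto simp: acts inv_mult_group Adm)
next
 fix z assume "z:assoc_point L act (AD) q D"
 then obtain h where h: "h:CL" "z = (act q h,AD (inv h) D)" by (auto simp: assoc_point_def)
 hence "z = (act (act q g) (inv g**h),AD (inv (inv g**h)) (AD (inv g) D))" using assms by (simp add: acts inv_mult_group Adm m_assoc[symmetric])
 thus "z:assoc_point L act (AD) (act q g) (AD (inv g) D)" unfolding assoc_point_def using assms h by auto
qed

lemma assoc_Ad_self: "(q,D):assoc_point L act (AD) q D" unfolding assoc_point_def by (intro CollectI exI[of _ \<one>]) (simp add: acts)

lemma assoc_Ad_inj: assumes "assoc_point L act (AD) q D = assoc_point L act (AD) q D'" shows "D = D'"
using assoc_Ad_self act_inj by (metis assms assoc_mem)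

lemma H_closure: "H:cch" and H_aa: "H:aL" using morse clch by (auto simp: is_morse_data_def)

lemma orbit_closed: "g:CL ==> D:adjoint_orbit L H ==> AD g D:adjoint_orbit L H" by (auto simp: adjoint_orbit_def Adm[symmetric])

text \<open>The Morse section as an equivariant map on frames. The frames with
  \<open>DD q = H\<close> form its reduction to the stabilizer of \<open>H\<close>, and the flow
  preserves \<open>DD\<close>.\<close>

definition DD :: "'q => 'l" where "DD q = (THE D. ta (proj q) = assoc_point L act (AD) q D)"

abbreviation "AT == assoc_topology L act (AD) (top_of_set (adjoint_orbit L H))"

lemma ta_AT: "cmap euclidean AT ta" using morse by (auto simp: is_morse_data_def)

lemma ta_proj: assumes "ta x = assoc_point L act (AD) p D" shows "proj p = x"
proof -
 show ?thesis using morse[unfolded is_morse_data_def] assoc_Ad_self assms by fastforce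
qed

lemma DD_ex: "EX D:adjoint_orbit L H. ta (proj q) = assoc_point L act (AD) q D"
proof -
 have "ta (proj q):topspace AT" using continuous_map_image_subset_topspace[OF ta_AT] by auto
 then obtain p D where p: "D:adjoint_orbit L H" "ta (proj q) = assoc_point L act (AD) p D"
  using quotient_imp_surjective_map[OF quotient_map_quotient_topology[of "prod_topology euclidean (top_of_set (adjoint_orbit L H))" "%(q,f). assoc_point L act (AD) q f"], symmetric]
  by (auto simp: assoc_topology_def)
 then obtain g where g: "g:CL" "q = act p g" using act_trans ta_proj by metis
 thus ?thesis using assoc_Ad p orbit_closed by blast
qed

lemma DD_eq: "ta (proj q) = assoc_point L act (AD) q D ==> DD q = D" unfolding DD_def using assoc_Ad_inj by (intro the_equality) auto

lemma DD: "ta (proj q) = assoc_point L act (AD) q (DD q)" "DD q:adjoint_orbit L H" using DD_ex[of q] DD_eq by auto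

lemma DD_act: "g:CL ==> DD (act q g) = AD (inv g) (DD q)" by (rule DD_eq) (simp add: assoc_Ad DD(1))

lemma DD_ph: "DD (ph q) = DD q"
proof (rule DD_eq)
 have "EF (assoc_point L act (AD) q (DD q)) = assoc_point L act (AD) (ph q) (DD q)"
  unfolding assoc_map_def assoc_point_def by (auto simp: image_iff) (metis ph_act)+
 moreover have "EF (ta (proj q)) = ta (F (proj q))" using morse by (auto simp: is_morse_data_def)
 ultimately show "ta (proj (ph q)) = assoc_point L act (AD) (ph q) (DD q)" by (simp add: DD(1) F_proj)
qed

lemma DD_ph_pow: "DD ((ph ^^ n) q) = DD q" by (induction n) (simp_all add: DD_ph)

text \<open>In a local trivialization the section becomes a map \<open>h\<close> on the base. The
  preimage of an open set under \<open>h\<close> is the preimage under \<open>ta\<close> of the set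
  \<open>V\<close> of bundle points whose fibre coordinate lies in it, and \<open>V\<close> is open
  in the quotient.\<close>

lemma continuous_DD: "continuous_on UNIV DD"
proof (rule continuous_on_locally)
 fix q0
 obtain U ga si where U: "open U" "proj q0:U" "cmap (top_of_set (proj -` U)) G ga" "continuous_on U si" "!!y. y:U ==> proj (si y) = y"
  "!!q. proj q:U ==> ga q:CL"
  "!!q h. proj q:U ==> h:CL ==> proj (act q h) = proj q&ga (act q h) = ga q**h" by (rule sections_Q) blast
 define h where "h y = AD (ga (si y)) (DD (si y))" for y
 have inv: "AD (ga q) D = AD (ga q') D'"
  if q: "proj q:U" "proj q':U" and e: "assoc_point L act (AD) q D = assoc_point L act (AD) q' D'" for q q' D D'
 proof -
  obtain g where g: "g:CL" "q' = act q g" "D' = AD (inv g) D" using assoc_Ad_self[of q' D'] unfolding e[symmetric] assoc_mem by auto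
  show ?thesis using U(7)[OF q(1) g(1)] g U(6)[OF q(1)] by (simp add: Adm)
 qed
 have DDh: "AD (ga q) (DD q) = h (proj q)" if "proj q:U" for q unfolding h_def using that U(5) DD(1) DD(1)[of "si (proj q)"] by (intro inv) auto
 have pc: "continuous_on UNIV proj" using principal by (simp add: principal_bundle_def)
 have oU: "open (proj -` U)" using U(1) pc by (intro open_vimage)
 have ch: "continuous_on U h" unfolding continuous_on_open_vimage[OF U(1)]
 proof (intro allI impI)
  fix O' :: "'l set" assume O: "open O'"
  let ?T = "prod_topology (euclidean :: 'q topology) (top_of_set (adjoint_orbit L H))"
  define V where "V = {assoc_point L act (AD) q D | q D. proj q:U&D:adjoint_orbit L H&AD (ga q) D:O'}"
  have pre: "{x:topspace ?T. (%(q,D). assoc_point L act (AD) q D) x:V} =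
    {x:topspace (subtopology ?T (proj -` U \<times> UNIV)). AD (ga (fst x)) (snd x):O'}" (is "?l = ?r")
  proof (rule subset_antisym; rule subsetI)
   fix x assume x: "x:?l"
   then obtain q D q' D' where qD: "x = (q,D)" "D:adjoint_orbit L H" "assoc_point L act (AD) q D = assoc_point L act (AD) q' D'"
    "proj q':U" "AD (ga q') D':O'" by (auto simp: V_def)
   obtain g where "g:CL" "q' = act q g" using assoc_Ad_self[of q' D'] unfolding qD(3)[symmetric] assoc_mem by auto
   thus "x:?r" using qD inv[OF _ qD(4,3)] by simp
  next
   fix x assume x: "x:?r"
   obtain q D where qD: "x = (q,D)" by (cases x)
   show "x:?l" unfolding V_def using x qD by auto
  qed
  have "cmap (subtopology ?T (proj -` U \<times> UNIV)) euclidean (%x. AD (ga (fst x)) (snd x))"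
  proof (rule continuous_map_Ad)
   have "cmap (subtopology ?T (proj -` U \<times> UNIV)) (top_of_set (proj -` U)) fst"
    by (auto simp: continuous_map_in_subtopology continuous_map_from_subtopology continuous_map_fst)
   from continuous_map_compose[OF this U(3)] show "cmap (subtopology ?T (proj -` U \<times> UNIV)) G (%x. ga (fst x))" by (simp add: o_def)
   show "cmap (subtopology ?T (proj -` U \<times> UNIV)) euclidean snd"
    by (rule continuous_map_from_subtopology, rule continuous_map_into_fulltopology, rule continuous_map_snd)
  qed
  hence "openin (subtopology ?T (proj -` U \<times> UNIV)) ?r" by (rule openin_continuous_map_preimage) (simp add: O)
  hence "openin (subtopology ?T (topspace ?T \<inter> (proj -` U \<times> UNIV))) ?r" by (metis (no_types) subtopology_restrict)
  moreover have "openin ?T (topspace ?T \<inter> (proj -` U \<times> UNIV))" using oU by (simp add: Times_Int_Times openin_prod_Times_iff)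
  ultimately have "openin AT V" unfolding pre assoc_topology_def openin_quotient_topology using openin_open_subtopology by (auto simp: V_def)
  hence "open {y. ta y:V}" using openin_continuous_map_preimage[OF ta_AT] by simp
  moreover have "{y. ta y:V} = h -` O' \<inter> U"
  proof (rule subset_antisym; rule subsetI)
   fix y assume "y : {y. ta y:V}"
   then obtain q D where qD: "ta y = assoc_point L act (AD) q D" "proj q:U" "AD (ga q) D:O'" by (auto simp: V_def)
   hence y: "proj q = y" by (intro ta_proj)
   hence "DD q = D" using qD(1) by (intro DD_eq) simp
   thus "y:h -` O' \<inter> U" using DDh[OF qD(2)] qD y by simp
  next
   fix y assume y: "y:h -` O' \<inter> U"
   have e: "proj (si y) = y" using U(5) y by blast
   show "y : {y. ta y:V}" unfolding V_def using y DD(1)[of "si y"] e DD(2) by (fastforce simp: h_def)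
  qed
  ultimately show "open (h -` O' \<inter> U)" by simp
 qed
 have "cmap (top_of_set (proj -` U)) euclidean (%q. AD (inv (ga q)) (h (proj q)))"
 proof (rule continuous_map_Ad[OF continuous_map_inv[OF U(3)]])
  show "cmap (top_of_set (proj -` U)) euclidean (%q. h (proj q))"
   using continuous_on_compose2[OF ch continuous_on_subset[OF pc subset_UNIV], of "proj -` U"] by auto
 qed
 moreover have "AD (inv (ga q)) (h (proj q)) = DD q" if "q:proj -` U" for q using DDh that Ad_inv(1)[OF U(6)[of q], of "DD q"] by simp
 ultimately show "EX W. open W&q0:W&continuous_on W DD" using continuous_on_cong[of "proj -` U" "proj -` U" "%q. AD (inv (ga q)) (h (proj q))" DD] oU U(2) by auto
qed

abbreviation "Mp == morse_component L act ta H {} \<one>\<^bsub>weyl_group L\<^esub>"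

text \<open>For the trivial Weyl element the fixed flags are the translates of the origin by
  elements carrying \<open>H\<close> to \<open>D\<close>; absorbing such an element into the frame
  turns \<open>D\<close> into \<open>H\<close>.\<close>

lemma Mp_eq: "Mp = ef ` {q. DD q = H}"
proof -
 have one: "\<one>\<^bsub>weyl_group L\<^esub> <#> PP = PP"
 proof (rule subset_antisym; rule subsetI)
  fix x assume "x:\<one>\<^bsub>weyl_group L\<^esub> <#> PP"
  then obtain m p where "m:M0" "p:PP" "x = m**p" by (auto simp: weyl_group_def set_mult_def)
  moreover have "m:PP" if "m:M0" for m unfolding parabolic_eq using that M0_simps(2) subspace_0[OF subsp(3)] NN_one by force
  ultimately show "x:PP" using PP_mult by blast
 next
  fix x assume x: "x:PP"
  thus "x:\<one>\<^bsub>weyl_group L\<^esub> <#> PP" using PP_carrier M0_simps(4) by (force simp: weyl_group_def set_mult_def)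
 qed
 show ?thesis
 proof (rule subset_antisym; rule subsetI)
  fix xi assume "xi:Mp"
  then obtain x p D f where x: "xi = flag_point L act p f" "ta x = assoc_point L act (AD) p D" "f:fix_flag L {} H D \<one>\<^bsub>weyl_group L\<^esub>"
   by (auto simp: morse_component_def)
  obtain g z where g: "f = (g**z) <# PP" "g:CL" "AD g H = D" "z:CL" "AD z H = H" using x(3) by (auto simp: fix_flag_def one stabilizer_def)
  have "DD p = D" using x(2) ta_proj by (intro DD_eq) simp
  moreover have "AD (inv z) H = H" "AD (inv g) D = H" using Ad_inv(1)[OF g(4), of H] g(5) Ad_inv(1)[OF g(2), of H] g(3) by auto
  ultimately show "xi:ef ` {q. DD q = H}" using DD_act x(1) g flag_pt by (simp add: inv_mult_group Adm)
 next
  fix xi assume "xi:ef ` {q. DD q = H}"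
  then obtain q where q: "xi = ef q" "DD q = H" by blast
  have "\<one> <# PP:fix_flag L {} H H \<one>\<^bsub>weyl_group L\<^esub>"
   unfolding fix_flag_def one by (intro CollectI exI[of _ \<one>]) (simp add: stabilizer_def)
  thus "xi:Mp" unfolding morse_component_def using q DD[of q] flag_pt[of \<one> q] acts(1) by (intro UN_I CollectI exI[of _ q]) auto
 qed
qed

lemma Mp_component: "Mp:chain_components EF (de {}) (topspace ET)" and Mp_attractor: "attractor ET EF Mp"
 using morse unfolding is_morse_data_def flag_bundle_def by blast+

text \<open>Near a given frame of \<open>R\<close> the section is, after one fixed translation,
  close to \<open>H\<close>, and \<open>orbit_local\<close> corrects it by an element of one compact
  set. Compactness of \<open>R\<close> leaves finitely many translations.\<close>

lemma bounded_reps: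
 obtains C where "compactin G C" "!!x. EX r:R. EX c:C. proj r = x&DD (act r c) = H"
proof -
 obtain C ep where C: "compactin G C" "ep > 0" "!!g. g:CL ==> norm (AD g H-H) < ep ==> EX c:C. AD g H = AD c H"
  by (rule orbit_local[OF H_closure]) blast
 have Cc: "C <= CL" using compactin_subset_topspace[OF C(1)] by simp
 have "EX W g. open W&r0:W&g:CL&(ALL r:W. EX c:C. DD (act r (g**c)) = H)" for r0
 proof -
  obtain g where g: "g:CL" "DD r0 = AD g H" using DD(2) by (auto simp: adjoint_orbit_def)
  have ca: "continuous_on UNIV (%r. act r g)" using continuous_act[of euclidean "%r. r" "%_. g"] g by simp
  define W where "W = {r. norm (DD (act r g)-H) < ep}"
  have "open W" unfolding W_def by (intro open_Collect_less continuous_intros continuous_on_compose2[OF continuous_DD ca]) auto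
  moreover have "EX c:C. DD (act r (g**c)) = H" if r: "r:W" for r
  proof -
   obtain h where h: "h:CL" "DD (act r g) = AD h H" using DD(2) by (auto simp: adjoint_orbit_def)
   then obtain c where c: "c:C" "DD (act r g) = AD c H" using C(3) r by (auto simp: W_def)
   hence "DD (act (act r g) c) = H" using Cc by (auto simp: DD_act)
   thus ?thesis using c(1) Cc g by (intro bexI) (auto simp: acts)
  qed
  ultimately show ?thesis using g C(2) by (fastforce simp: W_def DD_act)
 qed
 then obtain W g where W: "!!r. open (W r)&r:W r&g r:CL&(ALL r':W r. EX c:C. DD (act r' (g r**c)) = H)" by metis
 obtain D where D: "D <= R" "finite D" "R <= (\<Union>r\<in>D. W r)" by (rule compactE_image[OF compact_R, of R W]) (use W in auto)
 define C' where "C' = (\<Union>r\<in>D. (%c. g r**c) ` C)"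
 have "compactin G C'" unfolding C'_def
 proof (rule compactin_Union)
  show "finite ((%r. (%c. g r**c) ` C) ` D)" using D(2) by simp
  fix S assume "S:(%r. (%c. g r**c) ` C) ` D"
  then obtain r where r: "S = (%c. g r**c) ` C" by blast
  have "cmap G G (%c. g r**c)" using W by (intro cmap_mult) auto
  thus "compactin G S" unfolding r by (rule image_compactin[OF C(1)])
 qed
 moreover have "EX r:R. EX c:C'. proj r = x&DD (act r c) = H" for x
 proof -
  obtain r where r: "r:R" "proj r = x" using R_ex by blast
  then obtain r1 where r1: "r1:D" "r:W r1" using D(3) by blast
  then obtain c where "c:C" "DD (act r (g r1**c)) = H" using W by blast
  thus ?thesis using r r1 by (intro bexI) (auto simp: C'_def)
 qed
 ultimately show thesis using that by blast
qed

text \<open>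
 If \<open>ro b\<close> were very negative, a point close to the attractor would be moved by \<open>ph\<^sup>n\<close> to a fixed
 distance from it.
\<close>

lemma attractor_bound:
 assumes S: "compact S" "!!q. q:S ==> DD q = H" and ro: "ro:sL" "ro H ~= 0"
 shows "EX N c. ALL n q q' k k' b. n >= N --> q:S --> q':S --> k:KH H --> k':KH H --> b:aL -->
  (ph ^^ n) q = act q' (k**expG b**k') --> ro b >=-c"
proof -
 obtain Y where Y: "Y:rsp (%H.-ro H)" "!!H p. H:aL ==> ro H ~= 0 ==> p:PP ==> AD (expG (- Y)) H ~= AD p H"
  using negative_root_moves[OF ro(1)] by auto
 define BK where "BK = (%(q,k). act q k) ` (S \<times> KH H)"
 have BK: "compact BK" unfolding BK_def by (rule compact_act_image[OF S(1) compact_KH])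
 have BKH: "DD q = H" if "q:BK" for q
 proof -
  obtain q1 k where k: "q1:S" "k:KH H" "q = act q1 k" using \<open>q : BK\<close> by (auto simp: BK_def)
  thus ?thesis using KHs(2)[OF KHs(6)[OF k(2)]] KHs(3) S(2) by (simp add: DD_act)
 qed
 obtain V where V: "openin ET V" "Mp <= V" "omega_limit ET EF V = Mp" using Mp_attractor by (auto simp: attractor_def)
 have ca: "cmap (prod_topology euclidean euclideanreal) euclidean (%z. act (fst z) (expG (snd z *R Y)))"
  by (intro continuous_act cmap_expGc) (auto intro!: continuous_intros)
 let ?W = "{z. act (fst z) (expG (snd z *R Y)):ef -` V}"
 have W: "openin (prod_topology euclidean euclideanreal) ?W" using V(1) openin_continuous_map_preimage[OF ca, of "ef -` V"] by (simp add: openin_E)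
 have BW: "BK \<times> {0} <= ?W" using BKH V(2) by (auto simp: acts Mp_eq)
 obtain U1 U2 where "openin euclidean U1" "openin euclideanreal U2" "BK <= U1" "{0} <= U2" "U1 \<times> U2 <= ?W"
  by (rule Wallace_theorem_prod_topology[OF _ _ W BW]) (use BK in auto)
 hence U: "open U2" "BK <= U1" "0:U2" "U1 \<times> U2 <= ?W" by auto
 obtain e where e: "e > 0" "!!s. \<bar>s\<bar> < e ==> s:U2" using U(1,3) by (auto simp: open_dist)
 \<comment> \<open>Flags displaced from the attractor by the full step \<open>expG Y\<close>. They
   form a compact set off the attractor, which the closure of all sufficiently late images of
   \<open>V\<close> therefore misses.\<close>
 define Z where "Z = ef ` (%q. act q (expG Y)) ` BK"
 have Zc: "compactin ET Z" unfolding Z_def using BK continuous_act[of euclidean "%r. r" "%_. expG Y"]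
  by (intro image_compactin[OF _ continuous_ef]) (simp add: compact_continuous_image continuous_on_subset)
 have ZM: "Z \<inter> Mp = {}"
 proof -
  have False if z: "q:BK" "DD q' = H" "ef (act q (expG Y)) = ef q'" for q q'
  proof -
   obtain p where p: "p:PP" "q' = act (act q (expG Y)) p" by (rule ef_eq[OF z(3)])
   hence "AD (inv p) (AD (expG (- Y)) H) = H" using z(2) BKH[OF z(1)] PP_carrier by (simp add: DD_act expG_minus inv_mult_group Adm)
   thus False using Ad_inv(2)[OF PP_carrier[OF p(1)]] Y(2)[OF H_aa ro(2) p(1)] by metis
  qed
  thus ?thesis by (auto simp: Z_def Mp_eq)
 qed
 define A where "A n = ET closure_of (\<Union>k\<in>{n..}. (EF ^^ k) ` V)" for n
 have A: "A m <= A n" if "n <= m" for n m unfolding A_def using that by (intro closure_of_mono UN_mono) auto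
 have "EX N. A N \<inter> Z = {}"
 proof -
  have Zs: "Z <= topspace ET" using Zc compactin_subset_topspace by auto
  have "Z <= \<Union>(range (%n. topspace ET-A n))" using ZM V(3) Zs unfolding omega_limit_def A_def by auto
  moreover have "openin ET U" if "U:range (%n. topspace ET-A n)" for U using that by (auto simp: A_def)
  ultimately obtain \<F> where F: "finite \<F>" "\<F> <= range (%n. topspace ET-A n)" "Z <= \<Union>\<F>" using compactinD[OF Zc] by metis
  obtain I where I: "finite I" "\<F> = (%n. topspace ET-A n) ` I" using finite_subset_image[OF F(1,2)] by auto
  have "A (Max (insert 0 I)) \<inter> Z = {}"
  proof -
   have "A (Max (insert 0 I)) <= A n" if "n:I" for n using that I(1) by (intro A) auto
   thus ?thesis using F(3) I(2) by blast
  qed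
  thus ?thesis by blast
 qed
 then obtain N where N: "A N \<inter> Z = {}" by blast
 have "ro b >= ln e" if h: "n >= N" "q:S" "q':S" "k:KH H" "k':KH H" "b:aL" "(ph ^^ n) q = act q' (k**expG b**k')" for n q q' k k' b
 proof (rule ccontr)
  assume "~ ro b >= ln e"
  hence s: "exp (ro b) < e" using e(1) by (metis exp_less_cancel_iff exp_ln not_le)
  note c = KHs(3)[OF h(4)] KHs(3)[OF h(5)]
  \<comment> \<open>From \<open>q1\<close> the flow is given by \<open>k ** expG b\<close> alone.
    Moving \<open>expG b\<close> past the displacement \<open>exp (ro b) Y\<close> rescales it to
    \<open>Y\<close>, so for very negative \<open>ro b\<close> a point of \<open>V\<close> would be
    carried into \<open>Z\<close>.\<close>
  define q1 where "q1 = act q (inv k')"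
  define xi where "xi = ef (act q1 (expG (exp (ro b) *R Y)))"
  have xiV: "xi:V" using h(2) KHs(6)[OF h(5)] e(2) s U(2,4) by (auto simp: xi_def subset_iff q1_def BK_def)
  have "(ph ^^ n) (act q1 (expG (exp (ro b) *R Y))) = act q' (k**(expG b**expG (exp (ro b) *R Y)))"
   using c by (simp add: q1_def ph_pow_act h(7) acts m_assoc) (simp add: m_assoc[symmetric])
  hence "(ph ^^ n) (act q1 (expG (exp (ro b) *R Y))) = act (act (act q' k) (expG Y)) (expG b)" using Ad_root_space[OF h(6) Y(1)] mult_expG[of "expG b" "exp (ro b) *R Y"] c by (simp add: acts m_assoc Adlin exp_minus)
  hence "(EF ^^ n) xi = ef (act (act q' k) (expG Y))" by (simp add: xi_def EF_pow_ef ef_PP[OF AA_PP[OF h(6)]])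
  moreover have "act q' k:BK" using h(3,4) by (force simp: BK_def)
  ultimately have "(EF ^^ n) xi:Z" by (auto simp: Z_def)
  moreover have "(EF ^^ n) xi:A N"
  proof -
   have "(EF ^^ n) xi:topspace ET" unfolding xi_def EF_pow_ef topspace_E by simp
   thus ?thesis unfolding A_def closure_of_def using xiV h(1) by auto
  qed
  ultimately show False using N by blast
 qed
 thus ?thesis by (intro exI[of _ N] exI[of _ "- ln e"]) simp
qed

end

section \<open>Weyl orbits: adjointness of reflections and extreme points\<close>

context flag_grp
begin

text \<open>Each reflection is self-adjoint for the form, so a word in reflections can be moved to
  the other argument, in reversed order.\<close>

lemma RO_adjoint:
 assumes "Th <= sL" "X:aL" "x:RO Th X" "Y:aL" shows "EX y:RO Th Y. fo x Y = fo X y" using assms(3,4)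
proof (induction arbitrary: Y)
 case RO_base
 thus ?case using RO.RO_base by blast
next
 case (RO_step x ro)
 have a: "ro:rL" using RO_step.hyps(2) assms(1) simple_roots by auto
 have x: "x:aL" by (rule RO_aa[OF assms(1,2) RO_step.hyps(1)])
 obtain y where y: "y:RO Th (rfl ro Y)" "fo x (rfl ro Y) = fo X y" using RO_step.IH[OF rfl_aa[OF a RO_step.prems]] by auto
 show ?case using form_root_reflection[OF a x RO_step.prems] form_root_reflection[OF a RO_step.prems x] form_sym y RO_trans[OF y(1) RO.RO_step[OF RO.RO_base RO_step.hyps(2)]] by force
qed

lemma nB_RO:
 assumes "Th = {ro:sL. ro H = 0}" "H:aL" "X:aL" "x:RO Th X" shows "nB x = nB X" using RO_KH[OF assms] nB_KK KHs(1) by auto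

text \<open>The norm \<open>nB\<close> is strictly convex and constant on the orbit.\<close>

lemma extreme_points_RO:
 assumes "Th = {ro:sL. ro H = 0}" "H:aL" "X:aL"
 shows "{v. v extreme_point_of convex hull (RO Th X)} = RO Th X"
proof (rule subset_antisym; rule subsetI)
 fix v assume v: "v:RO Th X"
 have le: "nB x <= nB X" if "x:convex hull (RO Th X)" for x
 proof -
  have "convex {x. nB x <= nB X}" unfolding convex_def
  proof (intro ballI allI impI CollectI)
   fix x y and s t :: real assume h: "x : {x. nB x <= nB X}" "y : {x. nB x <= nB X}" "0 <= s" "0 <= t" "s+t = 1"
   have "nB (s *R x+t *R y) <= s * nB x+t * nB y" using nB_add[of "s *R x" "t *R y"] h by (simp add: nB_scaleR)
   also have "... <= s * nB X+t * nB X" using h by (intro add_mono mult_left_mono) auto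
   also have "... = nB X" using h by (simp add: distrib_right[symmetric])
   finally show "nB (s *R x+t *R y) <= nB X" .
  qed
  hence "convex hull (RO Th X) <= {x. nB x <= nB X}" using nB_RO[OF assms] by (intro hull_minimal) auto
  thus ?thesis using that by blast
 qed
 have "v ~: open_segment a b" if ab: "a:convex hull (RO Th X)" "b:convex hull (RO Th X)" for a b
 proof
  assume "v : open_segment a b"
  then obtain u where u: "a ~= b" "0 < u" "u < 1" "v = (1-u) *R a+u *R b" by (auto simp: in_segment)
  have "u * (1-u) * B (a-b) (a-b) > 0" using u B_pos[of "a-b"] by simp
  moreover have "B a a <= B X X" "B b b <= B X X" unfolding nB_sq[symmetric] using le[OF ab(1)] le[OF ab(2)] nB_nonneg by (simp_all add: mult_mono)
  hence "(1-u) * B a a+u * B b b <= (1-u) * B X X+u * B X X" using u by (intro add_mono) auto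
  moreover have "B v v = B X X" using nB_RO[OF assms v] nB_sq by metis
  ultimately show False by (simp add: u(4) Bf.add_left Bf.add_right Bf.scaleR_left Bf.scaleR_right Bf.diff_left Bf.diff_right algebra_simps)
 qed
 thus "v : {v. v extreme_point_of convex hull (RO Th X)}" using v hull_inc by (auto simp: extreme_point_of_def)
qed (use extreme_point_of_convex_hull in auto)

end

context flag_bundle_system
begin

subsection \<open>The cocycle over the attractor\<close>

text \<open>Changing the frame over a flag by a parabolic \<open>p\<close> adds \<open>aG p\<close>
  to both terms, so the difference depends on the flag only; on frames in \<open>R\<close> the
  second term is zero.\<close>

lemma a_cocycle_eq: "a_cocycle L act R ph n (ef q) = ka ((ph ^^ n) q)-ka q"
proof -
 have "a_cocycle_R L act R ph n r = ka ((ph ^^ n) q)-ka q" if r: "r:R" "ef q = ef r" for r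
 proof (rule ef_eq[OF r(2)])
  fix p assume p: "p:PP" "r = act q p"
  show ?thesis using ka_R[OF r(1)] ka_PP p PP_carrier a_cocycle_R_eq[OF r(1)] by (simp add: algebra_simps ph_pow_act)
 qed
 moreover obtain r where "r:R" "ef q = ef r" by (rule ef_R)
 ultimately show ?thesis unfolding a_cocycle_def by (intro the_equality) auto
qed

abbreviation "co == a_cocycle L act R ph"

lemma co_growth: obtains C where "C >= 0" "!!n xi. xi:topspace ET ==> nB (co n xi) <= C * real n"
proof -
 obtain C where C: "C >= 0" "!!n r. r:R ==> nB (kb ((ph ^^ n) r)) <= C * real n" using kb_growth by blast
 have "nB (co n xi) <= C * real n" if x: "xi:topspace ET" for n xi
 proof -
  obtain q where "xi = ef q" using x unfolding topspace_E by blast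
  moreover obtain r where "r:R" "ef q = ef r" by (rule ef_R)
  ultimately show ?thesis using nB_ka_kb[of "(ph ^^ n) r"] C(2)[of r n] by (simp add: a_cocycle_eq ka_R)
 qed
 thus thesis using that C(1) by blast
qed

lemma ka_aa: "ka q:aL" by (rule R_rep[of q]) (simp add: ka aG_aa)

lemma co_aa: "xi:topspace ET ==> co n xi:aL" using ka_aa subspace_diff[OF subsp(3)] by (auto simp: topspace_E a_cocycle_eq)

lemma co_add: "xi:topspace ET ==> co (n+m) xi = co n xi+co m ((EF ^^ n) xi)"
 by (auto simp: topspace_E a_cocycle_eq EF_pow_ef funpow_add add.commute)

lemma Mp_topspace: "Mp <= topspace ET" by (auto simp: Mp_eq topspace_E)

lemma Mp_invariant: "xi:Mp ==> (EF ^^ n) xi:Mp" by (auto simp: Mp_eq EF_pow_ef DD_ph_pow)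

text \<open>Simple roots vanishing at \<open>H\<close> are nonnegative on \<open>b\<close> by
  \<open>rdom\<close>, the others are bounded below by the attractor. A fixed multiple of
  \<open>H1\<close>, which is positive on all of them, makes up the deficit.\<close>

lemma attractor_bound_uniform:
 assumes S: "compact S" "ALL q:S. DD q = H"
 shows "EX N t. t >= 0&(ALL n q q' k k' b. n >= N --> q:S --> q':S --> k:KH H --> k':KH H --> rdom H b -->
  (ph ^^ n) q = act q' (k**expG b**k') --> b+t *R H1:cch)"
proof -
 have "EX N c. ALL n q q' k k' b. ro:sL --> ro H ~= 0 --> n >= N --> q:S --> q':S --> k:KH H --> k':KH H --> b:aL -->
  (ph ^^ n) q = act q' (k**expG b**k') --> ro b >=-c" for ro using attractor_bound[OF S(1) bspec[OF S(2)], of ro] by simp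
 then obtain N c where Nc: "!!ro n q q' k k' b. ro:sL ==> ro H ~= 0 ==> n >= N ro ==> q:S ==> q':S ==> k:KH H ==> k':KH H ==> b:aL ==>
  (ph ^^ n) q = act q' (k**expG b**k') ==> ro b >=-c ro" by metis
 define t where "t = (\<Sum>ro\<in>simple L. \<bar>c ro/ro H1\<bar>)"
 have t0: "t >= 0" by (simp add: t_def sum_nonneg)
 show ?thesis
 proof (intro exI[of _ t] exI[of _ "Max (insert 0 (N ` sL))"] conjI allI impI, rule t0)
  fix n q q' k k' b assume h: "n >= Max (insert 0 (N ` sL))" "q:S" "q':S" "k:KH H" "k':KH H" "rdom H b" "(ph ^^ n) q = act q' (k**expG b**k')"
  have ba: "b:aL" using h(6) by (simp add: rdom_def)
  show "b+t *R H1:cch" unfolding clch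
  proof (intro conjI ballI)
   show "b+t *R H1:aL" using ba H1_scale subspace_add[OF subsp(3)] by simp
   fix ro assume a: "ro:sL"
   hence ad: "ro:dual_aa L" "ro H1 > 0" using simple_roots rootsD(1) H1(1) by (auto simp: chamber_def)
   have lo: "ro b >=-\<bar>c ro\<bar>" using a finite_simple h(1) Nc[OF a _ _ h(2-5) ba h(7)] h(6) by (cases "ro H = 0") (force simp: rdom_def)+
   have "\<bar>c ro/ro H1\<bar> <= t" unfolding t_def using finite_simple a by (intro member_le_sum) auto
   thus "ro (b+t *R H1) >= 0" using ad(2) lo ba H1_scale by (simp add: dual_aaD[OF ad(1)] H1(2) pos_divide_le_eq)
  qed
 qed
qed

text \<open>
 For \<open>q = r c\<close> in the reduction to the stabilizer of \<open>H\<close> with \<open>c\<close> bounded, the polar part of \<open>ph\<^sup>n r\<close>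
 differs boundedly from the one computed inside the stabilizer.
\<close>

lemma flow_decomposition:
 shows "EX C N D. C <= CL&D >= 0&(ALL c:C. nX c <= D)&(ALL x. EX r:R. EX c:C. proj r = x&DD (act r c) = H) &
  (ALL n>=N. ALL r:R. ALL c:C. DD (act r c) = H --> (EX r':R. EX c':C. EX k:KH H. EX k':KH H. EX b.
   (ph ^^ n) (act r c) = act r' (c'**(k**expG b**k'))&rdom H b&norm (b-kb ((ph ^^ n) r)) <= D))"
proof -
 obtain C where C: "compactin G C" "!!x. EX r:R. EX c:C. proj r = x&DD (act r c) = H" by (rule bounded_reps) blast
 have Cc: "C <= CL" using compactin_subset_topspace[OF C(1)] by simp
 have "compactin euclideanreal (nX ` C)" by (rule image_compactin[OF C(1) continuous_nX])
 hence "bounded (nX ` C)" by (simp add: compact_imp_bounded)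
 then obtain a where a: "ALL x:nX ` C. norm x <= a" unfolding bounded_iff by blast
 have N0: "nX c <= a" if "c:C" for c using bspec[OF a, of "nX c"] that by simp
 define S where "S = (%(q,g). act q g) ` (R \<times> C) \<inter> DD -` {H}"
 have S: "compact S" "ALL q:S. DD q = H" unfolding S_def using continuous_DD closed_vimage compact_Int_closed[OF compact_act_image[OF compact_R C(1)]] by auto
 obtain N t where t: "t >= 0" "ALL n q q' k k' b. n >= N --> q:S --> q':S --> k:KH H --> k':KH H --> rdom H b -->
  (ph ^^ n) q = act q' (k**expG b**k') --> b+t *R H1:cch" using attractor_bound_uniform[OF S] by auto
 obtain K where K: "K > 0" "!!b b' c1 c2. b:cch ==> b':cch ==> c1:CL ==> c2:CL ==>
  expG b' = c1**expG b**c2 ==> norm (b'-b) <= K * (nX c1+nX c2)" using bp_perturb by blast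
 define D where "D = \<bar>a\<bar>+K * (2 * \<bar>a\<bar>+nB (t *R H1))+t * norm H1"
 have D0: "\<bar>a\<bar> <= D" "D >= 0" "K * (2 * \<bar>a\<bar>+nB (t *R H1))+t * norm H1 <= D" using K(1) t(1) nB_nonneg by (auto simp: D_def)
 have main: "EX r':R. EX c':C. EX k:KH H. EX k':KH H. EX b. (ph ^^ n) (act r c) = act r' (c'**(k**expG b**k'))&rdom H b&norm (b-kb ((ph ^^ n) r)) <= D"
  if h: "n >= N" "r:R" "c:C" "DD (act r c) = H" for n r c
 proof -
  have cc: "c:CL" using h(3) Cc by blast
  obtain r' c' where r': "r':R" "c':C" "proj r' = proj ((ph ^^ n) (act r c))" "DD (act r' c') = H" using C(2) by blast
  have cc': "c':CL" using r'(2) Cc by blast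
  obtain z where z: "z:CL" "(ph ^^ n) (act r c) = act (act r' c') z" using act_trans[of "act r' c'" "(ph ^^ n) (act r c)"] r'(3) cc' by auto
  \<comment> \<open>Both frames lie in the reduction, so the element relating them fixes
    \<open>H\<close>.\<close>
  have "z:stabilizer L H" using DD_act r'(4) DD_ph_pow[of n "act r c"] h(4) z(2) Ad_inv(2)[OF z(1), of H] z(1) by (simp add: stabilizer_def)
  then obtain k b k' where k: "k:KH H" "k':KH H" "rdom H b" "z = k**expG b**k'" using stabilizer_KAK[OF H_aa] by blast
  note kc = KHs(3)[OF k(1)] KHs(3)[OF k(2)]
  have Sm: "act r c:S" "act r' c':S" using h r' by (auto simp: S_def)
  \<comment> \<open>The perturbation estimate needs dominant elements on both sides. Replacing
    \<open>b\<close> by \<open>b1\<close> costs only the fixed factor with exponent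
    \<open>- t H1\<close>.\<close>
  define b1 where "b1 = b+t *R H1"
  have b1: "b1:cch" unfolding b1_def by (rule t(2)[rule_format, OF h(1) Sm k(1-3)]) (simp add: z(2) k(4))
  obtain r0 g where g: "r0:R" "g:CL" "(ph ^^ n) r = act r0 g" by (rule R_rep)
  have e: "act r0 (g**c) = act r' (c'**z)" using z g cc cc' by (simp add: ph_pow_act acts)
  hence "proj r0 = proj r'" using proj_act g(2) cc cc' z(1) by (metis m_closed)
  then obtain k3 where k3: "k3:KL" "r' = act r0 k3" by (rule R_trans[OF g(1) r'(1)])
  have k3c: "k3:CL" using k3 KKc by blast
  have "g**c = k3**(c'**z)" using e g(2) cc cc' z(1) k3c by (intro act_inj) (simp_all add: k3(2) acts)
  hence gg: "g = k3**(c'**z)**inv c" using g(2) cc by (metis inv_solve_right m_closed)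
  obtain q q' where q: "q:KL" "q':KL" "expG (bp g) = q**g**q'" by (rule bp_KAK[OF g(2)])
  note qc = KKc[OF q(1)] KKc[OF q(2)]
  have eb: "expG b = expG b1**expG (- (t *R H1))" using expG_aa_add[of b1 "- (t *R H1)"] b1 clch H1_scale[of "- t"] by (simp add: b1_def)
  have "q**g**q' = (q**k3**c'**k)**expG b1**(expG (- (t *R H1))**(k'**inv c**q'))"
   unfolding gg k(4) eb using kc qc cc cc' k3c by (simp add: m_assoc)
  hence "expG (bp g) = (q**k3**c'**k)**expG b1**(expG (- (t *R H1))**(k'**inv c**q'))" using q(3) by simp
  moreover have "bp g:cch" by (rule bp[OF g(2)])
  ultimately have "norm (bp g-b1) <= K * (nX (q**k3**c'**k)+nX (expG (- (t *R H1))**(k'**inv c**q')))"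
   using kc qc cc cc' k3c by (intro K(2)[OF b1]) auto
  also have "... <= K * (2 * \<bar>a\<bar>+nB (t *R H1))"
  proof (rule mult_left_mono)
   have 1: "nX (q**k3**c'**k) <= \<bar>a\<bar>"
    using nX_KK(1)[OF KK_mult[OF q(1) k3(1)] cc'] nX_KK(2)[OF KHs(1)[OF k(1)], of "q**k3**c'"] N0[OF r'(2)] qc k3c cc' by simp
   have "nX (expG (- (t *R H1))**(k'**inv c**q')) <= nX (expG (- (t *R H1)))+nX (k'**inv c**q')" using kc cc qc by (intro nX_mult) auto
   thus "nX (q**k3**c'**k)+nX (expG (- (t *R H1))**(k'**inv c**q')) <= 2 * \<bar>a\<bar>+nB (t *R H1)" using pX_eq[OF KK_one, of "- (t *R H1)"] H1_scale[of "- t"] aa_ss nX_KK(1)[OF KHs(1)[OF k(2)], of "inv c"] nX_KK(2)[OF q(2), of "k'**inv c"] nX_inv N0[OF h(3)] kc cc 1 by (auto simp: nX_def nB_minus)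
  qed (use K(1) in simp)
  finally have "norm (b1-bp g) <= K * (2 * \<bar>a\<bar>+nB (t *R H1))" by (simp add: norm_minus_commute)
  moreover have "norm (b-bp g) <= norm (b1-bp g)+t * norm H1" using norm_triangle_ineq4[of "b1-bp g" "t *R H1"] t(1) by (simp add: b1_def)
  ultimately have "norm (b-kb ((ph ^^ n) r)) <= D" using D0(3) by (simp add: g(3) kb[OF g(1,2)])
  moreover have "(ph ^^ n) (act r c) = act r' (c'**(k**expG b**k'))" using z k(4) cc' by (simp add: acts)
  ultimately show ?thesis using r'(1,2) k(1-3) by blast
 qed
 have "ALL c:C. nX c <= D" using N0 D0(1) by fastforce
 thus ?thesis by (rule_tac exI[of _ C], rule_tac exI[of _ N], rule_tac exI[of _ D]) (intro conjI allI impI ballI Cc D0(2) C(2) main; simp)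
qed

abbreviation "Th == {ro:sL. ro H = 0}"

text \<open>The starting frame is moved by \<open>inv k' ** inv w\<close>: this cancels
  \<open>k'\<close> and turns the \<open>A\<close>-part at time \<open>n\<close> into
  \<open>AD w b\<close>, which is close to \<open>n\<close> times \<open>AD w X = p\<close>. The
  starting point depends on \<open>n\<close>, as the assembly of chains from separate runs
  allows.\<close>

lemma orbit_exponents:
 assumes X: "X:aL" and lim: "!!r. r:R ==> proj r = x ==> (%k. (1/real k) *R kb ((ph ^^ k) r)) ----> X" and p: "p:RO Th X" and e: "e > 0"
 shows "EX N. ALL n>=N. EX y:Mp. norm (co n y-real n *R p) <= e * real n"
proof -
 obtain C N D where C: "C <= CL" "D >= 0" "ALL c:C. nX c <= D" "ALL x. EX r:R. EX c:C. proj r = x&DD (act r c) = H"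
  and dec: "ALL n>=N. ALL r:R. ALL c:C. DD (act r c) = H --> (EX r':R. EX c':C. EX k:KH H. EX k':KH H. EX b.
   (ph ^^ n) (act r c) = act r' (c'**(k**expG b**k'))&rdom H b&norm (b-kb ((ph ^^ n) r)) <= D)" using flow_decomposition by auto
 obtain w where w: "w:KH H" "!!Y. Y:aL ==> AD w Y:aL" "AD w X = p" using RO_KH[OF refl H_aa X p] by blast
 note wK = KHs(1)[OF w(1)] KHs(3)[OF w(1)]
 obtain r c where r: "r:R" "c:C" "proj r = x" "DD (act r c) = H" using C(4) by blast
 have cc: "c:CL" using r C by blast
 obtain C2 where C2: "C2 > 0" "!!x. norm x <= C2 * nB x" using norm_le_nB by blast
 obtain K where K: "K > 0" "!!x. norm (AD w x) <= norm x * K" using bounded_linear.pos_bounded[OF bounded_linear_Ad[OF wK(2)]] by auto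
 define e' where "e' = e/(2 * K)"
 have e': "e' > 0" "e' * K = e/2" using e K(1) by (simp_all add: e'_def)
 obtain N1 where N1: "!!n. n >= N1 ==> norm ((1/real n) *R kb ((ph ^^ n) r)-X) < e'" using LIMSEQ_D[OF lim[OF r(1,3)] e'(1)] by auto
 define A where "A = C2 * (2 * D)+D * K"
 obtain N2 :: nat where N2: "A/(e/2) < real N2" using reals_Archimedean2 by blast
 show ?thesis
 proof (intro exI[of _ "max (max N N1) (max N2 1)"] allI impI)
  fix n assume n: "n >= max (max N N1) (max N2 1)"
  obtain r' c' k k' b where d: "r':R" "c':C" "k:KH H" "k':KH H" "(ph ^^ n) (act r c) = act r' (c'**(k**expG b**k'))" "rdom H b" "norm (b-kb ((ph ^^ n) r)) <= D"
   using dec[rule_format, of n, OF _ r(1,2,4)] n by auto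
  have cc': "c':CL" using d(2) C(1) by blast
  note kc = KHs(3)[OF d(3)] KHs(3)[OF d(4)]
  define k2 where "k2 = inv k'**inv w"
  have k2: "k2:KH H" unfolding k2_def by (intro KHs(5,6) d(4) w(1))
  note k2c = KHs(1)[OF k2] KHs(3)[OF k2]
  define q where "q = act (act r c) k2"
  have yM: "ef q:Mp" using k2c r(4) KHs(2)[OF KHs(6)[OF k2]] by (simp add: Mp_eq q_def DD_act)
  have ba: "b:aL" using d(6) by (simp add: rdom_def)
  have kw: "k**inv w:KL" using KHs(1)[OF d(3)] wK KK_mult KK_inv by simp
  have "(ph ^^ n) q = act r' (c'**((k**expG b**k')**k2))"
   unfolding q_def ph_pow_act[OF k2c(2)] d(5) using kc cc' k2c by (simp add: acts m_assoc)
  hence "(ph ^^ n) q = act r' ((c'**(k**inv w))**expG (AD w b))" using normalizer_conj_expG[OF KK_inv[OF wK(1)], of b] wK(2) kc cc' by (simp add: k2_def m_assoc) (simp add: m_assoc[symmetric])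
  hence "ka ((ph ^^ n) q) = aG (c'**(k**inv w))+AD w b" using ka[OF d(1)] aG_mult_expG[OF _ w(2)[OF ba]] kc wK(2) cc' by simp
  moreover have "ka q = aG (c**k2)" using ka[OF r(1), of "c**k2"] cc k2c by (simp add: q_def acts)
  ultimately have co: "co n (ef q)-AD w b = aG (c'**(k**inv w))-aG (c**k2)" by (simp add: a_cocycle_eq)
  have "nB (co n (ef q)-AD w b) <= 2 * D"
   using nB_add[of "aG (c'**(k**inv w))" "- aG (c**k2)"] nB_aG[OF cc' kw] nB_aG[OF cc k2c(1)] bspec[OF C(3) r(2)] bspec[OF C(3) d(2)]
   unfolding co by (simp add: nB_minus)
  hence 1: "norm (co n (ef q)-AD w b) <= C2 * (2 * D)" using C2 by (meson mult_left_mono less_imp_le order_trans)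
  have 2: "norm (AD w b-AD w (kb ((ph ^^ n) r))) <= D * K"
   using K(2)[of "b-kb ((ph ^^ n) r)"] mult_right_mono[OF d(7) less_imp_le[OF K(1)]] by (simp add: Adlin(3)[OF wK(2)])
  have "kb ((ph ^^ n) r)-real n *R X = real n *R ((1/real n) *R kb ((ph ^^ n) r)-X)" by (simp add: scaleR_diff_right) (use n in simp)
  hence "norm (kb ((ph ^^ n) r)-real n *R X) <= real n * e'" using N1[of n] n by simp
  hence 3: "norm (AD w (kb ((ph ^^ n) r))-real n *R p) <= real n * (e/2)" using K(2)[of "kb ((ph ^^ n) r)-real n *R X"] mult_right_mono[of "norm (kb ((ph ^^ n) r)-real n *R X)" "real n * e'" K] K(1) e'(2) by (simp add: Adlin[OF wK(2)] w(3) mult.assoc)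
  have "A <= e/2 * real N2" using N2 e by (simp add: pos_divide_less_eq mult.commute)
  also have "... <= e/2 * real n" using n e by simp
  finally have "A <= e/2 * real n" .
  moreover have "norm (co n (ef q)-real n *R p) <= C2 * (2 * D)+(D * K+real n * (e/2))"
   by (rule norm_diff_triangle_le[OF 1 norm_diff_triangle_le[OF 2 3]])
  ultimately have "norm (co n (ef q)-real n *R p) <= e * real n" by (simp add: A_def mult.commute)
  thus "EX y:Mp. norm (co n y-real n *R p) <= e * real n" using yM by blast
 qed
qed

text \<open>The polar part descends to the base because \<open>kb\<close> is invariant under
  \<open>K\<close>; as a function there it can be averaged along the uniquely ergodic map.\<close>

definition ux :: "nat => 'x => 'l" where "ux n x = kb ((ph ^^ n) (SOME r. r:R&proj r = x))"

lemma ux: assumes "r:R" shows "ux n (proj r) = kb ((ph ^^ n) r)"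
proof -
 define r0 where "r0 = (SOME r'. r':R&proj r' = proj r)"
 have "r0:R&proj r0 = proj r" unfolding r0_def by (rule someI) (use assms in simp)
 then obtain k where k: "k:KL" "r = act r0 k" using R_trans[of r0 r] assms by metis
 have "kb ((ph ^^ n) r) = kb ((ph ^^ n) r0)" unfolding k(2) ph_pow_act[OF KKc[OF k(1)]] by (rule kb_KK[OF k(1)])
 thus ?thesis by (simp only: ux_def r0_def)
qed

lemma continuous_ux: "continuous_on UNIV (ux n)"
proof (rule continuous_on_locally)
 fix x
 obtain U si where U: "open U" "x:U" "continuous_on U si" "!!y. y:U ==> si y:R&proj (si y) = y" by (rule sections_R[of x]) blast
 have "continuous_on U (%y. kb ((ph ^^ n) (si y)))"
  by (rule continuous_on_compose2[OF continuous_kb continuous_on_compose2[OF continuous_ph U(3)]]) auto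
 moreover have "kb ((ph ^^ n) (si y)) = ux n y" if "y:U" for y using ux[of "si y" n] U(4)[OF that] by simp
 ultimately show "EX W. open W&x:W&continuous_on W (ux n)" using continuous_on_cong[of U U "%y. kb ((ph ^^ n) (si y))" "ux n"] U by auto
qed

text \<open>Modulo the parabolic subgroup every frame of the reduction is \<open>r c k\<close> with
  \<open>c\<close> bounded and \<open>k\<close> in \<open>KH H\<close>. The bounded factors
  contribute a constant, and Kostant's inequality inside the stabilizer bounds the remaining term by
  the pairing of \<open>b\<close> with the dominant \<open>H0'\<close>.\<close>

lemma co_upper:
 assumes H0: "H0:aL" and H0': "H0':RO Th H0" "rdom H H0'"
 obtains N C where "!!n q. n >= N ==> DD q = H ==> fo H0 (co n (ef q)) <= fo H0' (ux n (proj q))+C"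
proof -
 obtain C N D where C: "C <= CL" "D >= 0" "ALL c:C. nX c <= D" "ALL x. EX r:R. EX c:C. proj r = x&DD (act r c) = H"
  and dec: "ALL n>=N. ALL r:R. ALL c:C. DD (act r c) = H --> (EX r':R. EX c':C. EX k:KH H. EX k':KH H. EX b.
   (ph ^^ n) (act r c) = act r' (c'**(k**expG b**k'))&rdom H b&norm (b-kb ((ph ^^ n) r)) <= D)" using flow_decomposition by auto
 obtain v where v: "v:KH H" "AD v H0 = H0'" using RO_KH[OF refl H_aa H0 H0'(1)] by auto
 have w: "inv v:KH H" "AD (inv v) H0' = H0" using KHs(6)[OF v(1)] Ad_inv(1)[OF KHs(3)[OF v(1)], of H0] v(2) by auto
 obtain K where K: "K > 0" "!!x. norm (fo H0' x) <= norm x * K" using bounded_linear.pos_bounded[OF fm.bounded_linear_right, of H0'] by auto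
 show thesis
 proof (rule that[of N "2 * (nB H0 * D)+D * K"])
  fix n q assume n: "n >= N" and q: "DD q = H"
  obtain r c where r: "r:R" "c:C" "proj r = proj q" "DD (act r c) = H" using C(4) by blast
  have cc: "c:CL" using r C by blast
  obtain z where z: "z:CL" "q = act (act r c) z" using act_trans[of "act r c" q] r(3) cc by auto
  have kz: "kG z:KH H" using DD_act q z(2) r(4) Ad_inv(2)[OF z(1), of H] KG_stabilizer[OF H_aa] z(1) by (simp add: stabilizer_def)
  note kzc = KHs(1)[OF kz] KHs(3)[OF kz]
  obtain m where m: "aG z:aL" "m:NN L" "z = kG z**expG (aG z)**m" by (rule iwasawa[OF z(1)]) blast
  have p: "expG (aG z)**m:PP" using AA_PP[OF m(1)] NN_PP[OF m(2)] PP_mult by simp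
  define q1 where "q1 = act r (c**kG z)"
  have "c**z = (c**kG z)**(expG (aG z)**m)" by (subst m(3)) (use cc kzc NNc[OF m(2)] in "simp add: m_assoc")
  hence "q = act q1 (expG (aG z)**m)" using z(2) cc z(1) kzc NNc[OF m(2)] by (simp add: q1_def acts)
  hence e: "ef q = ef q1" using ef_PP[OF p] by simp
  obtain r' c' k k' b where d: "r':R" "c':C" "k:KH H" "k':KH H" "(ph ^^ n) (act r c) = act r' (c'**(k**expG b**k'))" "rdom H b" "norm (b-kb ((ph ^^ n) r)) <= D"
   using dec[rule_format, OF n r(1,2,4)] by auto
  have cc': "c':CL" using d(2) C(1) by blast
  note kc = KHs(3)[OF d(3)] KHs(3)[OF d(4)]
  have k2: "k'**kG z:KH H" by (rule KHs(5)[OF d(4) kz])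
  define y where "y = k**(expG b**(k'**kG z))"
  have yc: "y:CL" using kc kzc by (simp add: y_def)
  have "q1 = act (act r c) (kG z)" using cc kzc by (simp add: q1_def acts)
  hence "ka ((ph ^^ n) q1) = aG (c'**kG y)+aG y" using d(5) kc kzc cc' ka[OF d(1)] iwasawa_mult(2) by (simp add: ph_pow_act acts y_def m_assoc)
  moreover have "ka q1 = aG (c**kG z)" unfolding q1_def using ka[OF r(1)] cc kzc by simp
  ultimately have co: "co n (ef q) = aG (c'**kG y)+aG (expG b**(k'**kG z))-aG (c**kG z)" unfolding y_def using iwasawa_KK_left(2)[OF KHs(1)[OF d(3)]] kc kzc by (simp add: e a_cocycle_eq)
  have bound: "\<bar>form L H0 (aG (g**l))\<bar> <= nB H0 * D" if "g:C" "l:KL" for g l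
  proof -
   have g: "g:CL" "l:CL" using that C(1) KKc by auto
   have "\<bar>form L H0 (aG (g**l))\<bar> <= nB H0 * nB (aG (g**l))" using abs_B_le_nB form_aa[OF aG_aa] g by simp
   also have "... <= nB H0 * D" using nB_aG[OF g(1) that(2)] bspec[OF C(3) that(1)] nB_nonneg by (intro mult_left_mono) auto
   finally show ?thesis .
  qed
  have "fo H0' b <= fo H0' (kb ((ph ^^ n) r))+D * K"
  proof -
   show ?thesis using K(2)[of "b-kb ((ph ^^ n) r)"] mult_right_mono[OF d(7) less_imp_le[OF K(1)]] by (simp add: fm.diff_right)
  qed
  thus "fo H0 (co n (ef q)) <= fo H0' (ux n (proj q))+(2 * (nB H0 * D)+D * K)" unfolding co using kostant_stabilizer[OF H_closure d(6) H0'(2) k2 w(1)] w(2) H0 ux[OF r(1), of n] r(3) bound[OF d(2) kG_KK[OF yc]] bound[OF r(2) kzc(1)] by (simp add: fm.add_right fm.diff_right)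
 qed
qed

text \<open>
 Averaging the additive cocycle over blocks of length \<open>k\<close> compares it with the ergodic averages of the
 continuous function \<open>form H0' (ux k)\<close> on the base.
\<close>

lemma co_asymptotic:
 assumes nu: "invariant_prob F nu" "!!mea. invariant_prob F mea ==> mea = nu"
  and lim: "AE x in nu. ALL r:R. proj r = x --> (%k. (1/real k) *R kb ((ph ^^ k) r)) ----> X"
  and H0: "H0:aL" and H0': "H0':RO Th H0" "rdom H H0'" and e: "e > 0"
 shows "EX N. ALL n>=N. ALL xi:Mp. fo H0 (co n xi) <= real n * (fo H0' X+e)"
proof -
 interpret nu: prob_space nu using nu(1) by (simp add: invariant_prob_def)
 have sets: "sets nu = sets borel" using nu(1) by (simp add: invariant_prob_def)
 define f where "f k x = fo H0' (ux k x)/real k" for k x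
 have cf: "continuous_on UNIV (f k)" for k
 proof -
  have "continuous_on UNIV (%x. fo H0' (ux k x))"
   by (rule continuous_on_compose2[OF linear_continuous_on[OF fm.bounded_linear_right, of UNIV] continuous_ux]) simp
  thus ?thesis unfolding f_def divide_inverse by (rule continuous_on_mult_right)
 qed
 have mf: "f k:borel_measurable nu" for k using borel_measurable_continuous_onI[OF cf[of k]] by (simp add: measurable_cong_sets[OF sets refl])
 obtain Ck where Ck: "Ck >= 0" "!!n r. r:R ==> nB (kb ((ph ^^ n) r)) <= Ck * real n" using kb_growth by blast
 have kb_aa: "kb q:aL" for q by (rule R_rep[of q]) (metis kb bp clch)
 have fb: "norm (f k x) <= nB H0' * Ck" for k x
 proof (cases "k = 0")
  case False
  obtain r where r: "r:R" "proj r = x" using R_ex by blast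
  have "\<bar>form L H0' (ux k x)\<bar> <= nB H0' * nB (ux k x)" using abs_B_le_nB form_aa kb_aa by (simp add: ux_def)
  also have "... <= nB H0' * (Ck * real k)" using Ck(2)[OF r(1), of k] ux[OF r(1), of k] r(2) nB_nonneg by (intro mult_left_mono) auto
  finally show ?thesis using False by (simp add: f_def pos_divide_le_eq)
 qed (use Ck(1) nB_nonneg in "simp add: f_def")
 have "(%k. integral\<^sup>L nu (f k)) ----> integral\<^sup>L nu (%_. fo H0' X)"
 proof (rule integral_dominated_convergence[where w = "%_. nB H0' * Ck"])
  show "AE x in nu. (%k. f k x) ----> fo H0' X" using lim
  proof (rule AE_mp, intro AE_I2 impI)
   fix x assume l: "ALL r:R. proj r = x --> (%k. (1/real k) *R kb ((ph ^^ k) r)) ----> X"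
   obtain r where r: "r:R" "proj r = x" using R_ex by blast
   have "(%k. fo H0' ((1/real k) *R kb ((ph ^^ k) r))) ----> fo H0' X" using l r by (intro fm.tendsto tendsto_const) blast
   thus "(%k. f k x) ----> fo H0' X" using ux[OF r(1)] r(2) by (simp add: f_def fm.scaleR_right)
  qed
 qed (use mf fb in auto)
 hence limf: "(%k. integral\<^sup>L nu (f k)) ----> fo H0' X" by (simp add: nu.prob_space)
 obtain N C where up: "!!n q. n >= N ==> DD q = H ==> fo H0 (co n (ef q)) <= fo H0' (ux n (proj q))+C" using co_upper[OF H0 H0'] by blast
 obtain Cc where Cc: "Cc >= 0" "!!n xi. xi:topspace ET ==> nB (co n xi) <= Cc * real n" using co_growth by blast
 define C' where "C' = nB H0 * Cc"
 have C'0: "C' >= 0" using Cc(1) nB_nonneg by (simp add: C'_def)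
 have C': "\<bar>form L H0 (co n xi)\<bar> <= C' * real n" if "xi:topspace ET" for n xi
 proof -
  have "\<bar>form L H0 (co n xi)\<bar> <= nB H0 * nB (co n xi)" using abs_B_le_nB form_aa[OF co_aa[OF that]] by simp
  also have "... <= C' * real n" unfolding C'_def mult.assoc using Cc(2)[OF that] nB_nonneg by (intro mult_left_mono)
  finally show ?thesis .
 qed
 define ep where "ep = e/4"
 have ep: "ep > 0" using e by (simp add: ep_def)
 obtain N1 where N1: "!!k. k >= N1 ==> integral\<^sup>L nu (f k) < fo H0' X+ep"
  using order_tendstoD(2)[OF limf, of "fo H0' X+ep"] ep by (auto simp: eventually_sequentially)
 obtain N2 :: nat where N2: "C/ep < real N2" using reals_Archimedean2 by blast
 \<comment> \<open>One block length for the rest of the argument: long enough for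
   \<open>co_upper\<close>, for the integral of \<open>f k\<close> to be near its limit, and for the
   constant \<open>C\<close> to be at most \<open>ep * k\<close>.\<close>
 define k where "k = max (max N N1) (max N2 1)"
 have k: "k >= N" "k >= N1" "real k >= real N2" "real k > 0" by (auto simp: k_def)
 have "C < ep * real N2" using N2 ep by (simp add: pos_divide_less_eq mult.commute)
 also have "... <= ep * real k" using k(3) ep by simp
 finally have Ck': "C <= ep * real k" by simp
 obtain N3 where N3: "!!n x. n >= N3 ==> (\<Sum>i<n. f k ((F ^^ i) x)) <= real n * (integral\<^sup>L nu (f k)+ep)"
  using uniquely_ergodic_average[OF compact_X continuous_F nu(2) cf[of k] ep] by auto
 obtain N4 :: nat where N4: "2 * C' * real k/ep < real N4" using reals_Archimedean2 by blast
 show ?thesis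
 proof (intro exI[of _ "max N3 N4"] allI impI ballI)
  fix n xi assume n: "n >= max N3 N4" and xi: "xi:Mp"
  obtain q where q: "xi = ef q" "DD q = H" using xi by (auto simp: Mp_eq)
  define l where "l j = fo H0 (co j xi)" for j
  have xiE: "(EF ^^ i) xi:topspace ET" for i using Mp_invariant[OF xi] Mp_topspace by auto
  have diff: "l (i+j) = l i+fo H0 (co j ((EF ^^ i) xi))" for i j using co_add xiE[of 0] by (simp add: l_def fm.add_right)
  \<comment> \<open>Blocks start at every time, and their increments telescope to \<open>k\<close>
    terms near time \<open>n\<close> minus \<open>k\<close> terms near time \<open>0\<close>. Up to
    an error quadratic in \<open>k\<close> and independent of \<open>n\<close> this is
    \<open>k * l n\<close>.\<close>
  have tele: "(\<Sum>i<n. l (i+k)-l i) = (\<Sum>j<k. l (n+j)-l j)" for n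
  proof (induction n)
   case (Suc n)
   have "(\<Sum>j<k. l (Suc n+j))+l n = (\<Sum>j<Suc k. l (n+j))" by (subst sum.lessThan_Suc_shift) simp
   thus ?case using Suc by (simp add: sum_subtractf)
  qed simp
  have "(\<Sum>i<n. l (i+k)-l i) <= (\<Sum>i<n. real k * f k ((F ^^ i) (proj q))+C)"
  proof (rule sum_mono)
   fix i
   have "l (i+k)-l i = fo H0 (co k (ef ((ph ^^ i) q)))" using diff by (simp add: q(1) EF_pow_ef)
   also have "... <= fo H0' (ux k (proj ((ph ^^ i) q)))+C" by (rule up[OF k(1)]) (simp add: DD_ph_pow q(2))
   finally show "l (i+k)-l i <= real k * f k ((F ^^ i) (proj q))+C" using k(4) by (simp add: f_def F_pow_proj)
  qed
  also have "... = real k * (\<Sum>i<n. f k ((F ^^ i) (proj q)))+real n * C" by (simp add: sum.distrib sum_distrib_left)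
  also have "... <= real k * (real n * (fo H0' X+2 * ep))+real n * (ep * real k)"
  proof (intro add_mono mult_left_mono)
   have "(\<Sum>i<n. f k ((F ^^ i) (proj q))) <= real n * (integral\<^sup>L nu (f k)+ep)" using N3 n by simp
   also have "... <= real n * (fo H0' X+2 * ep)" using N1[OF k(2)] by (intro mult_left_mono) auto
   finally show "(\<Sum>i<n. f k ((F ^^ i) (proj q))) <= real n * (fo H0' X+2 * ep)" .
  qed (use Ck' in auto)
  finally have 1: "(\<Sum>j<k. l (n+j)-l j) <= real k * (real n * (fo H0' X+3 * ep))" unfolding tele by (simp add: algebra_simps)
  have "(\<Sum>j<k. l n-2 * C' * real k) <= (\<Sum>j<k. l (n+j)-l j)"
  proof (rule sum_mono)
   fix j assume "j : {..<k}"
   hence jk: "C' * real j <= C' * real k" using C'0 by (intro mult_left_mono) auto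
   show "l n-2 * C' * real k <= l (n+j)-l j" using C'[OF xiE[of 0], of j] diff C'[OF xiE[of n], of j] jk by (simp add: l_def)
  qed
  hence "real k * (l n-2 * C' * real k) <= real k * (real n * (fo H0' X+3 * ep))" using 1 by simp
  hence "l n-2 * C' * real k <= real n * (fo H0' X+3 * ep)" using k(4) by simp
  moreover have "2 * C' * real k <= ep * real N4" using N4 ep by (simp add: pos_divide_less_eq mult.commute)
  moreover have "ep * real N4 <= ep * real n" using n ep by simp
  ultimately show "fo H0 (co n xi) <= real n * (fo H0' X+e)" by (simp add: l_def ep_def algebra_simps)
 qed
qed

theorem morse_spectrum_eq:
 assumes nu: "invariant_prob F nu" "!!mea. invariant_prob F mea ==> mea = nu" and X: "is_polar_exponent L act proj R ph nu X"
 shows "morse_spectrum EF (de {}) Mp co = convex hull (RO Th X)"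
proof (rule subset_antisym)
 interpret cs: compact_system "topspace ET" "de {}" EF by (rule compact_system)
 interpret nu: prob_space nu using nu(1) by (simp add: invariant_prob_def)
 have Xa: "X:aL" using X clch by (auto simp: is_polar_exponent_def)
 have lim: "AE x in nu. ALL r:R. proj r = x --> (%k. (1/real k) *R kb ((ph ^^ k) r)) ----> X" using X a_plus_eq by (simp add: is_polar_exponent_def)
 have Ths: "Th <= sL" by auto
 have fin: "finite (RO Th X)" by (rule finite_RO[OF Ths Xa])
 obtain C2 where C2: "C2 > 0" "!!x. norm x <= C2 * nB x" using norm_le_nB by blast
 obtain Cc where Cc: "Cc >= 0" "!!n xi. xi:topspace ET ==> nB (co n xi) <= Cc * real n" using co_growth by blast
 show "convex hull (RO Th X) <= morse_spectrum EF (de {}) Mp co"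
 proof (rule cs.hull_subset_morse_spectrum[OF Mp_component _ _ _ _ fin])
  show "cs.mtotally_bounded Mp" using cs.compactin_imp_mtotally_bounded cs.compact_E cs.mtotally_bounded_subset Mp_topspace by (auto simp: compact_space_def)
  show "C2 * Cc >= 0" using C2(1) Cc(1) by simp
  show "norm (co n y) <= C2 * Cc * real n" if "y:Mp" for n y
  proof -
   show ?thesis using that Mp_topspace order_trans[OF C2(2)[of "co n y"] mult_left_mono[OF Cc(2)[of y n] less_imp_le[OF C2(1)]]] by auto
  qed
  show "(EF ^^ n) y:Mp" if "y:Mp" for n y by (rule Mp_invariant[OF that])
  \<comment> \<open>A property holding almost surely for a probability holds somewhere. A single
    such base point supplies all exponents of the orbit.\<close>
  have "EX x. ALL r:R. proj r = x --> (%k. (1/real k) *R kb ((ph ^^ k) r)) ----> X"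
  proof (rule ccontr)
   assume no: "~ ?thesis"
   have "AE x in nu. False" by (rule AE_mp[OF lim AE_I2]) (use no in blast)
   thus False by simp
  qed
  thus "EX N. ALL n>=N. EX y:Mp. norm (co n y-real n *R p) <= e * real n" if "p:RO Th X" "e > 0" for p e
   using orbit_exponents[OF Xa _ that] by auto
 qed
 show "morse_spectrum EF (de {}) Mp co <= convex hull (RO Th X)"
 proof
  fix v assume "v:morse_spectrum EF (de {}) Mp co"
  then obtain ep T m xi n where ch: "!!j. T j > 0&is_chain EF (de {}) Mp (ep j) (T j) (m j) (xi j) (n j)" "filterlim T at_top sequentially"
   and v: "(%j. (1/real (\<Sum>i<m j. n j i)) *R (\<Sum>i<m j. co (n j i) (xi j i))) ----> v" unfolding morse_spectrum_def by blast
  have xiM: "xi j i:Mp" "T j <= real (n j i)" if "i < m j" for i j using ch(1) that by (auto simp: is_chain_def)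
  have tot: "real (\<Sum>i<m j. n j i) > 0" for j
  proof -
   have "m j > 0" using ch(1) by (auto simp: is_chain_def)
   hence "real (n j 0) > 0" using xiM(2)[of 0 j] ch(1)[of j] by simp
   moreover have "n j 0 <= (\<Sum>i<m j. n j i)" using \<open>m j > 0\<close> by (intro member_le_sum) auto
   ultimately show ?thesis by linarith
  qed
  have va: "v:aL"
  proof (rule closed_sequentially[OF closed_subspace[OF subsp(3)] _ v])
   show "(1/real (\<Sum>i<m j. n j i)) *R (\<Sum>i<m j. co (n j i) (xi j i)):aL" for j
    using xiM(1) Mp_topspace co_aa by (intro subspace_scale subspace_sum subsp(3)) blast
  qed
  have upper: "EX y:RO Th X. fo H0 v <= fo H0 y" if H0: "H0:aL" for H0
  proof -
   obtain H0' where H0': "H0':RO Th H0" "rdom H H0'" by (rule RO_rdom[OF refl H0])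
   \<comment> \<open>Adjointness trades the reflected functional \<open>H0'\<close> at
     \<open>X\<close> for \<open>H0\<close> at a point of the orbit of \<open>X\<close>, so the
     bound is by the support function of the orbit.\<close>
   obtain y where y: "y:RO Th X" "fo H0' X = fo H0 y" using RO_adjoint[OF Ths H0 H0'(1) Xa] by auto
   have "fo H0 v <= fo H0' X+e" if e: "e > 0" for e
   proof -
    obtain N where N: "!!n xi. n >= N ==> xi:Mp ==> fo H0 (co n xi) <= real n * (fo H0' X+e)" using co_asymptotic[OF nu lim H0 H0' e] by auto
    have "\<forall>\<^sub>F j in sequentially. real N <= T j" using ch(2) by (simp add: filterlim_at_top)
    hence "\<forall>\<^sub>F j in sequentially. fo H0 ((1/real (\<Sum>i<m j. n j i)) *R (\<Sum>i<m j. co (n j i) (xi j i))) <= fo H0' X+e"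
    proof (rule eventually_mono)
     fix j assume T: "real N <= T j"
     have "(\<Sum>i<m j. fo H0 (co (n j i) (xi j i))) <= (\<Sum>i<m j. real (n j i) * (fo H0' X+e))"
      using xiM T by (intro sum_mono N) (fastforce, auto)
     also have "... = (fo H0' X+e) * real (\<Sum>i<m j. n j i)" by (simp add: sum_distrib_right[symmetric])
     finally show "fo H0 ((1/real (\<Sum>i<m j. n j i)) *R (\<Sum>i<m j. co (n j i) (xi j i))) <= fo H0' X+e"
      using tot by (simp add: fm.scaleR_right fm.sum_right pos_divide_le_eq)
    qed
    thus ?thesis using tendsto_upperbound[OF fm.tendsto[OF tendsto_const v]] by simp
   qed
   thus ?thesis using y field_le_epsilon by auto
  qed
  show "v:convex hull (RO Th X)"
  proof (rule ccontr)
   assume "v ~: convex hull (RO Th X)"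
   moreover have "closed (convex hull (RO Th X))" using fin by (simp add: compact_imp_closed finite_imp_compact_convex_hull)
   ultimately obtain a b where ab: "a \<bullet> v < b" "!!x. x:convex hull (RO Th X) ==> a \<bullet> x > b"
    using separating_hyperplane_closed_point[of "convex hull (RO Th X)" v] by auto
   \<comment> \<open>The limit \<open>v\<close> and the orbit lie in \<aa>, so the separating
     functional matters only there and is represented by an element of \<aa>. The sign turns the
     lower separation into an upper one.\<close>
   have "EX w:aa L. ALL x:aa L. B w x =-(a \<bullet> x)" by (rule B_riesz_on[OF subsp(3)]) (simp_all add: inner_add_right)
   then obtain w where w: "w:aL" "!!x. x:aL ==> fo w x =-(a \<bullet> x)" using form_aa by metis
   obtain y where "y:RO Th X" "fo w v <= fo w y" using upper[OF w(1)] by blast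
   thus False using ab(1) ab(2) w(2)[OF va] w(2)[OF RO_aa[OF Ths Xa]] hull_inc[of y "RO Th X" convex] by force
  qed
 qed
qed

end

theorem proposition11p1:
  fixes L :: "('g, 'l::euclidean_space) lie_data"
    and act :: "'q::topological_space \<Rightarrow> 'g \<Rightarrow> 'q"
    and proj :: "'q \<Rightarrow> 'x::metric_space"
    and R :: "'q set"
    and \<phi> :: "'q \<Rightarrow> 'q"
    and \<nu> :: "'x measure"
    and d :: "('l \<Rightarrow> real) set \<Rightarrow> ('q \<times> 'g set) set \<Rightarrow> ('q \<times> 'g set) set \<Rightarrow> real"
    and \<tau>Mo :: "'x \<Rightarrow> ('q \<times> 'l) set"
    and HMo HLy :: 'l
    and \<Theta>Mo :: "('l \<Rightarrow> real) set"
    and \<Lambda>Mo :: "'l set"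
  assumes "flag_data L"
    and "compact (UNIV :: 'x set)"
    and "principal_bundle L act proj"
    and "bundle_automorphism L act \<phi>"
    and "K_subbundle L act proj R"
    and "invariant_prob (base_map proj \<phi>) \<nu>"
    and "\<And>\<mu>. invariant_prob (base_map proj \<phi>) \<mu> \<Longrightarrow> \<mu> = \<nu>"
    and "\<And>U. open U \<Longrightarrow> U \<noteq> {} \<Longrightarrow> emeasure \<nu> U > 0"
    and "is_polar_exponent L act proj R \<phi> \<nu> HLy"
    and "flag_bundle_metrics L act d"
    and "is_morse_data L act proj \<phi> d \<tau>Mo HMo"
    and "\<Theta>Mo = {\<alpha> \<in> simple L. \<alpha> HMo = 0}"
    and "\<Lambda>Mo = morse_spectrum (assoc_map \<phi>) (d {})
           (morse_component L act \<tau>Mo HMo {} \<one>\<^bsub>weyl_group L\<^esub>) (a_cocycle L act R \<phi>)"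
  shows "polyhedron \<Lambda>Mo \<and>
         \<Lambda>Mo = convex hull {weyl_act L w HLy | w. w \<in> weyl_subgroup L \<Theta>Mo} \<and>
         {v. v extreme_point_of \<Lambda>Mo} = {weyl_act L w HLy | w. w \<in> weyl_subgroup L \<Theta>Mo}"
proof -
  have ch: "chamber L \<noteq> {}" using assms(11) by (auto simp: is_morse_data_def)
  interpret S: flag_bundle_system L act proj R \<phi> d \<tau>Mo HMo
    using assms ch by unfold_locales
  have T: "\<Theta>Mo \<subseteq> simple L" using assms(12) by blast
  have X: "HLy \<in> aa L" using assms(9) S.clch by (simp add: is_polar_exponent_def)
  note orb = S.weyl_orbit[OF T X]
  have \<Lambda>: "\<Lambda>Mo = convex hull S.RO \<Theta>Mo HLy"
    unfolding assms(12,13) using assms(6,7,9) by (rule S.morse_spectrum_eq)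
  have "polyhedron \<Lambda>Mo" unfolding \<Lambda> using S.finite_RO[OF T X]
    by (intro polytope_imp_polyhedron) (auto simp: polytope_def)
  then show ?thesis unfolding orb using S.extreme_points_RO[OF assms(12) S.H_aa X] \<Lambda> by simp
qed

end
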